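(* Let $\Phi$ be a polynomial time computable implicit set system and let $b,c\ge 1$ be constants. If there is an algorithm for $\Phi$-Extension with running time $b^{n-|X|}c^{k}N^{O(1)}$, then there is a randomized algorithm for $\Phi$-Subset with running time $\left(1+b-\frac{1}{c}\right)^{n}N^{O(1)}$.
   Context: An implicit set system is a function $\Phi$ that takes as input a string $I\in\{0,1\}^*$ (an instance) and outputs a set system $(U_I,\mathcal{F}_I)$, where $U_I$ is a finite universe and $\mathcal{F}_I$ is a collection of subsets of $U_I$. Write $n=|U_I|$ and $N=|I|$, and assume $N\ge n$. $\Phi$ is polynomial time computable if $U_I$ can be computed from $I$ in polynomial time and, given $I$, $U_I$ and $S\subseteq U_I$, membership $S\in\mathcal{F}_I$ can be decided in polynomial time. The problem $\Phi$-Subset: given an instance $I$, output a set $S\in\mathcal{F}_I$ if one exists. The problem $\Phi$-Extension: given an instance $I$, a set $X\subseteq U_I$ and an integer $k$, decide whether there exists $S\subseteq U_I\setminus X$ with $S\cup X\in\mathcal{F}_I$ and $|S|\le k$. A randomized algorithm here is a Monte Carlo algorithm with one-sided error: on instances where no solution exists it always answers negatively, and when a solution exists it outputs a solution (or answers positively) with probability greater than $1/2$. *)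

theory Defs
  imports "HOL-Probability.Probability" "HOL-Library.Log_Nat"
begin

section \<open>Random access machines with logarithmic cost\<close>

text \<open>
  Algorithms are structured programs of the random access machine of Cook-Reckhow and
  Aho-Hopcroft-Ullman under the logarithmic cost criterion: every number that is read, used as an
  address or computed is charged its binary length. A program refers to finitely many arrays,
  whose names are constants of the program text; a register is the cell at index 0 of an array.
  Up to factors polylogarithmic in the running time (hence polynomial in the input length for the
  time bounds below) this is the word RAM, so bases of exponential running times do not depend on
  the details of the machine.
\<close>

type_synonym mem = "nat \<Rightarrow> nat \<Rightarrow> nat"

datatype aexp =
    Const nat
  | Load nat aexp
  | Add aexp aexp
  | Sub aexp aexp
  | Mul aexp aexp
  | Div aexp aexp

datatype com =
    Skip
  | Store nat aexp aexp
  | Flip nat aexp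
  | Seq com com
  | Cond aexp com com
  | While aexp com

primrec eval :: "aexp \<Rightarrow> mem \<Rightarrow> nat" where
  "eval (Const v) m = v"
| "eval (Load a e) m = m a (eval e m)"
| "eval (Add e1 e2) m = eval e1 m + eval e2 m"
| "eval (Sub e1 e2) m = eval e1 m - eval e2 m"
| "eval (Mul e1 e2) m = eval e1 m * eval e2 m"
| "eval (Div e1 e2) m = eval e1 m div eval e2 m"

definition nbits :: "nat \<Rightarrow> nat" where
  "nbits v = max 1 (floorlog 2 v)"

primrec cost :: "aexp \<Rightarrow> mem \<Rightarrow> nat" where
  "cost (Const v) m = nbits v"
| "cost (Load a e) m = cost e m + nbits (eval (Load a e) m)"
| "cost (Add e1 e2) m = cost e1 m + cost e2 m + nbits (eval (Add e1 e2) m)"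
| "cost (Sub e1 e2) m = cost e1 m + cost e2 m + nbits (eval (Sub e1 e2) m)"
| "cost (Mul e1 e2) m = cost e1 m + cost e2 m + nbits (eval (Mul e1 e2) m)"
| "cost (Div e1 e2) m = cost e1 m + cost e2 m + nbits (eval (Div e1 e2) m)"

text \<open>
  \<open>runs p m w t m'\<close>: started in memory \<open>m\<close>, program \<open>p\<close> halts in memory \<open>m'\<close> after time \<open>t\<close>,
  and \<open>w\<close> is the sequence of outcomes of exactly those coin flips that it performed.
\<close>

inductive runs :: "com \<Rightarrow> mem \<Rightarrow> bool list \<Rightarrow> nat \<Rightarrow> mem \<Rightarrow> bool" where
  Skip: "runs Skip m [] 1 m"
| Store: "runs (Store a i e) m [] (1 + cost i m + cost e m)
            (m(a := (m a)(eval i m := eval e m)))"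
| Flip: "runs (Flip a i) m [w] (1 + cost i m) (m(a := (m a)(eval i m := of_bool w)))"
| Seq: "\<lbrakk>runs p1 m u t1 m1; runs p2 m1 v t2 m2\<rbrakk> \<Longrightarrow> runs (Seq p1 p2) m (u @ v) (t1 + t2) m2"
| CondTrue: "\<lbrakk>eval e m \<noteq> 0; runs p1 m u t m1\<rbrakk> \<Longrightarrow> runs (Cond e p1 p2) m u (1 + cost e m + t) m1"
| CondFalse: "\<lbrakk>eval e m = 0; runs p2 m u t m1\<rbrakk> \<Longrightarrow> runs (Cond e p1 p2) m u (1 + cost e m + t) m1"
| WhileTrue: "\<lbrakk>eval e m \<noteq> 0; runs p m u t1 m1; runs (While e p) m1 v t2 m2\<rbrakk>
    \<Longrightarrow> runs (While e p) m (u @ v) (1 + cost e m + t1 + t2) m2"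
| WhileFalse: "eval e m = 0 \<Longrightarrow> runs (While e p) m [] (1 + cost e m) m"

inductive_cases runs_SkipE: "runs Skip m w t m'"
inductive_cases runs_StoreE: "runs (Store a i e) m w t m'"
inductive_cases runs_FlipE: "runs (Flip a i) m w t m'"
inductive_cases runs_SeqE: "runs (Seq p1 p2) m w t m'"
inductive_cases runs_CondE: "runs (Cond e p1 p2) m w t m'"
inductive_cases runs_WhileE: "runs (While e p) m w t m'"

text \<open>
  An infinite sequence of coins determines the run; in particular the existential quantifiers
  over runs in the definitions below do not leave any choice.
\<close>

lemma runs_deterministic:
  "\<lbrakk>runs p m u t m1; runs p m v s m2; u @ x = v @ y\<rbrakk> \<Longrightarrow> u = v \<and> t = s \<and> m1 = m2"
proof (induction arbitrary: v s m2 x y rule: runs.induct)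
  case (Seq p1 m u1 t1 m1 p2 u2 t2 m2')
  obtain v1 s1 n1 v2 s2 where *: "v = v1 @ v2" "s = s1 + s2"
      "runs p1 m v1 s1 n1" "runs p2 n1 v2 s2 m2"
    using Seq.prems(1) by (auto elim: runs_SeqE)
  have 1: "u1 = v1 \<and> t1 = s1 \<and> m1 = n1"
    using Seq.IH(1)[OF *(3), of "u2 @ x" "v2 @ y"] Seq.prems(2) *(1) by simp
  then have "u2 = v2 \<and> t2 = s2 \<and> m2' = m2"
    using Seq.IH(2)[of v2 s2 m2 x y] Seq.prems(2) * by simp
  with 1 * show ?case by simp
next
  case (WhileTrue e m p u1 t1 m1 u2 t2 m2')
  obtain v1 s1 n1 v2 s2 where *: "v = v1 @ v2" "s = 1 + cost e m + s1 + s2"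
      "runs p m v1 s1 n1" "runs (While e p) n1 v2 s2 m2"
    using WhileTrue.prems(1) WhileTrue.hyps(1) by (auto elim: runs_WhileE)
  have 1: "u1 = v1 \<and> t1 = s1 \<and> m1 = n1"
    using WhileTrue.IH(1)[OF *(3), of "u2 @ x" "v2 @ y"] WhileTrue.prems(2) *(1) by simp
  then have "u2 = v2 \<and> t2 = s2 \<and> m2' = m2"
    using WhileTrue.IH(2)[of v2 s2 m2 x y] WhileTrue.prems(2) * by simp
  with 1 * show ?case by simp
next
  case (CondTrue e m p1 u t m1 p2)
  then obtain s' where "s = 1 + cost e m + s'" "runs p1 m v s' m2"
    by (auto elim: runs_CondE)
  with CondTrue.IH CondTrue.prems(2) show ?case by simp
next
  case (CondFalse e m p2 u t m1 p1)
  then obtain s' where "s = 1 + cost e m + s'" "runs p2 m v s' m2"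
    by (auto elim: runs_CondE)
  with CondFalse.IH CondFalse.prems(2) show ?case by simp
qed (auto elim: runs_SkipE runs_StoreE runs_FlipE runs_WhileE)

text \<open>
  A list in an array is stored with its entries increased by one, so that the first 0 marks its
  end. Input number \<open>a\<close> is in array \<open>a\<close>, all other cells are 0; the output is in array 0.
\<close>

definition input :: "nat list list \<Rightarrow> mem" where
  "input xss = (\<lambda>a i. if a < length xss \<and> i < length (xss ! a) then Suc (xss ! a ! i) else 0)"

definition outputs :: "mem \<Rightarrow> nat list \<Rightarrow> bool" where
  "outputs m ys \<longleftrightarrow> (\<forall>i < length ys. m 0 i = Suc (ys ! i)) \<and> m 0 (length ys) = 0"

text \<open>A deterministic computation is one that flips no coins.\<close>

definition computes_within :: "com \<Rightarrow> nat list list \<Rightarrow> real \<Rightarrow> nat list \<Rightarrow> bool" where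
  "computes_within p xss T ys \<longleftrightarrow> (\<exists>t m. runs p (input xss) [] t m \<and> real t \<le> T \<and> outputs m ys)"

definition coins :: "bool stream measure" where
  "coins = stream_space (measure_pmf (bernoulli_pmf (1 / 2)))"


section \<open>Implicit set systems\<close>

text \<open>
  Elements of universes are binary strings, identified with natural numbers. A set is given to
  and returned by a program as a list of its elements without repetitions, in any order.
\<close>

type_synonym set_system_map = "bool list \<Rightarrow> nat set \<times> nat set set"

definition universe :: "set_system_map \<Rightarrow> bool list \<Rightarrow> nat set" where
  "universe \<Phi> I = fst (\<Phi> I)"

definition family :: "set_system_map \<Rightarrow> bool list \<Rightarrow> nat set set" where
  "family \<Phi> I = snd (\<Phi> I)"

definition implicit_set_system :: "set_system_map \<Rightarrow> bool" where
  "implicit_set_system \<Phi> \<longleftrightarrow>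
     (\<forall>I. finite (universe \<Phi> I) \<and> family \<Phi> I \<subseteq> Pow (universe \<Phi> I) \<and>
          card (universe \<Phi> I) \<le> length I)"

definition bits :: "bool list \<Rightarrow> nat list" where
  "bits I = map of_bool I"

text \<open>
  Factors $N^{O(1)}$ are rendered as $C (N+1)^d$, because $C N^d$ would be 0 for the empty
  instance.
\<close>

definition poly_time_computable :: "set_system_map \<Rightarrow> bool" where
  "poly_time_computable \<Phi> \<longleftrightarrow>
     (\<exists>p C d. \<forall>I. \<exists>us. distinct us \<and> set us = universe \<Phi> I \<and>
        computes_within p [bits I] (C * (real (length I) + 1) ^ d) us) \<and>
     (\<exists>p C d. \<forall>I us xs. distinct us \<and> set us = universe \<Phi> I \<and>
        distinct xs \<and> set xs \<subseteq> universe \<Phi> I \<longrightarrow>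
        computes_within p [bits I, us, xs] (C * (real (length I) + 1) ^ d)
          [of_bool (set xs \<in> family \<Phi> I)])"

text \<open>
  Decision algorithms output the list \<open>[1]\<close> for yes and \<open>[0]\<close> for no. The parameter \<open>k\<close> of an
  extension instance is given in unary, as a list of length \<open>k\<close>: with \<open>k\<close> in binary, merely
  reading it would exceed the time bound $b^{n-|X|} c^k N^{O(1)}$ if $c = 1$ and \<open>k\<close> is huge. For
  $k \leq n$ (and larger \<open>k\<close> can be replaced by $n$) the choice is immaterial, since the two
  encodings can be converted into each other in time polynomial in $N$.
\<close>

definition extension_algorithm ::
  "set_system_map \<Rightarrow> com \<Rightarrow> (bool list \<Rightarrow> nat set \<Rightarrow> nat \<Rightarrow> real) \<Rightarrow> bool" where
  "extension_algorithm \<Phi> p T \<longleftrightarrow>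
     (\<forall>I xs k. distinct xs \<and> set xs \<subseteq> universe \<Phi> I \<longrightarrow>
        computes_within p [bits I, xs, replicate k 0] (T I (set xs) k)
          [of_bool (\<exists>S. S \<subseteq> universe \<Phi> I - set xs \<and> S \<union> set xs \<in> family \<Phi> I \<and> card S \<le> k)])"

text \<open>
  A search algorithm outputs \<open>[0]\<close> for the negative answer, and \<open>1\<close> followed by the elements of
  \<open>S\<close> for the answer \<open>S\<close>. The time bound holds for every sequence of coin flips.
\<close>

definition randomized_subset_algorithm ::
  "set_system_map \<Rightarrow> com \<Rightarrow> (bool list \<Rightarrow> real) \<Rightarrow> bool" where
  "randomized_subset_algorithm \<Phi> p T \<longleftrightarrow>
     (\<forall>I.
        (\<forall>\<omega>. \<exists>l t m. runs p (input [bits I]) (stake l \<omega>) t m \<and> real t \<le> T I) \<and>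
        (family \<Phi> I = {} \<longrightarrow>
          (\<forall>\<omega>. \<exists>l t m. runs p (input [bits I]) (stake l \<omega>) t m \<and> outputs m [0])) \<and>
        (family \<Phi> I \<noteq> {} \<longrightarrow>
          \<P>(\<omega> in coins. \<exists>l t m xs. runs p (input [bits I]) (stake l \<omega>) t m \<and>
             outputs m (1 # xs) \<and> distinct xs \<and> set xs \<in> family \<Phi> I) > 1 / 2))"

end

theory Submission
  imports Defs
begin

text \<open>
  A random set of \<open>t\<close> elements lies in a fixed solution of size \<open>k\<close> with probability
  \<open>(k choose t) / (n choose t)\<close> and then lacks \<open>k - t\<close> elements of it. Hence about
  \<open>(n choose t) / (k choose t)\<close> samples, each tested in time \<open>b ^ (n - t) * c ^ (k - t)\<close>, suffice to
  find an extensible one, which self-reduction then turns into a solution. For the best \<open>t\<close> the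
  total is at most \<open>(1 + b - 1 / c) ^ n\<close> up to a polynomial factor.

  The best \<open>t\<close> depends on the real numbers \<open>b\<close> and \<open>c\<close>, which need not be computable. So for every
  \<open>k\<close> all \<open>t\<close> compete under time budgets that double from round to round, until some \<open>t\<close> completes
  its batch of trials within the budget; to this end the extension algorithm is simulated under a
  clock. If \<open>k\<close> is the size of a solution, then batch number \<open>s\<close> misses with probability at most
  \<open>(1 / 2) ^ (s + 3)\<close>, whichever \<open>t\<close> it belongs to, so it does no harm that a race may be won by
  an unexpected \<open>t\<close>.
\<close>

section \<open>Lengths and costs\<close>

text \<open>The base of the running time comes from a cancellation. With
  \<open>\<beta> = b - 1 / c\<close> and the best \<open>t\<close>, the number of samples times the
  cost of a test collapses, up to a polynomial factor, to
  \<open>(n choose k) * \<beta> ^ (n - k)\<close>, a single term of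
  \<open>(1 + \<beta>) ^ n\<close>; only for very small solutions is \<open>t = 0\<close> treated
  separately. The growing batches are due to the race: any batch may turn out to be the one that
  ends it. The misses of all batches are therefore added up, and
  \<open>1/8 + 1/16 + ... = 1/4\<close> stays below \<open>1/2\<close>. A call that runs out of time
  tells nothing, so a batch counts as complete only if none of its calls did; an expensive
  \<open>t\<close> can delay a race but not spoil it. A suitable \<open>t\<close> is sure to
  complete, since every call made by the self-reduction is at most as expensive as the bound for the
  sample it starts from. Fair coins give uniform samples only approximately; the probabilities are
  rounded so that the total loss is at most a factor 2.\<close>

lemma nbits_le_iff: "1 \<le> k \<Longrightarrow> nbits v \<le> k \<longleftrightarrow> v < 2 ^ k"
  unfolding nbits_def using floorlog_leD[of 2 v k] floorlog_leI[of v 2 k] by auto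

lemma nbits_pos: "1 \<le> nbits v"
  by (simp add: nbits_def)

lemma less_nbits: "v < 2 ^ nbits v"
  using nbits_le_iff[OF nbits_pos] by blast

lemma nbits_mono: "u \<le> v \<Longrightarrow> nbits u \<le> nbits v"
  by (meson le_less_trans less_nbits nbits_le_iff nbits_pos)

lemma nbits_0 [simp]: "nbits 0 = 1" and nbits_1 [simp]: "nbits (Suc 0) = 1"
  using nbits_le_iff[of 1 0] nbits_le_iff[of 1 "Suc 0"] nbits_pos[of 0] nbits_pos[of "Suc 0"]
  by auto

lemma nbits_2: "nbits 2 \<le> 2"
  by (subst nbits_le_iff) auto

lemma nbits_mult: "nbits (u * v) \<le> nbits u + nbits v"
proof -
  have "u * v < 2 ^ nbits u * 2 ^ nbits v"
    using less_nbits[of u] less_nbits[of v] by (intro mult_strict_mono) auto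
  then show ?thesis
    using nbits_pos[of u] by (subst nbits_le_iff) (auto simp: power_add)
qed

text \<open>Weaker than the maximum plus one, but additive like the bound for products, so that sums
  and products can be treated alike. It rests on \<open>x + y <= x * y\<close> for
  \<open>x, y >= 2\<close>; every \<open>2 ^ nbits w\<close> is at least 2 because even 0 has length
  1.\<close>

lemma nbits_add: "nbits (u + v) \<le> nbits u + nbits v"
proof -
  have *: "x + y \<le> x * y" if xy: "2 \<le> x" "2 \<le> y" for x y :: nat
  proof -
    obtain x' y' where "x = 2 + x'" "y = 2 + y'"
      using le_Suc_ex[OF xy(1)] le_Suc_ex[OF xy(2)] by blast
    then show ?thesis by (simp add: algebra_simps)
  qed
  have "2 \<le> (2::nat) ^ nbits w" for w
    using power_increasing[OF nbits_pos[of w], of "2::nat"] by simp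
  then have "u + v < 2 ^ nbits u * 2 ^ nbits v"
    using less_nbits[of u] less_nbits[of v] *[of "2 ^ nbits u" "2 ^ nbits v"]
    by (intro less_le_trans[OF add_strict_mono *]) auto
  then show ?thesis
    using nbits_pos[of u] by (subst nbits_le_iff) (auto simp: power_add)
qed

lemma nbits_diff: "nbits (u - v) \<le> nbits u" and nbits_div: "nbits (u div v) \<le> nbits u"
  by (auto intro: nbits_mono)

text \<open>Turns lengths into values: a product of numbers \<open>2 * (v + 1)\<close> dominates 2
  to the sum of their lengths. The \<open>+ 1\<close> takes care of \<open>v = 0\<close>, whose
  length is 1.\<close>

lemma nbits_lower: "2 ^ nbits v \<le> 2 * (v + 1)"
proof (cases "nbits v = 1")
  case False
  then have "\<not> nbits v \<le> nbits v - 1" "1 \<le> nbits v - 1"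
    using nbits_pos[of v] by linarith+
  then have "2 ^ (nbits v - 1) \<le> v"
    using nbits_le_iff by (metis not_less)
  then have "2 * 2 ^ (nbits v - 1) \<le> 2 * v" by simp
  then show ?thesis
    using nbits_pos[of v] by (simp flip: power_Suc)
qed simp

lemma nbits_eval_le_cost: "nbits (eval e m) \<le> cost e m"
  by (cases e) auto

lemma cost_pos: "1 \<le> cost e m"
  using nbits_eval_le_cost nbits_pos le_trans by blast

text \<open>The ratio between \<open>cost\<close> and a common bound on the lengths of all cells
  that the expression may read. The doubling at a binary operation pays for the length of the
  result, which is at most the sum of the costs of the operands.\<close>

primrec exp_size :: "aexp \<Rightarrow> nat" where
  "exp_size (Const v) = nbits v"
| "exp_size (Load a e) = exp_size e + 1"
| "exp_size (Add e1 e2) = 2 * (exp_size e1 + exp_size e2)"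
| "exp_size (Sub e1 e2) = 2 * (exp_size e1 + exp_size e2)"
| "exp_size (Mul e1 e2) = 2 * (exp_size e1 + exp_size e2)"
| "exp_size (Div e1 e2) = 2 * (exp_size e1 + exp_size e2)"

primrec arrays :: "aexp \<Rightarrow> nat set" where
  "arrays (Const v) = {}"
| "arrays (Load a e) = insert a (arrays e)"
| "arrays (Add e1 e2) = arrays e1 \<union> arrays e2"
| "arrays (Sub e1 e2) = arrays e1 \<union> arrays e2"
| "arrays (Mul e1 e2) = arrays e1 \<union> arrays e2"
| "arrays (Div e1 e2) = arrays e1 \<union> arrays e2"

lemma cost_le_exp_size:
  assumes "1 \<le> Z"
  shows "(\<And>a i. a \<in> arrays e \<Longrightarrow> nbits (m a i) \<le> Z) \<Longrightarrow> cost e m \<le> exp_size e * Z"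
proof (induction e)
  case (Const v)
  then show ?case using assms by simp
next
  case (Load a e)
  then have "cost e m \<le> exp_size e * Z" "nbits (m a (eval e m)) \<le> Z" by auto
  then show ?case by simp
next
  case (Add e1 e2)
  then have "cost e1 m \<le> exp_size e1 * Z" "cost e2 m \<le> exp_size e2 * Z" by auto
  then show ?case
    using nbits_add[of "eval e1 m" "eval e2 m"] nbits_eval_le_cost[of e1 m]
      nbits_eval_le_cost[of e2 m] by (simp add: algebra_simps)
next
  case (Sub e1 e2)
  then have "cost e1 m \<le> exp_size e1 * Z" "cost e2 m \<le> exp_size e2 * Z" by auto
  then show ?case
    using nbits_diff[of "eval e1 m" "eval e2 m"] nbits_eval_le_cost[of e1 m]
    by (simp add: algebra_simps)
next
  case (Mul e1 e2)
  then have "cost e1 m \<le> exp_size e1 * Z" "cost e2 m \<le> exp_size e2 * Z" by auto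
  then show ?case
    using nbits_mult[of "eval e1 m" "eval e2 m"] nbits_eval_le_cost[of e1 m]
      nbits_eval_le_cost[of e2 m] by (simp add: algebra_simps)
next
  case (Div e1 e2)
  then have "cost e1 m \<le> exp_size e1 * Z" "cost e2 m \<le> exp_size e2 * Z" by auto
  then show ?case
    using nbits_div[of "eval e1 m" "eval e2 m"] nbits_eval_le_cost[of e1 m]
    by (simp add: algebra_simps)
qed

text \<open>Whatever is written was computed and charged its length, or is a coin of length 1.
  Elements of the universe are arbitrary numbers; this bounds their lengths once a program of known
  running time has produced them.\<close>

lemma runs_nbits:
  "runs p m w t m' \<Longrightarrow> m' a i = m a i \<or> nbits (m' a i) \<le> t"
proof (induction rule: runs.induct)
  case (Store b j e m)
  then show ?case
    using nbits_eval_le_cost[of e m] by auto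
next
  case (Flip b j m w)
  then show ?case by auto
next
  case (WhileTrue e m p u t1 m1 v t2 m2)
  then show ?case by (metis add.commute le_add2 le_trans)
qed (auto intro: le_trans)

section \<open>Deterministic runs\<close>

definition halts :: "com \<Rightarrow> mem \<Rightarrow> nat \<Rightarrow> (mem \<Rightarrow> bool) \<Rightarrow> bool" where
  "halts p m T Q \<longleftrightarrow> (\<exists>t m'. runs p m [] t m' \<and> t \<le> T \<and> Q m')"

lemma halts_mono: "halts p m T Q \<Longrightarrow> T \<le> T' \<Longrightarrow> (\<And>m'. Q m' \<Longrightarrow> Q' m') \<Longrightarrow> halts p m T' Q'"
  unfolding halts_def by (meson le_trans)

lemma halts_Skip: "Q m \<Longrightarrow> halts Skip m 1 Q"
  unfolding halts_def using runs.Skip by blast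

lemma halts_Store:
  "Q (m(a := (m a)(eval i m := eval e m))) \<Longrightarrow> halts (Store a i e) m (1 + cost i m + cost e m) Q"
  unfolding halts_def using runs.Store by blast

lemma halts_Seq:
  assumes "halts p1 m T1 R" and "\<And>m1. R m1 \<Longrightarrow> halts p2 m1 T2 Q"
  shows "halts (Seq p1 p2) m (T1 + T2) Q"
proof -
  obtain t1 m1 where 1: "runs p1 m [] t1 m1" "t1 \<le> T1" "R m1"
    using assms(1) unfolding halts_def by blast
  then obtain t2 m2 where "runs p2 m1 [] t2 m2" "t2 \<le> T2" "Q m2"
    using assms(2) unfolding halts_def by blast
  then show ?thesis
    using 1 runs.Seq[of p1 m "[]" t1 m1 p2 "[]" t2 m2] unfolding halts_def
    by (metis add_mono append_Nil)
qed

lemma halts_Cond: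
  assumes "eval e m \<noteq> 0 \<Longrightarrow> halts p1 m T Q" and "eval e m = 0 \<Longrightarrow> halts p2 m T Q"
  shows "halts (Cond e p1 p2) m (1 + cost e m + T) Q"
proof (cases "eval e m = 0")
  case True
  then obtain t m' where "runs p2 m [] t m'" "t \<le> T" "Q m'"
    using assms(2) unfolding halts_def by blast
  then show ?thesis
    using runs.CondFalse[OF True, of p2 "[]" t m' p1] unfolding halts_def
    by (metis add_le_cancel_left)
next
  case False
  then obtain t m' where "runs p1 m [] t m'" "t \<le> T" "Q m'"
    using assms(1) unfolding halts_def by blast
  then show ?thesis
    using runs.CondTrue[OF False, of p1 "[]" t m' p2] unfolding halts_def
    by (metis add_le_cancel_left)
qed

lemma halts_While_False: "eval e m = 0 \<Longrightarrow> Q m \<Longrightarrow> halts (While e p) m (1 + cost e m) Q"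
  unfolding halts_def using runs.WhileFalse by blast

lemma halts_While_True:
  assumes "eval e m \<noteq> 0" and "halts p m T1 R" and "\<And>m1. R m1 \<Longrightarrow> halts (While e p) m1 T2 Q"
  shows "halts (While e p) m (1 + cost e m + T1 + T2) Q"
proof -
  obtain t1 m1 where 1: "runs p m [] t1 m1" "t1 \<le> T1" "R m1"
    using assms(2) unfolding halts_def by blast
  then obtain t2 m2 where "runs (While e p) m1 [] t2 m2" "t2 \<le> T2" "Q m2"
    using assms(3) unfolding halts_def by blast
  then show ?thesis
    using 1 runs.WhileTrue[OF assms(1), of p "[]" t1 m1 "[]" t2 m2] unfolding halts_def
    by (intro exI[of _ "1 + cost e m + t1 + t2"] exI[of _ m2]) auto
qed

text \<open>The index of the invariant counts the iterations. The step has to derive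
  \<open>i < n\<close> whenever the guard holds, so that \<open>n\<close> bounds their number
  without a separate variant, while the loop may stop earlier.\<close>

lemma halts_While:
  assumes cost: "\<And>i m. i \<le> n \<Longrightarrow> Inv i m \<Longrightarrow> cost e m \<le> c"
    and step: "\<And>i m. i \<le> n \<Longrightarrow> Inv i m \<Longrightarrow> eval e m \<noteq> 0 \<Longrightarrow> i < n \<and> halts p m T (Inv (Suc i))"
    and init: "Inv 0 m"
  shows "halts (While e p) m ((n + 1) * (1 + c) + n * T) (\<lambda>m'. \<exists>i\<le>n. Inv i m' \<and> eval e m' = 0)"
proof -
  have "halts (While e p) m ((d + 1) * (1 + c) + d * T) (\<lambda>m'. \<exists>i\<le>n. Inv i m' \<and> eval e m' = 0)"
    if "Inv i m" "i + d = n" for i d m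
    using that
  proof (induction d arbitrary: i m)
    case 0
    then have "eval e m = 0" using step[of i m] by auto
    then have "halts (While e p) m (1 + cost e m) (\<lambda>m'. \<exists>i\<le>n. Inv i m' \<and> eval e m' = 0)"
      using 0 by (intro halts_While_False) auto
    then show ?case
      by (rule halts_mono) (use 0 cost[of i m] in auto)
  next
    case (Suc d)
    show ?case
    proof (cases "eval e m = 0")
      case True
      then have "halts (While e p) m (1 + cost e m) (\<lambda>m'. \<exists>i\<le>n. Inv i m' \<and> eval e m' = 0)"
        using Suc.prems by (intro halts_While_False exI[of _ i]) auto
      then show ?thesis
        by (rule halts_mono) (use Suc.prems cost[of i m] in auto)
    next
      case False
      then have "halts p m T (Inv (Suc i))" using step[of i m] Suc.prems by auto
      from halts_While_True[OF False this Suc.IH] Suc.prems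
      have "halts (While e p) m (1 + cost e m + T + ((d + 1) * (1 + c) + d * T))
          (\<lambda>m'. \<exists>i\<le>n. Inv i m' \<and> eval e m' = 0)" by auto
      then show ?thesis
        by (rule halts_mono) (use Suc.prems cost[of i m] in auto)
    qed
  qed
  from this[OF init, of n] show ?thesis by simp
qed

text \<open>
  The search program proper keeps its data in the arrays below 30. Arrays 30 to 32 are scratch
  space of the clock, and array \<open>33 + a\<close> holds array \<open>a\<close> of the simulated programs.
\<close>

definition small :: "nat \<Rightarrow> mem \<Rightarrow> bool" where
  "small L m \<longleftrightarrow> (\<forall>a < 30. \<forall>i. m a i < 2 ^ L)"

definition low :: "aexp \<Rightarrow> bool" where
  "low e \<longleftrightarrow> arrays e \<subseteq> {..<30}"

lemma cost_low: "small L m \<Longrightarrow> low e \<Longrightarrow> 1 \<le> L \<Longrightarrow> cost e m \<le> exp_size e * L"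
  by (intro cost_le_exp_size) (auto simp: low_def small_def nbits_le_iff subset_iff)

primrec com_size :: "com \<Rightarrow> nat" where
  "com_size Skip = 1"
| "com_size (Store a i e) = 1 + exp_size i + exp_size e"
| "com_size (Flip a i) = 1 + exp_size i"
| "com_size (Seq p1 p2) = com_size p1 + com_size p2"
| "com_size (Cond e p1 p2) = 1 + exp_size e + com_size p1 + com_size p2"
| "com_size (While e p) = 0"

primrec straight_line :: "com \<Rightarrow> bool" where
  "straight_line Skip = True"
| "straight_line (Store a i e) = (low i \<and> low e)"
| "straight_line (Flip a i) = False"
| "straight_line (Seq p1 p2) = (straight_line p1 \<and> straight_line p2)"
| "straight_line (Cond e p1 p2) = (low e \<and> straight_line p1 \<and> straight_line p2)"
| "straight_line (While e p) = False"

text \<open>The precondition also demands that values written to arrays below 30 stay under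
  \<open>2 ^ L\<close>. One symbolic execution thus yields the postcondition, the preservation of
  \<open>small\<close> and, through the latter, the time bound. Coins and loops are left to separate
  rules.\<close>

primrec wp :: "nat \<Rightarrow> com \<Rightarrow> (mem \<Rightarrow> bool) \<Rightarrow> mem \<Rightarrow> bool" where
  "wp L Skip Q m = Q m"
| "wp L (Store a i e) Q m =
    ((a < 30 \<longrightarrow> eval e m < 2 ^ L) \<and> Q (m(a := (m a)(eval i m := eval e m))))"
| "wp L (Flip a i) Q m = False"
| "wp L (Seq p1 p2) Q m = wp L p1 (wp L p2 Q) m"
| "wp L (Cond e p1 p2) Q m = (if eval e m \<noteq> 0 then wp L p1 Q m else wp L p2 Q m)"
| "wp L (While e p) Q m = False"

lemma halts_wp:
  assumes "1 \<le> L"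
  shows "straight_line p \<Longrightarrow> small L m \<Longrightarrow> wp L p Q m \<Longrightarrow> halts p m (com_size p * L) (\<lambda>m'. Q m' \<and>
    small L m')"
proof (induction p arbitrary: m Q)
  case Skip
  then show ?case using assms by (intro halts_mono[OF halts_Skip]) auto
next
  case (Store a i e)
  then have "cost i m \<le> exp_size i * L" "cost e m \<le> exp_size e * L"
    using assms by (auto intro: cost_low)
  moreover have "small L (m(a := (m a)(eval i m := eval e m)))"
    using Store by (auto simp: small_def)
  ultimately show ?case
    using Store assms
    by (intro halts_mono[OF halts_Store[where Q = "\<lambda>m'. Q m' \<and> small L m'"]])
      (auto simp: algebra_simps)
next
  case (Seq p1 p2)
  then show ?case
    by (intro halts_mono[OF halts_Seq[where R = "\<lambda>m'. wp L p2 Q m' \<and> small L m'"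
      and ?T1.0 = "com_size p1 * L" and ?T2.0 = "com_size p2 * L"]]) (auto simp: algebra_simps)
next
  case (Cond e p1 p2)
  then have "cost e m \<le> exp_size e * L"
    using assms by (auto intro: cost_low)
  moreover have "halts (Cond e p1 p2) m (1 + cost e m + (com_size p1 + com_size p2) * L)
    (\<lambda>m'. Q m' \<and> small L m')"
  proof (rule halts_Cond)
    assume "eval e m \<noteq> 0"
    then have "halts p1 m (com_size p1 * L) (\<lambda>m'. Q m' \<and> small L m')" using Cond by simp
    then show "halts p1 m ((com_size p1 + com_size p2) * L) (\<lambda>m'. Q m' \<and> small L m')"
      by (rule halts_mono) (simp_all add: algebra_simps)
  next
    assume "eval e m = 0"
    then have "halts p2 m (com_size p2 * L) (\<lambda>m'. Q m' \<and> small L m')" using Cond by simp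
    then show "halts p2 m ((com_size p1 + com_size p2) * L) (\<lambda>m'. Q m' \<and> small L m')"
      by (rule halts_mono) (simp_all add: algebra_simps)
  qed
  ultimately show ?case
    using assms by (elim halts_mono) (simp_all add: algebra_simps)
qed auto

section \<open>Simulation under a clock\<close>

abbreviation reg :: "nat \<Rightarrow> aexp" where "reg a \<equiv> Load a (Const 0)"

text \<open>
  A simulated program expects its memory to be 0. As it is not known which cells an earlier
  simulation has changed, simulation number \<open>v\<close> uses the fresh cells \<open>cell v i\<close>; register 22
  contains \<open>v\<close>.
\<close>

definition cell :: "nat \<Rightarrow> nat \<Rightarrow> nat" where
  "cell v i = (i + v) * (i + v) + i"

text \<open>The cells with \<open>i + v = d\<close> lie between \<open>d * d\<close> and
  \<open>d * d + d\<close>, hence below \<open>(d + 1) * (d + 1)\<close>, where the next diagonal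
  begins.\<close>

lemma cell_eq_iff [simp]: "cell v i = cell v' i' \<longleftrightarrow> v = v' \<and> i = i'"
proof
  have less: "cell v i < cell v' i'" if "i + v < i' + v'" for i v i' v'
  proof -
    have "cell v i \<le> (i + v) * (i + v) + (i + v)" by (simp add: cell_def)
    also have "\<dots> < Suc (i + v) * Suc (i + v)" by simp
    also have "\<dots> \<le> (i' + v') * (i' + v')" using that by (intro mult_mono) auto
    also have "\<dots> \<le> cell v' i'" by (simp add: cell_def)
    finally show ?thesis .
  qed
  assume eq: "cell v i = cell v' i'"
  then have "i + v = i' + v'"
    using less[of i v i' v'] less[of i' v' i v] by linarith
  then show "v = v' \<and> i = i'" using eq by (simp add: cell_def)
qed simp

definition cell_exp :: "aexp \<Rightarrow> aexp" where
  "cell_exp e = Add (Mul (Add e (reg 22)) (Add e (reg 22))) e"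

lemma eval_cell_exp [simp]: "eval (cell_exp e) M = cell (M 22 0) (eval e M)"
  by (simp add: cell_exp_def cell_def)

lemma cost_cell_exp:
  assumes "nbits (M 22 0) \<le> L"
  shows "cost (cell_exp e) M \<le> 3 * cost e M + 2 + 8 * L + 7 * nbits (eval e M)"
proof -
  let ?x = "eval e M" and ?v = "M 22 0"
  have 1: "nbits (?x + ?v) \<le> nbits ?x + L"
    using nbits_add[of ?x ?v] assms by linarith
  have 2: "nbits ((?x + ?v) * (?x + ?v)) \<le> 2 * nbits ?x + 2 * L"
    using nbits_mult[of "?x + ?v" "?x + ?v"] 1 by linarith
  have 3: "nbits ((?x + ?v) * (?x + ?v) + ?x) \<le> 3 * nbits ?x + 2 * L"
    using nbits_add[of "(?x + ?v) * (?x + ?v)" ?x] 2 by linarith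
  show ?thesis
    using 1 2 3 assms unfolding cell_exp_def by simp
qed

section \<open>Evaluating expressions over a simulated memory\<close>

primrec translate :: "aexp \<Rightarrow> aexp" where
  "translate (Const c) = Const c"
| "translate (Load a e) = Load (33 + a) (cell_exp (translate e))"
| "translate (Add e1 e2) = Add (translate e1) (translate e2)"
| "translate (Sub e1 e2) = Sub (translate e1) (translate e2)"
| "translate (Mul e1 e2) = Mul (translate e1) (translate e2)"
| "translate (Div e1 e2) = Div (translate e1) (translate e2)"

definition represents :: "nat \<Rightarrow> mem \<Rightarrow> mem \<Rightarrow> bool" where
  "represents v m M \<longleftrightarrow> M 22 0 = v \<and> (\<forall>a i. M (33 + a) (cell v i) = m a i)"

lemma eval_translate: "represents v m M \<Longrightarrow> eval (translate e) M = eval e m"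
  by (induction e) (auto simp: represents_def)

text \<open>\<open>cell_exp\<close> evaluates the address three times, whence the 3 in the case of
  \<open>Load\<close>. Nested loads multiply these factors, but they depend on the program text
  only.\<close>

primrec translate_factor :: "aexp \<Rightarrow> nat" where
  "translate_factor (Const c) = 1"
| "translate_factor (Load a e) = 3 * translate_factor e + 18"
| "translate_factor (Add e1 e2) = translate_factor e1 + translate_factor e2 + 1"
| "translate_factor (Sub e1 e2) = translate_factor e1 + translate_factor e2 + 1"
| "translate_factor (Mul e1 e2) = translate_factor e1 + translate_factor e2 + 1"
| "translate_factor (Div e1 e2) = translate_factor e1 + translate_factor e2 + 1"

lemma cost_cell_exp_translate:
  assumes "represents v m M" "nbits v \<le> L" "1 \<le> L" "cost (translate e) M
    \<le> translate_factor e * L * cost e m"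
  shows "cost (cell_exp (translate e)) M \<le> (3 * translate_factor e + 17) * L * cost e m"
proof -
  have "cost (cell_exp (translate e)) M \<le> 3 * cost (translate e) M + 2 + 8 * L + 7 * nbits
    (eval e m)"
    using cost_cell_exp[of M L "translate e"] assms
      by (simp add: eval_translate) (simp add: represents_def)
  also have "\<dots> \<le> 3 * (translate_factor e * L * cost e m) + 2 * (L * cost e m) + 8 * (L * cost e m)
      + 7 * (L * cost e m)"
    using assms(3,4) nbits_eval_le_cost[of e m] cost_pos[of e m]
      mult_mono[of 1 L 1 "cost e m"] mult_mono[of 1 L "nbits (eval e m)" "cost e m"]
      mult_mono[of L L 1 "cost e m"]
    by (intro add_mono mult_le_mono2) auto
  finally show ?thesis by (simp add: algebra_simps)
qed

lemma cost_translate: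
  assumes r: "represents v m M" and L: "nbits v \<le> L" "1 \<le> L"
  shows "cost (translate e) M \<le> translate_factor e * L * cost e m"
proof (induction e)
  case (Const c)
  then show ?case using L mult_mono[of 1 L "nbits c" "nbits c"] by simp
next
  case (Load a e)
  have "cost (translate (Load a e)) M = cost (cell_exp (translate e)) M + nbits (eval (Load a e) m)"
    using r eval_translate[OF r, of e] by (simp add: represents_def)
  also have "\<dots> \<le> (3 * translate_factor e + 17) * L * cost e m + nbits (eval (Load a e) m)"
    using cost_cell_exp_translate[OF r L Load] by simp
  also have "\<dots> \<le> (3 * translate_factor e + 18) * L * (cost e m + nbits (eval (Load a e) m))"
    using L(2) by (cases L) (simp_all add: algebra_simps)
  finally show ?case by simp
next
  case (Add e1 e2)
  have "cost (translate (Add e1 e2)) M \<le> translate_factor e1 * L * cost e1 m + translate_factor e2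
    * L * cost e2 m
      + L * nbits (eval (Add e1 e2) m)"
    using Add L(2) by (simp add: eval_translate[OF r] add_mono)
  then show ?case by (elim order_trans) (simp add: algebra_simps)
next
  case (Sub e1 e2)
  have "cost (translate (Sub e1 e2)) M \<le> translate_factor e1 * L * cost e1 m + translate_factor e2
    * L * cost e2 m
      + L * nbits (eval (Sub e1 e2) m)"
    using Sub L(2) by (simp add: eval_translate[OF r] add_mono)
  then show ?case by (elim order_trans) (simp add: algebra_simps)
next
  case (Mul e1 e2)
  have "cost (translate (Mul e1 e2)) M \<le> translate_factor e1 * L * cost e1 m + translate_factor e2
    * L * cost e2 m
      + L * nbits (eval (Mul e1 e2) m)"
    using Mul L(2) by (simp add: eval_translate[OF r] add_mono)
  then show ?case by (elim order_trans) (simp add: algebra_simps)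
next
  case (Div e1 e2)
  have "cost (translate (Div e1 e2)) M \<le> translate_factor e1 * L * cost e1 m + translate_factor e2
    * L * cost e2 m
      + L * nbits (eval (Div e1 e2) m)"
    using Div L(2) by (simp add: eval_translate[OF r] add_mono)
  then show ?case by (elim order_trans) (simp add: algebra_simps)
qed

text \<open>
  The clock needs the cost of an expression, a sum of logarithms, which is computed up to a constant
  factor as the logarithm of a product.
\<close>

definition pow_nbits :: "aexp \<Rightarrow> aexp" where
  "pow_nbits e = Mul (Const 2) (Add e (Const 1))"

lemma eval_pow_nbits: "eval (pow_nbits e) m = 2 * (eval e m + 1)"
  by (simp add: pow_nbits_def)

lemma nbits_pow_nbits: "nbits (2 * (x + 1)) \<le> nbits x + 3"
  using nbits_mult[of 2 "x + 1"] nbits_add[of x 1] nbits_2 by simp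

lemma cost_pow_nbits: "cost (pow_nbits e) m \<le> 10 * cost e m"
  using nbits_pow_nbits[of "eval e m"] nbits_add[of "eval e m" 1] nbits_2
    nbits_eval_le_cost[of e m] cost_pos[of e m] by (simp add: pow_nbits_def)

primrec pow_cost :: "aexp \<Rightarrow> aexp" where
  "pow_cost (Const c) = Const (2 * (c + 1))"
| "pow_cost (Load a e) = Mul (pow_cost e) (pow_nbits (Load a e))"
| "pow_cost (Add e1 e2) = Mul (Mul (pow_cost e1) (pow_cost e2)) (pow_nbits (Add e1 e2))"
| "pow_cost (Sub e1 e2) = Mul (Mul (pow_cost e1) (pow_cost e2)) (pow_nbits (Sub e1 e2))"
| "pow_cost (Mul e1 e2) = Mul (Mul (pow_cost e1) (pow_cost e2)) (pow_nbits (Mul e1 e2))"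
| "pow_cost (Div e1 e2) = Mul (Mul (pow_cost e1) (pow_cost e2)) (pow_nbits (Div e1 e2))"

lemma pow_nbits_lower: "2 ^ nbits (eval e m) \<le> eval (pow_nbits e) m"
  using nbits_lower[of "eval e m"] by (simp add: eval_pow_nbits)

lemma pow_cost_lower: "2 ^ cost e m \<le> eval (pow_cost e) m"
proof (induction e)
  case (Const c)
  then show ?case using nbits_lower[of c] by simp
next
  case (Load a e)
  then show ?case
    using pow_nbits_lower[of "Load a e" m] by (simp add: power_add distrib_left mult_le_mono)
next
  case (Add e1 e2)
  then show ?case
    using pow_nbits_lower[of "Add e1 e2" m] by (simp add: power_add distrib_left mult_le_mono)
next
  case (Sub e1 e2)
  then show ?case
    using pow_nbits_lower[of "Sub e1 e2" m] by (simp add: power_add distrib_left mult_le_mono)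
next
  case (Mul e1 e2)
  then show ?case
    using pow_nbits_lower[of "Mul e1 e2" m] by (simp add: power_add distrib_left mult_le_mono)
next
  case (Div e1 e2)
  then show ?case
    using pow_nbits_lower[of "Div e1 e2" m] by (simp add: power_add distrib_left mult_le_mono)
qed

text \<open>The logarithm of \<open>2 * (x + 1)\<close> exceeds the length of \<open>x\<close> by at
  most 1, and a length is at least 1. So lengths, and with them the sums of lengths that make up a
  cost, are overestimated by at most a factor 2.\<close>

lemma pow_nbits_upper: "eval (pow_nbits e) m \<le> 2 ^ (2 * nbits (eval e m))"
proof -
  have "eval (pow_nbits e) m \<le> 2 ^ Suc (nbits (eval e m))"
    using less_nbits[of "eval e m"] by (simp add: eval_pow_nbits)
  also have "\<dots> \<le> 2 ^ (2 * nbits (eval e m))"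
    using nbits_pos[of "eval e m"] by (intro power_increasing) auto
  finally show ?thesis .
qed

lemma pow_cost_upper: "eval (pow_cost e) m \<le> 2 ^ (2 * cost e m)"
proof (induction e)
  case (Const c)
  then show ?case using pow_nbits_upper[of "Const c" m] by (simp add: eval_pow_nbits)
next
  case (Load a e)
  then show ?case
    using pow_nbits_upper[of "Load a e" m] by (simp add: power_add distrib_left mult_le_mono)
next
  case (Add e1 e2)
  then show ?case
    using pow_nbits_upper[of "Add e1 e2" m] by (simp add: power_add distrib_left mult_le_mono)
next
  case (Sub e1 e2)
  then show ?case
    using pow_nbits_upper[of "Sub e1 e2" m] by (simp add: power_add distrib_left mult_le_mono)
next
  case (Mul e1 e2)
  then show ?case
    using pow_nbits_upper[of "Mul e1 e2" m] by (simp add: power_add distrib_left mult_le_mono)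
next
  case (Div e1 e2)
  then show ?case
    using pow_nbits_upper[of "Div e1 e2" m] by (simp add: power_add distrib_left mult_le_mono)
qed

lemma nbits_pow_cost: "nbits (eval (pow_cost e) m) \<le> 2 * cost e m + 1"
proof (subst nbits_le_iff)
  show "eval (pow_cost e) m < 2 ^ (2 * cost e m + 1)"
    using pow_cost_upper[of e m] by (rule le_less_trans) simp
qed simp

primrec pow_cost_factor :: "aexp \<Rightarrow> nat" where
  "pow_cost_factor (Const c) = 4"
| "pow_cost_factor (Load a e) = pow_cost_factor e + 22"
| "pow_cost_factor (Add e1 e2) = pow_cost_factor e1 + pow_cost_factor e2 + 22"
| "pow_cost_factor (Sub e1 e2) = pow_cost_factor e1 + pow_cost_factor e2 + 22"
| "pow_cost_factor (Mul e1 e2) = pow_cost_factor e1 + pow_cost_factor e2 + 22"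
| "pow_cost_factor (Div e1 e2) = pow_cost_factor e1 + pow_cost_factor e2 + 22"

lemma cost_pow_cost_binary:
  assumes "cost (pow_cost e1) m \<le> pow_cost_factor e1 * cost e1 m" "cost (pow_cost e2) m
    \<le> pow_cost_factor e2 * cost e2 m"
    and c: "cost e1 m + cost e2 m + nbits (eval e m) \<le> cost e m"
  shows "cost (Mul (Mul (pow_cost e1) (pow_cost e2)) (pow_nbits e)) m
    \<le> (pow_cost_factor e1 + pow_cost_factor e2 + 22) * cost e m"
proof -
  have 1: "nbits (eval (pow_cost e1) m * eval (pow_cost e2) m) \<le> 2 * cost e m"
    using nbits_mult[of "eval (pow_cost e1) m" "eval (pow_cost e2) m"] nbits_pow_cost[of e1 m]
      nbits_pow_cost[of e2 m] c
      nbits_pos[of "eval e m"] by linarith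
  have 2: "nbits (eval (pow_cost e1) m * eval (pow_cost e2) m * eval (pow_nbits e) m)
    \<le> 6 * cost e m"
    using nbits_mult[of "eval (pow_cost e1) m * eval (pow_cost e2) m" "eval (pow_nbits e) m"] 1
      nbits_pow_nbits[of "eval e m"] c cost_pos[of e1 m] cost_pos[of e2 m]
    by (simp add: eval_pow_nbits)
  have "pow_cost_factor e1 * cost e1 m + pow_cost_factor e2 * cost e2 m
    \<le> (pow_cost_factor e1 + pow_cost_factor e2) * cost e m"
    using c by (simp add: distrib_right add_mono mult_le_mono)
  then show ?thesis
    using 1 2 assms(1,2) cost_pow_nbits[of e m] by (simp add: algebra_simps)
qed

lemma cost_pow_cost: "cost (pow_cost e) m \<le> pow_cost_factor e * cost e m"
proof (induction e)
  case (Const c)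
  then show ?case using nbits_pow_nbits[of c] nbits_pos[of c] by simp
next
  case (Load a e)
  let ?e = "Load a e"
  have 2: "nbits (eval (pow_cost e) m * eval (pow_nbits ?e) m) \<le> 6 * cost ?e m"
    using nbits_mult[of "eval (pow_cost e) m" "eval (pow_nbits ?e) m"] nbits_pow_cost[of e m]
      nbits_pow_nbits[of "eval ?e m"] cost_pos[of e m] nbits_pos[of "eval ?e m"]
    by (simp add: eval_pow_nbits)
  have "pow_cost_factor e * cost e m \<le> pow_cost_factor e * cost ?e m" by simp
  then show ?case using 2 Load cost_pow_nbits[of ?e m] by (simp add: algebra_simps)
next
  case (Add e1 e2)
  then show ?case using cost_pow_cost_binary[of e1 m e2 "Add e1 e2"] by simp
next
  case (Sub e1 e2)
  then show ?case using cost_pow_cost_binary[of e1 m e2 "Sub e1 e2"] by simp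
next
  case (Mul e1 e2)
  then show ?case using cost_pow_cost_binary[of e1 m e2 "Mul e1 e2"] by simp
next
  case (Div e1 e2)
  then show ?case using cost_pow_cost_binary[of e1 m e2 "Div e1 e2"] by simp
qed

section \<open>Charging the clock for the cost of an expression\<close>

definition same :: "nat set \<Rightarrow> mem \<Rightarrow> mem \<Rightarrow> bool" where
  "same S m m' \<longleftrightarrow> (\<forall>a. a \<notin> S \<longrightarrow> m' a = m a)"

text \<open>
  Register 23 is the clock. It is decreased by \<open>2 ^ j\<close>, where \<open>2 ^ (2 ^ j)\<close> is the first iterated
  square of 2 that exceeds the value of \<open>w\<close>; this is \<open>log 2 w\<close> up to a factor of 2.
\<close>

definition pay :: "aexp \<Rightarrow> com" where
  "pay w =
    Seq (Store 30 (Const 0) w) (Seq (Store 31 (Const 0) (Const 2))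
      (Seq (Store 32 (Const 0) (Const 1))
    (Seq (While (Sub (Add (reg 30) (Const 1)) (reg 31))
      (Seq (Store 31 (Const 0) (Mul (reg 31) (reg 31)))
        (Store 32 (Const 0) (Add (reg 32) (reg 32)))))
    (Store 23 (Const 0) (Sub (reg 23) (reg 32))))))"

text \<open>All iterated squares but the last are at most \<open>x\<close>, and the last is 2 or the
  square of one of these. No intermediate result is thus longer than twice the length of
  \<open>x\<close>, which makes the time of a round linear in that length.\<close>

lemma halts_pay_loop:
  fixes x j :: nat
  assumes x: "2 \<le> x" and j: "x < 2 ^ (2 ^ j)" "\<And>i. i < j \<Longrightarrow> 2 ^ (2 ^ i) \<le> x"
    and M: "M 30 0 = x" "M 31 0 = 2" "M 32 0 = 1"
  shows "halts (While (Sub (Add (reg 30) (Const 1)) (reg 31))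
      (Seq (Store 31 (Const 0) (Mul (reg 31) (reg 31)))
        (Store 32 (Const 0) (Add (reg 32) (reg 32)))))
      M (27 * nbits x * (j + 1)) (\<lambda>M'. same {31, 32} M M' \<and> M' 32 0 = 2 ^ j)"
proof -
  define b where "b = nbits x"
  define Inv where "Inv i M' \<longleftrightarrow> same {31, 32} M M' \<and> M' 31 0 = 2 ^ (2 ^ i) \<and> M' 32 0 = 2 ^ i"
    for i M'
  have b2: "2 \<le> b"
    using nbits_le_iff[of 1 x] x unfolding b_def by simp
  have sq: "nbits (2 ^ (2 ^ i)) \<le> 2 * b" if "i \<le> j" for i
  proof (cases "i = j")
    case False
    then have "nbits (2 ^ (2 ^ i)) \<le> b"
      using j(2)[of i] that unfolding b_def by (intro nbits_mono) auto
    then show ?thesis by simp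
  next
    case True
    show ?thesis
    proof (cases j)
      case 0
      then show ?thesis using True nbits_2 b2 by simp
    next
      case (Suc h)
      then have "2 ^ (2 ^ h) \<le> x" using j(2)[of h] by simp
      then have "2 ^ (2 ^ j) \<le> x * x"
        using mult_mono[of "2 ^ (2 ^ h)" x "2 ^ (2 ^ h)" x] Suc
        by (simp add: power_add[symmetric] mult_2)
      then have "nbits (2 ^ (2 ^ j)) \<le> nbits (x * x)" by (rule nbits_mono)
      also have "\<dots> \<le> 2 * b" using nbits_mult[of x x] by (simp add: b_def)
      finally show ?thesis using True by simp
    qed
  qed
  have x1: "nbits (x + 1) \<le> b + 1" using nbits_add[of x 1] by (simp add: b_def)
  have L: "halts (While (Sub (Add (reg 30) (Const 1)) (reg 31))
      (Seq (Store 31 (Const 0) (Mul (reg 31) (reg 31)))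
        (Store 32 (Const 0) (Add (reg 32) (reg 32)))))
      M ((j + 1) * (1 + 10 * b) + j * (16 * b))
      (\<lambda>M'. \<exists>i\<le>j. Inv i M' \<and> eval (Sub (Add (reg 30) (Const 1)) (reg 31)) M' = 0)"
  proof (rule halts_While)
    fix i M' assume i: "i \<le> j" "Inv i M'"
    have M': "M' 30 0 = x" "M' 31 0 = 2 ^ (2 ^ i)" "M' 32 0 = 2 ^ i"
      using i M by (auto simp: Inv_def same_def)
    show "cost (Sub (Add (reg 30) (Const 1)) (reg 31)) M' \<le> 10 * b"
      using M' sq[OF i(1)] x1 b2 nbits_diff[of "x + 1" "2 ^ (2 ^ i)"] by (simp add: b_def)
    assume ne: "eval (Sub (Add (reg 30) (Const 1)) (reg 31)) M' \<noteq> 0"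
    then have le: "2 ^ (2 ^ i) \<le> x" using M' by simp
    then have lt: "i < j" using j(1) i(1) by (cases "i = j") auto
    have s: "nbits (2 ^ (2 ^ i)) \<le> b" unfolding b_def by (rule nbits_mono[OF le])
    have q: "nbits (2 ^ i) \<le> b"
      unfolding b_def by (rule nbits_mono) (use le less_exp[of "2 ^ i"] in linarith)
    have "halts (Seq (Store 31 (Const 0) (Mul (reg 31) (reg 31)))
        (Store 32 (Const 0) (Add (reg 32) (reg 32)))) M'
        ((1 + cost (Const 0) M' + cost (Mul (reg 31) (reg 31)) M')
         + (4 + 4 * b)) (Inv (Suc i))"
    proof (rule halts_Seq[where R = "\<lambda>M''. M'' = M'(31 := (M' 31)(0 := 2 ^ (2 ^ Suc i)))"])
      show "halts (Store 31 (Const 0) (Mul (reg 31) (reg 31))) M'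
         (1 + cost (Const 0) M' + cost (Mul (reg 31) (reg 31)) M')
         (\<lambda>M''. M'' = M'(31 := (M' 31)(0 := 2 ^ (2 ^ Suc i))))"
        by (rule halts_Store) (simp add: M' power_add[symmetric] mult_2)
      fix M1 assume M1: "M1 = M'(31 := (M' 31)(0 := 2 ^ (2 ^ Suc i)))"
      show "halts (Store 32 (Const 0) (Add (reg 32) (reg 32))) M1 (4 + 4 * b) (Inv (Suc i))"
      proof (rule halts_mono[OF halts_Store[where Q = "Inv (Suc i)"]])
        show "Inv (Suc i) (M1(32 := (M1 32)(eval (Const 0) M1 := eval (Add (reg 32) (reg 32)) M1)))"
          using i(2) M' M1 by (auto simp: Inv_def same_def)
        show "1 + cost (Const 0) M1 + cost (Add (reg 32) (reg 32)) M1 \<le> 4 + 4 * b"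
          using M1 M' q nbits_add[of "2 ^ i" "2 ^ i"] by simp
      qed
    qed
    then have "halts (Seq (Store 31 (Const 0) (Mul (reg 31) (reg 31)))
        (Store 32 (Const 0) (Add (reg 32) (reg 32)))) M' (16 * b) (Inv (Suc i))"
      by (rule halts_mono)
        (use M' s b2 nbits_mult[of "2 ^ (2 ^ i)" "2 ^ (2 ^ i)"] in simp_all)
    then show "i < j \<and> halts (Seq (Store 31 (Const 0) (Mul (reg 31) (reg 31)))
        (Store 32 (Const 0) (Add (reg 32) (reg 32)))) M' (16 * b) (Inv (Suc i))"
      using lt by simp
  next
    show "Inv 0 M" using M by (simp add: Inv_def same_def)
  qed
  show ?thesis
  proof (rule halts_mono[OF L])
    have "(j + 1) * (1 + 10 * b) + j * (16 * b) \<le> (j + 1) * (1 + 10 * b + 16 * b)"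
      by (simp add: algebra_simps)
    also have "\<dots> \<le> (j + 1) * (27 * b)" using b2 by (intro mult_le_mono2) simp
    finally show "(j + 1) * (1 + 10 * b) + j * (16 * b) \<le> 27 * nbits x * (j + 1)"
      by (simp add: b_def mult_ac)
  next
    fix M' assume "\<exists>i\<le>j. Inv i M' \<and> eval (Sub (Add (reg 30) (Const 1)) (reg 31)) M' = 0"
    then obtain i where i: "i \<le> j" "Inv i M'" "eval (Sub (Add (reg 30) (Const 1)) (reg 31)) M' = 0"
      by blast
    then have "x < 2 ^ (2 ^ i)" using M by (simp add: Inv_def same_def)
    then have "i = j" using j(2)[of i] i(1) by (cases "i < j") auto
    then show "same {31, 32} M M' \<and> M' 32 0 = 2 ^ j" using i(2) by (simp add: Inv_def)
  qed
qed

text \<open>About log log \<open>x\<close> rounds are needed, and \<open>nbits x < 2 ^ L\<close>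
  bounds their number by \<open>L\<close>. The exponent \<open>h = q / 2\<close> belongs to the last
  square that does not exceed \<open>x\<close>, so \<open>q\<close> is at most twice the logarithm
  of \<open>x\<close>.\<close>

lemma halts_pay:
  assumes x: "eval w M = x" "2 \<le> x" and L: "1 \<le> L" "nbits (M 23 0) \<le> L" "nbits x < 2 ^ L"
  shows "\<exists>q h. x < 2 ^ q \<and> q = 2 * h \<and> 2 ^ h \<le> x \<and>
    halts (pay w) M (72 * L * cost w M)
      (\<lambda>M'. same {23, 30, 31, 32} M M' \<and> M' 23 = (M 23)(0 := M 23 0 - q))"
proof -
  define j where "j = (LEAST j. x < 2 ^ (2 ^ j))"
  have big: "x < 2 ^ (2 ^ x)" by (meson less_exp less_trans)
  have j: "x < 2 ^ (2 ^ j)" "\<And>i. i < j \<Longrightarrow> 2 ^ (2 ^ i) \<le> x"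
    unfolding j_def using LeastI[of "\<lambda>j. x < 2 ^ (2 ^ j)", OF big] not_less_Least not_less by blast+
  have "j \<noteq> 0" using j(1) x(2) by (intro notI) simp
  then obtain g where g: "j = Suc g" by (cases j) auto
  define b where "b = nbits x"
  have b: "b \<le> cost w M" using nbits_eval_le_cost[of w M] x(1) by (simp add: b_def)
  have b2: "2 \<le> b"
    using nbits_le_iff[of 1 x] x(2) unfolding b_def by simp
  have h: "2 ^ (2 ^ g) \<le> x" using j(2)[of g] g by simp
  have "2 ^ g < b"
    using h less_nbits[of x] unfolding b_def
    by (metis le_less_trans one_less_numeral_iff power_less_imp_less_exp semiring_norm(76))
  then have "2 ^ g < (2::nat) ^ L" using L(3) b_def by linarith
  then have jL: "j \<le> L" using g by simp
  have nq: "nbits (2 ^ j) \<le> j + 1" by (subst nbits_le_iff) auto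
  have "halts (pay w) M ((1 + cost (Const 0) M + cost w M) +
    (4 + (3 + (27 * b * (j + 1) + (4 + 2 * L + nbits (2 ^ j))))))
      (\<lambda>M'. same {23, 30, 31, 32} M M' \<and> M' 23 = (M 23)(0 := M 23 0 - 2 ^ j))"
    unfolding pay_def
  proof (rule halts_Seq[where R = "\<lambda>M'. M' = M(30 := (M 30)(0 := x))"])
    show "halts (Store 30 (Const 0) w) M (1 + cost (Const 0) M + cost w M) (\<lambda>M'. M'
      = M(30 := (M 30)(0 := x)))"
      by (rule halts_Store) (simp add: x)
    fix M1 assume M1: "M1 = M(30 := (M 30)(0 := x))"
    show "halts (Seq (Store 31 (Const 0) (Const 2)) (Seq (Store 32 (Const 0) (Const 1))
      (Seq (While (Sub (Add (reg 30) (Const 1)) (reg 31))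
        (Seq (Store 31 (Const 0) (Mul (reg 31) (reg 31)))
          (Store 32 (Const 0) (Add (reg 32) (reg 32)))))
      (Store 23 (Const 0) (Sub (reg 23) (reg 32)))))) M1
        (4 + (3 + (27 * b * (j + 1) + (4 + 2 * L + nbits (2 ^ j)))))
      (\<lambda>M'. same {23, 30, 31, 32} M M' \<and> M' 23 = (M 23)(0 := M 23 0 - 2 ^ j))"
    proof (rule halts_Seq[where R = "\<lambda>M'. M' = M1(31 := (M1 31)(0 := 2))"])
      show "halts (Store 31 (Const 0) (Const 2)) M1 4 (\<lambda>M'. M' = M1(31 := (M1 31)(0 := 2)))"
        by (rule halts_mono[OF halts_Store[where Q = "\<lambda>M'. M' = M1(31 := (M1 31)(0 := 2))"]])
          (use nbits_2 in simp_all)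
      fix M2 assume M2: "M2 = M1(31 := (M1 31)(0 := 2))"
      show "halts (Seq (Store 32 (Const 0) (Const 1))
        (Seq (While (Sub (Add (reg 30) (Const 1)) (reg 31))
          (Seq (Store 31 (Const 0) (Mul (reg 31) (reg 31)))
            (Store 32 (Const 0) (Add (reg 32) (reg 32)))))
        (Store 23 (Const 0) (Sub (reg 23) (reg 32))))) M2
          (3 + (27 * b * (j + 1) + (4 + 2 * L + nbits (2 ^ j))))
        (\<lambda>M'. same {23, 30, 31, 32} M M' \<and> M' 23 = (M 23)(0 := M 23 0 - 2 ^ j))"
      proof (rule halts_Seq[where R = "\<lambda>M'. M' = M2(32 := (M2 32)(0 := 1))"])
        show "halts (Store 32 (Const 0) (Const 1)) M2 3 (\<lambda>M'. M' = M2(32 := (M2 32)(0 := 1)))"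
          by (rule halts_mono[OF halts_Store[where Q = "\<lambda>M'. M' = M2(32 := (M2 32)(0 := 1))"]])
            simp_all
        fix M3 assume M3: "M3 = M2(32 := (M2 32)(0 := 1))"
        show "halts (Seq (While (Sub (Add (reg 30) (Const 1)) (reg 31))
          (Seq (Store 31 (Const 0) (Mul (reg 31) (reg 31)))
            (Store 32 (Const 0) (Add (reg 32) (reg 32)))))
          (Store 23 (Const 0) (Sub (reg 23) (reg 32)))) M3
            (27 * b * (j + 1) + (4 + 2 * L + nbits (2 ^ j)))
          (\<lambda>M'. same {23, 30, 31, 32} M M' \<and> M' 23 = (M 23)(0 := M 23 0 - 2 ^ j))"
        proof (rule halts_Seq)
          show "halts (While (Sub (Add (reg 30) (Const 1)) (reg 31))
              (Seq (Store 31 (Const 0) (Mul (reg 31) (reg 31)))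
                (Store 32 (Const 0) (Add (reg 32) (reg 32)))))
              M3 (27 * b * (j + 1)) (\<lambda>M'. same {31, 32} M3 M' \<and> M' 32 0 = 2 ^ j)"
            unfolding b_def by (rule halts_pay_loop[OF x(2) j]) (simp_all add: M1 M2 M3)
          fix M4 assume M4: "same {31, 32} M3 M4 \<and> M4 32 0 = 2 ^ j"
          then have 23: "M4 23 = M 23" by (simp add: same_def M1 M2 M3)
          show "halts (Store 23 (Const 0) (Sub (reg 23) (reg 32))) M4 (4 + 2 * L + nbits (2 ^ j))
            (\<lambda>M'. same {23, 30, 31, 32} M M' \<and> M' 23 = (M 23)(0 := M 23 0 - 2 ^ j))"
          proof (rule halts_mono[OF halts_Store[where
                Q = "\<lambda>M'. same {23, 30, 31, 32} M M' \<and> M' 23 = (M 23)(0 := M 23 0 - 2 ^ j)"]])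
            show "1 + cost (Const 0) M4 + cost (Sub (reg 23) (reg 32)) M4
              \<le> 4 + 2 * L + nbits (2 ^ j)"
              using 23 M4 L(2) nbits_diff[of "M 23 0" "2 ^ j"] by simp
          qed (use M4 23 in \<open>auto simp: same_def M1 M2 M3\<close>)
        qed
      qed
    qed
  qed
  then have "halts (pay w) M (72 * L * cost w M)
      (\<lambda>M'. same {23, 30, 31, 32} M M' \<and> M' 23 = (M 23)(0 := M 23 0 - 2 ^ j))"
  proof (rule halts_mono)
    define P where "P = L * cost w M"
    have "27 * b * (j + 1) \<le> 27 * b * (2 * L)"
      using jL L(1) by (intro mult_le_mono2) simp
    also have "\<dots> \<le> 54 * P" using b by (simp add: P_def)
    finally have 1: "27 * b * (j + 1) \<le> 54 * P" .
    have "L \<le> P" "cost w M \<le> P"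
      using L(1) cost_pos[of w M] by (simp_all add: P_def)
    then show "(1 + cost (Const 0) M + cost w M) +
      (4 + (3 + (27 * b * (j + 1) + (4 + 2 * L + nbits (2 ^ j)))))
        \<le> 72 * L * cost w M"
      using 1 nq jL L(1) unfolding mult.assoc P_def[symmetric] by simp
  qed
  then show ?thesis
    using j(1) h g by (intro exI[of _ "2 ^ j"] exI[of _ "2 ^ g"]) simp
qed

text \<open>\<open>nbits (m a i) + F <= Z\<close> trades budget for length: a command is charged
  more than the length of what it writes, so lengths can grow only while \<open>F\<close> shrinks.
  Consequently \<open>Z\<close> bounds every cell, and a constant times \<open>Z\<close> bounds the
  cost of every expression of the simulated program.\<close>

definition sim_state :: "nat \<Rightarrow> nat \<Rightarrow> nat \<Rightarrow> mem \<Rightarrow> mem \<Rightarrow> nat \<Rightarrow> bool" where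
  "sim_state v L Z m M F \<longleftrightarrow> represents v m M \<and> M 23 0 = F \<and> 0 < F \<and> (\<forall>a i. nbits (m a i) + F \<le> Z) \<and>
     nbits v \<le> L \<and> nbits Z \<le> L"

text \<open>Registers 23 and 24 may change only in ways that keep \<open>small\<close>. Arrays 30 to
  32 are unrestricted, since each payment initializes them anew. The last conjunct keeps the cells
  of other simulations intact, in particular those of later ones, which have to be 0.\<close>

definition sim_frame :: "nat \<Rightarrow> mem \<Rightarrow> mem \<Rightarrow> bool" where
  "sim_frame v M M' \<longleftrightarrow> (\<forall>a < 33. a \<notin> {23, 24, 30, 31, 32} \<longrightarrow> M' a = M a) \<and>
     (\<forall>i. M' 23 i \<le> M 23 i) \<and> (\<forall>i. M' 24 i \<le> max 1 (M 24 i)) \<and>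
     (\<forall>a i u. u \<noteq> v \<longrightarrow> M' (33 + a) (cell u i) = M (33 + a) (cell u i))"

lemma sim_frame_refl: "sim_frame v M M"
  by (simp add: sim_frame_def)

lemma sim_frame_trans:
  assumes "sim_frame v M M1" "sim_frame v M1 M2"
  shows "sim_frame v M M2"
  unfolding sim_frame_def
proof (intro conjI allI impI)
  fix i
  show "M2 23 i \<le> M 23 i"
    using assms by (auto simp: sim_frame_def intro: le_trans)
  have "M2 24 i \<le> max 1 (M1 24 i)" "M1 24 i \<le> max 1 (M 24 i)"
    using assms by (auto simp: sim_frame_def)
  then show "M2 24 i \<le> max 1 (M 24 i)" by linarith
qed (use assms in \<open>auto simp: sim_frame_def\<close>)

lemma sim_state_L: "sim_state v L Z m M F \<Longrightarrow> 1 \<le> L"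
  using nbits_pos[of v] by (auto simp: sim_state_def)

lemma sim_state_FZ: "sim_state v L Z m M F \<Longrightarrow> F < Z" "sim_state v L Z m M F \<Longrightarrow> nbits F \<le> L"
proof -
  assume s: "sim_state v L Z m M F"
  then have "nbits (m 0 0) + F \<le> Z" by (simp add: sim_state_def)
  then show "F < Z" using nbits_pos[of "m 0 0"] by linarith
  then show "nbits F \<le> L" using nbits_mono[of F Z] s by (simp add: sim_state_def)
qed

lemma sim_state_cost: "sim_state v L Z m M F \<Longrightarrow> cost e m \<le> exp_size e * Z"
  using sim_state_FZ(1)[of v L Z m M F]
    by (intro cost_le_exp_size) (auto simp: sim_state_def dest: add_leD1)

definition pay_factor :: "aexp \<Rightarrow> nat" where
  "pay_factor e = 72 * (1 + nbits (3 * exp_size e)) * translate_factor (pow_cost e) *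
    pow_cost_factor e"

text \<open>The 4 consists of a factor 2 from \<open>pow_cost_upper\<close> and a factor 2 from the
  step between successive iterated squares.\<close>

lemma halts_charge:
  assumes s: "sim_state v L Z m M F"
  shows "\<exists>q. cost e m < q \<and> q \<le> 4 * cost e m \<and>
    halts (pay (translate (pow_cost e))) M (pay_factor e * (L * L) * cost e m)
      (\<lambda>M'. same {23, 30, 31, 32} M M' \<and> M' 23 = (M 23)(0 := F - q))"
proof -
  \<comment> \<open>The length of the value of \<open>pow_cost e\<close> is at most
    \<open>3 * exp_size e * Z\<close>, with \<open>Z < 2 ^ L\<close>. To keep it below
    \<open>2 ^ L'\<close>, the length of the constant has to be added to \<open>L\<close>; a
    multiple of \<open>L\<close> is taken so that the bound stays a product.\<close>
  define L' where "L' = (1 + nbits (3 * exp_size e)) * L"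
  let ?x = "eval (pow_cost e) m"
  have r: "represents v m M" and v: "nbits v \<le> L" and F: "M 23 0 = F" using s
    by (auto simp: sim_state_def)
  note L = sim_state_L[OF s]
  have Z: "Z < 2 ^ L" using s L by (simp add: sim_state_def nbits_le_iff)
  have LL': "L + nbits (3 * exp_size e) \<le> L'"
    using L by (simp add: L'_def algebra_simps)
  have x: "2 ^ cost e m \<le> ?x" "?x \<le> 2 ^ (2 * cost e m)" by (rule pow_cost_lower pow_cost_upper)+
  have "2 \<le> ?x"
    using x(1) power_increasing[OF cost_pos[of e m], of "2::nat"] by simp
  have "nbits ?x \<le> 3 * cost e m" using nbits_pow_cost[of e m] cost_pos[of e m] by linarith
  also have "\<dots> \<le> 3 * exp_size e * Z" using sim_state_cost[OF s, of e] by simp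
  also have "\<dots> < 2 ^ nbits (3 * exp_size e) * 2 ^ L"
    using Z less_nbits[of "3 * exp_size e"] by (intro mult_strict_mono) auto
  also have "\<dots> \<le> 2 ^ L'" using LL' by (simp add: power_add[symmetric] add.commute)
  finally have nx: "nbits ?x < 2 ^ L'" .
  obtain q h where q: "?x < 2 ^ q" "q = 2 * h" "2 ^ h \<le> ?x"
    "halts (pay (translate (pow_cost e))) M (72 * L' * cost (translate (pow_cost e)) M)
      (\<lambda>M'. same {23, 30, 31, 32} M M' \<and> M' 23 = (M 23)(0 := M 23 0 - q))"
    using halts_pay[of "translate (pow_cost e)" M ?x L'] \<open>2 \<le> ?x\<close> nx sim_state_FZ(2)[OF s] L LL' F
    by (auto simp: eval_translate[OF r])
  have "(2::nat) ^ cost e m < 2 ^ q" using x(1) q(1) by linarith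
  then have 1: "cost e m < q" by simp
  have "(2::nat) ^ h \<le> 2 ^ (2 * cost e m)" using x(2) q(3) by linarith
  then have 2: "q \<le> 4 * cost e m" using q(2) by simp
  have "72 * L' * cost (translate (pow_cost e)) M
    \<le> 72 * L' * (translate_factor (pow_cost e) * L * (pow_cost_factor e * cost e m))"
    using cost_translate[OF r v L, of "pow_cost e"] cost_pow_cost[of e m]
    by (intro mult_le_mono2) (meson le_trans mult_le_mono2)
  also have "\<dots> = pay_factor e * (L * L) * cost e m"
    by (simp add: pay_factor_def L'_def algebra_simps)
  finally show ?thesis
    using 1 2 q(4) F by (intro exI[of _ q] conjI) (auto elim: halts_mono)
qed

text \<open>With an exhausted clock nothing is evaluated any more: the cost expression would read
  cells about which nothing is known by then, whereas skipping it leaves only constant time.\<close>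

definition guard :: "aexp \<Rightarrow> com \<Rightarrow> com \<Rightarrow> com" where
  "guard e p1 p2 = Seq (Cond (reg 23) (pay (translate (pow_cost e))) Skip) (Cond (reg 23) p1 p2)"

lemma guard_zero:
  assumes "M 23 0 = 0" "halts p2 M T Q"
  shows "halts (guard e p1 p2) M (7 + T) Q"
proof -
  have "halts (guard e p1 p2) M ((1 + cost (reg 23) M + 1) + (3 + T)) Q"
    unfolding guard_def
  proof (rule halts_Seq[where R = "\<lambda>M'. M' = M"])
    show "halts (Cond (reg 23) (pay (translate (pow_cost e))) Skip) M (1 + cost (reg 23) M + 1)
      (\<lambda>M'. M' = M)"
      by (rule halts_Cond) (use assms in \<open>auto intro: halts_Skip[simplified]\<close>)
    fix M1 assume M1: "M1 = M"
    have "halts (Cond (reg 23) p1 p2) M1 (1 + cost (reg 23) M1 + T) Q"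
      by (rule halts_Cond) (use assms M1 in simp_all)
    then show "halts (Cond (reg 23) p1 p2) M1 (3 + T) Q"
      by (rule halts_mono) (use assms M1 in simp_all)
  qed
  then show ?thesis by (rule halts_mono) (use assms in simp_all)
qed

lemma sim_state_after_charge:
  assumes "sim_state v L Z m M F" "same {23, 30, 31, 32} M M'" "M' 23 0 = F'" "0 < F'" "F' \<le> F"
  shows "sim_state v L Z m M' F'"
  using assms unfolding sim_state_def represents_def same_def
  by (auto intro: le_trans[OF add_left_mono])

lemma guard_run:
  assumes s: "sim_state v L Z m M F"
    and 1: "\<And>M' q. cost e m < q \<Longrightarrow> q < F \<Longrightarrow> same {23, 30, 31, 32} M M' \<Longrightarrow>
        M' 23 = (M 23)(0 := F - q) \<Longrightarrow> sim_state v L Z m M' (F - q) \<Longrightarrow>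
          halts p1 M' (k * L * cost e m) (Q (F - q))"
    and 2: "\<And>M'. same {23, 30, 31, 32} M M' \<Longrightarrow> M' 23 = (M 23)(0 := 0) \<Longrightarrow> halts p2 M' 10 (Q 0)"
  shows "\<exists>F' < F. F \<le> F' + 4 * cost e m \<and>
     halts (guard e p1 p2) M ((pay_factor e + k + 16) * (exp_size e + 1) * (L * L) *
       (F - F' + (if F' = 0 then Z else 0))) (Q F')"
proof -
  note L = sim_state_L[OF s]
  obtain q where q: "cost e m < q" "q \<le> 4 * cost e m"
    "halts (pay (translate (pow_cost e))) M (pay_factor e * (L * L) * cost e m)
      (\<lambda>M'. same {23, 30, 31, 32} M M' \<and> M' 23 = (M 23)(0 := F - q))"
    using halts_charge[OF s] by blast
  have F: "0 < F" "M 23 0 = F" using s by (auto simp: sim_state_def)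
  define c where "c = (pay_factor e + k + 16) * (L * L) * cost e m"
  have "halts (guard e p1 p2) M ((1 + cost (reg 23) M + pay_factor e * (L * L) * cost e m) +
    (2 + L + (k * L * cost e m + 10))) (Q (F - q))"
    unfolding guard_def
  proof (rule halts_Seq)
    show "halts (Cond (reg 23) (pay (translate (pow_cost e))) Skip) M
      (1 + cost (reg 23) M + pay_factor e * (L * L) * cost e m)
       (\<lambda>M'. same {23, 30, 31, 32} M M' \<and> M' 23 = (M 23)(0 := F - q))"
      by (rule halts_Cond) (use q F in auto)
    fix M' assume M': "same {23, 30, 31, 32} M M' \<and> M' 23 = (M 23)(0 := F - q)"
    have nF: "nbits (F - q) \<le> L" using nbits_diff[of F q] sim_state_FZ(2)[OF s] by linarith
    have "halts (Cond (reg 23) p1 p2) M' (1 + cost (reg 23) M' + (k * L * cost e m + 10))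
      (Q (F - q))"
    proof (rule halts_Cond)
      assume "eval (reg 23) M' \<noteq> 0"
      then have "halts p1 M' (k * L * cost e m) (Q (F - q))"
        using M' q s by (intro 1 sim_state_after_charge[OF s]) auto
      then show "halts p1 M' (k * L * cost e m + 10) (Q (F - q))" by (rule halts_mono) auto
    next
      assume "eval (reg 23) M' = 0"
      then have "F - q = 0" using M' by simp
      then have "halts p2 M' 10 (Q (F - q))" using 2[of M'] M' by simp
      then show "halts p2 M' (k * L * cost e m + 10) (Q (F - q))" by (rule halts_mono) auto
    qed
    then show "halts (Cond (reg 23) p1 p2) M' (2 + L + (k * L * cost e m + 10)) (Q (F - q))"
      by (rule halts_mono) (use M' nF in simp_all)
  qed
  then have R: "halts (guard e p1 p2) M c (Q (F - q))"
  proof (rule halts_mono)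
    define P where "P = L * L * cost e m"
    have P: "L \<le> P" "1 \<le> P" "L * cost e m \<le> P"
      using L cost_pos[of e m] by (simp_all add: P_def)
    have "k * L * cost e m \<le> k * P"
      using mult_le_mono2[OF P(3), of k] by (simp add: mult.assoc)
    moreover have "c = pay_factor e * P + k * P + 16 * P" "pay_factor e * (L * L) * cost e m
      = pay_factor e * P"
      by (simp_all only: c_def P_def algebra_simps)
    moreover have "cost (reg 23) M \<le> 1 + L" using F sim_state_FZ(2)[OF s] by simp
    ultimately show "1 + cost (reg 23) M + pay_factor e * (L * L) * cost e m +
      (2 + L + (k * L * cost e m + 10)) \<le> c"
      using P by linarith
  qed
  have c: "c \<le> (pay_factor e + k + 16) * (exp_size e + 1) * (L * L) * (F - (F - q) + (if F - q
    = 0 then Z else 0))"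
  proof -
    \<comment> \<open>If the charge exhausts the budget, the truncated difference
      \<open>F - (F - q)\<close> is just \<open>F\<close> and may be far below the cost. This is the
      case in which \<open>Z\<close> has to pay.\<close>
    have "cost e m \<le> (exp_size e + 1) * (F - (F - q) + (if F - q = 0 then Z else 0))"
    proof (cases "F - q = 0")
      case True
      have "cost e m \<le> exp_size e * Z" by (rule sim_state_cost[OF s])
      also have "\<dots> \<le> (exp_size e + 1) * (F + Z)" by (intro mult_le_mono) auto
      finally show ?thesis using True by simp
    next
      case False
      then show ?thesis using q(1) by simp
    qed
    then have "(pay_factor e + k + 16) * (L * L) * cost e m \<le>
        (pay_factor e + k + 16) * (L * L) * ((exp_size e + 1) * (F - (F - q) + (if F - q
          = 0 then Z else 0)))"
      by (rule mult_le_mono2)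
    then show ?thesis by (simp only: c_def mult_ac)
  qed
  have "halts (guard e p1 p2) M ((pay_factor e + k + 16) * (exp_size e + 1) * (L * L) *
      (F - (F - q) + (if F - q = 0 then Z else 0))) (Q (F - q))"
    by (rule halts_mono[OF R c])
  then show ?thesis
    using q(1,2) F by (intro exI[of _ "F - q"]) auto
qed

text \<open>\<open>1 - (1 - x)\<close> maps \<open>x\<close> to 0 or 1, so register 24 stays small
  however large the simulated value is. After a time-out it becomes 0, which stops every simulated
  loop.\<close>

definition test :: "aexp \<Rightarrow> com" where
  "test e = guard e (Store 24 (Const 0) (Sub (Const 1) (Sub (Const 1) (translate e))))
                    (Store 24 (Const 0) (Const 0))"

text \<open>
  In the case of \<open>Store\<close> the product \<open>Mul i e\<close> only serves as an expression whose cost covers both.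
  Coin flips need no simulation, since the simulated programs are deterministic.
\<close>

primrec sim :: "com \<Rightarrow> com" where
  "sim Skip = test (Const 0)"
| "sim (Store a i e) = guard (Mul i e) (Store (33 + a) (cell_exp (translate i)) (translate e)) Skip"
| "sim (Flip a i) = Skip"
| "sim (Seq p1 p2) = Seq (sim p1) (sim p2)"
| "sim (Cond e p1 p2) = Seq (test e) (Cond (reg 24) (sim p1) (sim p2))"
| "sim (While e p) = Seq (test e) (While (reg 24) (Seq (sim p) (test e)))"

lemma sim_frame_update_24: "M' = M(24 := (M 24)(0 := y)) \<Longrightarrow> y \<le> 1 \<Longrightarrow> sim_frame v M M'"
  by (auto simp: sim_frame_def)

lemma sim_frame_charge: "same {23, 30, 31, 32} M M' \<Longrightarrow> M' 23 = (M 23)(0 := y) \<Longrightarrow> y \<le> M 23 0 \<Longrightarrow>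
  sim_frame v M M'"
  by (auto simp: sim_frame_def same_def)

lemma test_zero:
  assumes "M 23 0 = 0"
  shows "halts (test e) M 10 (\<lambda>M'. M' 23 0 = 0 \<and> M' 24 0 = 0 \<and> sim_frame v M M')"
proof -
  have "halts (Store 24 (Const 0) (Const 0)) M (1 + cost (Const 0) M + cost (Const 0) M)
      (\<lambda>M'. M' 23 0 = 0 \<and> M' 24 0 = 0 \<and> sim_frame v M M')"
    by (rule halts_Store) (use assms sim_frame_update_24 in auto)
  then have "halts (test e) M (7 + (1 + cost (Const 0) M + cost (Const 0) M))
      (\<lambda>M'. M' 23 0 = 0 \<and> M' 24 0 = 0 \<and> sim_frame v M M')"
    unfolding test_def using assms by (intro guard_zero)
  then show ?thesis by (rule halts_mono) auto
qed

definition test_factor :: "aexp \<Rightarrow> nat" where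
  "test_factor e = (pay_factor e + (translate_factor e + 6) + 16) * (exp_size e + 1)"

lemma test_run:
  assumes s: "sim_state v L Z m M F"
  shows "\<exists>F' < F. F \<le> F' + 4 * cost e m \<and>
     halts (test e) M (test_factor e * (L * L) * (F - F' + (if F' = 0 then Z else 0)))
       (\<lambda>M'. M' 23 0 = F' \<and> sim_frame v M M' \<and>
         (if F' = 0 then M' 24 0 = 0 else sim_state v L Z m M' F' \<and>
           M' 24 0 = (if eval e m = 0 then 0 else 1)))"
  unfolding test_def test_factor_def
proof (rule guard_run[OF s])
  note L = sim_state_L[OF s]
  fix M' q assume q: "cost e m < q" "q < F" and same: "same {23, 30, 31, 32} M M'"
    and 23: "M' 23 = (M 23)(0 := F - q)" and s': "sim_state v L Z m M' (F - q)"
  have r: "represents v m M'" "nbits v \<le> L" using s' by (auto simp: sim_state_def)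
  let ?Q = "\<lambda>M''. M'' 23 0 = F - q \<and> sim_frame v M M'' \<and>
         (if F - q = 0 then M'' 24 0 = 0 else sim_state v L Z m M'' (F - q) \<and>
           M'' 24 0 = (if eval e m = 0 then 0 else 1))"
  let ?x = "Sub (Const 1) (Sub (Const 1) (translate e))"
  show "halts (Store 24 (Const 0) ?x) M' ((translate_factor e + 6) * L * cost e m) ?Q"
  proof (rule halts_mono[OF halts_Store[where Q = ?Q]])
    let ?M = "M'(24 := (M' 24)(eval (Const 0) M' := eval ?x M'))"
    have "sim_frame v M' ?M" by (intro sim_frame_update_24[OF _ _]) auto
    moreover have "sim_frame v M M'" using same 23 s
      by (intro sim_frame_charge[of _ _ "F - q"]) (auto simp: sim_state_def)
    moreover have "sim_state v L Z m ?M (F - q)" using s'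
      by (auto simp: sim_state_def represents_def)
    ultimately show "?Q ?M"
      using 23 q(2) sim_frame_trans[of v M M' ?M] by (auto simp: eval_translate[OF r(1)])
    define P where "P = L * cost e m"
    have "cost (translate e) M' \<le> translate_factor e * P"
      using cost_translate[OF r L, of e] by (simp add: P_def mult.assoc)
    moreover have "1 \<le> P" using L cost_pos[of e m] by (simp add: P_def)
    moreover have "nbits (Suc 0 - y) \<le> 1" for y using nbits_diff[of 1 y] by simp
    note this[of "eval (translate e) M'"] this[of "Suc 0 - eval (translate e) M'"]
    moreover have "(translate_factor e + 6) * L * cost e m = translate_factor e * P + 6 * P"
      by (simp add: P_def algebra_simps)
    ultimately show "1 + cost (Const 0) M' + cost ?x M' \<le> (translate_factor e + 6) * L * cost e m"
      by simp
  qed simp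
next
  fix M' assume M': "same {23, 30, 31, 32} M M'" "M' 23 = (M 23)(0 := 0)"
  let ?Q = "\<lambda>M''. M'' 23 0 = 0 \<and> sim_frame v M M'' \<and>
         (if (0::nat) = 0 then M'' 24 0 = 0 else sim_state v L Z m M'' 0 \<and>
           M'' 24 0 = (if eval e m = 0 then 0 else 1))"
  show "halts (Store 24 (Const 0) (Const 0)) M' 10 ?Q"
  proof (rule halts_mono[OF halts_Store[where Q = ?Q]])
    let ?M = "M'(24 := (M' 24)(eval (Const 0) M' := eval (Const 0) M'))"
    have "sim_frame v M' ?M" by (intro sim_frame_update_24[OF _ _]) auto
    moreover have "sim_frame v M M'" using M' by (intro sim_frame_charge[of _ _ 0]) auto
    ultimately show "?Q ?M"
      using M' sim_frame_trans[of v M M' ?M] by auto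
  qed simp_all
qed

primrec idle_time :: "com \<Rightarrow> nat" where
  "idle_time Skip = 20"
| "idle_time (Store a i e) = 20"
| "idle_time (Flip a i) = 20"
| "idle_time (Seq p1 p2) = idle_time p1 + idle_time p2"
| "idle_time (Cond e p1 p2) = 20 + idle_time p1 + idle_time p2"
| "idle_time (While e p) = 20"

text \<open>With an exhausted clock all tests fail, hence no loop body is entered and the simulation
  merely walks through the program text.\<close>

lemma sim_zero:
  "M 23 0 = 0 \<Longrightarrow> halts (sim p) M (idle_time p) (\<lambda>M'. M' 23 0 = 0 \<and> sim_frame v M M')"
proof (induction p arbitrary: M)
  case Skip
  show ?case unfolding sim.simps
    by (rule halts_mono[OF test_zero[of M "Const 0" v]]) (use Skip in auto)
next
  case (Store a i e)
  have "halts (sim (Store a i e)) M (7 + 1) (\<lambda>M'. M' 23 0 = 0 \<and> sim_frame v M M')"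
    unfolding sim.simps
  proof (rule guard_zero)
    show "halts Skip M 1 (\<lambda>M'. M' 23 0 = 0 \<and> sim_frame v M M')"
      by (rule halts_Skip) (simp add: Store sim_frame_refl)
  qed (rule Store)
  then show ?case by (rule halts_mono) simp_all
next
  case (Flip a i)
  show ?case unfolding sim.simps
    by (rule halts_mono[OF halts_Skip[where Q = "\<lambda>M'. M' = M"]]) (use Flip sim_frame_refl in auto)
next
  case (Seq p1 p2)
  show ?case
    unfolding sim.simps idle_time.simps
  proof (rule halts_Seq[where R = "\<lambda>M'. M' 23 0 = 0 \<and> sim_frame v M M'"])
    show "halts (sim p1) M (idle_time p1) (\<lambda>M'. M' 23 0 = 0 \<and> sim_frame v M M')"
      using Seq by simp
  qed (auto intro!: halts_mono[OF Seq.IH(2)] intro: sim_frame_trans)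
next
  case (Cond e p1 p2)
  have "halts (sim (Cond e p1 p2)) M (10 + (idle_time p1 + idle_time p2 + 10)) (\<lambda>M'. M' 23 0 = 0 \<and>
    sim_frame v M M')"
    unfolding sim.simps
  proof (rule halts_Seq[OF test_zero[of M e v, OF Cond.prems]])
    fix M1 assume M1: "M1 23 0 = 0 \<and> M1 24 0 = 0 \<and> sim_frame v M M1"
    have "halts (Cond (reg 24) (sim p1) (sim p2)) M1 (1 + cost (reg 24) M1 + idle_time p2)
      (\<lambda>M'. M' 23 0 = 0 \<and> sim_frame v M M')"
      by (rule halts_Cond) (use M1 in \<open>auto intro!: halts_mono[OF Cond.IH(2)] intro:
        sim_frame_trans\<close>)
    then show "halts (Cond (reg 24) (sim p1) (sim p2)) M1 (idle_time p1 + idle_time p2 + 10)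
      (\<lambda>M'. M' 23 0 = 0 \<and> sim_frame v M M')"
      by (rule halts_mono) (use M1 in simp_all)
  qed
  then show ?case by (rule halts_mono) auto
next
  case (While e p)
  have "halts (sim (While e p)) M (10 + 10) (\<lambda>M'. M' 23 0 = 0 \<and> sim_frame v M M')"
    unfolding sim.simps
  proof (rule halts_Seq[OF test_zero[of M e v, OF While.prems]])
    fix M1 assume M1: "M1 23 0 = 0 \<and> M1 24 0 = 0 \<and> sim_frame v M M1"
    have "halts (While (reg 24) (Seq (sim p) (test e))) M1 (1 + cost (reg 24) M1) (\<lambda>M'. M' 23 0
      = 0 \<and> sim_frame v M M')"
      by (rule halts_While_False) (use M1 in auto)
    then show "halts (While (reg 24) (Seq (sim p) (test e))) M1 10 (\<lambda>M'. M' 23 0 = 0 \<and>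
      sim_frame v M M')"
      by (rule halts_mono) (use M1 in simp_all)
  qed
  then show ?case by (rule halts_mono) auto
qed

primrec sim_factor :: "com \<Rightarrow> nat" where
  "sim_factor Skip = test_factor (Const 0)"
| "sim_factor (Store a i e)
  = (pay_factor (Mul i e) + (3 * translate_factor i + translate_factor e + 20) + 16) *
  (exp_size (Mul i e) + 1)"
| "sim_factor (Flip a i) = 1"
| "sim_factor (Seq p1 p2) = sim_factor p1 + sim_factor p2 + idle_time p2"
| "sim_factor (Cond e p1 p2) = test_factor e + sim_factor p1 + sim_factor p2 + idle_time p1 +
  idle_time p2 + 10"
| "sim_factor (While e p) = test_factor e + sim_factor p + 30"

text \<open>\<open>T\<close> is the time of the simulation and \<open>t\<close> that of the
  simulated run. The total charge is at most \<open>8 * t\<close>; a budget above that is never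
  exhausted, and as long as some budget is left the simulated memory is represented
  faithfully.\<close>

definition sim_bound :: "nat \<Rightarrow> nat \<Rightarrow> nat \<Rightarrow> nat \<Rightarrow> mem \<Rightarrow> mem \<Rightarrow> nat \<Rightarrow> nat \<Rightarrow> nat \<Rightarrow> mem \<Rightarrow> bool" where
  "sim_bound k v L Z m' M F t T M' \<longleftrightarrow> M' 23 0 < F \<and> F \<le> M' 23 0 + 8 * t \<and>
     T \<le> k * (L * L) * (F - M' 23 0 + (if M' 23 0 = 0 then Z else 0)) \<and> sim_frame v M M' \<and>
     (M' 23 0 \<noteq> 0 \<longrightarrow> sim_state v L Z m' M' (M' 23 0))"

lemma sim_bound_of_halts:
  assumes "F' < F" "F \<le> F' + 8 * t"
    and "halts p M (k * (L * L) * (F - F' + (if F' = 0 then Z else 0)))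
      (\<lambda>M'. M' 23 0 = F' \<and> sim_frame v M M' \<and> (F' \<noteq> 0 \<longrightarrow> sim_state v L Z m' M' F'))"
  shows "\<exists>T M'. runs p M [] T M' \<and> sim_bound k v L Z m' M F t T M'"
  using assms unfolding halts_def sim_bound_def by blast

lemma good_mono: "sim_bound k v L Z m' M F t T M' \<Longrightarrow> t \<le> s \<Longrightarrow> sim_bound k v L Z m' M F s T M'"
  by (auto simp: sim_bound_def)

text \<open>The losses of budget telescope, and the surcharge \<open>Z\<close> occurs at most once,
  because the first part leaves some budget. The constant \<open>c\<close> accounts for a branch
  taken in between.\<close>

lemma good_trans:
  assumes 1: "sim_bound k1 v L Z m1 M F t1 T1 M1" "M1 23 0 \<noteq> 0"
    and 2: "sim_bound k2 v L Z m2 M1 (M1 23 0) t2 T2 M2"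
    and k: "k1 + c \<le> k" "k2 \<le> k"
  shows "sim_bound k v L Z m2 M F (t1 + t2) (T1 + c + T2) M2"
proof -
  let ?X = "L * L" and ?z = "if M2 23 0 = 0 then Z else 0"
  have "sim_state v L Z m1 M1 (M1 23 0)" using 1 by (simp add: sim_bound_def)
  then have X: "1 \<le> ?X" using sim_state_L[of v L Z m1 M1] by simp
  have "T1 \<le> k1 * ?X * (F - M1 23 0)" "1 \<le> F - M1 23 0" using 1 by (auto simp: sim_bound_def)
  moreover have "c \<le> c * ?X * (F - M1 23 0)"
    using X \<open>1 \<le> F - M1 23 0\<close> mult_mono[of 1 ?X 1 "F - M1 23 0"] by (simp add: mult.assoc)
  ultimately have "T1 + c \<le> (k1 + c) * ?X * (F - M1 23 0)"
    by (simp add: algebra_simps)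
  also have "\<dots> \<le> k * ?X * (F - M1 23 0)" using k by (intro mult_le_mono1)
  finally have a: "T1 + c \<le> k * ?X * (F - M1 23 0)" .
  have "T2 \<le> k2 * ?X * (M1 23 0 - M2 23 0 + ?z)" using 2 unfolding sim_bound_def by blast
  also have "\<dots> \<le> k * ?X * (M1 23 0 - M2 23 0 + ?z)" using k by (intro mult_le_mono1)
  finally have "T1 + c + T2 \<le> k * ?X * (F - M1 23 0 + (M1 23 0 - M2 23 0 + ?z))"
    unfolding distrib_left[of _ "F - M1 23 0"] using a by linarith
  moreover have "F - M1 23 0 + (M1 23 0 - M2 23 0 + ?z) = F - M2 23 0 + ?z"
    using 1 2 by (simp add: sim_bound_def)
  ultimately show ?thesis
    using 1 2 by (auto simp: sim_bound_def intro: sim_frame_trans)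
qed

text \<open>Once the clock has run out, the rest takes constant time, which is absorbed into the
  factor \<open>k\<close>. The memory \<open>m2\<close> is arbitrary, as nothing is claimed about
  the simulated memory any more.\<close>

lemma good_zero:
  assumes 1: "sim_bound k1 v L Z m1 M F t T1 M1" "M1 23 0 = 0" and L: "1 \<le> L"
    and 2: "T2 \<le> c" "M2 23 0 = 0" "sim_frame v M1 M2"
    and k: "k1 + c \<le> k"
  shows "sim_bound k v L Z m2 M F t (T1 + T2) M2"
proof -
  let ?X = "L * L"
  have "T1 \<le> k1 * ?X * (F + Z)" "1 \<le> F + Z" using 1 by (auto simp: sim_bound_def)
  moreover have "c \<le> c * ?X * (F + Z)"
    using L \<open>1 \<le> F + Z\<close> mult_mono[of 1 ?X 1 "F + Z"] by (simp add: mult.assoc)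
  ultimately have "T1 + T2 \<le> (k1 + c) * ?X * (F + Z)"
    using 2(1) by (simp add: algebra_simps)
  also have "\<dots> \<le> k * ?X * (F + Z)" using k by (intro mult_le_mono1)
  finally show ?thesis using 1 2 by (auto simp: sim_bound_def intro: sim_frame_trans)
qed

lemma test_good:
  assumes "sim_state v L Z m M F"
  shows "\<exists>T M'. runs (test e) M [] T M' \<and> sim_bound (test_factor e) v L Z m M F (cost e m) T M' \<and>
    M' 24 0 = (if M' 23 0 = 0 \<or> eval e m = 0 then 0 else 1)"
proof -
  obtain F' T M' where *: "F' < F" "F \<le> F' + 4 * cost e m"
    "runs (test e) M [] T M'" "T \<le> test_factor e * (L * L) * (F - F' + (if F' = 0 then Z else 0))"
    "M' 23 0 = F'" "sim_frame v M M'"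
    "if F' = 0 then M' 24 0 = 0 else sim_state v L Z m M' F' \<and>
      M' 24 0 = (if eval e m = 0 then 0 else 1)"
    using test_run[OF assms, of e] unfolding halts_def by blast
  then show ?thesis
    by (intro exI[of _ T] exI[of _ M']) (auto simp: sim_bound_def split: if_splits)
qed

lemma sim_zero_runs:
  assumes "M 23 0 = 0"
  shows "\<exists>T M'. runs (sim p) M [] T M' \<and> T \<le> idle_time p \<and> M' 23 0 = 0 \<and> sim_frame v M M'"
  using sim_zero[of M p v] assms unfolding halts_def by blast

lemma cond_good:
  assumes s: "sim_state v L Z m M F"
    and IH: "\<And>M1. sim_state v L Z m M1 (M1 23 0) \<Longrightarrow>
      \<exists>T M'. runs (sim (if eval e m = 0 then p2 else p1)) M1 [] T M' \<and>
        sim_bound (sim_factor (if eval e m = 0 then p2 else p1)) v L Z m' M1 (M1 23 0) t T M'"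
  shows "\<exists>T M'. runs (sim (Cond e p1 p2)) M [] T M' \<and>
    sim_bound (sim_factor (Cond e p1 p2)) v L Z m' M F (1 + cost e m + t) T M'"
proof -
  obtain T1 M1 where 1: "runs (test e) M [] T1 M1" "sim_bound (test_factor e) v L Z m M F
    (cost e m) T1 M1"
    "M1 24 0 = (if M1 23 0 = 0 \<or> eval e m = 0 then 0 else 1)"
    using test_good[OF s, of e] by blast
  show ?thesis
  proof (cases "M1 23 0 = 0")
    case True
    then obtain T2 M2 where 2: "runs (sim p2) M1 [] T2 M2" "T2 \<le> idle_time p2" "M2 23 0
      = 0" "sim_frame v M1 M2"
      using sim_zero_runs by blast
    have "runs (Cond (reg 24) (sim p1) (sim p2)) M1 [] (1 + cost (reg 24) M1 + T2) M2"
      by (rule runs.CondFalse) (use 1 2 True in auto)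
    from runs.Seq[OF 1(1) this]
    have "runs (sim (Cond e p1 p2)) M [] (T1 + (3 + T2)) M2"
      using 1(3) True by (simp add: numeral_3_eq_3)
    moreover have "sim_bound (sim_factor (Cond e p1 p2)) v L Z m' M F (cost e m) (T1 + (3 + T2)) M2"
      by (rule good_zero[OF 1(2) True sim_state_L[OF s] _ 2(3,4), of _ "3 + idle_time p2"])
        (use 2 in auto)
    ultimately show ?thesis by (blast intro: good_mono[where t = "cost e m"] trans_le_add1 le_add2)
  next
    case False
    then have "sim_state v L Z m M1 (M1 23 0)" using 1(2) by (simp add: sim_bound_def)
    from IH[OF this] obtain T2 M2 where 2: "runs (sim (if eval e m = 0 then p2 else p1)) M1 [] T2
      M2"
      "sim_bound (sim_factor (if eval e m = 0 then p2 else p1)) v L Z m' M1 (M1 23 0) t T2 M2"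
        by blast
    have "runs (Cond (reg 24) (sim p1) (sim p2)) M1 [] (1 + cost (reg 24) M1 + T2) M2"
      using 2(1) 1(3) False runs.CondFalse[of "reg 24" M1 "sim p2" "[]" T2 M2 "sim p1"]
        runs.CondTrue[of "reg 24" M1 "sim p1" "[]" T2 M2 "sim p2"] by (auto split: if_splits)
    from runs.Seq[OF 1(1) this]
    have "runs (sim (Cond e p1 p2)) M [] (T1 + 3 + T2) M2"
      using 1(3) by (auto simp: numeral_3_eq_3 split: if_splits)
    moreover have "sim_bound (sim_factor (Cond e p1 p2)) v L Z m' M F (cost e m + t) (T1 + 3 + T2)
      M2"
      by (rule good_trans[OF 1(2) False 2(2)]) auto
    then have "sim_bound (sim_factor (Cond e p1 p2)) v L Z m' M F (1 + cost e m + t) (T1 + 3 + T2)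
      M2"
      by (rule good_mono) simp
    ultimately show ?thesis by blast
  qed
qed

text \<open>
  The budget is decreased by the cost of a command before that command is executed, so only the
  single command that exhausts it can take longer than what is left; its time is bounded by \<open>Z\<close>,
  as no number in memory is longer than the budget used so far.
\<close>

lemma sim_run:
  assumes "runs p m w t m'" "w = []" "sim_state v L Z m M F"
  shows "\<exists>T M'. runs (sim p) M [] T M' \<and> sim_bound (sim_factor p) v L Z m' M F t T M'"
  using assms
proof (induction arbitrary: M F rule: runs.induct)
  case (Skip m)
  then show ?case
    using test_good[of v L Z m M F "Const 0"] unfolding sim.simps sim_factor.simps by fastforce
next
  case (Store a i e m)
  note s = Store(2) and L = sim_state_L[OF Store(2)]
  let ?m' = "m(a := (m a)(eval i m := eval e m))"
  let ?Q = "\<lambda>F' M'. M' 23 0 = F' \<and> sim_frame v M M' \<and> (F' \<noteq> 0 \<longrightarrow> sim_state v L Z ?m' M' F')"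
  have "\<exists>F' < F. F \<le> F' + 4 * cost (Mul i e) m \<and>
     halts (guard (Mul i e) (Store (33 + a) (cell_exp (translate i)) (translate e)) Skip) M
       ((pay_factor (Mul i e) + (3 * translate_factor i + translate_factor e + 20) + 16) *
         (exp_size (Mul i e) + 1) * (L * L) * (F - F' + (if F' = 0 then Z else 0)))
       (?Q F')"
  proof (rule guard_run[OF s])
    fix M' q assume q: "cost (Mul i e) m < q" "q < F" and same: "same {23, 30, 31, 32} M M'"
      and 23: "M' 23 = (M 23)(0 := F - q)" and s': "sim_state v L Z m M' (F - q)"
    have r: "represents v m M'" "nbits v \<le> L" using s' by (auto simp: sim_state_def)
    have v: "M' 22 0 = v" using r by (simp add: represents_def)
    show "halts (Store (33 + a) (cell_exp (translate i)) (translate e)) M'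
      ((3 * translate_factor i + translate_factor e + 20) * L * cost (Mul i e) m) (?Q (F - q))"
    proof (rule halts_mono[OF halts_Store[where Q = "?Q (F - q)"]])
      let ?M = "M'(33 + a := (M' (33 + a))(eval (cell_exp (translate i)) M' := eval (translate e)
        M'))"
      have M: "?M = M'(33 + a := (M' (33 + a))(cell v (eval i m) := eval e m))"
        by (simp add: eval_translate[OF r(1)] v)
      have "sim_frame v M M'" using same 23 s
        by (intro sim_frame_charge[of _ _ "F - q"]) (auto simp: sim_state_def)
      moreover have "sim_frame v M' ?M" unfolding M sim_frame_def by auto
      moreover have "sim_state v L Z ?m' ?M (F - q)"
        unfolding M sim_state_def
      proof (intro conjI allI)
        show "represents v ?m' (M'(33 + a := (M' (33 + a))(cell v (eval i m) := eval e m)))"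
          using r(1) by (auto simp: represents_def)
        fix b j
        \<comment> \<open>The value written is shorter than the charge, so its length plus the
          remaining budget is below the old budget, which is below \<open>Z\<close>.\<close>
        have "nbits (eval e m) < q" using q(1) nbits_eval_le_cost[of e m] by simp
        then have "nbits (eval e m) + (F - q) \<le> Z" using q(2) sim_state_FZ(1)[OF s] by linarith
        moreover have "nbits (m b j) + (F - q) \<le> Z" using s' unfolding sim_state_def by blast
        ultimately show "nbits (?m' b j) + (F - q) \<le> Z" by (cases "b = a") auto
      qed (use s' in \<open>auto simp: sim_state_def\<close>)
      ultimately show "?Q (F - q) ?M"
        using 23 sim_frame_trans[of v M M' ?M] by auto
      define P where "P = L * cost (Mul i e) m"
      have P: "L * cost i m \<le> P" "L * cost e m \<le> P" "1 \<le> P"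
        using L cost_pos[of "Mul i e" m] by (simp_all add: P_def)
      have "cost (cell_exp (translate i)) M' \<le> (3 * translate_factor i + 17) * P"
        using cost_cell_exp_translate[OF r L cost_translate[OF r L], of i] mult_le_mono2[OF P(1),
          of "3 * translate_factor i + 17"]
        unfolding mult.assoc by linarith
      moreover have "cost (translate e) M' \<le> translate_factor e * P"
        using cost_translate[OF r L, of e] mult_le_mono2[OF P(2), of "translate_factor e"]
        unfolding mult.assoc by linarith
      moreover have "(3 * translate_factor i + translate_factor e + 20) * L * cost (Mul i e) m
        = (3 * translate_factor i + 17) * P + translate_factor e * P + 3 * P"
        by (simp add: P_def algebra_simps)
      ultimately show "1 + cost (cell_exp (translate i)) M' + cost (translate e) M'
        \<le> (3 * translate_factor i + translate_factor e + 20) * L * cost (Mul i e) m"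
        using P(3) by linarith
    qed simp
  next
    fix M' assume M': "same {23, 30, 31, 32} M M'" "M' 23 = (M 23)(0 := 0)"
    have "sim_frame v M M'" using M' by (intro sim_frame_charge[of _ _ 0]) auto
    then show "halts Skip M' 10 (?Q 0)"
      by (intro halts_mono[OF halts_Skip[where Q = "?Q 0"]]) (use M' in auto)
  qed
  then obtain F' where F': "F' < F" "F \<le> F' + 4 * cost (Mul i e) m"
    "halts (sim (Store a i e)) M (sim_factor (Store a i e) * (L * L) * (F - F' + (if F'
      = 0 then Z else 0))) (?Q F')"
    unfolding sim.simps sim_factor.simps by blast
  \<comment> \<open>The source of the 8 in \<open>sim_bound\<close>: the artificial product costs at
    most twice as much as its two factors, and charges are at most four times the cost.\<close>
  moreover have "4 * cost (Mul i e) m \<le> 8 * (1 + cost i m + cost e m)"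
    using nbits_mult[of "eval i m" "eval e m"] nbits_eval_le_cost[of i m] nbits_eval_le_cost[of e m]
    by simp
  ultimately show ?case
    by (intro sim_bound_of_halts[OF _ _ F'(3)]) auto
next
  case (Flip a i m w)
  then show ?case by simp
next
  case (Seq p1 m u t1 m1 p2 w t2 m2)
  from Seq.prems(1) have uw: "u = []" "w = []" by auto
  from Seq.IH(1)[OF uw(1) Seq.prems(2)] obtain T1 M1 where 1: "runs (sim p1) M [] T1 M1"
    "sim_bound (sim_factor p1) v L Z m1 M F t1 T1 M1" by blast
  show ?case
  proof (cases "M1 23 0 = 0")
    case True
    then obtain T2 M2 where 2: "runs (sim p2) M1 [] T2 M2" "T2 \<le> idle_time p2" "M2 23 0
      = 0" "sim_frame v M1 M2"
      using sim_zero_runs by blast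
    have "sim_bound (sim_factor (Seq p1 p2)) v L Z m2 M F t1 (T1 + T2) M2"
      by (rule good_zero[OF 1(2) True sim_state_L[OF Seq.prems(2)] 2(2-4)]) simp
    then have "sim_bound (sim_factor (Seq p1 p2)) v L Z m2 M F (t1 + t2) (T1 + T2) M2"
      by (rule good_mono) simp
    then show ?thesis using runs.Seq[OF 1(1) 2(1)] by auto
  next
    case False
    then have "sim_state v L Z m1 M1 (M1 23 0)" using 1(2) by (simp add: sim_bound_def)
    from Seq.IH(2)[OF uw(2) this] obtain T2 M2 where 2: "runs (sim p2) M1 [] T2 M2"
      "sim_bound (sim_factor p2) v L Z m2 M1 (M1 23 0) t2 T2 M2" by blast
    have "sim_bound (sim_factor (Seq p1 p2)) v L Z m2 M F (t1 + t2) (T1 + 0 + T2) M2"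
      by (rule good_trans[OF 1(2) False 2(2)]) auto
    then show ?thesis using runs.Seq[OF 1(1) 2(1)] by auto
  qed
next
  case (CondTrue e m p1 u t m1 p2)
  show ?case
    by (rule cond_good[OF CondTrue.prems(2)]) (use CondTrue in simp)
next
  case (CondFalse e m p2 u t m1 p1)
  show ?case
    by (rule cond_good[OF CondFalse.prems(2)]) (use CondFalse in simp)
next
  case (WhileTrue e m p u t1 m1 w t2 m2)
  let ?W = "While (reg 24) (Seq (sim p) (test e))"
  note L = sim_state_L[OF WhileTrue.prems(2)]
  from WhileTrue.prems(1) have uw: "u = []" "w = []" by auto
  obtain T0 M0 where 0: "runs (test e) M [] T0 M0" "sim_bound (test_factor e) v L Z m M F
    (cost e m) T0 M0"
    "M0 24 0 = (if M0 23 0 = 0 then 0 else 1)"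
    using test_good[OF WhileTrue.prems(2), of e] WhileTrue.hyps(1) by auto
  show ?case
  proof (cases "M0 23 0 = 0")
    case True
    have "runs ?W M0 [] (1 + cost (reg 24) M0) M0"
      by (rule runs.WhileFalse) (use 0 True in simp)
    from runs.Seq[OF 0(1) this] have "runs (sim (While e p)) M [] (T0 + 3) M0"
      using 0(3) True by (simp add: numeral_3_eq_3)
    moreover have "sim_bound (sim_factor (While e p)) v L Z m2 M F (cost e m) (T0 + 3) M0"
      by (rule good_zero[OF 0(2) True L, of 3 3]) (use True sim_frame_refl in auto)
    then have "sim_bound (sim_factor (While e p)) v L Z m2 M F (1 + cost e m + t1 + t2) (T0 + 3) M0"
      by (rule good_mono) simp
    ultimately show ?thesis by blast
  next
    case False
    then have "sim_state v L Z m M0 (M0 23 0)" using 0(2) by (simp add: sim_bound_def)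
    from WhileTrue.IH(1)[OF uw(1) this] obtain T1 M1 where 1: "runs (sim p) M0 [] T1 M1"
      "sim_bound (sim_factor p) v L Z m1 M0 (M0 23 0) t1 T1 M1" by blast
    have g: "sim_bound (test_factor e + sim_factor p + 10) v L Z m1 M F (cost e m + t1)
      (T0 + 3 + T1) M1"
      by (rule good_trans[OF 0(2) False 1(2)]) auto
    have "\<exists>T2 M2. runs (Seq (test e) ?W) M1 [] T2 M2 \<and>
        sim_bound (sim_factor (While e p)) v L Z m2 M F (1 + cost e m + t1 + t2)
          (T0 + 3 + T1 + T2) M2"
    proof (cases "M1 23 0 = 0")
      case True
      then obtain T2 M2 where 2: "runs (sim (While e p)) M1 [] T2 M2" "T2 \<le> idle_time (While e p)"
          "M2 23 0 = 0" "sim_frame v M1 M2"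
        using sim_zero_runs by blast
      have "sim_bound (sim_factor (While e p)) v L Z m2 M F (cost e m + t1) (T0 + 3 + T1 + T2) M2"
        by (rule good_zero[OF g True L 2(2-4)]) simp
      then have "sim_bound (sim_factor (While e p)) v L Z m2 M F (1 + cost e m + t1 + t2)
        (T0 + 3 + T1 + T2) M2"
        by (rule good_mono) simp
      then show ?thesis using 2(1) by auto
    next
      case False
      then have "sim_state v L Z m1 M1 (M1 23 0)" using g by (simp add: sim_bound_def)
      from WhileTrue.IH(2)[OF uw(2) this] obtain T2 M2 where 2: "runs (sim (While e p)) M1 [] T2 M2"
        "sim_bound (sim_factor (While e p)) v L Z m2 M1 (M1 23 0) t2 T2 M2" by blast
      have "sim_bound (sim_factor (While e p)) v L Z m2 M F (cost e m + t1 + t2)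
        (T0 + 3 + T1 + 0 + T2) M2"
        by (rule good_trans[OF g False 2(2)]) auto
      then have "sim_bound (sim_factor (While e p)) v L Z m2 M F (1 + cost e m + t1 + t2)
        (T0 + 3 + T1 + T2) M2"
        by (auto intro: good_mono)
      then show ?thesis using 2(1) by auto
    qed
    then obtain T2 M2 where 2: "runs (Seq (test e) ?W) M1 [] T2 M2"
        "sim_bound (sim_factor (While e p)) v L Z m2 M F (1 + cost e m + t1 + t2)
          (T0 + 3 + T1 + T2) M2" by blast
    \<comment> \<open>The simulation of a loop starts with a test of its own. The test in front of
      the remaining iterations is split off and becomes the end of the body just executed, which is
      where the translated loop has it.\<close>
    from 2(1) obtain S1 S2 N where 3: "runs (test e) M1 [] S1 N" "runs ?W N [] S2 M2" "T2 = S1 + S2"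
      by (auto elim: runs_SeqE)
    have "runs (Seq (sim p) (test e)) M0 [] (T1 + S1) N" using runs.Seq[OF 1(1) 3(1)] by simp
    then have "runs ?W M0 [] (1 + cost (reg 24) M0 + (T1 + S1) + S2) M2"
      using runs.WhileTrue[of "reg 24" M0 "Seq (sim p) (test e)" "[]" "T1 + S1" N "[]" S2 M2] 3(2)
        0(3) False
      by simp
    from runs.Seq[OF 0(1) this] have "runs (sim (While e p)) M [] (T0 + 3 + T1 + T2) M2"
      using 0(3) False 3(3) by (simp add: algebra_simps numeral_3_eq_3)
    with 2(2) show ?thesis by blast
  qed
next
  case (WhileFalse e m p)
  let ?W = "While (reg 24) (Seq (sim p) (test e))"
  obtain T0 M0 where 0: "runs (test e) M [] T0 M0" "sim_bound (test_factor e) v L Z m M F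
    (cost e m) T0 M0"
    "M0 24 0 = 0"
    using test_good[OF WhileFalse.prems(2), of e] WhileFalse.hyps by auto
  have "runs ?W M0 [] (1 + cost (reg 24) M0) M0"
    by (rule runs.WhileFalse) (use 0 in simp)
  from runs.Seq[OF 0(1) this] have r: "runs (sim (While e p)) M [] (T0 + 3) M0"
    using 0(3) by (simp add: numeral_3_eq_3)
  have "T0 \<le> test_factor e * (L * L) * (F - M0 23 0 + (if M0 23 0 = 0 then Z else 0))" "1
    \<le> F - M0 23 0"
    using 0(2) by (auto simp: sim_bound_def)
  moreover have "3 \<le> 3 * (L * L) * (F - M0 23 0 + (if M0 23 0 = 0 then Z else 0))"
    using calculation(2) sim_state_L[OF WhileFalse.prems(2)]
      mult_mono[of 1 "L * L" 1 "F - M0 23 0 + (if M0 23 0 = 0 then Z else 0)"] by simp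
  ultimately have "T0 + 3 \<le> (test_factor e + 3) * (L * L) * (F - M0 23 0 + (if M0 23 0
    = 0 then Z else 0))"
    unfolding distrib_right by linarith
  also have "\<dots> \<le> sim_factor (While e p) * (L * L) * (F - M0 23 0 + (if M0 23 0 = 0 then Z else 0))"
    by (intro mult_le_mono1) simp
  finally have "sim_bound (sim_factor (While e p)) v L Z m M F (1 + cost e m) (T0 + 3) M0"
    using 0(2) by (auto simp: sim_bound_def)
  with r show ?case by blast
qed

section \<open>Randomized runs\<close>

text \<open>
  For every sequence of coins \<open>\<omega>\<close>, program \<open>p\<close> halts within time \<open>T\<close>; \<open>\<rho> \<omega>\<close> consists of the final
  memory, which has distribution \<open>D\<close>,
    and the unused coins, which are fresh. The latter is expressed by
  integrating an arbitrary function of the final memory and the unused coins.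
\<close>

definition samples_via :: "com \<Rightarrow> mem \<Rightarrow> nat \<Rightarrow> mem pmf \<Rightarrow> (bool stream \<Rightarrow> mem \<times> bool stream) \<Rightarrow> bool"
  where
  "samples_via p m T D \<rho> \<longleftrightarrow>
     (\<forall>\<omega>. \<exists>l t. runs p m (stake l \<omega>) t (fst (\<rho> \<omega>)) \<and> t \<le> T \<and> snd (\<rho> \<omega>) = sdrop l \<omega> \<and>
        fst (\<rho> \<omega>) \<in> set_pmf D) \<and>
     (\<forall>g :: mem \<Rightarrow> bool stream \<Rightarrow> ennreal. (\<forall>m'. g m' \<in> borel_measurable coins) \<longrightarrow>
        (\<lambda>\<omega>. g (fst (\<rho> \<omega>)) (snd (\<rho> \<omega>))) \<in> borel_measurable coins \<and>
        (\<integral>\<^sup>+\<omega>. g (fst (\<rho> \<omega>)) (snd (\<rho> \<omega>)) \<partial>coins) = (\<integral>\<^sup>+m'. (\<integral>\<^sup>+\<omega>. g m' \<omega> \<partial>coins) \<partial>measure_pmf D))"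

definition samples :: "com \<Rightarrow> mem \<Rightarrow> nat \<Rightarrow> mem pmf \<Rightarrow> bool" where
  "samples p m T D \<longleftrightarrow> (\<exists>\<rho>. samples_via p m T D \<rho>)"

lemma samples_mono: "samples p m T D \<Longrightarrow> T \<le> T' \<Longrightarrow> samples p m T' D"
  unfolding samples_def samples_via_def by (blast intro: le_trans)

lemma samples_det: "runs p m [] t m' \<Longrightarrow> t \<le> T \<Longrightarrow> samples p m T (return_pmf m')"
  unfolding samples_def samples_via_def
proof (rule exI[of _ "\<lambda>\<omega>. (m', \<omega>)"], intro conjI allI impI)
  assume *: "runs p m [] t m'" "t \<le> T"
  fix \<omega> :: "bool stream"
  show "\<exists>l t. runs p m (stake l \<omega>) t (fst (m', \<omega>)) \<and> t \<le> T \<and> snd (m', \<omega>) = sdrop l \<omega> \<and>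
      fst (m', \<omega>) \<in> set_pmf (return_pmf m')"
    by (rule exI[of _ 0], rule exI[of _ t]) (use * in auto)
qed auto

text \<open>A stream of independent coins consists of its first coin and an independent stream of
  the same distribution.\<close>

lemma samples_Flip:
  "samples (Flip a i) m (1 + cost i m)
     (map_pmf (\<lambda>w. m(a := (m a)(eval i m := of_bool w))) (bernoulli_pmf (1 / 2)))"
  (is "samples _ _ _ (map_pmf ?f _)")
  unfolding samples_def samples_via_def
proof (intro exI[of _ "\<lambda>\<omega>. (?f (shd \<omega>), stl \<omega>)"] conjI allI impI)
  fix \<omega> :: "bool stream"
  show "\<exists>l t. runs (Flip a i) m (stake l \<omega>) t (fst (?f (shd \<omega>), stl \<omega>)) \<and> t \<le> 1 + cost i m \<and>
      snd (?f (shd \<omega>), stl \<omega>) = sdrop l \<omega> \<and>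
      fst (?f (shd \<omega>), stl \<omega>) \<in> set_pmf (map_pmf ?f (bernoulli_pmf (1 / 2)))"
    using runs.Flip[of a i m "shd \<omega>"]
    by (intro exI[of _ 1] exI[of _ "1 + cost i m"]) (auto simp: set_pmf_bernoulli)
next
  fix g :: "mem \<Rightarrow> bool stream \<Rightarrow> ennreal"
  assume g: "\<forall>m'. g m' \<in> borel_measurable coins"
  let ?G = "\<lambda>\<omega>. g (?f (shd \<omega>)) (stl \<omega>)"
  have [measurable]: "g m' \<in> borel_measurable
    (stream_space (measure_pmf (bernoulli_pmf (1 / 2))))" for m'
    using g by (simp add: coins_def)
  \<comment> \<open>Measurability of \<open>g\<close> is known only for each fixed memory, so the
    two memories that can arise are separated.\<close>
  have "?G = (\<lambda>\<omega>. if shd \<omega> then g (?f True) (stl \<omega>) else g (?f False) (stl \<omega>))"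
    by auto
  also have "\<dots> \<in> borel_measurable coins"
    unfolding coins_def by measurable
  finally have m: "?G \<in> borel_measurable coins" .
  then show "(\<lambda>\<omega>. g (fst (?f (shd \<omega>), stl \<omega>)) (snd (?f (shd \<omega>), stl \<omega>))) \<in> borel_measurable coins"
    by simp
  have "(\<integral>\<^sup>+\<omega>. ?G \<omega> \<partial>coins)
    = (\<integral>\<^sup>+x. (\<integral>\<^sup>+X. ?G (x ## X) \<partial>coins) \<partial>measure_pmf (bernoulli_pmf (1 / 2)))"
    using m unfolding coins_def
      by (intro prob_space.nn_integral_stream_space[OF prob_space_measure_pmf])
  then show "(\<integral>\<^sup>+\<omega>. g (fst (?f (shd \<omega>), stl \<omega>)) (snd (?f (shd \<omega>), stl \<omega>)) \<partial>coins)
      = (\<integral>\<^sup>+m'. (\<integral>\<^sup>+\<omega>. g m' \<omega> \<partial>coins) \<partial>measure_pmf (map_pmf ?f (bernoulli_pmf (1 / 2))))"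
    by simp
qed

text \<open>How runs combine is left to the premise \<open>comp\<close>, and \<open>c\<close> is the
  overhead of the combination; thus one proof covers sequences as well as the unfolding of a
  loop.\<close>

lemma samples_bind:
  assumes 1: "samples p1 m T1 D"
    and 2: "\<And>m1. m1 \<in> set_pmf D \<Longrightarrow> samples p2 m1 T2 (E m1)"
    and comp: "\<And>u t1 m1 w t2 m2. m1 \<in> set_pmf D \<Longrightarrow> runs p1 m u t1 m1 \<Longrightarrow> runs p2 m1 w t2 m2 \<Longrightarrow>
      runs p m (u @ w) (c + t1 + t2) m2"
  shows "samples p m (c + T1 + T2) (bind_pmf D E)"
proof -
  obtain \<rho> where "samples_via p1 m T1 D \<rho>"
    using 1 unfolding samples_def by blast
  note r = this[unfolded samples_via_def, THEN conjunct1, rule_format]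
    this[unfolded samples_via_def, THEN conjunct2, rule_format]
  have "\<forall>m1 \<in> set_pmf D. \<exists>\<sigma>. samples_via p2 m1 T2 (E m1) \<sigma>"
    using 2 unfolding samples_def by blast
  then obtain \<sigma> where "\<And>m1. m1 \<in> set_pmf D \<Longrightarrow> samples_via p2 m1 T2 (E m1) (\<sigma> m1)"
    by metis
  note s = this[unfolded samples_via_def, THEN conjunct1, rule_format]
    this[unfolded samples_via_def, THEN conjunct2, rule_format]
  show ?thesis
    unfolding samples_def samples_via_def
  proof (intro exI[of _ "\<lambda>\<omega>. \<sigma> (fst (\<rho> \<omega>)) (snd (\<rho> \<omega>))"] conjI allI impI)
    fix \<omega>
    obtain l1 t1 where 1: "runs p1 m (stake l1 \<omega>) t1 (fst (\<rho> \<omega>))" "t1 \<le> T1" "snd (\<rho> \<omega>) = sdrop l1 \<omega>"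
      "fst (\<rho> \<omega>) \<in> set_pmf D" using r(1) by blast
    let ?s = "\<sigma> (fst (\<rho> \<omega>)) (snd (\<rho> \<omega>))"
    obtain l2 t2 where 2: "runs p2 (fst (\<rho> \<omega>)) (stake l2 (sdrop l1 \<omega>)) t2 (fst ?s)" "t2 \<le> T2"
      "snd ?s = sdrop l2 (sdrop l1 \<omega>)" "fst ?s \<in> set_pmf (E (fst (\<rho> \<omega>)))"
      using s(1)[OF 1(4), of "snd (\<rho> \<omega>)"] 1(3) by auto
    have "runs p m (stake (l1 + l2) \<omega>) (c + t1 + t2) (fst ?s)"
      using comp[OF 1(4) 1(1) 2(1)] by (simp add: stake_add)
    then show "\<exists>l t. runs p m (stake l \<omega>) t (fst ?s) \<and> t \<le> c + T1 + T2 \<and> snd ?s = sdrop l \<omega> \<and>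
        fst ?s \<in> set_pmf (bind_pmf D E)"
      using 1 2 by (intro exI[of _ "l1 + l2"] exI[of _ "c + t1 + t2"]) (auto simp: sdrop_add)
  next
    fix g :: "mem \<Rightarrow> bool stream \<Rightarrow> ennreal"
    assume g: "\<forall>m'. g m' \<in> borel_measurable coins"
    \<comment> \<open>\<open>\<sigma> m1\<close> is a sampler only for \<open>m1\<close> in the
      support of \<open>D\<close>. The integrand is cut off outside, where nothing is known about
      measurability; the run itself never gets there.\<close>
    define h where "h m1 \<omega> = (if m1 \<in> set_pmf D then g (fst (\<sigma> m1 \<omega>)) (snd (\<sigma> m1 \<omega>)) else 0)" for
      m1 \<omega>
    have h: "h m1 \<in> borel_measurable coins" for m1
      using s(2)[of m1 g] g by (cases "m1 \<in> set_pmf D") (auto simp: h_def[abs_def])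
    have D: "fst (\<rho> \<omega>) \<in> set_pmf D" for \<omega> using r(1) by blast
    have eq: "(\<lambda>\<omega>. h (fst (\<rho> \<omega>)) (snd (\<rho> \<omega>)))
      = (\<lambda>\<omega>. g (fst (\<sigma> (fst (\<rho> \<omega>)) (snd (\<rho> \<omega>)))) (snd (\<sigma> (fst (\<rho> \<omega>)) (snd (\<rho> \<omega>)))))"
      using D by (simp add: h_def)
    show "(\<lambda>\<omega>. g (fst (\<sigma> (fst (\<rho> \<omega>)) (snd (\<rho> \<omega>)))) (snd (\<sigma> (fst (\<rho> \<omega>)) (snd (\<rho> \<omega>))))) \<in>
      borel_measurable coins"
      using r(2)[of h, OF h] unfolding eq by blast
    have "(\<integral>\<^sup>+m1. (\<integral>\<^sup>+\<omega>. h m1 \<omega> \<partial>coins) \<partial>measure_pmf D)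
        = (\<integral>\<^sup>+m1. (\<integral>\<^sup>+m'. (\<integral>\<^sup>+\<omega>. g m' \<omega> \<partial>coins) \<partial>measure_pmf (E m1)) \<partial>measure_pmf D)"
      using s(2) g by (intro nn_integral_cong_AE AE_pmfI) (simp add: h_def)
    then show "(\<integral>\<^sup>+\<omega>. g (fst (\<sigma> (fst (\<rho> \<omega>)) (snd (\<rho> \<omega>)))) (snd (\<sigma> (fst (\<rho> \<omega>)) (snd (\<rho> \<omega>)))) \<partial>coins)
        = (\<integral>\<^sup>+m'. (\<integral>\<^sup>+\<omega>. g m' \<omega> \<partial>coins) \<partial>measure_pmf (bind_pmf D E))"
      using r(2)[of h, OF h] unfolding eq by simp
  qed
qed

text \<open>An upper bound on an expectation rather than on a probability: \<open>f\<close> can then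
  be a potential, such as the chance of failure given what has happened so far. \<open>T\<close> and
  \<open>Q\<close> hold for every outcome of the coins, the bound \<open>v\<close> on
  average.\<close>

definition expects :: "com \<Rightarrow> mem \<Rightarrow> nat \<Rightarrow> (mem \<Rightarrow> bool) \<Rightarrow> (mem \<Rightarrow> ennreal) \<Rightarrow> ennreal \<Rightarrow> bool" where
  "expects p m T Q f v \<longleftrightarrow> (\<exists>D. samples p m T D \<and> (\<forall>m' \<in> set_pmf D. Q m') \<and>
    (\<integral>\<^sup>+m'. f m' \<partial>measure_pmf D) \<le> v)"

lemma expects_mono:
  assumes "expects p m T Q f v" "T \<le> T'" "\<And>m'. Q m' \<Longrightarrow> Q' m'" "\<And>m'. Q m' \<Longrightarrow> f' m' \<le> f m'" "v \<le> v'"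
  shows "expects p m T' Q' f' v'"
proof -
  obtain D where D: "samples p m T D" "\<forall>m' \<in> set_pmf D. Q m'" "(\<integral>\<^sup>+m'. f m' \<partial>measure_pmf D) \<le> v"
    using assms(1) unfolding expects_def by blast
  have "(\<integral>\<^sup>+m'. f' m' \<partial>measure_pmf D) \<le> (\<integral>\<^sup>+m'. f m' \<partial>measure_pmf D)"
    using D(2) assms(4) by (intro nn_integral_mono_AE AE_pmfI) auto
  then show ?thesis
    using D assms unfolding expects_def by (meson samples_mono order_trans)
qed

lemma expects_const:
  assumes "expects p m T Q g v" "\<And>m'. Q m' \<Longrightarrow> f m' \<le> w"
  shows "expects p m T Q f w"
proof -
  obtain D where D: "samples p m T D" "\<forall>m' \<in> set_pmf D. Q m'"
    using assms(1) unfolding expects_def by blast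
  have "(\<integral>\<^sup>+m'. f m' \<partial>measure_pmf D) \<le> (\<integral>\<^sup>+m'. w \<partial>measure_pmf D)"
    using D(2) assms(2) by (intro nn_integral_mono_AE AE_pmfI) auto
  also have "\<dots> = w" by simp
  finally show ?thesis using D unfolding expects_def by blast
qed

lemma expects_of_halts:
  assumes "halts p m T Q" "\<And>m'. Q m' \<Longrightarrow> f m' \<le> v"
  shows "expects p m T Q f v"
proof -
  obtain t m' where "runs p m [] t m'" "t \<le> T" "Q m'"
    using assms(1) unfolding halts_def by blast
  then show ?thesis
    using samples_det[of p m t m' T] assms(2) unfolding expects_def
      by (intro exI[of _ "return_pmf m'"]) simp
qed

lemma expects_Flip:
  assumes "\<And>w. Q (m(a := (m a)(eval i m := of_bool w)))"
  shows "expects (Flip a i) m (1 + cost i m) Q f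
    ((f (m(a := (m a)(eval i m := 0))) + f (m(a := (m a)(eval i m := 1)))) / 2)"
proof -
  have "ennreal (1 / 2) = 1 / 2"
    by (metis divide_ennreal ennreal_1 ennreal_numeral zero_le_numeral zero_le_one
      zero_less_numeral)
  then show ?thesis
  unfolding expects_def using assms
  by (intro exI[of _ "map_pmf (\<lambda>w. m(a := (m a)(eval i m := of_bool w))) (bernoulli_pmf (1 / 2))"]
      conjI samples_Flip)
    (auto simp: field_simps ennreal_divide_times add_divide_distrib_ennreal mult.commute
      nn_integral_bernoulli_pmf)
qed

lemma expects_bind:
  assumes 1: "expects p1 m T1 R h v" and 2: "\<And>m1. R m1 \<Longrightarrow> expects p2 m1 T2 Q f (h m1)"
    and comp: "\<And>u t1 m1 w t2 m2. R m1 \<Longrightarrow> runs p1 m u t1 m1 \<Longrightarrow> runs p2 m1 w t2 m2 \<Longrightarrow>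
      runs p m (u @ w) (c + t1 + t2) m2"
  shows "expects p m (c + T1 + T2) Q f v"
proof -
  obtain D where D: "samples p1 m T1 D" "\<forall>m' \<in> set_pmf D. R m'" "(\<integral>\<^sup>+m'. h m' \<partial>measure_pmf D) \<le> v"
    using 1 unfolding expects_def by blast
  obtain E where E: "\<And>m1. R m1 \<Longrightarrow> samples p2 m1 T2 (E m1) \<and> (\<forall>m' \<in> set_pmf (E m1). Q m') \<and>
      (\<integral>\<^sup>+m'. f m' \<partial>measure_pmf (E m1)) \<le> h m1"
    using 2 unfolding expects_def by metis
  have "(\<integral>\<^sup>+m'. f m' \<partial>measure_pmf (bind_pmf D E))
    = (\<integral>\<^sup>+m1. (\<integral>\<^sup>+m'. f m' \<partial>measure_pmf (E m1)) \<partial>measure_pmf D)"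
    by simp
  also have "\<dots> \<le> (\<integral>\<^sup>+m'. h m' \<partial>measure_pmf D)"
    using E D(2) by (intro nn_integral_mono_AE AE_pmfI) auto
  also have "\<dots> \<le> v" by (rule D(3))
  finally have "(\<integral>\<^sup>+m'. f m' \<partial>measure_pmf (bind_pmf D E)) \<le> v" .
  moreover have "samples p m (c + T1 + T2) (bind_pmf D E)"
    by (rule samples_bind[OF D(1)]) (use D(2) E comp in auto)
  ultimately show ?thesis
    unfolding expects_def using D(2) E by (intro exI[of _ "bind_pmf D E"]) auto
qed

lemma expects_Seq:
  assumes "expects p1 m T1 R h v" and "\<And>m1. R m1 \<Longrightarrow> expects p2 m1 T2 Q f (h m1)"
  shows "expects (Seq p1 p2) m (T1 + T2) Q f v"
proof -
  have "expects (Seq p1 p2) m (0 + T1 + T2) Q f v"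
    by (rule expects_bind[OF assms]) (auto intro: runs.Seq)
  then show ?thesis by simp
qed

lemma expects_lift:
  assumes "expects p m T Q f v" "\<And>w t m'. runs p m w t m' \<Longrightarrow> runs q m w (c + t) m'"
  shows "expects q m (c + T) Q f v"
proof -
  have "samples q m (c + T) D" if D: "samples p m T D" for D
  proof -
    obtain \<rho> where r: "samples_via p m T D \<rho>" using D unfolding samples_def by blast
    have "\<exists>l t. runs q m (stake l \<omega>) t (fst (\<rho> \<omega>)) \<and> t \<le> c + T \<and> snd (\<rho> \<omega>) = sdrop l \<omega> \<and>
        fst (\<rho> \<omega>) \<in> set_pmf D" for \<omega>
    proof -
      obtain l t where "runs p m (stake l \<omega>) t (fst (\<rho> \<omega>))" "t \<le> T" "snd (\<rho> \<omega>) = sdrop l \<omega>"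
        "fst (\<rho> \<omega>) \<in> set_pmf D"
        using r unfolding samples_via_def by blast
      then show ?thesis using assms(2) by (intro exI[of _ l] exI[of _ "c + t"]) auto
    qed
    then show ?thesis using r unfolding samples_def samples_via_def by blast
  qed
  then show ?thesis using assms(1) unfolding expects_def by blast
qed

lemma expects_Cond:
  assumes "eval e m \<noteq> 0 \<Longrightarrow> expects p1 m T Q f v" and "eval e m = 0 \<Longrightarrow> expects p2 m T Q f v"
  shows "expects (Cond e p1 p2) m (1 + cost e m + T) Q f v"
proof (cases "eval e m = 0")
  case True
  then show ?thesis using assms(2)
    by (intro expects_lift[of p2]) (auto intro: runs.CondFalse[simplified])
next
  case False
  then show ?thesis using assms(1)
    by (intro expects_lift[of p1]) (auto intro: runs.CondTrue[simplified])
qed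

text \<open>The potential \<open>\<phi>\<close> is a supermartingale along the iterations: its
  expectation after one round is at most its present value, and on exit it dominates
  \<open>f\<close>.\<close>

lemma expects_While:
  assumes cost: "\<And>i m. i \<le> n \<Longrightarrow> Inv i m \<Longrightarrow> cost e m \<le> c"
    and step: "\<And>i m. i \<le> n \<Longrightarrow> Inv i m \<Longrightarrow> eval e m \<noteq> 0 \<Longrightarrow>
      i < n \<and> expects p m T (Inv (Suc i)) (\<phi> (Suc i)) (\<phi> i m)"
    and stop: "\<And>i m. i \<le> n \<Longrightarrow> Inv i m \<Longrightarrow> eval e m = 0 \<Longrightarrow> Q m \<and> f m \<le> \<phi> i m"
    and init: "Inv 0 m"
  shows "expects (While e p) m ((n + 1) * (1 + c) + n * T) Q f (\<phi> 0 m)"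
proof -
  have "expects (While e p) m ((d + 1) * (1 + c) + d * T) Q f (\<phi> i m)"
    if "Inv i m" "i + d = n" for i d m
    using that
  proof (induction d arbitrary: i m)
    case 0
    then have e: "eval e m = 0" using step[of i m] by auto
    then have "expects (While e p) m (1 + cost e m) Q f (\<phi> i m)"
      using stop[of i m] 0
      by (intro expects_mono[OF expects_of_halts[OF halts_While_False[where Q = "\<lambda>m'. Q m' \<and>
        f m' \<le> \<phi> i m"],
          where f = f and v = "\<phi> i m"]]) auto
    then show ?case
      by (rule expects_mono) (use 0 cost[of i m] in auto)
  next
    case (Suc d)
    show ?case
    proof (cases "eval e m = 0")
      case True
      then have "expects (While e p) m (1 + cost e m) Q f (\<phi> i m)"
        using stop[of i m] Suc.prems
        by (intro expects_mono[OF expects_of_halts[OF halts_While_False[where Q = "\<lambda>m'. Q m' \<and>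
          f m' \<le> \<phi> i m"],
          where f = f and v = "\<phi> i m"]]) auto
      then show ?thesis
        by (rule expects_mono) (use Suc.prems cost[of i m] in auto)
    next
      case False
      then have 1: "expects p m T (Inv (Suc i)) (\<phi> (Suc i)) (\<phi> i m)" using step[of i m] Suc.prems
        by auto
      have "expects (While e p) m (1 + cost e m + T + ((d + 1) * (1 + c) + d * T)) Q f (\<phi> i m)"
      proof (rule expects_bind[OF 1])
        fix m1 assume "Inv (Suc i) m1"
        then show "expects (While e p) m1 ((d + 1) * (1 + c) + d * T) Q f (\<phi> (Suc i) m1)"
          using Suc.prems by (intro Suc.IH) auto
      qed (use runs.WhileTrue[OF False] in blast)
      then show ?thesis
        by (rule expects_mono) (use Suc.prems cost[of i m] in auto)
    qed
  qed
  from this[OF init, of n] show ?thesis by simp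
qed

lemma expects_scale:
  assumes "expects p m T Q f v"
  shows "expects p m T Q (\<lambda>m'. c * f m') (c * v)"
proof -
  obtain D where D: "samples p m T D" "\<forall>m' \<in> set_pmf D. Q m'" "(\<integral>\<^sup>+m'. f m' \<partial>measure_pmf D) \<le> v"
    using assms unfolding expects_def by blast
  then show ?thesis
    unfolding expects_def by (intro exI[of _ D]) (auto simp: nn_integral_cmult mult_left_mono)
qed

lemma runs_stake_unique:
  assumes "runs p m (stake k \<omega>) t m1" "runs p m (stake l \<omega>) s m2"
  shows "m1 = m2"
proof -
  have "stake k \<omega> @ stake l (sdrop k \<omega>) = stake l \<omega> @ stake k (sdrop l \<omega>)"
    by (simp add: stake_add add.commute)
  then show ?thesis using runs_deterministic[OF assms] by blast
qed

lemma expects_run: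
  "expects p m T Q f v \<Longrightarrow> \<exists>l t m'. runs p m (stake l \<omega>) t m' \<and> t \<le> T \<and> Q m'"
  unfolding expects_def samples_def samples_via_def by blast

text \<open>For an indicator of failure the expectation is the probability. The event quantifies
  over runs, but coins determine the run, so it coincides with the event that the memory given by
  \<open>\<rho>\<close> satisfies \<open>R\<close>; its measurability comes from
  \<open>samples_via\<close>.\<close>

lemma expects_prob:
  assumes "expects p m T Q (\<lambda>m'. if R m' then 0 else 1) (ennreal v)" "0 \<le> v"
  shows "\<P>(\<omega> in coins. \<exists>l t m'. runs p m (stake l \<omega>) t m' \<and> Q m' \<and> R m') \<ge> 1 - v"
proof -
  interpret prob_space coins
    unfolding coins_def by (rule prob_space.prob_space_stream_space[OF prob_space_measure_pmf])
  obtain D \<rho> where D: "samples_via p m T D \<rho>" "\<forall>m' \<in> set_pmf D. Q m'"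
    "(\<integral>\<^sup>+m'. (if R m' then 0 else 1) \<partial>measure_pmf D) \<le> ennreal v"
    using assms(1) unfolding expects_def samples_def by blast
  let ?g = "\<lambda>m' (\<omega> :: bool stream). if R m' then 0 else 1 :: ennreal"
  have g: "(\<lambda>\<omega>. ?g (fst (\<rho> \<omega>)) (snd (\<rho> \<omega>))) \<in> borel_measurable coins"
    "(\<integral>\<^sup>+\<omega>. ?g (fst (\<rho> \<omega>)) (snd (\<rho> \<omega>)) \<partial>coins) = (\<integral>\<^sup>+m'. (\<integral>\<^sup>+\<omega>. ?g m' \<omega> \<partial>coins) \<partial>measure_pmf D)"
    using D(1)[unfolded samples_via_def, THEN conjunct2, rule_format, of ?g] by simp_all
  have sp: "space coins = UNIV" by (simp add: coins_def space_stream_space)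
  let ?N = "{\<omega>. \<not> R (fst (\<rho> \<omega>))}"
  have "?N = (\<lambda>\<omega>. ?g (fst (\<rho> \<omega>)) (snd (\<rho> \<omega>))) -` {1} \<inter> space coins"
    by (auto simp: sp)
  then have N: "?N \<in> sets coins" using measurable_sets[OF g(1), of "{1}"] by simp
  have "emeasure coins ?N = (\<integral>\<^sup>+\<omega>. indicator ?N \<omega> \<partial>coins)" using N by simp
  also have "\<dots> = (\<integral>\<^sup>+\<omega>. ?g (fst (\<rho> \<omega>)) (snd (\<rho> \<omega>)) \<partial>coins)"
    by (intro nn_integral_cong) auto
  also have "\<dots> = (\<integral>\<^sup>+m'. (if R m' then 0 else 1) \<partial>measure_pmf D)"
    unfolding g(2) by (intro nn_integral_cong) (simp add: emeasure_space_1)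
  finally have "emeasure coins ?N \<le> ennreal v" using D(3) by simp
  then have "prob ?N \<le> v" using assms(2) by (simp add: emeasure_eq_measure)
  moreover have "{\<omega> \<in> space coins. \<exists>l t m'. runs p m (stake l \<omega>) t m' \<and> Q m' \<and>
    R m'} = space coins - ?N"
  proof -
    have "(\<exists>l t m'. runs p m (stake l \<omega>) t m' \<and> Q m' \<and> R m') \<longleftrightarrow> R (fst (\<rho> \<omega>))" for \<omega>
    proof -
      obtain l t where "runs p m (stake l \<omega>) t (fst (\<rho> \<omega>))" "fst (\<rho> \<omega>) \<in> set_pmf D"
        using D(1) unfolding samples_via_def by blast
      then show ?thesis using runs_stake_unique D(2) by blast
    qed
    then show ?thesis by (auto simp: sp)
  qed
  ultimately show ?thesis using N prob_compl[of ?N] by simp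
qed

section \<open>The best sample size\<close>

lemma binomial_Suc_times: "Suc j * (m choose Suc j) = (m - j) * (m choose j)"
  using binomial_absorption[of j m] binomial_absorb_comp[of m j] by simp

text \<open>\<open>left\<close> and \<open>right\<close> say that the term of index \<open>a\<close>
  is at least as large as its two neighbours. The ratio of successive terms is decreasing, so that
  term is the maximum and the sum of \<open>m + 1\<close> terms is at most \<open>m + 1\<close>
  times as large.\<close>

lemma binomial_mode:
  fixes \<beta> \<gamma> :: real
  assumes nonneg: "0 \<le> \<beta>" "0 \<le> \<gamma>" and a: "a \<le> m"
    and left: "real a * \<gamma> \<le> (real m - real a + 1) * \<beta>"
    and right: "(real m - real a) * \<beta> \<le> (real a + 1) * \<gamma>"
  shows "(\<beta> + \<gamma>) ^ m \<le> (real m + 1) * (real (m choose a) * \<beta> ^ a * \<gamma> ^ (m - a))"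
proof -
  define T where "T j = real (m choose j) * \<beta> ^ j * \<gamma> ^ (m - j)" for j
  have b: "real (Suc j) * real (m choose Suc j) = (real m - real j) * real (m choose j)"
    if "j < m" for j
  proof -
    have "real (Suc j * (m choose Suc j)) = real ((m - j) * (m choose j))"
      by (simp only: binomial_Suc_times)
    then show ?thesis using that by (simp only: of_nat_mult of_nat_diff less_imp_le)
  qed
  have split: "T j = real (m choose j) * \<gamma> * (\<beta> ^ j * \<gamma> ^ (m - Suc j))"
      "T (Suc j) = real (m choose Suc j) * \<beta> * (\<beta> ^ j * \<gamma> ^ (m - Suc j))" if "j < m" for j
  proof -
    have "m - j = Suc (m - Suc j)" using that by simp
    then show "T j = real (m choose j) * \<gamma> * (\<beta> ^ j * \<gamma> ^ (m - Suc j))"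
      unfolding T_def by simp
  qed (simp add: T_def)
  have up: "T j \<le> T (Suc j)" if "j < a" for j
  proof -
    have "real (Suc j) * \<gamma> \<le> real a * \<gamma>" using that nonneg by (intro mult_right_mono) auto
    also have "\<dots> \<le> (real m - real a + 1) * \<beta>" by (rule left)
    also have "\<dots> \<le> (real m - real j) * \<beta>" using that nonneg by (intro mult_right_mono) auto
    finally have "real (m choose j) * (real (Suc j) * \<gamma>)
      \<le> real (m choose j) * ((real m - real j) * \<beta>)"
      by (rule mult_left_mono) simp
    also have "\<dots> = real (Suc j) * (real (m choose Suc j) * \<beta>)"
      unfolding mult.assoc[symmetric] using b[of j] that a
        by (simp only: mult.commute less_le_trans)
    finally have "real (Suc j) * (real (m choose j) * \<gamma>)
      \<le> real (Suc j) * (real (m choose Suc j) * \<beta>)"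
      unfolding mult.left_commute[of "real (m choose j)" "real (Suc j)"] .
    then have "real (m choose j) * \<gamma> \<le> real (m choose Suc j) * \<beta>"
      by (rule mult_left_le_imp_le) simp
    then show ?thesis
      using split[of j] that a nonneg by (simp only:) (intro mult_right_mono, auto)
  qed
  have down: "T (Suc j) \<le> T j" if "a \<le> j" "j < m" for j
  proof -
    have "(real m - real j) * \<beta> \<le> (real m - real a) * \<beta>"
      using that nonneg by (intro mult_right_mono) auto
    also have "\<dots> \<le> (real a + 1) * \<gamma>" by (rule right)
    also have "\<dots> \<le> real (Suc j) * \<gamma>" using that nonneg by (intro mult_right_mono) auto
    finally have "real (m choose j) * ((real m - real j) * \<beta>)
      \<le> real (m choose j) * (real (Suc j) * \<gamma>)"
      by (rule mult_left_mono) simp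
    moreover have "real (m choose j) * ((real m - real j) * \<beta>)
      = real (Suc j) * (real (m choose Suc j) * \<beta>)"
      unfolding mult.assoc[symmetric] using b[of j] that by (simp only: mult.commute)
    ultimately have "real (Suc j) * (real (m choose Suc j) * \<beta>)
      \<le> real (Suc j) * (real (m choose j) * \<gamma>)"
      unfolding mult.left_commute[of "real (m choose j)" "real (Suc j)"] by simp
    then have "real (m choose Suc j) * \<beta> \<le> real (m choose j) * \<gamma>"
      by (rule mult_left_le_imp_le) simp
    then show ?thesis
      using split[of j] that nonneg by (simp only:) (intro mult_right_mono, auto)
  qed
  have max: "T j \<le> T a" if "j \<le> m" for j
  proof (cases "j \<le> a")
    case True
    then show ?thesis
    proof (induction rule: inc_induct)
      case (step i)
      then show ?case using up[of i] by linarith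
    qed simp
  next
    case False
    then have "a \<le> j" by simp
    then show ?thesis using that
    proof (induction rule: dec_induct)
      case (step i)
      then show ?case using down[of i] by simp
    qed simp
  qed
  have "(\<beta> + \<gamma>) ^ m = (\<Sum>j\<le>m. T j)"
    by (simp add: binomial_ring T_def)
  also have "\<dots> \<le> (\<Sum>j\<le>m. T a)" using max by (intro sum_mono) auto
  finally show ?thesis by (simp add: T_def mult_ac add.commute)
qed

text \<open>Bernoulli's inequality for real exponents, from concavity of \<open>ln\<close>:
  \<open>1 + u\<close> is the convex combination of 1 and \<open>1 + p * u\<close> with weight
  \<open>1 / p\<close> on the latter.\<close>

lemma Bernoulli_powr:
  fixes u p :: real
  assumes "0 \<le> u" "1 \<le> p"
  shows "1 + p * u \<le> (1 + u) powr p"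
proof -
  have "(1 - 1 / p) * ln 1 + (1 / p) * ln (1 + p * u)
    \<le> ln ((1 - 1 / p) *\<^sub>R 1 + (1 / p) *\<^sub>R (1 + p * u))"
    using assms by (intro concave_onD[OF ln_concave]) (auto simp: add_pos_nonneg)
  also have "(1 - 1 / p) *\<^sub>R 1 + (1 / p) *\<^sub>R (1 + p * u) = 1 + u"
    using assms by (simp add: field_simps)
  finally have "ln (1 + p * u) \<le> p * ln (1 + u)"
    using assms by (simp add: field_simps)
  then have "exp (ln (1 + p * u)) \<le> exp (p * ln (1 + u))" by simp
  then show ?thesis
    using assms by (simp add: powr_def add_pos_nonneg)
qed

text \<open>Here the empty sample is good enough. The base on the right is
  \<open>b * (1 + u)\<close>, so the claim amounts to \<open>c ^ k <= (1 + u) ^ n\<close>. Two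
  applications of Bernoulli's inequality give
  \<open>c <= (1 + b * u) powr c <= (1 + u) powr (b * c)\<close>, and \<open>k * b * c <= n\<close>
  does the rest.\<close>

lemma small_solutions:
  fixes b c :: real
  assumes "1 \<le> b" "1 \<le> c" "real k * (b * c) \<le> real n"
  shows "b ^ n * c ^ k \<le> (1 + b - 1 / c) ^ n"
proof -
  define u where "u = (1 - 1 / c) / b"
  have u: "0 \<le> u" using assms by (simp add: u_def)
  have "c \<le> (1 + (1 - 1 / c)) powr c"
    using Bernoulli_powr[of "1 - 1 / c" c] assms by (simp add: field_simps)
  also have "1 + (1 - 1 / c) = 1 + b * u" using assms by (simp add: u_def)
  also have "(1 + b * u) powr c \<le> ((1 + u) powr b) powr c"
    using Bernoulli_powr[OF u, of b] assms u by (intro powr_mono2) auto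
  finally have "c \<le> (1 + u) powr (b * c)" by (simp add: powr_powr)
  then have "c ^ k \<le> ((1 + u) powr (b * c)) ^ k" using assms by (intro power_mono) auto
  also have "\<dots> = (1 + u) powr (real k * (b * c))"
    using u by (simp add: powr_powr powr_realpow[symmetric] mult_ac)
  also have "\<dots> \<le> (1 + u) powr real n" using assms u by (intro powr_mono) auto
  also have "\<dots> = (1 + u) ^ n" using u by (simp add: powr_realpow)
  finally have "b ^ n * c ^ k \<le> b ^ n * (1 + u) ^ n" using assms by (intro mult_left_mono) auto
  also have "\<dots> = (b * (1 + u)) ^ n" by (simp add: power_mult_distrib)
  also have "b * (1 + u) = 1 + b - 1 / c" using assms by (simp add: u_def distrib_left)
  finally show ?thesis .
qed

text \<open>
  With \<open>m = n - t\<close>, the weight of sample size \<open>t\<close> is close to optimal when \<open>n - k\<close> is the index of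
  the largest term in the binomial expansion of \<open>((b - 1 / c) + 1 / c) ^ m\<close>.
\<close>

lemma optimal_sample_size:
  fixes b c :: real
  assumes bc: "1 \<le> b" "1 \<le> c" and k: "k \<le> n"
  shows "\<exists>t\<le>k. real (n choose t) * (b ^ (n - t) * c ^ (k - t)) \<le>
    real (k choose t) * ((real n + 1) * (1 + b - 1 / c) ^ n)"
proof -
  define \<beta> where "\<beta> = b - 1 / c"
  define \<gamma> where "\<gamma> = 1 / c"
  define a where "a = n - k"
  \<comment> \<open>\<open>P m\<close> is the condition \<open>left\<close> of
    \<open>binomial_mode\<close> at index \<open>a\<close>. For the least such \<open>m\<close>, the
    failure of \<open>P (m - 1)\<close> supplies \<open>right\<close>, so that \<open>a\<close> is
    the mode for this exponent.\<close>
  define P where "P m \<longleftrightarrow> a \<le> m \<and> real a * \<gamma> \<le> (real m - real a + 1) * \<beta>" for m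
  have "1 / c \<le> 1" "0 \<le> 1 / c" using bc by simp_all
  then have "1 / c \<le> b" using bc by linarith
  then have nonneg: "0 \<le> \<beta>" "0 \<le> \<gamma>" using bc unfolding \<beta>_def \<gamma>_def by auto
  have base: "1 \<le> 1 + \<beta>" "1 + \<beta> = 1 + b - 1 / c" using nonneg by (auto simp: \<beta>_def)
  show ?thesis
  proof (cases "\<exists>m\<le>n. P m")
    case True
    define m where "m = (LEAST m. P m)"
    obtain m' where m': "m' \<le> n" "P m'" using True by blast
    have Pm: "P m" unfolding m_def by (rule LeastI[of P, OF m'(2)])
    have "m \<le> m'" unfolding m_def by (rule Least_le[of P, OF m'(2)])
    with m' have mn: "m \<le> n" by simp
    have am: "a \<le> m" using Pm by (simp add: P_def)
    have right: "(real m - real a) * \<beta> \<le> (real a + 1) * \<gamma>"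
    proof (cases "m = a")
      case True
      then show ?thesis using nonneg by simp
    next
      case False
      then have m1: "a \<le> m - 1" "m - 1 < m" using am by auto
      then have "\<not> P (m - 1)" unfolding m_def by (metis not_less_Least)
      then have "(real m - real a) * \<beta> \<le> real a * \<gamma>"
        using m1 by (auto simp: P_def of_nat_diff algebra_simps)
      also have "\<dots> \<le> (real a + 1) * \<gamma>" using nonneg by (intro mult_right_mono) auto
      finally show ?thesis .
    qed
    define t where "t = n - m"
    have t: "t \<le> k" "n - t = m" "m - a = k - t" "n - k = a"
      using am mn k by (auto simp: t_def a_def)
    have "b ^ m = (\<beta> + \<gamma>) ^ m" by (simp add: \<beta>_def \<gamma>_def)
    also have "\<dots> \<le> (real m + 1) * (real (m choose a) * \<beta> ^ a * \<gamma> ^ (m - a))"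
      using Pm right nonneg am by (intro binomial_mode) (auto simp: P_def)
    finally have "b ^ m * c ^ (k - t) \<le> (real m + 1) * (real (m choose a) * \<beta> ^ a * \<gamma> ^ (m - a)) *
      c ^ (k - t)"
      using bc by (intro mult_right_mono) auto
    also have "\<dots> = (real m + 1) * (real (m choose a) * \<beta> ^ a)"
      using bc t by (simp add: \<gamma>_def power_one_over field_simps)
    also have "\<dots> \<le> (real n + 1) * (real (m choose a) * \<beta> ^ a)"
      using mn nonneg by (intro mult_right_mono) auto
    finally have "real (n choose t) * (b ^ m * c ^ (k - t)) \<le>
        real (n choose t) * ((real n + 1) * (real (m choose a) * \<beta> ^ a))"
      by (intro mult_left_mono) auto
    also have "\<dots> = real ((n choose t) * (m choose a)) * ((real n + 1) * \<beta> ^ a)"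
      by (simp add: mult_ac)
    \<comment> \<open>Trinomial revision: choosing first the sample and then the complement of the
      solution amounts to choosing the solution and then the sample within it. The factor
      \<open>k choose t\<close> is the one on the right-hand side of the claim.\<close>
    also have "(n choose t) * (m choose a) = (n choose k) * (k choose t)"
    proof -
      have "m choose a = (n - t) choose (k - t)"
        using binomial_symmetric[of a m] am t by simp
      then show ?thesis using choose_mult[of t k n] t k by simp
    qed
    also have "real ((n choose k) * (k choose t)) * ((real n + 1) * \<beta> ^ a)
        = real (k choose t) * ((real n + 1) * (real (n choose k) * \<beta> ^ (n - k)))"
      using t by (simp add: mult_ac)
    also have "\<dots> \<le> real (k choose t) * ((real n + 1) * (1 + \<beta>) ^ n)"
    proof -
      \<comment> \<open>What remains is one term of the expansion of
        \<open>(1 + \<beta>) ^ n\<close>.\<close>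
      have "real (n choose k) * \<beta> ^ (n - k) = real (n choose k) * 1 ^ k * \<beta> ^ (n - k)" by simp
      also have "\<dots> \<le> (\<Sum>j\<le>n. real (n choose j) * 1 ^ j * \<beta> ^ (n - j))"
        using k nonneg by (intro member_le_sum) auto
      also have "\<dots> = (1 + \<beta>) ^ n" by (simp add: binomial_ring)
      finally show ?thesis by (intro mult_left_mono) auto
    qed
    finally show ?thesis using t base by (intro exI[of _ t]) simp
  next
    case False
    then have "\<not> real a * \<gamma> \<le> (real n - real a + 1) * \<beta>" by (auto simp: P_def a_def)
    then have "(real k + 1) * \<beta> < (real n - real k) * \<gamma>"
      using k by (simp add: a_def of_nat_diff algebra_simps)
    moreover have "real k * \<beta> \<le> (real k + 1) * \<beta>" using nonneg by (intro mult_right_mono) auto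
    ultimately have "real k * (\<beta> + \<gamma>) \<le> real n * \<gamma>" by (simp add: algebra_simps)
    then have "real k * b \<le> real n / c" by (simp add: \<beta>_def \<gamma>_def)
    then have "real k * (b * c) \<le> real n" using bc by (simp add: field_simps)
    then have "b ^ n * c ^ k \<le> (1 + b - 1 / c) ^ n" by (rule small_solutions[OF bc])
    also have "\<dots> \<le> (real n + 1) * (1 + b - 1 / c) ^ n"
      using base by (simp add: algebra_simps)
    finally show ?thesis by (intro exI[of _ 0]) simp
  qed
qed

section \<open>The number of trials as a quotient of falling factorials\<close>

definition falling :: "nat \<Rightarrow> nat \<Rightarrow> nat" where
  "falling n t = (\<Prod>i<t. n - i)"

lemma falling_0 [simp]: "falling n 0 = 1"
  and falling_Suc: "falling n (Suc t) = falling n t * (n - t)"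
  by (simp_all add: falling_def)

lemma falling_eq: "falling n t = fact t * (n choose t)"
proof (induction t)
  case (Suc t)
  have "falling n (Suc t) = fact t * ((n - t) * (n choose t))"
    using Suc by (simp add: falling_Suc)
  also have "\<dots> = fact (Suc t) * (n choose Suc t)"
    unfolding binomial_Suc_times[symmetric]
      by (simp only: fact_Suc of_nat_id mult.assoc mult.left_commute)
  finally show ?case .
qed simp

text \<open>
  The quotient of the falling factorials is that of the binomial coefficients, but a program can
  update falling factorials by a single multiplication.
\<close>

definition reps :: "nat \<Rightarrow> nat \<Rightarrow> nat \<Rightarrow> nat" where
  "reps n k t = falling n t div falling k t + 1"

text \<open>The \<open>+ 1\<close> in \<open>reps\<close> compensates for rounding down. It at most
  doubles the quotient, which is at least 1 as \<open>k <= n\<close>.\<close>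

lemma reps_bounds:
  assumes "t \<le> k" "k \<le> n"
  shows "real (n choose t) \<le> real (k choose t) * real (reps n k t)"
    and "real (k choose t) * real (reps n k t) \<le> 2 * real (n choose t)"
proof -
  have eq: "falling n t div falling k t = (n choose t) div (k choose t)"
    by (simp add: falling_eq)
  have pos: "0 < k choose t" using assms by simp
  have "n choose t < (k choose t) * ((n choose t) div (k choose t)) + (k choose t)"
    using dividend_less_times_div[OF pos, of "n choose t"] by simp
  then have "n choose t \<le> (k choose t) * reps n k t"
    by (simp add: reps_def eq algebra_simps)
  then show "real (n choose t) \<le> real (k choose t) * real (reps n k t)"
    by (metis of_nat_le_iff of_nat_mult)
  have "(k choose t) * ((n choose t) div (k choose t)) \<le> n choose t" by simp
  moreover have "k choose t \<le> n choose t" using assms by (intro binomial_right_mono) auto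
  ultimately have "(k choose t) * reps n k t \<le> 2 * (n choose t)"
    unfolding reps_def eq distrib_left by linarith
  then have "real ((k choose t) * reps n k t) \<le> real (2 * (n choose t))"
    by (simp only: of_nat_le_iff)
  then show "real (k choose t) * real (reps n k t) \<le> 2 * real (n choose t)" by simp
qed

text \<open>The witness \<open>q\<close> is \<open>a * D / r\<close> rounded up. A number drawn
  uniformly below \<open>D\<close> thus passes the test \<open>x * r < a * D\<close> with
  probability \<open>q / D\<close>, which is at least \<open>a / r\<close> and exceeds it by less
  than \<open>1 / D\<close>.\<close>

lemma card_threshold:
  fixes a r D :: nat
  assumes "a \<le> r" "1 \<le> r"
  shows "\<exists>q\<le>D. {x. x < D \<and> x * r < a * D} = {..<q} \<and> a * D \<le> q * r \<and> q * r < a * D + r"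
proof (intro exI[of _ "(a * D + r - 1) div r"] conjI)
  let ?q = "(a * D + r - 1) div r"
  have iff: "x < ?q \<longleftrightarrow> x * r < a * D" for x
    using less_eq_div_iff_mult_less_eq[of r "Suc x" "a * D + r - 1"] assms by (auto simp: Suc_le_eq)
  have "a * D \<le> D * r" using assms by (simp add: mult.commute mult_le_mono)
  then have "\<not> D * r < a * D" by linarith
  then have "\<not> D < ?q" using iff[of D] by blast
  then show qD: "?q \<le> D" by simp
  show "{x. x < D \<and> x * r < a * D} = {..<?q}" using iff qD by force
  show "a * D \<le> ?q * r" using iff[of ?q] by simp
  show "?q * r < a * D + r"
    using assms div_times_less_eq_dividend[of "a * D + r - 1" r] by linarith
qed

text \<open>
  A lower bound for the probability that \<open>a\<close> elements chosen from the remaining \<open>r\<close> all belong to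
  a set that contains \<open>\<kappa>\<close> of these. The next element is taken with a probability that is rounded to
  a multiple of \<open>1 / D\<close>; each such decision costs at most a factor \<open>1 - n / D\<close>.
\<close>

definition hit_prob :: "nat \<Rightarrow> nat \<Rightarrow> nat \<Rightarrow> nat \<Rightarrow> nat \<Rightarrow> real" where
  "hit_prob n D r a \<kappa> = (1 - real n / real D) ^ r * (real (\<kappa> choose a) / real (r choose a))"

text \<open>Without rounding, both inequalities are equations between ratios of binomial
  coefficients, the first one by Pascal's rule. An element of the target set may be taken or left,
  any other one has to be left. As \<open>q\<close> is rounded up, only the probability of leaving
  an element suffers; the factor \<open>1 - n / D\<close> per element makes up for this.\<close>

lemma hit_prob_step:
  assumes q: "q \<le> D" "a * D \<le> q * r" "q * r < a * D + r"
    and r: "1 \<le> r" "a \<le> r" "r \<le> n" "n \<le> D"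
  shows "1 \<le> \<kappa> \<Longrightarrow> \<kappa> \<le> r \<Longrightarrow> hit_prob n D r a \<kappa> \<le>
      real q / real D * (if a = 0 then 0 else hit_prob n D (r - 1) (a - 1) (\<kappa> - 1)) +
      (1 - real q / real D) * hit_prob n D (r - 1) a (\<kappa> - 1)" (is "_ \<Longrightarrow> _ \<Longrightarrow> ?in")
    and "\<kappa> < r \<Longrightarrow> hit_prob n D r a \<kappa> \<le> (1 - real q / real D) * hit_prob n D (r - 1) a \<kappa>"
proof -
  define g where "g = 1 - real n / real D"
  have D: "0 < D" using r by linarith
  have g: "0 \<le> g" "g \<le> 1" using r D by (auto simp: g_def)
  have low: "real a / real r \<le> real q / real D"
  proof -
    have "real a * real D \<le> real q * real r" using q(2) by (metis of_nat_le_iff of_nat_mult)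
    then show ?thesis using D r by (simp add: field_simps)
  qed
  have high: "(real r - real a) / real r * g \<le> 1 - real q / real D" if "a < r"
  proof -
    have "real q * real r \<le> real a * real D + real r"
      using q(3) by (metis less_imp_le of_nat_add of_nat_le_iff of_nat_mult)
    then have "real q / real D \<le> real a / real r + 1 / real D"
      using D r by (simp add: field_simps)
    moreover have "(real r - real a) / real r * g \<le> (real r - real a) / real r - 1 / real D"
    proof -
      \<comment> \<open>Since \<open>a < r\<close>, the difference \<open>r - a\<close> is at least
        1, and \<open>r <= n\<close>. This is why the loss per decision can be stated with
        \<open>n / D\<close> uniformly in \<open>a\<close> and \<open>r\<close>.\<close>
      have "1 * real r \<le> (real r - real a) * real n" using that r by (intro mult_mono) auto
      then have "1 / real D \<le> (real r - real a) / real r * (real n / real D)"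
        using D r by (simp add: field_simps)
      then show ?thesis unfolding g_def right_diff_distrib by simp
    qed
    moreover have "(real r - real a) / real r = 1 - real a / real r" using r
      by (simp add: field_simps)
    ultimately show ?thesis by linarith
  qed
  have q1: "0 \<le> 1 - real q / real D" using q(1) D by (simp add: field_simps)
  obtain r' where r': "r = Suc r'" using r by (cases r) auto
  have out: "g ^ r * (real (l choose a) / real (r choose a)) \<le>
      (1 - real q / real D) * (g ^ r' * (real (l choose a) / real (r' choose a)))"
    if "l \<le> r'" for l
  proof (cases "a < r")
    case True
    have "(r - a) * (r choose a) = r * (r' choose a)"
      using binomial_absorb_comp[of r a] r' by simp
    then have "(real r - real a) * real (r choose a) = real r * real (r' choose a)"
      using r by (metis of_nat_diff of_nat_mult)
    moreover have "0 < r' choose a" "0 < r choose a" using True r' by auto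
    ultimately have "1 / real (r choose a) = (real r - real a) / real r / real (r' choose a)"
      using r by (simp add: field_simps)
    then have "g ^ r * (real (l choose a) / real (r choose a)) =
        (real r - real a) / real r * g * (g ^ r' * (real (l choose a) / real (r' choose a)))"
      using r' by (simp add: divide_inverse mult_ac)
    also have "\<dots> \<le> (1 - real q / real D) * (g ^ r' * (real (l choose a) / real (r' choose a)))"
      using high[OF True] g by (intro mult_right_mono) auto
    finally show ?thesis .
  next
    case False
    \<comment> \<open>All \<open>r\<close> remaining elements would have to be hits, but at most
      \<open>r - 1\<close> of them can be; the left side vanishes.\<close>
    then have "l < a" using that r' r by simp
    then show ?thesis by (simp add: binomial_eq_0)
  qed
  show "hit_prob n D r a \<kappa> \<le> (1 - real q / real D) * hit_prob n D (r - 1) a \<kappa>" if "\<kappa> < r"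
    using out[of \<kappa>] that r' by (simp add: hit_prob_def g_def)
  assume \<kappa>: "1 \<le> \<kappa>" "\<kappa> \<le> r"
  then obtain l where l: "\<kappa> = Suc l" "l \<le> r'" using r' by (cases \<kappa>) auto
  show ?in
  proof (cases a)
    case 0
    then show ?thesis using out[OF l(2)] l r' by (simp add: hit_prob_def g_def)
  next
    case (Suc a')
    have "Suc a' * (r choose Suc a') = r * (r' choose a')"
      using binomial_absorption[of a' r] r' by simp
    then have "real (Suc a') * real (r choose Suc a') = real r * real (r' choose a')"
      by (metis of_nat_mult)
    moreover have "0 < r' choose a'" "0 < r choose Suc a'" using Suc r r' by auto
    ultimately have "1 / real (r choose a) = real a / real r / real (r' choose a')"
      using r Suc by (simp add: field_simps del: of_nat_Suc binomial_Suc_Suc)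
    then have "g ^ r * (real (l choose a') / real (r choose a)) =
        real a / real r * (g * (g ^ r' * (real (l choose a') / real (r' choose a'))))"
      using r' by (simp add: divide_inverse mult_ac)
    also have "\<dots> \<le> real a / real r * (1 * (g ^ r' * (real (l choose a') / real (r' choose a'))))"
      using g by (intro mult_left_mono mult_right_mono) auto
    also have "\<dots> \<le> real q / real D * (g ^ r' * (real (l choose a') / real (r' choose a')))"
      unfolding mult_1 using low g by (intro mult_right_mono) auto
    finally have "g ^ r * (real (l choose a') / real (r choose a)) + g ^ r *
      (real (l choose a) / real (r choose a))
        \<le> real q / real D * (g ^ r' * (real (l choose a') / real (r' choose a'))) +
          (1 - real q / real D) * (g ^ r' * (real (l choose a) / real (r' choose a)))"
      using out[OF l(2)] by linarith
    moreover have "real (\<kappa> choose a) = real (l choose a') + real (l choose a)" using l Suc by simp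
    ultimately show ?thesis
      using Suc l r' by (simp add: hit_prob_def g_def add_divide_distrib distrib_left)
  qed
qed

text \<open>The reason for \<open>D = 4 ^ n\<close>, a number drawn with \<open>2 * n\<close> coins:
  all \<open>n\<close> roundings together cost at most the factor
  \<open>(1 - n / D) ^ n >= 1 - n ^ 2 / D >= 1 / 2\<close>.\<close>

lemma hit_prob_start:
  assumes "t \<le> k" "k \<le> n"
  shows "1 / (2 * real (reps n k t)) \<le> hit_prob n (4 ^ n) n t k"
proof -
  have sq: "2 * n ^ 2 \<le> 4 ^ n"
  proof (induction n)
    case (Suc n)
    show ?case
    proof (cases "n = 0")
      case False
      then have "2 * (Suc n) ^ 2 \<le> 4 * (2 * n ^ 2)" by (cases n) (simp_all add: power2_eq_square)
      then show ?thesis using Suc by simp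
    qed simp
  qed simp
  then have "real (2 * n ^ 2) \<le> real (4 ^ n)" by (simp only: of_nat_le_iff)
  then have "2 * real n ^ 2 \<le> 4 ^ n" by simp
  then have "1 / 2 \<le> 1 + real n * - (real n / 4 ^ n)"
    by (simp add: field_simps power2_eq_square)
  also have "n \<le> 4 ^ n" using less_exp[of n] power_mono[of "2::nat" 4 n] by linarith
  then have "real n \<le> real (4 ^ n)" by (simp only: of_nat_le_iff)
  then have "real n / 4 ^ n \<le> 1" by simp
  then have "1 + real n * - (real n / 4 ^ n) \<le> (1 + - (real n / 4 ^ n)) ^ n"
    by (intro Bernoulli_inequality) auto
  finally have half: "1 / 2 \<le> (1 - real n / 4 ^ n) ^ n" by simp
  have "real (n choose t) \<le> real (k choose t) * real (reps n k t)" by (rule reps_bounds[OF assms])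
  moreover have "0 < n choose t" "0 < reps n k t" using assms by (auto simp: reps_def)
  ultimately have "1 / real (reps n k t) \<le> real (k choose t) / real (n choose t)"
    by (simp add: field_simps)
  then have "1 / 2 * (1 / real (reps n k t))
    \<le> (1 - real n / 4 ^ n) ^ n * (real (k choose t) / real (n choose t))"
    using half by (intro mult_mono) auto
  then show ?thesis by (simp add: hit_prob_def)
qed

text \<open>\<open>2 * M\<close> independent trials of success probability
  \<open>1 / (2 * M)\<close> all fail with probability at most \<open>exp (- 1) <= 1 / 2\<close>;
  there are \<open>g\<close> such groups.\<close>

lemma miss_all:
  assumes "1 \<le> M"
  shows "(1 - 1 / (2 * real M)) ^ (2 * M * g) \<le> (1 / 2) ^ g"
proof -
  let ?x = "1 / (2 * real M)"
  have M: "0 \<le> 1 - ?x" using assms by (simp add: field_simps)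
  have "(1 - ?x) ^ (2 * M) \<le> exp (- ?x) ^ (2 * M)"
    using exp_ge_add_one_self[of "- ?x"] M by (intro power_mono) auto
  also have "\<dots> = exp (- 1)" using assms by (simp add: exp_of_nat_mult[symmetric])
  also have "exp (- 1) \<le> (1 / 2 :: real)"
    using exp_ge_add_one_self[of 1] by (simp add: exp_minus field_simps)
  finally have "((1 - ?x) ^ (2 * M)) ^ g \<le> (1 / 2) ^ g" using M by (intro power_mono) auto
  then show ?thesis by (simp add: power_mult)
qed

section \<open>Calling the extension algorithm\<close>

text \<open>
  The arrays of the search program: 0 output, 1 copy of the instance, 2 universe, 3 characteristic
  function of the sample \<open>X\<close>. Its registers: 4 \<open>n\<close>, 5 \<open>k\<close>, 6 number of elements that may still be
  added to \<open>X\<close>, 7 \<open>t\<close>, 8 batch number \<open>s\<close>, 9 time budget of the round, 10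
    and 11 falling factorials of
  \<open>n\<close> and \<open>k\<close>, 12 their quotient \<open>reps n k t\<close>, 13 end of the race, 14 some call timed out, 15 trials
  left, 16 position in the universe, 17 elements still to be sampled,
    18 random number below the power
  of two in 19, 20 coins left to flip, 21 last coin, 22 number of the simulation, 23 clock,
    24 value of
  the last simulated test, 25 answer of the last call, 26 and 27 loop counters,
    28 time limit per call.
\<close>

notation Seq (infixr ";;" 60)
abbreviation assign :: "nat \<Rightarrow> aexp \<Rightarrow> com" (infix "::=" 61) where
  "r ::= e \<equiv> Store r (Const 0) e"

lemma halts_loop:
  assumes L: "1 \<le> L" and e: "low e" and p: "straight_line p"
    and step: "\<And>i m. i \<le> k \<Longrightarrow> Inv i m \<Longrightarrow> small L m \<Longrightarrow> eval e m \<noteq> 0 \<Longrightarrow>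
      i < k \<and> wp L p (Inv (Suc i)) m"
    and init: "Inv 0 m" "small L m"
  shows "halts (While e p) m ((1 + exp_size e + com_size p) * (L * (k + 1)))
    (\<lambda>m'. \<exists>i\<le>k. Inv i m' \<and> eval e m' = 0 \<and> small L m')"
proof -
  have "halts (While e p) m ((k + 1) * (1 + exp_size e * L) + k * (com_size p * L))
    (\<lambda>m'. \<exists>i\<le>k. (Inv i m' \<and> small L m') \<and> eval e m' = 0)"
  proof (rule halts_While)
    show "Inv 0 m \<and> small L m" using init by simp
    fix i m assume i: "i \<le> k" "Inv i m \<and> small L m"
    show "cost e m \<le> exp_size e * L" using i e L by (intro cost_low) auto
    assume "eval e m \<noteq> 0"
    then have "i < k \<and> wp L p (Inv (Suc i)) m" using step i by blast
    then show "i < k \<and> halts p m (com_size p * L) (\<lambda>m'. Inv (Suc i) m' \<and> small L m')"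
      using halts_wp[OF L p, of m "Inv (Suc i)"] i by blast
  qed
  moreover have "(k + 1) * (1 + exp_size e * L) + k * (com_size p * L)
    \<le> (k + 1) * (L + exp_size e * L) + (k + 1) * (com_size p * L)"
    using L by (intro add_mono mult_le_mono) auto
  ultimately show ?thesis
    by (elim halts_mono) (auto simp: algebra_simps)
qed

lemma low_simps [simp]:
  "low (Const c)" "low (Load a e) \<longleftrightarrow> a < 30 \<and> low e"
  "low (Add e1 e2) \<longleftrightarrow> low e1 \<and> low e2" "low (Sub e1 e2) \<longleftrightarrow> low e1 \<and> low e2"
  "low (Mul e1 e2) \<longleftrightarrow> low e1 \<and> low e2" "low (Div e1 e2) \<longleftrightarrow> low e1 \<and> low e2"
  by (auto simp: low_def)

lemma low_cell_exp [simp]: "low (cell_exp e) \<longleftrightarrow> low e"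
  by (auto simp: cell_exp_def)

section \<open>Writing the arguments of a call into fresh cells\<close>

definition load_instance :: com where
  "load_instance = While (Load 1 (reg 26))
    (Store 33 (cell_exp (reg 26)) (Load 1 (reg 26)) ;; 26 ::= Add (reg 26) (Const 1))"

definition load_chosen :: com where
  "load_chosen = While (Sub (reg 4) (reg 26))
    (Cond (Load 3 (reg 26))
       (Store 34 (cell_exp (reg 27)) (Load 2 (reg 26)) ;; 27 ::= Add (reg 27) (Const 1)) Skip ;;
     26 ::= Add (reg 26) (Const 1))"

definition load_budget :: com where
  "load_budget = While (Sub (reg 6) (reg 26))
    (Store 35 (cell_exp (reg 26)) (Const 1) ;; 26 ::= Add (reg 26) (Const 1))"

text \<open>The answer entry is stored increased by one, hence the subtraction. A clock at 0 means
  that the simulation may have been cut off; the answer then remains negative and only the flag in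
  register 14 is raised.\<close>

definition readout :: com where
  "readout = 25 ::= Const 0 ;;
    Cond (reg 23)
      (Cond (Sub (Load 33 (cell_exp (Const 0))) (Const 1)) (25 ::= Const 1) Skip)
      (14 ::= Const 1)"

definition call :: "com \<Rightarrow> com" where
  "call p =
    (22 ::= Add (reg 22) (Const 1) ;; 26 ::= Const 0) ;; load_instance ;;
    (26 ::= Const 0 ;; 27 ::= Const 0) ;; load_chosen ;;
    (26 ::= Const 0) ;; load_budget ;;
    (23 ::= reg 28) ;; sim p ;; readout"

definition chosen :: "nat list \<Rightarrow> mem \<Rightarrow> nat \<Rightarrow> nat list" where
  "chosen us m j = map ((!) us) (filter (\<lambda>i. m 3 i \<noteq> 0) [0..<j])"

lemma chosen_0 [simp]: "chosen us m 0 = []"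
  by (simp add: chosen_def)

lemma chosen_Suc: "chosen us m (Suc j) = chosen us m j @ (if m 3 j \<noteq> 0 then [us ! j] else [])"
  by (simp add: chosen_def)

lemma chosen_length: "length (chosen us m j) \<le> j"
  by (induction j) (auto simp: chosen_Suc)

lemma chosen_cong: "m 3 = m' 3 \<Longrightarrow> chosen us m j = chosen us m' j"
  by (simp add: chosen_def)

lemma set_chosen: "set (chosen us m j) = {us ! i | i. i < j \<and> m 3 i \<noteq> 0}"
  by (auto simp: chosen_def)

lemma distinct_chosen: "distinct us \<Longrightarrow> j \<le> length us \<Longrightarrow> distinct (chosen us m j)"
  by (auto simp: chosen_def distinct_map inj_on_def nth_eq_iff_index_eq)

text \<open>One fixed instance. \<open>TE\<close> bounds the time of the extension algorithm in
  terms of the size of the given set and of the number of elements that may be added; by its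
  monotonicity a time limit that suffices for a sample suffices for all later, larger sets.
  \<open>L\<close> bounds the lengths of the numbers and occurs in the analysis only, not in the
  program.\<close>

locale search =
  fixes I :: "bool list" and us :: "nat list" and Fam :: "nat set set" and pE :: com
    and TE :: "nat \<Rightarrow> nat \<Rightarrow> nat" and L :: nat
  assumes us: "distinct us" "length us \<le> length I"
    and fam: "Fam \<subseteq> Pow (set us)"
    and ext: "\<And>xs \<kappa>. distinct xs \<Longrightarrow> set xs \<subseteq> set us \<Longrightarrow>
      \<exists>t m. runs pE (input [bits I, xs, replicate \<kappa> 0]) [] t m \<and> t \<le> TE (length xs) \<kappa> \<and>
        outputs m [of_bool (\<exists>S. S \<subseteq> set us - set xs \<and> S \<union> set xs \<in> Fam \<and> card S \<le> \<kappa>)]"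
    and TE_mono: "\<And>x y j k. y \<le> x \<Longrightarrow> j \<le> k \<Longrightarrow> TE x j \<le> TE y k"
    and L: "1 \<le> L" "length I + 3 < 2 ^ L"
begin

abbreviation "n \<equiv> length us"
abbreviation "N \<equiv> length I"

definition extensible :: "nat set \<Rightarrow> nat \<Rightarrow> bool" where
  "extensible X \<kappa> \<longleftrightarrow> (\<exists>S. S \<subseteq> set us - X \<and> S \<union> X \<in> Fam \<and> card S \<le> \<kappa>)"

definition X :: "mem \<Rightarrow> nat set" where
  "X m = set (chosen us m n)"

text \<open>What holds between any two calls. The condition on the cells of numbers above register
  22 keeps the memory of all future simulations at 0.\<close>

definition env :: "mem \<Rightarrow> bool" where
  "env m \<longleftrightarrow> (\<forall>i. m 1 i = input [bits I] 0 i) \<and> (\<forall>i<n. m 2 i = Suc (us ! i)) \<and> m 4 0 = n \<and>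
     (\<forall>a i u. m 22 0 < u \<longrightarrow> m (33 + a) (cell u i) = 0) \<and> small L m"

lemma card_X: "card (X m) = length (chosen us m n)"
  unfolding X_def by (rule distinct_card) (simp add: distinct_chosen us)

lemma load_instance:
  assumes "\<And>i. m 1 i = input [bits I] 0 i" "m 26 0 = 0" "small L m"
    and "\<And>i. m 33 (cell (m 22 0) i) = 0"
  shows "halts load_instance m (300 * (L * (N + 1))) (\<lambda>m'. same {26, 33} m m' \<and> small L m' \<and>
    m' 26 0 = N \<and>
    (\<forall>j. m' 33 (cell (m 22 0) j) = input [bits I] 0 j) \<and>
    (\<forall>u j. u \<noteq> m 22 0 \<longrightarrow> m' 33 (cell u j) = m 33 (cell u j)))"
  unfolding load_instance_def
proof (rule halts_mono[OF halts_loop[where k = N and L = L and Inv = "\<lambda>i m'. same {26, 33} m m' \<and>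
  m' 26 0 = i \<and>
    (\<forall>j. m' 33 (cell (m 22 0) j) = (if j < i then m 1 j else 0)) \<and>
    (\<forall>u j. u \<noteq> m 22 0 \<longrightarrow> m' 33 (cell u j) = m 33 (cell u j))"]])
  fix i m'
  assume "i \<le> N" "same {26, 33} m m' \<and> m' 26 0 = i \<and>
    (\<forall>j. m' 33 (cell (m 22 0) j) = (if j < i then m 1 j else 0)) \<and>
    (\<forall>u j. u \<noteq> m 22 0 \<longrightarrow> m' 33 (cell u j) = m 33 (cell u j))"
    "small L m'" "eval (Load 1 (reg 26)) m' \<noteq> 0"
  moreover from this have "i < N"
    using assms(1) by (auto simp: same_def input_def bits_def split: if_splits)
  ultimately show "i < N \<and> wp L (Store 33 (cell_exp (reg 26)) (Load 1 (reg 26)) ;;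
    26 ::= Add (reg 26) (Const 1))
     (\<lambda>m'. same {26, 33} m m' \<and> m' 26 0 = Suc i \<and>
    (\<forall>j. m' 33 (cell (m 22 0) j) = (if j < Suc i then m 1 j else 0)) \<and>
    (\<forall>u j. u \<noteq> m 22 0 \<longrightarrow> m' 33 (cell u j) = m 33 (cell u j))) m'"
    using L by (auto simp: same_def)
next
  fix m'
  assume "\<exists>i\<le>N. (same {26, 33} m m' \<and> m' 26 0 = i \<and>
    (\<forall>j. m' 33 (cell (m 22 0) j) = (if j < i then m 1 j else 0)) \<and>
    (\<forall>u j. u \<noteq> m 22 0 \<longrightarrow> m' 33 (cell u j) = m 33 (cell u j))) \<and>
    eval (Load 1 (reg 26)) m' = 0 \<and> small L m'"
  then obtain i where i: "i \<le> N" "same {26, 33} m m'" "m' 26 0 = i"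
    "\<And>j. m' 33 (cell (m 22 0) j) = (if j < i then m 1 j else 0)"
    "\<And>u j. u \<noteq> m 22 0 \<Longrightarrow> m' 33 (cell u j) = m 33 (cell u j)" "m' 1 i = 0" "small L m'"
    by auto
  then have "input [bits I] 0 i = 0" using assms(1)[of i] by (simp add: same_def)
  then have "i = N" using i(1) by (auto simp: input_def bits_def split: if_splits)
  then show "same {26, 33} m m' \<and> small L m' \<and> m' 26 0 = N \<and>
    (\<forall>j. m' 33 (cell (m 22 0) j) = input [bits I] 0 j) \<and>
    (\<forall>u j. u \<noteq> m 22 0 \<longrightarrow> m' 33 (cell u j) = m 33 (cell u j))"
    using i assms(1) by (auto simp: input_def bits_def)
next
  show "(1 + exp_size (Load 1 (reg 26)) + com_size (Store 33 (cell_exp (reg 26)) (Load 1 (reg 26))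
    ;; 26 ::= Add (reg 26) (Const 1)))
      * (L * (N + 1)) \<le> 300 * (L * (N + 1))"
    by (intro mult_le_mono1) (simp add: cell_exp_def)
qed (use assms L in \<open>auto simp: same_def\<close>)

lemma load_chosen:
  assumes "m 4 0 = n" "\<And>i. i < n \<Longrightarrow> m 2 i = Suc (us ! i)" "m 26 0 = 0" "m 27 0 = 0" "small L m"
    and "\<And>i. m 34 (cell (m 22 0) i) = 0"
  shows "halts load_chosen m (300 * (L * (N + 1))) (\<lambda>m'. same {26, 27, 34} m m' \<and> small L m' \<and>
    (\<forall>j. m' 34 (cell (m 22 0) j)
      = (if j < length (chosen us m n) then Suc (chosen us m n ! j) else 0)) \<and>
    (\<forall>u j. u \<noteq> m 22 0 \<longrightarrow> m' 34 (cell u j) = m 34 (cell u j)))"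
  unfolding load_chosen_def
proof (rule halts_mono[OF halts_loop[where k = n and L = L and Inv = "\<lambda>i m'. same {26, 27,
  34} m m' \<and> m' 26 0 = i \<and>
    m' 27 0 = length (chosen us m i) \<and>
    (\<forall>j. m' 34 (cell (m 22 0) j)
      = (if j < length (chosen us m i) then Suc (chosen us m i ! j) else 0)) \<and>
    (\<forall>u j. u \<noteq> m 22 0 \<longrightarrow> m' 34 (cell u j) = m 34 (cell u j))"]])
  fix i m'
  assume *: "i \<le> n" "same {26, 27, 34} m m' \<and> m' 26 0 = i \<and>
    m' 27 0 = length (chosen us m i) \<and>
    (\<forall>j. m' 34 (cell (m 22 0) j)
      = (if j < length (chosen us m i) then Suc (chosen us m i ! j) else 0)) \<and>
    (\<forall>u j. u \<noteq> m 22 0 \<longrightarrow> m' 34 (cell u j) = m 34 (cell u j))"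
    "small L m'" "eval (Sub (reg 4) (reg 26)) m' \<noteq> 0"
  moreover from this have "i < n" using assms(1) by (auto simp: same_def)
  moreover have "length (chosen us m i) + 1 < 2 ^ L" "i + 1 < 2 ^ L"
    using chosen_length[of us m i] L us * by auto
  ultimately show "i < n \<and> wp L (Cond (Load 3 (reg 26))
       (Store 34 (cell_exp (reg 27)) (Load 2 (reg 26)) ;; 27 ::= Add (reg 27) (Const 1)) Skip ;;
     26 ::= Add (reg 26) (Const 1)) (\<lambda>m'. same {26, 27, 34} m m' \<and> m' 26 0 = Suc i \<and>
    m' 27 0 = length (chosen us m (Suc i)) \<and>
    (\<forall>j. m' 34 (cell (m 22 0) j)
      = (if j < length (chosen us m (Suc i)) then Suc (chosen us m (Suc i) ! j) else 0)) \<and>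
    (\<forall>u j. u \<noteq> m 22 0 \<longrightarrow> m' 34 (cell u j) = m 34 (cell u j))) m'"
    using assms(2)[of i] by (auto simp: same_def chosen_Suc nth_append)
next
  fix m'
  assume "\<exists>i\<le>n. (same {26, 27, 34} m m' \<and> m' 26 0 = i \<and>
    m' 27 0 = length (chosen us m i) \<and>
    (\<forall>j. m' 34 (cell (m 22 0) j)
      = (if j < length (chosen us m i) then Suc (chosen us m i ! j) else 0)) \<and>
    (\<forall>u j. u \<noteq> m 22 0 \<longrightarrow> m' 34 (cell u j) = m 34 (cell u j))) \<and>
    eval (Sub (reg 4) (reg 26)) m' = 0 \<and> small L m'"
  then obtain i where i: "i \<le> n" "same {26, 27, 34} m m'" "m' 26 0 = i"
    "\<And>j. m' 34 (cell (m 22 0) j)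
      = (if j < length (chosen us m i) then Suc (chosen us m i ! j) else 0)"
    "\<And>u j. u \<noteq> m 22 0 \<Longrightarrow> m' 34 (cell u j) = m 34 (cell u j)" "m' 4 0 \<le> i" "small L m'"
    by auto
  then have "i = n" using assms(1) by (simp add: same_def)
  then show "same {26, 27, 34} m m' \<and> small L m' \<and>
    (\<forall>j. m' 34 (cell (m 22 0) j)
      = (if j < length (chosen us m n) then Suc (chosen us m n ! j) else 0)) \<and>
    (\<forall>u j. u \<noteq> m 22 0 \<longrightarrow> m' 34 (cell u j) = m 34 (cell u j))"
    using i by auto
next
  show "(1 + exp_size (Sub (reg 4) (reg 26)) + com_size (Cond (Load 3 (reg 26))
       (Store 34 (cell_exp (reg 27)) (Load 2 (reg 26)) ;; 27 ::= Add (reg 27) (Const 1)) Skip ;;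
     26 ::= Add (reg 26) (Const 1)))
      * (L * (n + 1)) \<le> 300 * (L * (N + 1))"
    using us by (intro mult_le_mono) (simp_all add: cell_exp_def)
qed (use assms L in \<open>auto simp: same_def\<close>)

lemma load_budget:
  assumes "m 6 0 \<le> N" "m 26 0 = 0" "small L m"
    and "\<And>i. m 35 (cell (m 22 0) i) = 0"
  shows "halts load_budget m (300 * (L * (N + 1))) (\<lambda>m'. same {26, 35} m m' \<and> small L m' \<and>
    (\<forall>j. m' 35 (cell (m 22 0) j) = (if j < m 6 0 then 1 else 0)) \<and>
    (\<forall>u j. u \<noteq> m 22 0 \<longrightarrow> m' 35 (cell u j) = m 35 (cell u j)))"
  unfolding load_budget_def
proof (rule halts_mono[OF halts_loop[where k = "m 6 0" and L = L and Inv = "\<lambda>i m'. same {26,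
  35} m m' \<and> m' 26 0 = i \<and>
    (\<forall>j. m' 35 (cell (m 22 0) j) = (if j < i then 1 else 0)) \<and>
    (\<forall>u j. u \<noteq> m 22 0 \<longrightarrow> m' 35 (cell u j) = m 35 (cell u j))"]])
  fix i m'
  assume *: "i \<le> m 6 0" "same {26, 35} m m' \<and> m' 26 0 = i \<and>
    (\<forall>j. m' 35 (cell (m 22 0) j) = (if j < i then 1 else 0)) \<and>
    (\<forall>u j. u \<noteq> m 22 0 \<longrightarrow> m' 35 (cell u j) = m 35 (cell u j))"
    "small L m'" "eval (Sub (reg 6) (reg 26)) m' \<noteq> 0"
  moreover have "i + 1 < 2 ^ L"
    using L assms(1) * by auto
  ultimately show "i < m 6 0 \<and> wp L (Store 35 (cell_exp (reg 26)) (Const 1) ;;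
    26 ::= Add (reg 26) (Const 1))
    (\<lambda>m'. same {26, 35} m m' \<and> m' 26 0 = Suc i \<and>
    (\<forall>j. m' 35 (cell (m 22 0) j) = (if j < Suc i then 1 else 0)) \<and>
    (\<forall>u j. u \<noteq> m 22 0 \<longrightarrow> m' 35 (cell u j) = m 35 (cell u j))) m'"
    by (auto simp: same_def)
next
  fix m'
  assume "\<exists>i\<le>m 6 0. (same {26, 35} m m' \<and> m' 26 0 = i \<and>
    (\<forall>j. m' 35 (cell (m 22 0) j) = (if j < i then 1 else 0)) \<and>
    (\<forall>u j. u \<noteq> m 22 0 \<longrightarrow> m' 35 (cell u j) = m 35 (cell u j))) \<and>
    eval (Sub (reg 6) (reg 26)) m' = 0 \<and> small L m'"
  then show "same {26, 35} m m' \<and> small L m' \<and>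
    (\<forall>j. m' 35 (cell (m 22 0) j) = (if j < m 6 0 then 1 else 0)) \<and>
    (\<forall>u j. u \<noteq> m 22 0 \<longrightarrow> m' 35 (cell u j) = m 35 (cell u j))"
    by (auto simp: same_def)
next
  show "(1 + exp_size (Sub (reg 6) (reg 26)) + com_size (Store 35 (cell_exp (reg 26)) (Const 1) ;;
    26 ::= Add (reg 26) (Const 1)))
      * (L * (m 6 0 + 1)) \<le> 300 * (L * (N + 1))"
    using assms(1) by (intro mult_le_mono) (simp_all add: cell_exp_def)
qed (use assms L in \<open>auto simp: same_def\<close>)

end

lemma smallD: "small L m \<Longrightarrow> a < 30 \<Longrightarrow> m a i < 2 ^ L"
  by (simp add: small_def)

context search
begin

text \<open>The guarantee is one-sided: a positive answer is always right, a negative one only if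
  the flag in register 14 is down. The flag is never lowered by a call, and it is not raised if the
  limit exceeds the largest possible charge \<open>8 * TE\<close>.\<close>

definition call_post :: "mem \<Rightarrow> mem \<Rightarrow> bool" where
  "call_post m m' \<longleftrightarrow> env m' \<and> m' 22 0 = Suc (m 22 0) \<and> (\<forall>a<22. a \<noteq> 14 \<longrightarrow> m' a = m a) \<and>
     m' 28 = m 28 \<and> m' 29 = m 29 \<and> (m 14 0 \<noteq> 0 \<longrightarrow> m' 14 0 \<noteq> 0) \<and>
     (m' 25 0 \<noteq> 0 \<longrightarrow> extensible (X m) (m 6 0)) \<and>
     (m' 14 0 = 0 \<longrightarrow> extensible (X m) (m 6 0) \<longrightarrow> m' 25 0 \<noteq> 0) \<and>
     (8 * TE (card (X m)) (m 6 0) < m 28 0 \<longrightarrow> m' 14 0 = m 14 0)"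

definition loaded :: "mem \<Rightarrow> mem \<Rightarrow> bool" where
  "loaded m M \<longleftrightarrow> same {22, 23, 26, 27, 33, 34, 35} m M \<and> small L M \<and> M 22 0 = Suc (m 22 0) \<and>
     (\<forall>a j. M (33 + a) (cell (Suc (m 22 0)) j) =
       input [bits I, chosen us m n, replicate (m 6 0) 0] a j) \<and>
     (\<forall>a j u. u \<noteq> Suc (m 22 0) \<longrightarrow> M (33 + a) (cell u j) = m (33 + a) (cell u j))"

definition answered :: "mem \<Rightarrow> mem \<Rightarrow> bool" where
  "answered m M \<longleftrightarrow> (\<forall>a<30. a \<notin> {22, 23, 24, 26, 27} \<longrightarrow> M a = m a) \<and> small L M \<and>
     M 22 0 = Suc (m 22 0) \<and>
     (M 23 0 \<noteq> 0 \<longrightarrow> M 33 (cell (Suc (m 22 0)) 0) = Suc (of_bool (extensible (X m) (m 6 0)))) \<and>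
     (8 * TE (card (X m)) (m 6 0) < m 28 0 \<longrightarrow> M 23 0 \<noteq> 0) \<and>
     (\<forall>a j u. u \<noteq> Suc (m 22 0) \<longrightarrow> M (33 + a) (cell u j) = m (33 + a) (cell u j))"

lemma small_sim_frame: "sim_frame v M M' \<Longrightarrow> small L M \<Longrightarrow> small L M'"
  unfolding small_def
proof (intro allI impI)
  fix a i :: nat
  assume sim_frame: "sim_frame v M M'" and b: "\<forall>a<30. \<forall>i. M a i < 2 ^ L" and a: "a < 30"
  have "(1::nat) < 2 ^ L" using L by linarith
  consider "a = 23" | "a = 24" | "a \<notin> {23, 24}" by blast
  then show "M' a i < 2 ^ L"
  proof cases
    case 1
    then show ?thesis using sim_frame b a by (metis sim_frame_def le_less_trans)
  next
    case 2
    have "M' 24 i \<le> max 1 (M 24 i)" using sim_frame by (simp add: sim_frame_def)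
    also have "\<dots> < 2 ^ L" using b \<open>1 < 2 ^ L\<close> by simp
    finally show ?thesis using 2 by simp
  next
    case 3
    then show ?thesis using sim_frame b a by (auto simp: sim_frame_def)
  qed
qed

lemma sim_call:
  assumes env: "env m" and ld: "loaded m M" and F: "M 23 0 = m 28 0" "m 28 0 + L < 2 ^ L"
    and v: "Suc (m 22 0) < 2 ^ L"
  shows "halts (sim pE) M ((3 * sim_factor pE + idle_time pE) * (L * L * L * (m 28 0 + 1)))
    (answered m)"
proof -
  let ?v = "Suc (m 22 0)" and ?F = "m 28 0"
  let ?in = "input [bits I, chosen us m n, replicate (m 6 0) 0]"
  have ans: "answered m M'" if sim_frame: "sim_frame ?v M M'"
    and res: "M' 23 0 \<noteq> 0 \<Longrightarrow> M' 33 (cell ?v 0) = Suc (of_bool (extensible (X m) (m 6 0)))"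
      "8 * TE (card (X m)) (m 6 0) < ?F \<Longrightarrow> M' 23 0 \<noteq> 0" for M'
  proof -
    have "small L M'" using small_sim_frame[OF sim_frame] ld by (simp add: loaded_def)
    then show ?thesis
      using ld sim_frame res by (simp add: answered_def loaded_def sim_frame_def same_def)
  qed
  show ?thesis
  proof (cases "?F = 0")
    case True
    \<comment> \<open>\<open>sim_state\<close> requires a positive budget; a limit of 0 makes the
      simulation idle from the start.\<close>
    then have "halts (sim pE) M (idle_time pE) (answered m)"
      using F by (intro halts_mono[OF sim_zero[of M pE ?v]]) (auto intro!: ans)
    then show ?thesis
      by (rule halts_mono) (use L True mult_le_mono[of "idle_time pE" "3 * sim_factor pE +
        idle_time pE" 1 "L * L * L"] in simp_all)
  next
    case False
    have in_less: "?in a j < 2 ^ L" for a j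
    proof -
      have "small L m" using env by (simp add: env_def)
      note bm = smallD[OF this, of 1 j] smallD[OF this, of 2]
      have "m 1 j = input [bits I] 0 j" using env unfolding env_def by blast
      then have "input [bits I] 0 j < 2 ^ L" using bm(1) by simp
      moreover have "Suc (us ! i) < 2 ^ L" if "i < n" for i
        using env that bm(2)[of i] by (simp add: env_def)
      then have "Suc u < 2 ^ L" if "u \<in> set us" for u
        using that by (metis in_set_conv_nth)
      moreover have "set (chosen us m n) \<subseteq> set us" by (auto simp: set_chosen)
      moreover have "(1::nat) < 2 ^ L" using L by linarith
      ultimately show ?thesis
        by (auto simp: input_def nth_Cons subset_iff split: nat.splits if_splits)
    qed
    \<comment> \<open>The arguments of the call have length at most \<open>L\<close>, so the initial
      value of the bound \<open>Z\<close> is \<open>L\<close> plus the budget.\<close>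
    have Z: "nbits (L + ?F) \<le> L" using F L by (subst nbits_le_iff) auto
    have s: "sim_state ?v L (L + ?F) ?in M ?F"
      unfolding sim_state_def represents_def
      using ld F False v L Z in_less by (auto simp: loaded_def nbits_le_iff)
    have "set (chosen us m n) \<subseteq> set us" by (auto simp: set_chosen)
    moreover have "distinct (chosen us m n)" by (simp add: distinct_chosen us)
    ultimately obtain t m' where run: "runs pE ?in [] t m'" "t \<le> TE (card (X m)) (m 6 0)"
      "outputs m' [of_bool (extensible (X m) (m 6 0))]"
      using ext[of "chosen us m n" "m 6 0"] unfolding extensible_def X_def[symmetric] card_X
        by blast
    obtain T M' where M': "runs (sim pE) M [] T M'" "sim_bound (sim_factor pE) ?v L (L + ?F) m' M
      ?F t T M'"
      using sim_run[OF run(1) refl s] by blast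
    have "answered m M'"
    proof (rule ans)
      show "sim_frame ?v M M'" using M' by (simp add: sim_bound_def)
      show "M' 33 (cell ?v 0) = Suc (of_bool (extensible (X m) (m 6 0)))" if "M' 23 0 \<noteq> 0"
      proof -
        have "represents ?v m' M'" using M' that by (simp add: sim_bound_def sim_state_def)
        then have "M' (33 + 0) (cell ?v 0) = m' 0 0" unfolding represents_def by blast
        then show ?thesis using run(3) by (simp add: outputs_def)
      qed
      show "M' 23 0 \<noteq> 0" if "8 * TE (card (X m)) (m 6 0) < ?F"
        using M' that run(2) by (auto simp: sim_bound_def)
    qed
    moreover have "T \<le> (3 * sim_factor pE + idle_time pE) * (L * L * L * (?F + 1))"
    proof -
      have "T \<le> sim_factor pE * (L * L) * (?F - M' 23 0 + (if M' 23 0 = 0 then L + ?F else 0))"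
        using M' unfolding sim_bound_def by blast
      also have "\<dots> \<le> sim_factor pE * (L * L) * (3 * (L * (?F + 1)))"
      proof (intro mult_le_mono2)
        have "?F \<le> L * ?F" using L by simp
        moreover have "(if M' 23 0 = 0 then L + ?F else 0) \<le> L + ?F" by simp
        moreover have "3 * (L * (?F + 1)) = 3 * (L * ?F) + 3 * L" by (simp add: algebra_simps)
        ultimately show "?F - M' 23 0 + (if M' 23 0 = 0 then L + ?F else 0) \<le> 3 * (L * (?F + 1))"
          by linarith
      qed
      also have "\<dots> \<le> (3 * sim_factor pE + idle_time pE) * (L * L * L * (?F + 1))"
        by (simp add: algebra_simps)
      finally show ?thesis .
    qed
    ultimately show ?thesis using M'(1) unfolding halts_def by blast
  qed
qed

lemma readout:
  assumes an: "answered m M" and env: "env m"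
  shows "halts readout M (100 * L) (call_post m)"
proof -
  let ?v = "Suc (m 22 0)"
  have post: "call_post m M'"
    if "\<forall>a. a \<notin> {14, 25} \<longrightarrow> M' a = M a" "small L M'"
      "M' 14 0 = (if M 23 0 = 0 then 1 else M 14 0)"
      "M 23 0 \<noteq> 0 \<longrightarrow> M' 25 0 = of_bool (extensible (X m) (m 6 0))"
      "M 23 0 = 0 \<longrightarrow> M' 25 0 = 0" for M'
    using an env that unfolding call_post_def answered_def env_def by auto
  have bM: "small L M" using an by (simp add: answered_def)
  have L1: "(1::nat) < 2 ^ L" using L by linarith
  let ?M = "M(25 := (M 25)(0 := 0))"
  have "halts readout M (5 * L + (2 + L + (40 * L + 10 * L))) (call_post m)"
    unfolding readout_def
  proof (rule halts_Seq[where R = "\<lambda>M'. M' = ?M \<and> small L M'"])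
    show "halts (25 ::= Const 0) M (5 * L) (\<lambda>M'. M' = ?M \<and> small L M')"
      by (rule halts_mono[OF halts_wp[OF L(1), where Q = "\<lambda>M'. M' = ?M"]]) (use bM L in auto)
    fix M1 assume M1: "M1 = ?M \<and> small L M1"
    have "halts (Cond (reg 23) (Cond (Sub (Load 33 (cell_exp (Const 0))) (Const 1))
      (25 ::= Const 1) Skip) (14 ::= Const 1)) M1
        (1 + cost (reg 23) M1 + (40 * L + 10 * L)) (call_post m)"
    proof (rule halts_Cond)
      assume "eval (reg 23) M1 = 0"
      then have z: "M 23 0 = 0" using M1 by simp
      have "halts (14 ::= Const 1) M1 (com_size (14 ::= Const 1) * L)
        (\<lambda>M'. M' = M1(14 := (M1 14)(0 := 1)) \<and> small L M')"
        by (rule halts_wp) (use M1 L L1 in auto)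
      then show "halts (14 ::= Const 1) M1 (40 * L + 10 * L) (call_post m)"
        by (rule halts_mono) (use M1 z in \<open>auto intro!: post\<close>)
    next
      assume "eval (reg 23) M1 \<noteq> 0"
      then have nz: "M 23 0 \<noteq> 0" using M1 by simp
      then have val: "M1 33 (cell ?v 0) = Suc (of_bool (extensible (X m) (m 6 0)))" "M1 22 0 = ?v"
        using an M1 by (auto simp: answered_def)
      have "M 22 0 < 2 ^ L" using bM by (simp add: small_def)
      then have "nbits ?v \<le> L"
        using an L by (subst nbits_le_iff) (simp_all add: answered_def)
      then have cPR: "cost (cell_exp (Const 0)) M1 \<le> 3 * 1 + 2 + 8 * L + 7"
        using cost_cell_exp[of M1 L "Const 0"] val by simp
      have "halts (Cond (Sub (Load 33 (cell_exp (Const 0))) (Const 1)) (25 ::= Const 1) Skip) M1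
          (1 + cost (Sub (Load 33 (cell_exp (Const 0))) (Const 1)) M1 + 10 * L) (call_post m)"
      proof (rule halts_Cond)
        assume "eval (Sub (Load 33 (cell_exp (Const 0))) (Const 1)) M1 \<noteq> 0"
        then have y: "extensible (X m) (m 6 0)" using val by (auto split: if_splits)
        have "halts (25 ::= Const 1) M1 (com_size (25 ::= Const 1) * L)
          (\<lambda>M'. M' = M1(25 := (M1 25)(0 := 1)) \<and> small L M')"
          by (rule halts_wp) (use M1 L L1 in auto)
        then show "halts (25 ::= Const 1) M1 (10 * L) (call_post m)"
          by (rule halts_mono) (use M1 nz y in \<open>auto intro!: post\<close>)
      next
        assume "eval (Sub (Load 33 (cell_exp (Const 0))) (Const 1)) M1 = 0"
        then have y: "\<not> extensible (X m) (m 6 0)" using val by (auto split: if_splits)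
        have "halts Skip M1 1 (call_post m)" by (rule halts_Skip, rule post) (use M1 nz y in auto)
        then show "halts Skip M1 (10 * L) (call_post m)" by (rule halts_mono) (use L in auto)
      qed
      moreover have "1 + cost (Sub (Load 33 (cell_exp (Const 0))) (Const 1)) M1 \<le> 40 * L"
        using cPR val nbits_2 L by (simp add: numeral_2_eq_2)
      ultimately show "halts (Cond (Sub (Load 33 (cell_exp (Const 0))) (Const 1)) (25 ::= Const 1)
        Skip) M1
          (40 * L + 10 * L) (call_post m)"
        by (elim halts_mono) auto
    qed
    moreover have "1 + cost (reg 23) M1 \<le> 2 + L"
    proof -
      have "M1 23 0 < 2 ^ L" using smallD[OF conjunct2[OF M1], of 23 0] by simp
      then show ?thesis using L by (simp add: nbits_le_iff)
    qed
    ultimately show "halts (Cond (reg 23) (Cond (Sub (Load 33 (cell_exp (Const 0))) (Const 1))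
      (25 ::= Const 1) Skip) (14 ::= Const 1)) M1
        (2 + L + (40 * L + 10 * L)) (call_post m)"
      by (elim halts_mono) auto
  qed
  then show ?thesis by (rule halts_mono) (use L in auto)
qed

definition call_factor :: nat where "call_factor = 3 * sim_factor pE + idle_time pE + 2000"

lemma call:
  assumes env: "env m" and m: "m 6 0 \<le> n" "m 28 0 + L < 2 ^ L" "Suc (m 22 0) < 2 ^ L"
  shows "halts (call pE) m (call_factor * (L * L * L * (N + 1 + m 28 0))) (call_post m)"
proof -
  let ?v = "Suc (m 22 0)" and ?F = "m 28 0"
  note e = env[unfolded env_def]
  have L2: "(2::nat) < 2 ^ L" using L by linarith
  \<comment> \<open>The three truth values record which of the three arguments are already loaded;
    \<open>S\<close> collects further arrays that may have changed.\<close>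
  define A where "A = (\<lambda>S i x k m'. same (S \<union> {22, 26, 27, 33, 34, 35}) m m' \<and> small L m' \<and>
    m' 22 0 = ?v \<and>
      (\<forall>j. m' 33 (cell ?v j) = (if i then input [bits I] 0 j else 0)) \<and>
      (\<forall>j. m' 34 (cell ?v j) = (if x \<and>
        j < length (chosen us m n) then Suc (chosen us m n ! j) else 0)) \<and>
      (\<forall>j. m' 35 (cell ?v j) = (if k \<and> j < m 6 0 then 1 else 0)) \<and>
      (\<forall>a\<in>{33, 34, 35}. \<forall>j u. u \<noteq> ?v \<longrightarrow> m' a (cell u j) = m a (cell u j)))"
  have fresh: "m (33 + a) (cell ?v j) = 0" for a j using e by simp
  note fr0 = fresh[of 0, simplified] fresh[of 1, simplified] fresh[of 2, simplified]
  have S1: "halts (22 ::= Add (reg 22) (Const 1) ;; 26 ::= Const 0) m (100 * L)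
     (\<lambda>m'. A {} False False False m' \<and> m' 26 0 = 0)"
    by (rule halts_mono[OF halts_wp[OF L(1), where Q = "\<lambda>m'. same {22, 26} m m' \<and> m' 26 0 = 0 \<and>
      m' 22 0 = ?v"]])
      (use e m(3) fr0 in \<open>auto simp: A_def same_def\<close>)
  have S2: "halts load_instance m1 (300 * (L * (N + 1))) (A {} True False False)"
    if "A {} False False False m1 \<and> m1 26 0 = 0" for m1
    by (rule halts_mono[OF load_instance]) (use that e in \<open>auto simp: A_def same_def\<close>)
  have S3: "halts (26 ::= Const 0 ;; 27 ::= Const 0) m1 (100 * L)
     (\<lambda>m'. A {} True False False m' \<and> m' 26 0 = 0 \<and> m' 27 0 = 0)"
    if "A {} True False False m1" for m1
    by (rule halts_mono[OF halts_wp[OF L(1), where Q = "\<lambda>m'. same {26, 27} m1 m' \<and> m' 26 0 = 0 \<and>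
      m' 27 0 = 0"]])
      (use that L2 in \<open>auto simp: A_def same_def\<close>)
  have S4: "halts load_chosen m1 (300 * (L * (N + 1))) (A {} True True False)"
    if "A {} True False False m1 \<and> m1 26 0 = 0 \<and> m1 27 0 = 0" for m1
  proof -
    have chosen: "chosen us m1 j = chosen us m j" for j using that
      by (intro chosen_cong) (simp add: A_def same_def)
    show ?thesis
      by (rule halts_mono[OF load_chosen]) (use that e in \<open>auto simp: A_def same_def chosen\<close>)
  qed
  have S5: "halts (26 ::= Const 0) m1 (100 * L) (\<lambda>m'. A {} True True False m' \<and> m' 26 0 = 0)"
    if "A {} True True False m1" for m1
    by (rule halts_mono[OF halts_wp[OF L(1), where Q = "\<lambda>m'. same {26} m1 m' \<and> m' 26 0 = 0"]])
      (use that L2 in \<open>auto simp: A_def same_def\<close>)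
  have S6: "halts load_budget m1 (300 * (L * (N + 1))) (A {} True True True)"
    if "A {} True True False m1 \<and> m1 26 0 = 0" for m1
    by (rule halts_mono[OF load_budget]) (use that m(1) us in \<open>auto simp: A_def same_def\<close>)
  have S7: "halts (23 ::= reg 28) m1 (100 * L) (\<lambda>m'. loaded m m' \<and> m' 23 0 = ?F)"
    if "A {} True True True m1" for m1
  proof (rule halts_mono[OF halts_wp[OF L(1), where Q = "\<lambda>m'. same {23} m1 m' \<and> m' 23 0 = ?F"]])
    fix m' assume "(same {23} m1 m' \<and> m' 23 0 = ?F) \<and> small L m'"
    then have A: "A {23} True True True m'" and 23: "m' 23 0 = ?F"
      using that by (auto simp: A_def same_def)
    have "m' (33 + a) (cell ?v j) = input [bits I, chosen us m n, replicate (m 6 0) 0] a j \<and>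
        (\<forall>u. u \<noteq> ?v \<longrightarrow> m' (33 + a) (cell u j) = m (33 + a) (cell u j))" for a j
    proof -
      consider "a = 0" | "a = 1" | "a = 2" | "3 \<le> a" by linarith
      then show ?thesis
      proof cases
        case 4
        then have "m' (33 + a) = m (33 + a)" using A by (simp add: A_def same_def)
        then show ?thesis using 4 fresh[of a j] by (simp add: input_def)
      qed (use A in \<open>auto simp: A_def input_def\<close>)
    qed
    then show "loaded m m' \<and> m' 23 0 = ?F"
      using A 23 unfolding loaded_def by (simp add: A_def insert_commute)
  qed (use that m in \<open>auto simp: A_def same_def\<close>)
  have S8: "halts (sim pE) m1 ((3 * sim_factor pE + idle_time pE) * (L * L * L * (?F + 1)))
    (answered m)"
    if "loaded m m1 \<and> m1 23 0 = ?F" for m1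
    using sim_call[OF env, of m1] that m by simp
  have S9: "halts readout m1 (100 * L) (call_post m)" if "answered m m1" for m1
    using readout[OF that env] .
  have T8: "halts (sim pE ;;
    readout) m1 ((3 * sim_factor pE + idle_time pE) * (L * L * L * (?F + 1)) + 100 * L)
    (call_post m)"
    if "loaded m m1 \<and> m1 23 0 = ?F" for m1
    by (rule halts_Seq[OF S8[OF that] S9])
  note T7 = halts_Seq[OF S7 T8] note T6 = halts_Seq[OF S6 T7] note T5 = halts_Seq[OF S5 T6]
  note T4 = halts_Seq[OF S4 T5] note T3 = halts_Seq[OF S3 T4] note T2 = halts_Seq[OF S2 T3]
  note T1 = halts_Seq[OF S1 T2, folded call_def]
  show ?thesis
  proof (rule halts_mono[OF T1])
    define W where "W = L * L * L * (N + 1 + ?F)"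
    have "L * (N + 1) \<le> L * L * L * (N + 1 + ?F)" using L(1) by (intro mult_mono) auto
    then have 1: "L * (N + 1) \<le> W" by (simp add: W_def)
    have "L * 1 \<le> L * L * L * (N + 1 + ?F)" using L(1) by (intro mult_mono) auto
    then have 2: "L \<le> W" by (simp add: W_def)
    have "(3 * sim_factor pE + idle_time pE) * (L * L * L * (?F + 1))
      \<le> (3 * sim_factor pE + idle_time pE) * W"
      unfolding W_def by (intro mult_le_mono2) simp
    moreover have "call_factor * W = (3 * sim_factor pE + idle_time pE) * W + 2000 * W"
      by (simp add: call_factor_def distrib_right)
    ultimately show "100 * L +
      (300 * (L * (N + 1)) + (100 * L + (300 * (L * (N + 1)) + (100 * L + (300 * (L * (N + 1)) +
      (100 * L + ((3 * sim_factor pE + idle_time pE) * (L * L * L * (?F + 1)) + 100 * L)))))))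
        \<le> call_factor * (L * L * L * (N + 1 + ?F))"
      using 1 2 unfolding W_def[symmetric] by linarith
  qed
qed

end

section \<open>Testing a sample\<close>

definition emit_loop :: com where
  "emit_loop = While (Sub (reg 4) (reg 26))
    (Cond (Load 3 (reg 26))
       (Store 0 (reg 27) (Load 2 (reg 26)) ;; 27 ::= Add (reg 27) (Const 1)) Skip ;;
     26 ::= Add (reg 26) (Const 1))"

definition emit :: com where
  "emit = (0 ::= Const 2 ;; 26 ::= Const 0 ;; 27 ::= Const 1) ;; emit_loop ;;
    Store 0 (reg 27) (Const 0)"

definition attempt :: "com \<Rightarrow> com" where
  "attempt p = (Store 3 (reg 16) (Const 1) ;; 6 ::= Sub (reg 6) (Const 1)) ;; call p ;;
    Cond (reg 25) Skip (Store 3 (reg 16) (Const 0) ;; 6 ::= Add (reg 6) (Const 1))"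

definition reduce :: "com \<Rightarrow> com" where
  "reduce p = While (Sub (reg 4) (reg 16))
    (Cond (Load 3 (reg 16)) Skip (Cond (reg 6) (attempt p) Skip) ;;
     16 ::= Add (reg 16) (Const 1))"

text \<open>The last call, with nothing left to add, asks whether \<open>X\<close> itself belongs to
  the family. Whatever is output has therefore been verified, even if earlier calls timed out or the
  sample had no extension.\<close>

definition check :: "com \<Rightarrow> com" where
  "check p = (6 ::= Sub (reg 5) (reg 7) ;; 16 ::= Const 0) ;; reduce p ;;
    (6 ::= Const 0) ;; call p ;; Cond (reg 25) emit Skip"

lemma set_eq_card_0: "finite A \<Longrightarrow> S \<subseteq> A \<Longrightarrow> card S \<le> 0 \<Longrightarrow> S = {}"
  using finite_subset by fastforce

context search
begin

lemma X_cong: "m 3 = m' 3 \<Longrightarrow> X m = X m'"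
  unfolding X_def by (simp cong: chosen_cong)

lemma X_update: "m' 3 = (m 3)(i := Suc 0) \<Longrightarrow> i < n \<Longrightarrow> X m' = insert (us ! i) (X m)"
  unfolding X_def set_chosen by auto

lemma X_subset: "X m \<subseteq> set us" "finite (X m)"
  unfolding X_def by (auto simp: set_chosen)

lemma emit_loop:
  assumes "env m" "m 26 0 = 0" "m 27 0 = 1" "m 0 0 = 2"
  shows "halts emit_loop m (300 * (L * (N + 1))) (\<lambda>m'. same {0, 26, 27} m m' \<and> small L m' \<and>
    m' 0 0 = 2 \<and> m' 27 0 = Suc (length (chosen us m n)) \<and>
    (\<forall>j < length (chosen us m n). m' 0 (Suc j) = Suc (chosen us m n ! j)))"
  unfolding emit_loop_def
proof (rule halts_mono[OF halts_loop[where k = n and L = L and Inv = "\<lambda>i m'. same {0, 26,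
  27} m m' \<and> m' 26 0 = i \<and>
    m' 0 0 = 2 \<and> m' 27 0 = Suc (length (chosen us m i)) \<and>
    (\<forall>j < length (chosen us m i). m' 0 (Suc j) = Suc (chosen us m i ! j))"]])
  fix i m'
  assume *: "i \<le> n" "same {0, 26, 27} m m' \<and> m' 26 0 = i \<and>
    m' 0 0 = 2 \<and> m' 27 0 = Suc (length (chosen us m i)) \<and>
    (\<forall>j < length (chosen us m i). m' 0 (Suc j) = Suc (chosen us m i ! j))"
    "small L m'" "eval (Sub (reg 4) (reg 26)) m' \<noteq> 0"
  moreover from this have i: "i < n" using assms(1) by (auto simp: same_def env_def)
  moreover have "length (chosen us m i) + 2 < 2 ^ L" "i + 1 < 2 ^ L"
    using chosen_length[of us m i] L us * by auto
  moreover have "m 2 i = Suc (us ! i)" using assms(1) i by (simp add: env_def)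
  moreover have "m 2 i < 2 ^ L" using assms(1) by (intro smallD) (auto simp: env_def)
  ultimately show "i < n \<and> wp L (Cond (Load 3 (reg 26))
       (Store 0 (reg 27) (Load 2 (reg 26)) ;; 27 ::= Add (reg 27) (Const 1)) Skip ;;
     26 ::= Add (reg 26) (Const 1)) (\<lambda>m'. same {0, 26, 27} m m' \<and> m' 26 0 = Suc i \<and>
    m' 0 0 = 2 \<and> m' 27 0 = Suc (length (chosen us m (Suc i))) \<and>
    (\<forall>j < length (chosen us m (Suc i)). m' 0 (Suc j) = Suc (chosen us m (Suc i) ! j))) m'"
    by (auto simp: same_def chosen_Suc nth_append less_Suc_eq)
next
  fix m'
  assume "\<exists>i\<le>n. (same {0, 26, 27} m m' \<and> m' 26 0 = i \<and>
    m' 0 0 = 2 \<and> m' 27 0 = Suc (length (chosen us m i)) \<and>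
    (\<forall>j < length (chosen us m i). m' 0 (Suc j) = Suc (chosen us m i ! j))) \<and>
    eval (Sub (reg 4) (reg 26)) m' = 0 \<and> small L m'"
  then obtain i where i: "i \<le> n" "same {0, 26, 27} m m'" "m' 26 0 = i"
    "m' 0 0 = 2" "m' 27 0 = Suc (length (chosen us m i))"
    "\<forall>j < length (chosen us m i). m' 0 (Suc j) = Suc (chosen us m i ! j)" "m' 4 0 \<le> i" "small L m'"
    by auto
  then have "i = n" using assms(1) by (simp add: same_def env_def)
  then show "same {0, 26, 27} m m' \<and> small L m' \<and>
    m' 0 0 = 2 \<and> m' 27 0 = Suc (length (chosen us m n)) \<and>
    (\<forall>j < length (chosen us m n). m' 0 (Suc j) = Suc (chosen us m n ! j))"
    using i by auto
next
  show "(1 + exp_size (Sub (reg 4) (reg 26)) + com_size (Cond (Load 3 (reg 26))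
       (Store 0 (reg 27) (Load 2 (reg 26)) ;; 27 ::= Add (reg 27) (Const 1)) Skip ;;
     26 ::= Add (reg 26) (Const 1)))
      * (L * (n + 1)) \<le> 300 * (L * (N + 1))"
    using us by (intro mult_le_mono) simp_all
qed (use assms L in \<open>auto simp: same_def env_def\<close>)

lemma emit:
  assumes "env m"
  shows "halts emit m (500 * (L * (N + 1))) (\<lambda>m'. same {0, 26, 27} m m' \<and> small L m' \<and>
    outputs m' (1 # chosen us m n))"
proof -
  have L2: "(2::nat) < 2 ^ L" using L by linarith
  have "halts emit m (100 * L + (300 * (L * (N + 1)) + 100 * L)) (\<lambda>m'. same {0, 26, 27} m m' \<and>
    small L m' \<and>
    outputs m' (1 # chosen us m n))"
    unfolding emit_def
  proof (rule halts_Seq[OF _ halts_Seq])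
    show "halts (0 ::= Const 2 ;; 26 ::= Const 0 ;; 27 ::= Const 1) m (100 * L)
        (\<lambda>m'. (same {0, 26, 27} m m' \<and> m' 0 0 = 2 \<and> m' 26 0 = 0 \<and> m' 27 0 = 1) \<and> small L m')"
      by (rule halts_mono[OF halts_wp[OF L(1), where Q = "\<lambda>m'. same {0, 26, 27} m m' \<and>
        m' 0 0 = 2 \<and> m' 26 0 = 0 \<and> m' 27 0 = 1"]])
        (use assms L2 nbits_2 in \<open>auto simp: same_def env_def\<close>)
    fix m1 assume m1: "(same {0, 26, 27} m m1 \<and> m1 0 0 = 2 \<and> m1 26 0 = 0 \<and> m1 27 0 = 1) \<and>
      small L m1"
    have "env m1" using m1 assms by (auto simp: env_def same_def)
    moreover have chosen: "chosen us m1 j = chosen us m j" for j using m1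
      by (intro chosen_cong) (simp add: same_def)
    ultimately show "halts emit_loop m1 (300 * (L * (N + 1))) (\<lambda>m'. same {0, 26, 27} m m' \<and>
      small L m' \<and>
        m' 0 0 = 2 \<and> m' 27 0 = Suc (length (chosen us m n)) \<and>
        (\<forall>j < length (chosen us m n). m' 0 (Suc j) = Suc (chosen us m n ! j)))"
      using m1 by (intro halts_mono[OF emit_loop]) (auto simp: same_def chosen)
  next
    fix m2 assume m2: "same {0, 26, 27} m m2 \<and> small L m2 \<and>
        m2 0 0 = 2 \<and> m2 27 0 = Suc (length (chosen us m n)) \<and>
        (\<forall>j < length (chosen us m n). m2 0 (Suc j) = Suc (chosen us m n ! j))"
    show "halts (Store 0 (reg 27) (Const 0)) m2 (100 * L) (\<lambda>m'. same {0, 26, 27} m m' \<and> small L m' \<and>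
        outputs m' (1 # chosen us m n))"
      by (rule halts_mono[OF halts_wp[OF L(1), where Q = "\<lambda>m'. same {0, 26, 27} m m' \<and>
        outputs m' (1 # chosen us m n)"]])
        (use m2 L2 in \<open>auto simp: same_def outputs_def nth_Cons split: nat.splits\<close>)
  qed
  then show ?thesis by (rule halts_mono) (simp_all add: algebra_simps)
qed

section \<open>The invariant of the self-reduction\<close>

definition sol :: "nat set \<Rightarrow> nat \<Rightarrow> nat set \<Rightarrow> bool" where
  "sol Y \<kappa> S \<longleftrightarrow> S \<subseteq> set us - Y \<and> S \<union> Y \<in> Fam \<and> card S \<le> \<kappa>"

lemma extensible_sol: "extensible Y \<kappa> \<longleftrightarrow> (\<exists>S. sol Y \<kappa> S)"
  by (simp add: extensible_def sol_def)

lemma sol_insert: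
  assumes "sol (insert u Y) \<kappa> S" "u \<in> set us" "u \<notin> Y"
  shows "sol Y (Suc \<kappa>) (insert u S)"
proof -
  have "finite S" using assms(1) finite_subset[of S "set us"] by (auto simp: sol_def)
  then show ?thesis using assms by (auto simp: sol_def card_insert_if)
qed

lemma sol_remove:
  assumes "sol Y (Suc \<kappa>) S" "u \<in> S"
  shows "sol (insert u Y) \<kappa> (S - {u})"
proof -
  have "finite S" using assms(1) finite_subset[of S "set us"] by (auto simp: sol_def)
  moreover have "S - {u} \<union> insert u Y = S \<union> Y" using assms(2) by blast
  ultimately show ?thesis using assms by (auto simp: sol_def)
qed

text \<open>\<open>c\<close> is the position in register 16 and \<open>i\<close> the number of
  elements dealt with; they differ between a decision and the increment. Without time-outs, every
  completion of \<open>X\<close> within the budget avoids the elements that were dealt with but not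
  added. Hence only the empty completion survives at the end. Set size plus budget is constant,
  which the time bounds rely on.\<close>

definition reduce_inv :: "mem \<Rightarrow> nat \<Rightarrow> nat \<Rightarrow> mem \<Rightarrow> bool" where
  "reduce_inv m0 c i m \<longleftrightarrow> env m \<and> (\<forall>a<22. a \<notin> {3, 6, 14, 16} \<longrightarrow> m a = m0 a) \<and> m 28 = m0 28 \<and>
     m 16 0 = c \<and> m 22 0 \<le> m0 22 0 + i \<and> X m0 \<subseteq> X m \<and>
     card (X m) + m 6 0 = card (X m0) + m0 6 0 \<and> (m0 14 0 \<noteq> 0 \<longrightarrow> m 14 0 \<noteq> 0) \<and>
     (8 * TE (card (X m0)) (m0 6 0) < m0 28 0 \<longrightarrow> m 14 0 = m0 14 0) \<and>
     (m 14 0 = 0 \<longrightarrow> (extensible (X m0) (m0 6 0) \<longrightarrow> extensible (X m) (m 6 0)) \<and>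
        (\<forall>S. sol (X m) (m 6 0) S \<longrightarrow> (\<forall>j<i. us ! j \<in> X m \<or> us ! j \<notin> S)))"

text \<open>The set only grows and the budget only shrinks, and both make a call cheaper; no call of
  the self-reduction is thus more expensive than the bound for its starting point.\<close>

lemma reduce_inv_TE:
  assumes "reduce_inv m0 c i m" "card (X m) \<le> x" "\<kappa> \<le> m 6 0"
  shows "TE x \<kappa> \<le> TE (card (X m0)) (m0 6 0)"
proof (rule TE_mono)
  have "card (X m0) \<le> card (X m)"
    using assms(1) X_subset by (intro card_mono) (auto simp: reduce_inv_def)
  moreover have "card (X m) + m 6 0 = card (X m0) + m0 6 0"
    using assms(1) by (simp add: reduce_inv_def)
  ultimately show "card (X m0) \<le> x" "\<kappa> \<le> m0 6 0" using assms(2,3) by linarith+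
qed

abbreviation call_time :: "nat \<Rightarrow> nat" where
  "call_time F \<equiv> call_factor * (L * L * L * (N + 1 + F))"

lemma attempt:
  assumes inv: "reduce_inv m0 i i m" and i: "i < n" and new: "m 3 i = 0" and pos: "m 6 0 \<noteq> 0"
    and m0: "card (X m0) + m0 6 0 \<le> n" "m0 28 0 + L < 2 ^ L" "m0 22 0 + n + 2 < 2 ^ L"
  shows "halts (attempt pE) m (100 * L + (call_time (m0 28 0) + 100 * L)) (reduce_inv m0 i (Suc i))"
  unfolding attempt_def
proof (rule halts_Seq[OF _ halts_Seq])
  let ?u = "us ! i"
  have L2: "(2::nat) < 2 ^ L" using L by linarith
  have env: "env m" using inv by (simp add: reduce_inv_def)
  have bm: "small L m" using env by (simp add: env_def)
  have i16: "m 16 0 = i" using inv by (simp add: reduce_inv_def)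
  have u: "?u \<in> set us" "?u \<notin> X m"
    using i new us by (auto simp: X_def set_chosen nth_eq_iff_index_eq)
  have \<kappa>: "m 6 0 \<le> n" using inv m0 by (simp add: reduce_inv_def)
  let ?R1 = "\<lambda>m1. same {3, 6} m m1 \<and> m1 3 = (m 3)(i := 1) \<and> m1 6 0 = m 6 0 - 1 \<and> small L m1"
  show "halts (Store 3 (reg 16) (Const 1) ;; 6 ::= Sub (reg 6) (Const 1)) m (100 * L) ?R1"
    by (rule halts_mono[OF halts_wp[OF L(1), where Q = "\<lambda>m1. same {3, 6} m m1 \<and>
      m1 3 = (m 3)(i := 1) \<and> m1 6 0 = m 6 0 - 1"]])
      (use bm L2 i16 smallD[OF bm, of 6 0] in \<open>auto simp: same_def\<close>)
  let ?R2 = "\<lambda>m2. \<exists>m1. ?R1 m1 \<and> call_post m1 m2"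
  show "halts (call pE) m1 (call_time (m0 28 0)) ?R2" if m1: "?R1 m1" for m1
  proof -
    have "env m1" using env m1 by (auto simp: env_def same_def)
    moreover have "m1 6 0 \<le> n" using m1 \<kappa> by simp
    moreover have "m1 28 0 = m0 28 0" using m1 inv by (simp add: reduce_inv_def same_def)
    moreover have "Suc (m1 22 0) < 2 ^ L" using m1 inv m0 i by (simp add: reduce_inv_def same_def)
    ultimately show ?thesis
      using call[of m1] m0 m1 by (auto elim!: halts_mono)
  qed
  show "halts (Cond (reg 25) Skip (Store 3 (reg 16) (Const 0) ;; 6 ::= Add (reg 6) (Const 1))) m2
    (100 * L)
      (reduce_inv m0 i (Suc i))" if R2: "?R2 m2" for m2
  proof -
    obtain m1 where m1: "?R1 m1" and cp: "call_post m1 m2" using R2 by blast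
    have X1: "X m1 = insert ?u (X m)" using m1 i by (intro X_update) auto
    have card1: "card (X m1) = Suc (card (X m))" using X1 u X_subset by simp
    have m2: "m2 3 = (m 3)(i := 1)" "m2 6 0 = m 6 0 - 1" "m2 16 0 = i" "env m2" "small L m2"
      "\<And>a. a < 22 \<Longrightarrow> a \<notin> {3, 6, 14} \<Longrightarrow> m2 a = m a" "m2 28 = m 28" "m2 22 0 = Suc (m 22 0)"
      using m1 cp i16 by (auto simp: call_post_def same_def env_def)
    have X2: "X m2 = X m1" using m2 m1 by (intro X_cong) simp
    have tmo: "m0 14 0 \<noteq> 0 \<longrightarrow> m2 14 0 \<noteq> 0" "m2 14 0 = 0 \<Longrightarrow> m 14 0 = 0"
      using m1 cp inv by (auto simp: call_post_def same_def reduce_inv_def)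
    have tmo': "8 * TE (card (X m0)) (m0 6 0) < m0 28 0 \<longrightarrow> m2 14 0 = m0 14 0"
    proof
      assume F: "8 * TE (card (X m0)) (m0 6 0) < m0 28 0"
      have "TE (card (X m1)) (m1 6 0) \<le> TE (card (X m0)) (m0 6 0)"
        using m1 card1 by (intro reduce_inv_TE[OF inv]) auto
      moreover have "m1 28 0 = m0 28 0" "m1 14 0 = m 14 0" using m1 inv
        by (auto simp: reduce_inv_def same_def)
      ultimately have "m2 14 0 = m 14 0" using cp F by (simp add: call_post_def)
      then show "m2 14 0 = m0 14 0" using inv F by (simp add: reduce_inv_def)
    qed
    have "halts (Cond (reg 25) Skip (Store 3 (reg 16) (Const 0) ;; 6 ::= Add (reg 6) (Const 1)))
      m2 (1 + cost (reg 25) m2 + 50 * L)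
      (reduce_inv m0 i (Suc i))"
    proof (rule halts_Cond)
      assume "eval (reg 25) m2 \<noteq> 0"
      then have y: "extensible (X m1) (m1 6 0)" using cp by (simp add: call_post_def)
      have avoid: "us ! j \<in> X m2 \<or> us ! j \<notin> S" if S: "sol (X m2) (m2 6 0) S" and j: "j < Suc i"
        and t: "m2 14 0 = 0" for S j
      proof (cases "j = i")
        case True
        then show ?thesis using X1 X2 by simp
      next
        case False
        \<comment> \<open>A completion of the enlarged set, together with the new element, completes
          the old one; so elements avoided before remain avoided.\<close>
        have "sol (X m) (Suc (m2 6 0)) (insert ?u S)"
          using S X1 X2 u by (intro sol_insert) auto
        then have "sol (X m) (m 6 0) (insert ?u S)" using m2(2) pos by simp
        then have "us ! j \<in> X m \<or> us ! j \<notin> insert ?u S"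
          using inv tmo(2)[OF t] j False unfolding reduce_inv_def by (meson less_SucE)
        then show ?thesis using X1 X2 by blast
      qed
      have "reduce_inv m0 i (Suc i) m2"
        unfolding reduce_inv_def
      proof (intro conjI)
        show "m2 22 0 \<le> m0 22 0 + Suc i" using m2(8) inv by (simp add: reduce_inv_def)
        show "X m0 \<subseteq> X m2" using inv X1 X2 by (auto simp: reduce_inv_def)
        show "card (X m2) + m2 6 0 = card (X m0) + m0 6 0"
        proof -
          have "card (X m) + m 6 0 = card (X m0) + m0 6 0" using inv unfolding reduce_inv_def
            by blast
          then show ?thesis using X2 card1 m2(2) pos by simp
        qed
        show "m2 14 0 = 0 \<longrightarrow> (extensible (X m0) (m0 6 0) \<longrightarrow> extensible (X m2) (m2 6 0)) \<and>
          (\<forall>S. sol (X m2) (m2 6 0) S \<longrightarrow> (\<forall>j<Suc i. us ! j \<in> X m2 \<or> us ! j \<notin> S))"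
          using y m1 m2(2) X2 avoid by simp
        show "\<forall>a<22. a \<notin> {3, 6, 14, 16} \<longrightarrow> m2 a = m0 a"
          using m2(6) inv by (simp add: reduce_inv_def)
        show "m2 28 = m0 28" using m2(7) inv by (simp add: reduce_inv_def)
      qed (use m2 tmo tmo' in auto)
      then show "halts Skip m2 (50 * L) (reduce_inv m0 i (Suc i))"
        using L by (intro halts_mono[OF halts_Skip]) auto
    next
      assume "eval (reg 25) m2 = 0"
      then have no: "m2 14 0 = 0 \<Longrightarrow> \<not> extensible (X m1) (m1 6 0)" using cp
        by (auto simp: call_post_def)
      have "m 6 0 < 2 ^ L" by (rule smallD[OF bm]) simp
      then have "halts (Store 3 (reg 16) (Const 0) ;; 6 ::= Add (reg 6) (Const 1)) m2
          (com_size (Store 3 (reg 16) (Const 0) ;; 6 ::= Add (reg 6) (Const 1)) * L)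
          (\<lambda>m'. (same {3, 6} m2 m' \<and> m' 3 = m 3 \<and> m' 6 0 = m 6 0) \<and> small L m')"
        using m2 pos new L2 L(1) by (intro halts_wp) (auto simp: same_def)
      then show "halts (Store 3 (reg 16) (Const 0) ;; 6 ::= Add (reg 6) (Const 1)) m2 (50 * L)
        (reduce_inv m0 i (Suc i))"
      proof (rule halts_mono)
        fix m' assume m': "(same {3, 6} m2 m' \<and> m' 3 = m 3 \<and> m' 6 0 = m 6 0) \<and> small L m'"
        have X': "X m' = X m" using m' by (intro X_cong) simp
        have env': "env m'" using m2(4) m' by (auto simp: env_def same_def)
        \<comment> \<open>If a completion contained the rejected element, its other members would
          complete the enlarged set, against the negative answer.\<close>
        have un: "?u \<notin> S" if "sol (X m) (m 6 0) S" "m2 14 0 = 0" for S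
        proof
          assume "?u \<in> S"
          then have "sol (X m1) (m1 6 0) (S - {?u})"
            using sol_remove[of "X m" "m1 6 0" S ?u] that m1 pos X1 by simp
          then show False using no that(2) by (auto simp: extensible_sol)
        qed
        have eq: "m' 14 = m2 14" "m' 28 = m2 28" "m' 16 = m2 16" "m' 22 = m2 22"
          using m' by (auto simp: same_def)
        have sim_frame: "\<forall>a<22. a \<notin> {3, 6, 14, 16} \<longrightarrow> m' a = m0 a"
          using m' m2 inv by (auto simp: reduce_inv_def same_def)
        show "reduce_inv m0 i (Suc i) m'"
          unfolding reduce_inv_def X' eq
        proof (intro conjI)
          show "m2 22 0 \<le> m0 22 0 + Suc i" using m2(8) inv by (simp add: reduce_inv_def)
          show "m2 14 0 = 0 \<longrightarrow> (extensible (X m0) (m0 6 0) \<longrightarrow> extensible (X m) (m' 6 0)) \<and>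
            (\<forall>S. sol (X m) (m' 6 0) S \<longrightarrow> (\<forall>j<Suc i. us ! j \<in> X m \<or> us ! j \<notin> S))"
            using inv tmo(2) m' un by (auto simp: reduce_inv_def less_Suc_eq)
          show "card (X m) + m' 6 0 = card (X m0) + m0 6 0" "X m0 \<subseteq> X m"
            using m' inv by (simp_all add: reduce_inv_def)
          show "m2 28 = m0 28" using m2(7) inv by (simp add: reduce_inv_def)
        qed (use m2 tmo tmo' env' sim_frame in auto)
      qed (simp add: algebra_simps)
    qed
    moreover have "1 + cost (reg 25) m2 \<le> 2 + L"
      using smallD[OF m2(5), of 25 0] L by (simp add: nbits_le_iff)
    ultimately show ?thesis
      by (elim halts_mono) (use L in auto)
  qed
qed

lemma reduce:
  assumes inv: "reduce_inv m0 0 0 m0"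
    and m0: "card (X m0) + m0 6 0 \<le> n" "m0 28 0 + L < 2 ^ L" "m0 22 0 + n + 2 < 2 ^ L"
  shows "halts (reduce pE) m0 ((N + 1) * (call_time (m0 28 0) + 1000 * L)) (reduce_inv m0 n n)"
  unfolding reduce_def
proof (rule halts_mono[OF halts_While[where n = n and Inv = "\<lambda>i. reduce_inv m0 i i" and c = "20 * L"
      and T = "call_time (m0 28 0) + 700 * L"]])
  show "reduce_inv m0 0 0 m0" by (rule inv)
  fix i m assume i: "i \<le> n" and inv: "reduce_inv m0 i i m"
  have bm: "small L m" and n4: "m 4 0 = n" "m 16 0 = i" using inv
    by (auto simp: reduce_inv_def env_def)
  show "cost (Sub (reg 4) (reg 16)) m \<le> 20 * L"
    by (rule order_trans[OF cost_low[OF bm _ L(1)]]) auto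
  assume "eval (Sub (reg 4) (reg 16)) m \<noteq> 0"
  then have i: "i < n" using n4 by simp
  \<comment> \<open>An element may be passed over without a call if it is already in
    \<open>X\<close>, or if nothing can be added any more: then the empty set is the only candidate
    for a completion.\<close>
  have skip: "reduce_inv m0 i (Suc i) m" if "us ! i \<in> X m \<or> m 6 0 = 0"
  proof -
    have "us ! i \<in> X m \<or> us ! i \<notin> S" if "sol (X m) (m 6 0) S" for S
    proof (cases "m 6 0 = 0")
      case True
      then have "S = {}" using that set_eq_card_0[of "set us" S] by (auto simp: sol_def)
      then show ?thesis by simp
    qed (use \<open>us ! i \<in> X m \<or> m 6 0 = 0\<close> in auto)
    then show ?thesis using inv by (auto simp: reduce_inv_def less_Suc_eq)
  qed
  have "halts (Cond (Load 3 (reg 16)) Skip (Cond (reg 6) (attempt pE) Skip) ;;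
     16 ::= Add (reg 16) (Const 1)) m
       ((1 + cost (Load 3 (reg 16)) m + (1 + cost (reg 6) m + (call_time (m0 28 0) + 200 * L))) +
       100 * L) (reduce_inv m0 (Suc i) (Suc i))"
  proof (rule halts_Seq)
    show "halts (Cond (Load 3 (reg 16)) Skip (Cond (reg 6) (attempt pE) Skip)) m
      (1 + cost (Load 3 (reg 16)) m + (1 + cost (reg 6) m + (call_time (m0 28 0) + 200 * L)))
        (reduce_inv m0 i (Suc i))"
    proof (rule halts_Cond)
      assume "eval (Load 3 (reg 16)) m \<noteq> 0"
      then have "us ! i \<in> X m" using n4 i by (auto simp: X_def set_chosen)
      then show "halts Skip m (1 + cost (reg 6) m + (call_time (m0 28 0) + 200 * L))
        (reduce_inv m0 i (Suc i))"
        using skip by (intro halts_mono[OF halts_Skip]) auto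
    next
      assume "eval (Load 3 (reg 16)) m = 0"
      then have new: "m 3 i = 0" using n4 by simp
      show "halts (Cond (reg 6) (attempt pE) Skip) m
        (1 + cost (reg 6) m + (call_time (m0 28 0) + 200 * L)) (reduce_inv m0 i (Suc i))"
      proof (rule halts_Cond)
        assume "eval (reg 6) m \<noteq> 0"
        then show "halts (attempt pE) m (call_time (m0 28 0) + 200 * L) (reduce_inv m0 i (Suc i))"
          by (intro halts_mono[OF attempt[OF inv i new _ m0]]) auto
      next
        assume "eval (reg 6) m = 0"
        then show "halts Skip m (call_time (m0 28 0) + 200 * L) (reduce_inv m0 i (Suc i))"
          using skip L by (intro halts_mono[OF halts_Skip]) auto
      qed
    qed
    fix m1 assume m1: "reduce_inv m0 i (Suc i) m1"
    have "Suc i < 2 ^ L" using i us L by linarith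
    then have "halts (16 ::= Add (reg 16) (Const 1)) m1 (com_size (16 ::= Add (reg 16) (Const 1))
      * L)
        (\<lambda>m'. (same {16} m1 m' \<and> m' 16 0 = Suc i) \<and> small L m')"
      using m1 L(1) by (intro halts_wp) (auto simp: reduce_inv_def env_def same_def)
    then show "halts (16 ::= Add (reg 16) (Const 1)) m1 (100 * L) (reduce_inv m0 (Suc i) (Suc i))"
    proof (rule halts_mono)
      fix m' assume m': "(same {16} m1 m' \<and> m' 16 0 = Suc i) \<and> small L m'"
      then have X': "X m' = X m1" by (intro X_cong) (simp add: same_def)
      have "env m1" using m1 unfolding reduce_inv_def by blast
      then have env': "env m'" using m' by (simp add: env_def same_def)
      have eq: "m' 14 = m1 14" "m' 28 = m1 28" "m' 6 = m1 6" "m' 22 = m1 22"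
        using m' by (auto simp: same_def)
      have sim_frame: "\<forall>a<22. a \<notin> {3, 6, 14, 16} \<longrightarrow> m' a = m0 a"
        using m' m1 unfolding reduce_inv_def same_def by simp
      show "reduce_inv m0 (Suc i) (Suc i) m'"
        using m1 m' env' sim_frame unfolding reduce_inv_def X' eq by blast
    qed simp
  qed
  moreover have "cost (Load 3 (reg 16)) m \<le> 20 * L" "cost (reg 6) m \<le> 20 * L"
    by (rule order_trans[OF cost_low[OF bm _ L(1)]]; simp)+
  ultimately show "i < n \<and> halts (Cond (Load 3 (reg 16)) Skip (Cond (reg 6) (attempt pE) Skip) ;;
     16 ::= Add (reg 16) (Const 1)) m (call_time (m0 28 0) + 700 * L)
       (reduce_inv m0 (Suc i) (Suc i))"
    using i L by (auto elim!: halts_mono)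
next
  fix m assume "\<exists>i\<le>n. reduce_inv m0 i i m \<and> eval (Sub (reg 4) (reg 16)) m = 0"
  then obtain i where "i \<le> n" "reduce_inv m0 i i m" "m 4 0 \<le> m 16 0" by auto
  moreover from this have "m 4 0 = n" "m 16 0 = i" unfolding reduce_inv_def env_def by blast+
  ultimately have "i = n" by simp
  moreover note \<open>reduce_inv m0 i i m\<close>
  ultimately show "reduce_inv m0 n n m" by simp
next
  have "(n + 1) * (1 + 20 * L) + n * (call_time (m0 28 0) + 700 * L)
    \<le> (n + 1) * (21 * L) + (n + 1) * (call_time (m0 28 0) + 700 * L)"
    using L by (intro add_mono mult_le_mono) auto
  also have "\<dots> = (n + 1) * (call_time (m0 28 0) + 721 * L)"
    by (simp only: distrib_left[symmetric]) simp
  also have "\<dots> \<le> (N + 1) * (call_time (m0 28 0) + 1000 * L)" using us by (intro mult_le_mono) auto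
  finally show "(n + 1) * (1 + 20 * L) + n * (call_time (m0 28 0) + 700 * L)
    \<le> (N + 1) * (call_time (m0 28 0) + 1000 * L)" .
qed

text \<open>The leading 1 of a positive answer, stored increased by one.\<close>

definition found :: "mem \<Rightarrow> bool" where
  "found m \<longleftrightarrow> m 0 0 = 2"

text \<open>The invariant behind the one-sided error: between trials the output is either the
  negative answer or a verified solution.\<close>

definition sound :: "mem \<Rightarrow> bool" where
  "sound m \<longleftrightarrow> outputs m [0] \<or> (\<exists>xs. outputs m (1 # xs) \<and> distinct xs \<and> set xs \<in> Fam)"

lemma found_cong: "m' 0 = m 0 \<Longrightarrow> found m' = found m"
  by (simp add: found_def)

lemma sound_cong: "m' 0 = m 0 \<Longrightarrow> sound m' = sound m"
  by (simp add: sound_def outputs_def)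

definition check_post :: "mem \<Rightarrow> mem \<Rightarrow> bool" where
  "check_post m m' \<longleftrightarrow> env m' \<and> (\<forall>a<22. a \<notin> {0, 3, 6, 14, 16} \<longrightarrow> m' a = m a) \<and> m' 28 = m 28 \<and>
     m' 22 0 \<le> m 22 0 + n + 1 \<and> (sound m \<longrightarrow> sound m') \<and> (found m \<longrightarrow> found m') \<and>
     (m 14 0 \<noteq> 0 \<longrightarrow> m' 14 0 \<noteq> 0) \<and>
     (8 * TE (card (X m)) (m 5 0 - m 7 0) < m 28 0 \<longrightarrow> m' 14 0 = m 14 0) \<and>
     (m' 14 0 = 0 \<longrightarrow> extensible (X m) (m 5 0 - m 7 0) \<longrightarrow> found m')"

abbreviation "check_time F \<equiv> (N + 2) * (call_time F + 2000 * L)"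

lemma check:
  assumes env: "env m" and X: "card (X m) + (m 5 0 - m 7 0) \<le> n"
    and m: "m 28 0 + L < 2 ^ L" "m 22 0 + n + 2 < 2 ^ L"
  shows "halts (check pE) m (check_time (m 28 0)) (check_post m)"
proof -
  have L2: "(2::nat) < 2 ^ L" using L by linarith
  have bm: "small L m" using env by (simp add: env_def)
  let ?\<kappa> = "m 5 0 - m 7 0" and ?F = "m 28 0"
  let ?A = "\<lambda>m0. (same {6, 16} m m0 \<and> m0 6 0 = ?\<kappa> \<and> m0 16 0 = 0) \<and> small L m0"
  let ?B = "\<lambda>m1. \<exists>m0. ?A m0 \<and> reduce_inv m0 n n m1"
  let ?C = "\<lambda>m2. \<exists>m0 m1. ?A m0 \<and> reduce_inv m0 n n m1 \<and> (same {6} m1 m2 \<and> m2 6 0 = 0) \<and> small L m2"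
  let ?D = "\<lambda>m3. \<exists>m0 m1 m2. ?A m0 \<and> reduce_inv m0 n n m1 \<and> (same {6} m1 m2 \<and> m2 6 0 = 0) \<and>
    small L m2 \<and> call_post m2 m3"
  have A: "env m0 \<and> X m0 = X m \<and> m0 28 = m 28 \<and> m0 22 = m 22 \<and> m0 14 = m 14" if "?A m0" for m0
  proof -
    have "env m0" using that env by (simp add: env_def same_def)
    moreover have "X m0 = X m" using that by (intro X_cong) (simp add: same_def)
    ultimately show ?thesis using that by (simp add: same_def)
  qed
  have S1: "halts (6 ::= Sub (reg 5) (reg 7) ;; 16 ::= Const 0) m (100 * L) ?A"
    by (rule halts_mono[OF halts_wp[OF L(1), where Q = "\<lambda>m0. same {6, 16} m m0 \<and> m0 6 0 = ?\<kappa> \<and>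
      m0 16 0 = 0"]])
      (use bm L2 smallD[OF bm, of 5 0] in \<open>auto simp: same_def\<close>)
  have S2: "halts (reduce pE) m0 ((N + 1) * (call_time ?F + 1000 * L)) ?B" if m0: "?A m0" for m0
  proof -
    have "reduce_inv m0 0 0 m0" using A[OF m0] m0 by (simp add: reduce_inv_def)
    from reduce[OF this] show ?thesis
      using A[OF m0] m0 X m by (auto elim!: halts_mono)
  qed
  have S3: "halts (6 ::= Const 0) m1 (100 * L) ?C" if B: "?B m1" for m1
  proof -
    have "small L m1" using B by (auto simp: reduce_inv_def env_def)
    then have "halts (6 ::= Const 0) m1 (com_size (6 ::= Const 0) * L) (\<lambda>m2. (same {6} m1 m2 \<and>
      m2 6 0 = 0) \<and> small L m2)"
      using L2 L(1) by (intro halts_wp) (auto simp: same_def)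
    then show ?thesis by (rule halts_mono) (use B in auto)
  qed
  have C: "env m2 \<and> X m2 = X m1 \<and> m2 28 = m1 28 \<and> m2 22 = m1 22 \<and> m2 14 = m1 14"
    if "env m1" "(same {6} m1 m2 \<and> m2 6 0 = 0) \<and> small L m2" for m1 m2
  proof -
    have "env m2" using that by (simp add: env_def same_def)
    moreover have "X m2 = X m1" using that by (intro X_cong) (simp add: same_def)
    ultimately show ?thesis using that by (simp add: same_def)
  qed
  have S4: "halts (call pE) m2 (call_time ?F) ?D" if c: "?C m2" for m2
  proof -
    obtain m0 m1 where m0: "?A m0" and m1: "reduce_inv m0 n n m1"
      and m2: "(same {6} m1 m2 \<and> m2 6 0 = 0) \<and> small L m2"
      using c by blast
    have "env m1" "m1 28 = m0 28" "m1 22 0 \<le> m0 22 0 + n" using m1 unfolding reduce_inv_def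
      by blast+
    note 2 = C[OF this(1) m2] and 1 = this
    have "halts (call pE) m2 (call_time (m2 28 0)) (call_post m2)"
      using 1 2 A[OF m0] m m2 by (intro call) auto
    moreover have "m2 28 0 = ?F" using 1 2 A[OF m0] by simp
    ultimately show ?thesis using m0 m1 m2 by (auto elim!: halts_mono)
  qed
  have S5: "halts (Cond (reg 25) emit Skip) m3 (100 * L + 500 * (L * (N + 1))) (check_post m)"
    if d: "?D m3" for m3
  proof -
    obtain m0 m1 m2 where m0: "?A m0" and m1: "reduce_inv m0 n n m1"
      and m2: "(same {6} m1 m2 \<and> m2 6 0 = 0) \<and> small L m2"
      and m3: "call_post m2 m3" using d by blast
    note a = A[OF m0]
    have e1: "env m1" "m1 28 = m0 28" "m1 22 0 \<le> m0 22 0 + n" using m1 unfolding reduce_inv_def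
      by blast+
    note c = C[OF e1(1) m2]
    have X3: "X m3 = X m2" using m3 by (intro X_cong) (simp add: call_post_def)
    have env3: "env m3" using m3 by (simp add: call_post_def)
    have sim_frame: "\<forall>a<22. a \<notin> {3, 6, 14, 16} \<longrightarrow> m3 a = m a"
    proof (intro allI impI)
      fix a :: nat assume a: "a < 22" "a \<notin> {3, 6, 14, 16}"
      have "m3 a = m2 a" using m3 a by (auto simp: call_post_def)
      also have "\<dots> = m1 a" using m2 a by (simp add: same_def)
      also have "\<dots> = m0 a" using m1 a by (simp add: reduce_inv_def)
      also have "\<dots> = m a" using m0 a by (simp add: same_def)
      finally show "m3 a = m a" .
    qed
    have m0': "m0 0 = m 0" "m3 0 = m 0" using m0 sim_frame by (auto simp: same_def)
    have 28: "m3 28 = m 28" using m3 a c e1 by (simp add: call_post_def)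
    have v: "m3 22 0 \<le> m 22 0 + n + 1" using m3 a c e1 by (simp add: call_post_def)
    have m6: "m0 6 0 = ?\<kappa>" using m0 by simp
    have t1: "m 14 0 \<noteq> 0 \<longrightarrow> m1 14 0 \<noteq> 0" "8 * TE (card (X m)) ?\<kappa> < ?F \<longrightarrow> m1 14 0 = m 14 0"
      using m1 a m6 unfolding reduce_inv_def by metis+
    have t3: "m1 14 0 \<noteq> 0 \<longrightarrow> m3 14 0 \<noteq> 0" using m3 c by (simp add: call_post_def)
    have t3': "8 * TE (card (X m)) ?\<kappa> < ?F \<longrightarrow> m3 14 0 = m 14 0"
    proof
      assume F: "8 * TE (card (X m)) ?\<kappa> < ?F"
      have "TE (card (X m1)) 0 \<le> TE (card (X m0)) (m0 6 0)" by (rule reduce_inv_TE[OF m1]) auto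
      then have "8 * TE (card (X m2)) (m2 6 0) < m2 28 0" using F a c e1 m2 m6 by simp
      then have "m3 14 0 = m2 14 0" using m3 by (simp add: call_post_def)
      then show "m3 14 0 = m 14 0" using c t1 F by simp
    qed
    have hits: "extensible (X m2) (m2 6 0)" if t: "m3 14 0 = 0" and y: "extensible (X m) ?\<kappa>"
    proof -
      have "m1 14 0 = 0" using t t3 by auto
      then have "extensible (X m1) (m1 6 0)" and av: "\<And>S. sol (X m1) (m1 6 0) S \<Longrightarrow>
        \<forall>j<n. us ! j \<in> X m1 \<or> us ! j \<notin> S"
        using m1 y a m6 unfolding reduce_inv_def by metis+
      then obtain S where S: "sol (X m1) (m1 6 0) S" by (auto simp: extensible_sol)
      \<comment> \<open>The whole universe has been dealt with, so an element of the completion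
        would have to be in \<open>X\<close> or be avoided, and it is neither.\<close>
      have "S = {}"
      proof (rule ccontr)
        assume "S \<noteq> {}"
        then obtain u where "u \<in> S" by blast
        then have "u \<in> set us" "u \<notin> X m1" using S by (auto simp: sol_def)
        then show False using av[OF S] \<open>u \<in> S\<close> by (metis in_set_conv_nth)
      qed
      then have "sol (X m2) (m2 6 0) {}" using S c m2 by (simp add: sol_def)
      then show ?thesis by (auto simp: extensible_sol)
    qed
    have "halts (Cond (reg 25) emit Skip) m3 (1 + cost (reg 25) m3 +
      (50 * L + 500 * (L * (N + 1)))) (check_post m)"
    proof (rule halts_Cond)
      assume "eval (reg 25) m3 \<noteq> 0"
      then have "extensible (X m2) (m2 6 0)" using m3 by (simp add: call_post_def)
      then obtain S where "sol (X m2) 0 S" using m2 by (auto simp: extensible_sol)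
      moreover from this have "S = {}" using set_eq_card_0[of "set us" S] by (auto simp: sol_def)
      ultimately have XF: "X m3 \<in> Fam" using X3 by (simp add: sol_def)
      show "halts emit m3 (50 * L + 500 * (L * (N + 1))) (check_post m)"
      proof (rule halts_mono[OF emit[OF env3]])
        fix m' assume m': "same {0, 26, 27} m3 m' \<and> small L m' \<and> outputs m' (1 # chosen us m3 n)"
        have "env m'" using env3 m' by (simp add: env_def same_def)
        moreover have "sound m'" using m' XF us unfolding sound_def X_def
          by (blast intro: distinct_chosen)
        moreover have "found m'" using m' by (auto simp: found_def outputs_def)
        moreover have "m' 28 = m3 28" "m' 22 = m3 22" "m' 14 = m3 14" using m'
          by (auto simp: same_def)
        moreover have "\<forall>a<22. a \<notin> {0, 3, 6, 14, 16} \<longrightarrow> m' a = m a" using m' sim_frame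
          by (simp add: same_def)
        ultimately show "check_post m m'"
          using 28 v t1 t3 t3' unfolding check_post_def by simp
      qed simp
    next
      assume "eval (reg 25) m3 = 0"
      then have "\<not> (m3 14 0 = 0 \<and> extensible (X m) ?\<kappa>)" using hits m3 by (auto simp: call_post_def)
      then have "check_post m m3"
        using env3 sim_frame 28 v t1 t3 t3' sound_cong[of m3 m] found_cong[of m3 m] m0'(2)
          unfolding check_post_def by auto
      then show "halts Skip m3 (50 * L + 500 * (L * (N + 1))) (check_post m)"
        using L by (intro halts_mono[OF halts_Skip]) auto
    qed
    moreover have "1 + cost (reg 25) m3 \<le> 2 + L"
      using smallD[of L m3 25 0] env3 L by (simp add: nbits_le_iff env_def)
    ultimately show ?thesis by (elim halts_mono) (use L in auto)
  qed
  note T4 = halts_Seq[OF S4 S5] note T3 = halts_Seq[OF S3 T4] note T2 = halts_Seq[OF S2 T3]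
  note T1 = halts_Seq[OF S1 T2, folded check_def]
  show ?thesis
  proof (rule halts_mono[OF T1])
    have "check_time ?F = (N + 1) * (call_time ?F + 1000 * L) + (N + 1) * (1000 * L) +
      (call_time ?F + 2000 * L)"
      by (simp add: algebra_simps)
    moreover have "500 * (L * (N + 1)) \<le> (N + 1) * (1000 * L)" by simp
    ultimately show "100 * L + ((N + 1) * (call_time ?F + 1000 * L) + (100 * L + (call_time ?F +
        (100 * L + 500 * (L * (N + 1)))))) \<le> check_time ?F"
      by linarith
  qed
qed

end

section \<open>Selection sampling\<close>

text \<open>The mean of \<open>f\<close> over all numbers that arise from \<open>R\<close> by
  appending \<open>h\<close> binary digits. The recursion follows the order in which the coins are
  flipped.\<close>

primrec coin_mean :: "nat \<Rightarrow> (nat \<Rightarrow> ennreal) \<Rightarrow> nat \<Rightarrow> ennreal" where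
  "coin_mean 0 f R = f R"
| "coin_mean (Suc h) f R = (coin_mean h f (2 * R) + coin_mean h f (2 * R + 1)) / 2"

lemma ennreal_mean: "0 \<le> x \<Longrightarrow> 0 \<le> y \<Longrightarrow> (ennreal x + ennreal y) / 2 = ennreal ((x + y) / 2)"
  using divide_ennreal[of "x + y" 2] by simp

lemma coin_mean_real:
  assumes "\<And>x. 0 \<le> g x"
  shows "coin_mean h (\<lambda>x. ennreal (g x)) R = ennreal ((\<Sum>x<2 ^ h. g (R * 2 ^ h + x)) / 2 ^ h)"
proof (induction h arbitrary: R)
  case (Suc h)
  have split: "(\<Sum>x<2 ^ Suc h. g (R * 2 ^ Suc h + x)) =
      (\<Sum>x<2 ^ h. g (2 * R * 2 ^ h + x)) + (\<Sum>x<2 ^ h. g ((2 * R + 1) * 2 ^ h + x))"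
  proof -
    have "{..<2 ^ Suc h} = {..<2 ^ h} \<union> {2 ^ h..<2 ^ h + 2 ^ h :: nat}" by auto
    moreover have "(\<Sum>x = 2 ^ h..<2 ^ h + 2 ^ h. g (R * 2 ^ Suc h + x))
      = (\<Sum>x<2 ^ h. g (R * 2 ^ Suc h + (x + 2 ^ h)))"
      using sum.shift_bounds_nat_ivl[of "\<lambda>x. g (R * 2 ^ Suc h + x)" 0 "2 ^ h" "2 ^ h"]
      by (simp add: lessThan_atLeast0)
    moreover have "(\<Sum>x\<in>{..<2 ^ h} \<union> {2 ^ h..<2 ^ h + 2 ^ h}. g (R * 2 ^ Suc h + x)) =
        (\<Sum>x<2 ^ h. g (R * 2 ^ Suc h + x)) + (\<Sum>x = 2 ^ h..<2 ^ h + 2 ^ h. g (R * 2 ^ Suc h + x))"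
      by (intro sum.union_disjoint) auto
    ultimately show ?thesis by (simp add: algebra_simps)
  qed
  have "coin_mean (Suc h) (\<lambda>x. ennreal (g x)) R =
      (ennreal ((\<Sum>x<2 ^ h. g (2 * R * 2 ^ h + x)) / 2 ^ h) + ennreal
        ((\<Sum>x<2 ^ h. g ((2 * R + 1) * 2 ^ h + x)) / 2 ^ h)) / 2"
    by (simp only: coin_mean.simps Suc)
  also have "\<dots> = ennreal
    (((\<Sum>x<2 ^ h. g (2 * R * 2 ^ h + x)) / 2 ^ h + (\<Sum>x<2 ^ h. g ((2 * R + 1) * 2 ^ h + x)) / 2 ^ h)
    / 2)"
    using assms by (intro ennreal_mean) (simp_all add: sum_nonneg)
  also have "\<dots> = ennreal ((\<Sum>x<2 ^ Suc h. g (R * 2 ^ Suc h + x)) / 2 ^ Suc h)"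
    unfolding split by (simp add: field_simps)
  finally show ?case .
qed simp

definition toss :: com where
  "toss = While (reg 20) (Flip 21 (Const 0) ;;
    (18 ::= Add (Add (reg 18) (reg 18)) (reg 21) ;; 19 ::= Add (reg 19) (reg 19) ;;
      20 ::= Sub (reg 20) (Const 1)))"

lemma expects_toss:
  assumes L: "1 \<le> L" "2 ^ h < (2::nat) ^ L" "h < 2 ^ L"
    and m: "small L m" "m 18 0 = 0" "m 19 0 = 1" "m 20 0 = h"
  shows "expects toss m ((h + 1) * (200 * L)) (\<lambda>m'. same {18, 19, 20, 21} m m' \<and> small L m' \<and>
    m' 19 0 = 2 ^ h \<and> m' 18 0 < 2 ^ h)
    (\<lambda>m'. f (m' 18 0)) (coin_mean h f 0)"
proof -
  define Inv where "Inv i m' \<longleftrightarrow> same {18, 19, 20, 21} m m' \<and> small L m' \<and> m' 20 0 = h - i \<and>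
    m' 19 0 = 2 ^ i \<and> m' 18 0 < 2 ^ i" for i m'
  let ?p = "18 ::= Add (Add (reg 18) (reg 18)) (reg 21) ;; 19 ::= Add (reg 19) (reg 19) ;;
    20 ::= Sub (reg 20) (Const 1)"
  have L1: "(1::nat) < 2 ^ L" using L power_increasing[of 1 L "2::nat"] by simp
  have "expects toss m ((h + 1) * (1 + 10 * L) + h * (100 * L))
     (\<lambda>m'. same {18, 19, 20, 21} m m' \<and> small L m' \<and> m' 19 0 = 2 ^ h \<and> m' 18 0 < 2 ^ h)
    (\<lambda>m'. f (m' 18 0)) (coin_mean (h - 0) f (m 18 0))"
    unfolding toss_def
  proof (rule expects_While[where Inv = Inv and \<phi> = "\<lambda>i m'. coin_mean (h - i) f (m' 18 0)"])
    fix i m' assume i: "i \<le> h" "Inv i m'"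
    then have bm: "small L m'" by (simp add: Inv_def)
    show "cost (reg 20) m' \<le> 10 * L" by (rule order_trans[OF cost_low[OF bm _ L(1)]]) auto
    {
      assume "eval (reg 20) m' = 0"
      then have "i = h" using i by (simp add: Inv_def)
      then show "(same {18, 19, 20, 21} m m' \<and> small L m' \<and> m' 19 0 = 2 ^ h \<and> m' 18 0 < 2 ^ h) \<and>
          f (m' 18 0) \<le> coin_mean (h - i) f (m' 18 0)"
        using i by (simp add: Inv_def)
    next
      assume "eval (reg 20) m' \<noteq> 0"
      then have ih: "i < h" using i by (simp add: Inv_def)
      then obtain k where k: "h - i = Suc k" "h - Suc i = k" by (metis Suc_diff_Suc)
      let ?h = "\<lambda>m1. coin_mean k f (2 * m1 18 0 + m1 21 0)"
      have pow: "2 * 2 ^ i < (2::nat) ^ L"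
        using power_increasing[of "Suc i" h "2::nat"] ih L(2) unfolding power_Suc by linarith
      have "expects (Flip 21 (Const 0) ;; ?p) m' ((1 + cost (Const 0) m') + 80 * L) (Inv (Suc i))
          (\<lambda>m''. coin_mean k f (m'' 18 0))
            ((?h (m'(21 := (m' 21)(0 := 0))) + ?h (m'(21 := (m' 21)(0 := 1)))) / 2)"
      proof (rule expects_Seq[where h = ?h
        and R = "\<lambda>m1. \<exists>w. m1 = m'(21 := (m' 21)(0 := of_bool w))"])
        show "expects (Flip 21 (Const 0)) m' (1 + cost (Const 0) m') (\<lambda>m1. \<exists>w. m1
          = m'(21 := (m' 21)(0 := of_bool w)))
          ?h ((?h (m'(21 := (m' 21)(0 := 0))) + ?h (m'(21 := (m' 21)(0 := 1)))) / 2)"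
          by (rule expects_Flip[where i = "Const 0", unfolded eval.simps]) blast
        fix m1 assume "\<exists>w. m1 = m'(21 := (m' 21)(0 := of_bool w))"
        then obtain w where m1: "m1 = m'(21 := (m' 21)(0 := of_bool w))" by blast
        have b1: "small L m1" using bm L1 unfolding m1 by (auto simp: small_def)
        have "m' 18 0 + 1 \<le> 2 ^ i" using i by (simp add: Inv_def)
        then have R: "2 * m' 18 0 + of_bool w < 2 * 2 ^ i" by (cases w) auto
        have "halts ?p m1 (com_size ?p * L) (\<lambda>m''. (same {18, 19, 20} m1 m'' \<and>
          m'' 20 0 = h - Suc i \<and>
            m'' 19 0 = 2 ^ Suc i \<and> m'' 18 0 = 2 * m1 18 0 + m1 21 0) \<and> small L m'')"
          using i R pow L(3) b1 unfolding m1
            by (intro halts_wp[OF L(1)]) (auto simp: same_def Inv_def)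
        then have "halts ?p m1 (80 * L) (\<lambda>m''. Inv (Suc i) m'' \<and> m'' 18 0 = 2 * m1 18 0 + m1 21 0)"
          by (rule halts_mono) (use R i in \<open>auto simp: Inv_def same_def m1\<close>)
        then have "expects ?p m1 (80 * L) (\<lambda>m''. Inv (Suc i) m'' \<and> m'' 18 0 = 2 * m1 18 0 + m1 21 0)
            (\<lambda>m''. coin_mean k f (m'' 18 0)) (?h m1)"
          by (rule expects_of_halts) simp
        then show "expects ?p m1 (80 * L) (Inv (Suc i)) (\<lambda>m''. coin_mean k f (m'' 18 0)) (?h m1)"
          by (rule expects_mono) auto
      qed
      moreover have "coin_mean (h - i) f (m' 18 0)
        = (?h (m'(21 := (m' 21)(0 := 0))) + ?h (m'(21 := (m' 21)(0 := 1)))) / 2"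
        unfolding k by simp
      ultimately show "i < h \<and> expects (Flip 21 (Const 0) ;; ?p) m' (100 * L) (Inv (Suc i))
          (\<lambda>m''. coin_mean (h - Suc i) f (m'' 18 0)) (coin_mean (h - i) f (m' 18 0))"
        using ih L unfolding k(2) by (auto elim!: expects_mono)
    }
  next
    show "Inv 0 m" using m by (simp add: Inv_def same_def)
  qed
  then show ?thesis
  proof (rule expects_mono)
    have "(h + 1) * (1 + 10 * L) + h * (100 * L) \<le> (h + 1) * (11 * L) + (h + 1) * (100 * L)"
      using L by (intro add_mono mult_le_mono) auto
    also have "\<dots> \<le> (h + 1) * (200 * L)" unfolding distrib_left[symmetric]
      by (intro mult_le_mono2) simp
    finally show "(h + 1) * (1 + 10 * L) + h * (100 * L) \<le> (h + 1) * (200 * L)" .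
  qed (use m in simp_all)
qed

text \<open>Selection sampling: if \<open>a\<close> elements are still wanted and \<open>r\<close>
  are left, the next one is taken with probability about \<open>a / r\<close>. The test
  \<open>x / D < a / r\<close> is written without denominators.\<close>

definition decide :: com where
  "decide = Cond (Sub (Mul (reg 17) (reg 19)) (Mul (reg 18) (Sub (reg 4) (reg 16))))
      (Store 3 (reg 16) (Const 1) ;; 17 ::= Sub (reg 17) (Const 1))
      (Store 3 (reg 16) (Const 0)) ;;
    16 ::= Add (reg 16) (Const 1)"

definition sample :: com where
  "sample = (17 ::= reg 7 ;; 16 ::= Const 0) ;;
    While (Sub (reg 4) (reg 16))
      ((18 ::= Const 0 ;; 19 ::= Const 1 ;; 20 ::= Add (reg 4) (reg 4)) ;; toss ;; decide)"

lemma hit_prob_le_1: "\<kappa> \<le> r \<Longrightarrow> n \<le> D \<Longrightarrow> hit_prob n D r a \<kappa> \<le> 1"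
  unfolding hit_prob_def
proof (intro mult_le_one power_le_one)
  assume "\<kappa> \<le> r" "n \<le> D"
  then have "\<kappa> choose a \<le> r choose a" by (intro binomial_right_mono)
  then show "real (\<kappa> choose a) / real (r choose a) \<le> 1"
    by (auto simp: divide_le_eq_1)
qed (auto simp: divide_le_eq)

lemma sum_threshold:
  fixes A B :: real
  assumes "{x. x < D \<and> P x} = {..<q}" "q \<le> D"
  shows "(\<Sum>x<D. if P x then A else B) = real q * A + (real D - real q) * B"
proof -
  have "(\<Sum>x<D. if P x then A else B) = (\<Sum>x\<in>{..<q}. A) + (\<Sum>x\<in>{q..<D}. B)"
  proof -
    have D: "{..<D} = {..<q} \<union> {q..<D}" using assms(2) by auto
    have P: "P x \<longleftrightarrow> x < q" if "x < D" for x
      using that assms(1) by (metis (mono_tags) lessThan_iff mem_Collect_eq)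
    have "(\<Sum>x\<in>{..<q}. if P x then A else B) = (\<Sum>x\<in>{..<q}. A)"
      using P assms(2) by (intro sum.cong) auto
    moreover have "(\<Sum>x\<in>{q..<D}. if P x then A else B) = (\<Sum>x\<in>{q..<D}. B)"
      using P by (intro sum.cong) auto
    ultimately show ?thesis
      unfolding D by (subst sum.union_disjoint) auto
  qed
  then show ?thesis using assms(2) by (simp add: of_nat_diff)
qed

context search
begin

text \<open>The potential for sampling: a bound on the probability that the final sample is not
  contained in \<open>S\<close>, given the first \<open>i\<close> decisions. Taking one element
  outside \<open>S\<close> settles it at 1.\<close>

definition miss :: "nat set \<Rightarrow> nat \<Rightarrow> mem \<Rightarrow> real" where
  "miss S i m = (if set (chosen us m i) \<subseteq> S
     then 1 - hit_prob n (4 ^ n) (n - i) (m 17 0) (card (S \<inter> set (drop i us))) else 1)"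

lemma card_rest: "card (S \<inter> set (drop i us)) \<le> n - i"
proof -
  have "card (S \<inter> set (drop i us)) \<le> card (set (drop i us))" by (intro card_mono) auto
  also have "\<dots> \<le> n - i" using card_length[of "drop i us"] by simp
  finally show ?thesis .
qed

lemma card_rest_Suc:
  assumes "i < n"
  shows "card (S \<inter> set (drop i us))
    = (if us ! i \<in> S then Suc (card (S \<inter> set (drop (Suc i) us))) else card
    (S \<inter> set (drop (Suc i) us)))"
proof -
  have "drop i us = us ! i # drop (Suc i) us" using assms by (simp add: Cons_nth_drop_Suc)
  moreover have "us ! i \<notin> set (drop (Suc i) us)"
    using us(1) assms calculation by (metis distinct.simps(2) distinct_drop)
  ultimately show ?thesis by simp
qed

lemma n_le: "n \<le> 4 ^ n"
  using less_exp[of n] power_mono[of "2::nat" 4 n] by linarith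

definition sample_inv :: "mem \<Rightarrow> nat \<Rightarrow> mem \<Rightarrow> bool" where
  "sample_inv m0 i m \<longleftrightarrow> same {3, 16, 17, 18, 19, 20, 21} m0 m \<and> small L m \<and> m 16 0 = i \<and>
     m 17 0 \<le> n - i \<and> length (chosen us m i) + m 17 0 = m0 7 0"

lemma sample_round:
  assumes env: "env m0" and L4: "4 ^ n < (2::nat) ^ L" and i: "i < n" and inv: "sample_inv m0 i m"
  shows "expects ((18 ::= Const 0 ;; 19 ::= Const 1 ;; 20 ::= Add (reg 4) (reg 4)) ;; toss ;;
    decide) m
     (100 * L + ((2 * n + 1) * (200 * L) + 200 * L)) (sample_inv m0 (Suc i))
       (\<lambda>m'. ennreal (miss S (Suc i) m')) (ennreal (miss S i m))"
proof -
  let ?D = "4 ^ n :: nat"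
  define r where "r = n - i"
  define a where "a = m 17 0"
  define u where "u = us ! i"
  define \<kappa> where "\<kappa> = card (S \<inter> set (drop (Suc i) us))"
  define ok where "ok \<longleftrightarrow> set (chosen us m i) \<subseteq> S"
  \<comment> \<open>\<open>A\<close> and \<open>B\<close> are the potentials after the next element
    has been taken and after it has been left.\<close>
  define A where "A = (if ok \<and> u \<in> S then 1 - hit_prob n ?D (r - 1) (a - 1) \<kappa> else 1)"
  define B where "B = (if ok then 1 - hit_prob n ?D (r - 1) a \<kappa> else 1)"
  have bm: "small L m" using inv by (simp add: sample_inv_def)
  have n4: "m 4 0 = n" "m 16 0 = i" using inv env by (auto simp: sample_inv_def env_def same_def)
  have r: "1 \<le> r" "a \<le> r" "r \<le> n" using i inv by (auto simp: r_def a_def sample_inv_def)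
  have L1: "(1::nat) < 2 ^ L" "N + 3 < 2 ^ L" using L by linarith+
  have n2: "n + n < 2 ^ L"
  proof -
    have "2 * m \<le> 4 ^ m" for m :: nat
    proof (induction m)
      case (Suc m)
      define P where "P = (4::nat) ^ m"
      have "1 \<le> P" by (simp add: P_def)
      then show ?case using Suc unfolding power_Suc P_def[symmetric] by simp
    qed simp
    from this[of n] L4 show ?thesis by simp
  qed
  have \<kappa>r: "\<kappa> \<le> r - 1" using card_rest[of S "Suc i"] by (simp add: \<kappa>_def r_def)
  have AB: "0 \<le> A" "0 \<le> B" using hit_prob_le_1[OF \<kappa>r n_le] by (auto simp: A_def B_def)
  let ?P = "\<lambda>x. x * r < a * ?D"
  let ?f = "\<lambda>x. ennreal (if ?P x then A else B)"
  let ?R1 = "\<lambda>m1. (same {18, 19, 20} m m1 \<and> m1 18 0 = 0 \<and> m1 19 0 = 1 \<and> m1 20 0 = 2 * n) \<and>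
    small L m1"
  let ?R2 = "\<lambda>m2. same {18, 19, 20, 21} m m2 \<and> small L m2 \<and> m2 19 0 = ?D \<and> m2 18 0 < ?D"
  have S1: "halts (18 ::= Const 0 ;; 19 ::= Const 1 ;; 20 ::= Add (reg 4) (reg 4)) m (100 * L) ?R1"
    by (rule halts_mono[OF halts_wp[OF L(1), where Q = "\<lambda>m1. same {18, 19, 20} m m1 \<and>
      m1 18 0 = 0 \<and> m1 19 0 = 1 \<and> m1 20 0 = 2 * n"]])
      (use bm L1 n4 n2 in \<open>auto simp: same_def\<close>)
  have S2: "expects toss m1 ((2 * n + 1) * (200 * L)) ?R2 (\<lambda>m'. ?f (m' 18 0))
    (coin_mean (2 * n) ?f 0)" if m1: "?R1 m1" for m1
  proof -
    have D: "(2::nat) ^ (2 * n) = ?D" by (simp add: power_mult)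
    show ?thesis
      by (rule expects_mono[OF expects_toss[of L "2 * n" m1 ?f]]) (use m1 L(1) L4 n2 D in \<open>auto
        simp: same_def\<close>)
  qed
  have S3: "expects decide m2 (200 * L) (sample_inv m0 (Suc i)) (\<lambda>m'. ennreal (miss S (Suc i) m'))
    (?f (m2 18 0))" if m2: "?R2 m2" for m2
  proof -
    have m2': "m2 16 0 = i" "m2 4 0 = n" "m2 17 0 = a" "m2 3 = m 3" using m2 n4
      by (auto simp: same_def a_def)
    have sel2: "chosen us m' i = chosen us m i" if "\<And>j. j < i \<Longrightarrow> m' 3 j = m 3 j" for m'
      using that unfolding chosen_def by (intro arg_cong[of _ _ "map ((!) us)"] filter_cong) auto
    have bnd17: "a < 2 ^ L" using smallD[OF bm, of 17 0] by (simp add: a_def)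
    let ?Q = "\<lambda>m'. same {3, 16, 17} m2 m' \<and> m' 16 0 = Suc i \<and>
      m' 3 = (m 3)(i := of_bool (?P (m2 18 0))) \<and>
      m' 17 0 = (if ?P (m2 18 0) then a - 1 else a)"
    have "halts decide m2 (com_size decide * L) (\<lambda>m'. ?Q m' \<and> small L m')"
      unfolding decide_def using m2 m2' L1 bnd17 i us
      by (intro halts_wp[OF L(1)]) (auto simp: same_def r_def)
    then have "halts decide m2 (200 * L) (\<lambda>m'. ?Q m' \<and> small L m')"
      by (rule halts_mono) (auto simp: decide_def)
    then show ?thesis
    proof (intro expects_mono[OF expects_of_halts[where f = "\<lambda>m'. ennreal (miss S (Suc i) m')"
      and v = "?f (m2 18 0)"]])
      fix m' assume m': "?Q m' \<and> small L m'"
      have s: "chosen us m' (Suc i) = chosen us m i @ (if ?P (m2 18 0) then [u] else [])"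
        using m' sel2[of m'] by (simp add: chosen_Suc u_def)
      have drop: "m 17 0 = a" "n - Suc i = r - 1" by (simp_all add: a_def r_def)
      show "ennreal (miss S (Suc i) m') \<le> ?f (m2 18 0)"
        using m' by (auto simp: miss_def s A_def B_def ok_def \<kappa>_def drop)
      \<comment> \<open>With \<open>a = r\<close> every number below \<open>D\<close> passes the
        test, so an element is left only if enough others remain. This is what makes the sample have
        exactly the prescribed size.\<close>
      have "a \<le> r - 1" if "\<not> ?P (m2 18 0)"
      proof (rule ccontr)
        assume "\<not> a \<le> r - 1"
        then have "a = r" using r by simp
        then show False using that m2 r by (simp add: mult.commute)
      qed
      moreover have "0 < a" if "?P (m2 18 0)" using that by (cases a) auto
      ultimately show "sample_inv m0 (Suc i) m'"
        using m' m2 inv r s drop unfolding sample_inv_def by (auto simp: same_def)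
    qed auto
  qed
  have coin_mean: "coin_mean (2 * n) ?f 0 \<le> ennreal (miss S i m)"
  proof -
    obtain q where q: "q \<le> ?D" "{x. x < ?D \<and> ?P x} = {..<q}" "a * ?D \<le> q * r" "q * r < a * ?D + r"
      using card_threshold[OF r(2,1), of ?D] by blast
    have D: "(2::nat) ^ (2 * n) = ?D" "(2::real) ^ (2 * n) = real ?D" by (simp_all add: power_mult)
    have "coin_mean (2 * n) ?f 0 = ennreal ((\<Sum>x<?D. if ?P x then A else B) / real ?D)"
      using AB by (subst coin_mean_real) (simp_all add: D del: of_nat_power)
    also have "(\<Sum>x<?D. if ?P x then A else B) = real q * A + (real ?D - real q) * B"
      by (rule sum_threshold[OF q(2,1)])
    also have "(real q * A + (real ?D - real q) * B) / real ?D
      = real q / real ?D * A + (1 - real q / real ?D) * B"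
      by (simp add: add_divide_distrib diff_divide_distrib left_diff_distrib del: of_nat_power)
    also have "\<dots> \<le> miss S i m"
    proof (cases ok)
      case False
      then show ?thesis by (simp add: A_def B_def miss_def ok_def)
    next
      case True
      note step = hit_prob_step[OF q(1,3,4) r n_le]
      show ?thesis
      proof (cases "u \<in> S")
        case True
        have k: "card (S \<inter> set (drop i us)) = Suc \<kappa>" using card_rest_Suc[OF i, of S] True
          by (simp add: u_def \<kappa>_def)
        have "hit_prob n ?D r a (Suc \<kappa>) \<le>
            real q / real ?D * (if a = 0 then 0 else hit_prob n ?D (r - 1) (a - 1) \<kappa>) +
              (1 - real q / real ?D) * hit_prob n ?D (r - 1) a \<kappa>"
        proof -
          have "1 \<le> Suc \<kappa>" "Suc \<kappa> \<le> r" using \<kappa>r r by simp_all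
          from step(1)[OF this, unfolded diff_Suc_1] show ?thesis .
        qed
        \<comment> \<open>For \<open>a = 0\<close> the truncated \<open>a - 1\<close> in
          \<open>A\<close> makes no sense, but then the weight \<open>q / D\<close> of
          \<open>A\<close> is 0.\<close>
        moreover have "a = 0 \<Longrightarrow> q = 0" using q(4) r(1) by (cases q) auto
        then have "real q / real ?D * A = real q / real ?D - real q / real ?D * (if a
          = 0 then 0 else hit_prob n ?D (r - 1) (a - 1) \<kappa>)"
          using True \<open>ok\<close> by (auto simp: A_def right_diff_distrib)
        moreover have "(1 - real q / real ?D) * B = 1 - real q / real ?D - (1 - real q / real ?D)
          * hit_prob n ?D (r - 1) a \<kappa>"
          using \<open>ok\<close> by (simp add: B_def right_diff_distrib)
        moreover have "miss S i m = 1 - hit_prob n ?D r a (Suc \<kappa>)"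
          using \<open>ok\<close> k by (simp add: miss_def ok_def r_def a_def)
        ultimately show ?thesis by linarith
      next
        case False
        have k: "card (S \<inter> set (drop i us)) = \<kappa>" using card_rest_Suc[OF i, of S] False
          by (simp add: u_def \<kappa>_def)
        have "hit_prob n ?D r a \<kappa> \<le> (1 - real q / real ?D) * hit_prob n ?D (r - 1) a \<kappa>"
          using step(2)[of \<kappa>] \<kappa>r r by simp
        moreover have "real q / real ?D * A = real q / real ?D" using False by (simp add: A_def)
        moreover have "(1 - real q / real ?D) * B = 1 - real q / real ?D - (1 - real q / real ?D)
          * hit_prob n ?D (r - 1) a \<kappa>"
          using \<open>ok\<close> by (simp add: B_def right_diff_distrib)
        moreover have "miss S i m = 1 - hit_prob n ?D r a \<kappa>"
          using \<open>ok\<close> k by (simp add: miss_def ok_def r_def a_def)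
        ultimately show ?thesis by linarith
      qed
    qed
    finally show ?thesis by (simp add: ennreal_leI)
  qed
  have S1': "expects (18 ::= Const 0 ;; 19 ::= Const 1 ;; 20 ::= Add (reg 4) (reg 4)) m (100 * L)
    ?R1
      (\<lambda>_. ennreal (miss S i m)) (ennreal (miss S i m))"
    by (rule expects_of_halts[OF S1]) simp
  show ?thesis
  proof (rule expects_Seq[OF S1' expects_Seq])
    fix m1 assume "?R1 m1"
    then show "expects toss m1 ((2 * n + 1) * (200 * L)) ?R2 (\<lambda>m'. ?f (m' 18 0))
      (ennreal (miss S i m))"
      using coin_mean by (intro expects_mono[OF S2]) auto
  qed (rule S3)
qed

lemma sample:
  assumes env: "env m0" and L4: "4 ^ n < (2::nat) ^ L" and t: "m0 7 0 \<le> n" and S: "S \<subseteq> set us"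
  shows "expects sample m0 ((N + 1) * (N + 1) * (1000 * L))
    (\<lambda>m. same {3, 16, 17, 18, 19, 20, 21} m0 m \<and> env m \<and> card (X m) = m0 7 0)
    (\<lambda>m. if X m \<subseteq> S then 0 else 1) (ennreal (1 - hit_prob n (4 ^ n) n (m0 7 0) (card S)))"
proof -
  have bm: "small L m0" using env by (simp add: env_def)
  have L2: "(2::nat) < 2 ^ L" using L by linarith
  let ?p = "(18 ::= Const 0 ;; 19 ::= Const 1 ;; 20 ::= Add (reg 4) (reg 4)) ;; toss ;; decide"
  let ?Q = "\<lambda>m. same {3, 16, 17, 18, 19, 20, 21} m0 m \<and> env m \<and> card (X m) = m0 7 0"
  let ?v = "1 - hit_prob n (4 ^ n) n (m0 7 0) (card S)"
  have init: "halts (17 ::= reg 7 ;; 16 ::= Const 0) m0 (100 * L) (\<lambda>m1. sample_inv m0 0 m1 \<and>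
    miss S 0 m1 = ?v)"
  proof (rule halts_mono[OF halts_wp[OF L(1), where Q = "\<lambda>m1. same {16, 17} m0 m1 \<and> m1 16 0 = 0 \<and>
    m1 17 0 = m0 7 0"]])
    fix m1 assume m1: "(same {16, 17} m0 m1 \<and> m1 16 0 = 0 \<and> m1 17 0 = m0 7 0) \<and> small L m1"
    have "S \<inter> set us = S" using S by blast
    then show "sample_inv m0 0 m1 \<and> miss S 0 m1 = ?v"
      using m1 t by (auto simp: sample_inv_def miss_def same_def)
  qed (use bm L2 smallD[OF bm, of 7 0] in \<open>auto simp: same_def\<close>)
  have loop: "expects (While (Sub (reg 4) (reg 16)) ?p) m1 ((n + 1) * (1 + 20 * L) + n *
    (100 * L + ((2 * n + 1) * (200 * L) + 200 * L)))
      ?Q (\<lambda>m. if X m \<subseteq> S then 0 else 1) (ennreal (miss S 0 m1))" if m1: "sample_inv m0 0 m1" for m1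
  proof (rule expects_While[where Inv = "sample_inv m0" and \<phi> = "\<lambda>i m. ennreal (miss S i m)"])
    show "sample_inv m0 0 m1" by (rule m1)
    fix i m assume i: "i \<le> n" "sample_inv m0 i m"
    have b: "small L m" and n4: "m 4 0 = n" "m 16 0 = i" using i env
      by (auto simp: sample_inv_def env_def same_def)
    show "cost (Sub (reg 4) (reg 16)) m \<le> 20 * L"
      by (rule order_trans[OF cost_low[OF b _ L(1)]]) auto
    {
      assume "eval (Sub (reg 4) (reg 16)) m \<noteq> 0"
      then have "i < n" using n4 by simp
      then show "i < n \<and> expects ?p m (100 * L + ((2 * n + 1) * (200 * L) + 200 * L))
        (sample_inv m0 (Suc i))
          (\<lambda>m'. ennreal (miss S (Suc i) m')) (ennreal (miss S i m))"
        using sample_round[OF env L4 _ i(2)] by simp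
    next
      assume "eval (Sub (reg 4) (reg 16)) m = 0"
      then have "i = n" using n4 i by simp
      moreover have "env m" using i(2) env by (simp add: sample_inv_def env_def same_def)
      ultimately show "?Q m \<and> (if X m \<subseteq> S then 0 else 1) \<le> ennreal (miss S i m)"
        \<comment> \<open>With no element left, nothing is wanted any more and
          \<open>hit_prob\<close> is 1; the potential has become the indicator of a miss.\<close>
        using i by (auto simp: sample_inv_def miss_def hit_prob_def card_X X_def[symmetric])
    }
  qed
  have "expects sample m0
    (100 * L + ((n + 1) * (1 + 20 * L) + n * (100 * L + ((2 * n + 1) * (200 * L) + 200 * L))))
      ?Q (\<lambda>m. if X m \<subseteq> S then 0 else 1) (ennreal ?v)"
    unfolding sample_def
  proof (rule expects_Seq)
    show "expects (17 ::= reg 7 ;; 16 ::= Const 0) m0 (100 * L) (\<lambda>m1. sample_inv m0 0 m1 \<and>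
      miss S 0 m1 = ?v) (\<lambda>_. ennreal ?v) (ennreal ?v)"
      by (rule expects_of_halts[OF init]) simp
    fix m1 assume "sample_inv m0 0 m1 \<and> miss S 0 m1 = ?v"
    then show "expects (While (Sub (reg 4) (reg 16)) ?p) m1 ((n + 1) * (1 + 20 * L) + n *
      (100 * L + ((2 * n + 1) * (200 * L) + 200 * L)))
      ?Q (\<lambda>m. if X m \<subseteq> S then 0 else 1) (ennreal ?v)"
      using loop[of m1] by simp
  qed
  then show ?thesis
  proof (rule expects_mono)
    define M where "M = N + 1"
    have nM: "n + 1 \<le> M" "1 \<le> M" using us by (auto simp: M_def)
    have MM: "M \<le> M * M" "1 \<le> M * M" using nM by auto
    have "100 * L \<le> 100 * (M * M * L)" using MM(2) by simp
    moreover have "(n + 1) * (1 + 20 * L) \<le> 21 * (M * M * L)"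
    proof -
      have "(n + 1) * (1 + 20 * L) \<le> (M * M) * (21 * L)" using nM MM L
        by (intro mult_le_mono) linarith+
      then show ?thesis by simp
    qed
    moreover have "n * (100 * L + ((2 * n + 1) * (200 * L) + 200 * L)) \<le> 700 * (M * M * L)"
    proof -
      have "(2 * n + 1) * (200 * L) \<le> (2 * M) * (200 * L)" using nM by (intro mult_le_mono1) simp
      moreover have "L \<le> M * L" using nM by simp
      moreover have "(2 * M) * (200 * L) = 400 * (M * L)" by simp
      ultimately have "100 * L + ((2 * n + 1) * (200 * L) + 200 * L) \<le> 700 * (M * L)" by linarith
      then have "n * (100 * L + ((2 * n + 1) * (200 * L) + 200 * L)) \<le> M * (700 * (M * L))"
        using nM by (intro mult_le_mono) auto
      then show ?thesis by (simp add: algebra_simps)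
    qed
    ultimately have "100 * L + ((n + 1) * (1 + 20 * L) + n *
      (100 * L + ((2 * n + 1) * (200 * L) + 200 * L))) \<le> 821 * (M * M * L)"
      by linarith
    then show "100 * L + ((n + 1) * (1 + 20 * L) + n *
      (100 * L + ((2 * n + 1) * (200 * L) + 200 * L))) \<le> (N + 1) * (N + 1) * (1000 * L)"
      unfolding M_def[symmetric] by simp
  qed auto
qed

end

section \<open>Batches of trials\<close>

lemma expects_add:
  assumes "expects p m T Q f v"
  shows "expects p m T Q (\<lambda>m'. c + f m') (c + v)"
proof -
  obtain D where D: "samples p m T D" "\<forall>m' \<in> set_pmf D. Q m'" "(\<integral>\<^sup>+m'. f m' \<partial>measure_pmf D) \<le> v"
    using assms unfolding expects_def by blast
  have "(\<integral>\<^sup>+m'. c + f m' \<partial>measure_pmf D) = c + (\<integral>\<^sup>+m'. f m' \<partial>measure_pmf D)"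
    by (simp add: nn_integral_add measure_pmf.emeasure_space_1)
  then show ?thesis
    using D unfolding expects_def by (intro exI[of _ D]) (auto intro: add_left_mono)
qed

definition trial :: "com \<Rightarrow> com" where
  "trial p = sample ;; check p ;; 15 ::= Sub (reg 15) (Const 1)"

text \<open>
  If \<open>k\<close> is the size of a solution, a trial misses it with probability at most
  \<open>1 - 1 / (2 * reps n k t)\<close>, so that a batch of \<open>2 * reps n k t * (s + 3)\<close> of them
  misses with probability at most \<open>(1 / 2) ^ (s + 3)\<close>.
\<close>

definition batch :: "com \<Rightarrow> com" where
  "batch p = (12 ::= Add (Div (reg 10) (reg 11)) (Const 1) ;; 28 ::= Div (reg 9) (reg 12)) ;;
    Cond (reg 28)
      ((14 ::= Const 0 ;; 15 ::= Mul (Mul (Const 2) (reg 12)) (Add (reg 8) (Const 3))) ;;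
       While (reg 15) (trial p) ;;
       13 ::= Sub (Const 1) (reg 14))
      Skip"

lemma falling_le: "falling n t \<le> n ^ t"
  unfolding falling_def using prod_mono[of "{..<t}" "\<lambda>i. n - i" "\<lambda>_. n"] by simp

lemma falling_le_self: "t \<le> n \<Longrightarrow> falling n t \<le> n ^ n"
  using order_trans[OF falling_le[of n t] power_increasing[of t n n]] by (cases "n = 0") auto

text \<open>\<open>BB\<close> is a budget with which, for every \<open>k\<close>, some
  \<open>t\<close> is sure to complete: divided among \<open>reps\<close> trials it leaves each call
  a limit above \<open>8 * TE\<close>. At most \<open>lb\<close> doublings reach it. The other
  assumptions make \<open>L\<close> large enough for all numbers that occur, \<open>LV\<close>
  mainly for the number of simulations. \<open>Sol\<close> is any set, so that instances without
  solutions are covered by the same statements.\<close>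

locale search_all = search +
  fixes BB lb :: nat and Sol :: "nat set"
  assumes opt: "\<And>k. k \<le> length us \<Longrightarrow> \<exists>t\<le>k. reps (length us) k t * (8 * TE t (k - t) + 2) \<le> BB"
    and lb: "BB \<le> 2 ^ lb"
    and L4: "4 ^ length us < (2::nat) ^ L"
    and Ln: "length us ^ length us + 1 < 2 ^ L"
    and LV: "(length us + 2) * ((lb + 1) * (length us + 1) + 1) *
        (2 ^ (lb + 1) * ((lb + 1) * (length us + 1) + 3) * (length us + 1)) +
        2 ^ (lb + 1) + L + length us + 4 < 2 ^ L"
begin

text \<open>Rounds 0 to \<open>lb\<close>, each with at most \<open>n + 1\<close> values of
  \<open>t\<close>.\<close>

definition max_batches :: nat where "max_batches = (lb + 1) * (n + 1)"
text \<open>Bounds the number of simulations in a single batch: at most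
  \<open>2 * 2 ^ lb * (max_batches + 3)\<close> trials with at most \<open>n + 1\<close> calls each,
  one per element of the universe and a final one.\<close>

definition max_versions :: nat where "max_versions = 2 ^ (lb + 1) * (max_batches + 3) * (n + 1)"

lemma LV': "(n + 2) * (max_batches + 1) * max_versions + 2 ^ (lb + 1) + L + n + 4 < 2 ^ L"
  using LV by (simp add: max_batches_def max_versions_def)

definition good :: "nat \<Rightarrow> bool" where
  "good k \<longleftrightarrow> Sol \<in> Fam \<and> card Sol = k"

definition trial_miss :: "nat \<Rightarrow> nat \<Rightarrow> real" where
  "trial_miss k t = (if good k then 1 - 1 / (2 * real (reps n k t)) else 1)"

lemma trial_miss_bounds: "0 \<le> trial_miss k t" "trial_miss k t \<le> 1"
  by (auto simp: trial_miss_def reps_def field_simps)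

definition trial_frame :: "mem \<Rightarrow> mem \<Rightarrow> bool" where
  "trial_frame m m' \<longleftrightarrow> env m' \<and> (\<forall>a<22. a \<notin> {0, 3, 6, 14, 15, 16, 17, 18, 19, 20, 21} \<longrightarrow> m' a = m a) \<and>
     m' 28 = m 28 \<and> sound m' \<and> (found m \<longrightarrow> found m') \<and> (m 14 0 \<noteq> 0 \<longrightarrow> m' 14 0 \<noteq> 0) \<and>
     (8 * TE (m 7 0) (m 5 0 - m 7 0) < m 28 0 \<longrightarrow> m' 14 0 = m 14 0)"

lemma trial_frame_refl: "env m \<Longrightarrow> sound m \<Longrightarrow> trial_frame m m"
  by (simp add: trial_frame_def)

lemma trial_frame_trans:
  assumes 1: "trial_frame m m1" and 2: "trial_frame m1 m2"
  shows "trial_frame m m2"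
proof -
  have "m1 7 = m 7" "m1 5 = m 5" "m1 28 = m 28" using 1 by (auto simp: trial_frame_def)
  then show ?thesis using 1 2 unfolding trial_frame_def by simp
qed

definition trial_factor :: nat where "trial_factor = call_factor + 4000"

abbreviation "P0 \<equiv> (N + 2) * (N + 2) * (L * L * L)"

text \<open>A trial that times out does not count as a failure here: its batch will not end the
  race, so the chance of success is merely deferred.\<close>

lemma trial:
  assumes env: "env m" and so: "sound m" and t: "m 7 0 \<le> m 5 0" "m 5 0 \<le> n"
    and F: "m 28 0 + L < 2 ^ L" "m 22 0 + n + 2 < 2 ^ L"
  shows "expects (trial pE) m (trial_factor * P0 * (1 + m 28 0))
    (\<lambda>m'. trial_frame m m' \<and> m' 15 0 = m 15 0 - 1 \<and> m' 22 0 \<le> m 22 0 + n + 1)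
    (\<lambda>m'. if found m' \<or> m' 14 0 \<noteq> 0 then 0 else 1)
    (if found m \<or> m 14 0 \<noteq> 0 then 0 else ennreal (trial_miss (m 5 0) (m 7 0)))"
proof -
  let ?t = "m 7 0" and ?k = "m 5 0" and ?F = "m 28 0"
  \<comment> \<open>If \<open>good\<close> fails, only the trivial bound 1 is claimed, and the empty
    set serves as a dummy target inside the universe.\<close>
  define S where "S = (if good ?k then Sol else {})"
  have S: "S \<subseteq> set us" using fam by (auto simp: S_def good_def)
  let ?Q = "\<lambda>m'. trial_frame m m' \<and> m' 15 0 = m 15 0 - 1 \<and> m' 22 0 \<le> m 22 0 + n + 1"
  let ?f = "\<lambda>m'. if found m' \<or> m' 14 0 \<noteq> 0 then 0 else 1 :: ennreal"
  let ?Q1 = "\<lambda>m1. same {3, 16, 17, 18, 19, 20, 21} m m1 \<and> env m1 \<and> card (X m1) = ?t"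
  have c: "halts (check pE ;; 15 ::= Sub (reg 15) (Const 1)) m1 (check_time ?F + 100 * L)
      (\<lambda>m'. ?Q m' \<and> (extensible (X m1) (?k - ?t) \<longrightarrow> found m' \<or> m' 14 0 \<noteq> 0))" if m1: "?Q1 m1" for m1
  proof (rule halts_Seq)
    have eq: "m1 5 = m 5" "m1 7 = m 7" "m1 28 = m 28" "m1 22 = m 22" "m1 14 = m 14" "m1 0
      = m 0" "m1 15 = m 15"
      using m1 by (auto simp: same_def)
    have "halts (check pE) m1 (check_time (m1 28 0)) (check_post m1)"
      using m1 t F by (intro check) (auto simp: eq)
    then show "halts (check pE) m1 (check_time ?F) (check_post m1)" by (simp add: eq)
    fix m2 assume m2: "check_post m1 m2"
    then have b2: "small L m2" by (simp add: check_post_def env_def)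
    have "m2 15 = m 15" using m2 by (simp add: check_post_def eq)
    then have "halts (15 ::= Sub (reg 15) (Const 1)) m2 (com_size (15 ::= Sub (reg 15) (Const 1))
      * L)
        (\<lambda>m'. (same {15} m2 m' \<and> m' 15 0 = m 15 0 - 1) \<and> small L m')"
      using b2 L smallD[OF b2, of 15 0] by (intro halts_wp) (auto simp: same_def)
    then show "halts (15 ::= Sub (reg 15) (Const 1)) m2 (100 * L)
        (\<lambda>m'. ?Q m' \<and> (extensible (X m1) (?k - ?t) \<longrightarrow> found m' \<or> m' 14 0 \<noteq> 0))"
    proof (rule halts_mono)
      fix m' assume m': "(same {15} m2 m' \<and> m' 15 0 = m 15 0 - 1) \<and> small L m'"
      have e: "m' 0 = m2 0" "m' 14 = m2 14" "m' 22 = m2 22" "m' 28 = m2 28" using m'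
        by (auto simp: same_def)
      have "env m2" using m2 by (simp add: check_post_def)
      then have env': "env m'" using m' by (simp add: env_def same_def)
      have sim_frame: "\<forall>a<22. a \<notin> {0, 3, 6, 14, 15, 16, 17, 18, 19, 20, 21} \<longrightarrow> m' a = m a"
      proof (intro allI impI)
        fix a :: nat assume a: "a < 22" "a \<notin> {0, 3, 6, 14, 15, 16, 17, 18, 19, 20, 21}"
        have "m' a = m2 a" using m' a by (simp add: same_def)
        also have "\<dots> = m1 a" using m2 a by (simp add: check_post_def)
        also have "\<dots> = m a" using m1 a by (simp add: same_def)
        finally show "m' a = m a" .
      qed
      have cX: "card (X m1) = ?t" using m1 by simp
      have f: "sound m'" "found m \<longrightarrow> found m'" "found m' = found m2"
        using m2 so sound_cong[of m1 m] sound_cong[of m' m2] found_cong[of m1 m]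
          found_cong[of m' m2] e eq
        by (auto simp: check_post_def)
      show "?Q m' \<and> (extensible (X m1) (?k - ?t) \<longrightarrow> found m' \<or> m' 14 0 \<noteq> 0)"
        using m2 m' env' sim_frame f cX unfolding trial_frame_def check_post_def e eq by auto
    qed simp
  qed
  have step1: "expects sample m ((N + 1) * (N + 1) * (1000 * L)) ?Q1
      (\<lambda>m. if X m \<subseteq> S then 0 else 1) (ennreal (1 - hit_prob n (4 ^ n) n ?t (card S)))"
    using t by (intro sample[OF env L4 _ S]) simp
  have T: "(N + 1) * (N + 1) * (1000 * L) + (check_time ?F + 100 * L)
    \<le> trial_factor * P0 * (1 + ?F)"
  proof -
    define W where "W = P0 * (1 + ?F)"
    have LL: "L \<le> L * L * L" using L(1) by simp
    have 1: "(N + 1) * (N + 1) * (1000 * L) \<le> 1000 * W"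
    proof -
      have "(N + 1) * (N + 1) * L * 1 \<le> (N + 2) * (N + 2) * (L * L * L) * (1 + ?F)"
        using LL by (intro mult_le_mono) auto
      then show ?thesis by (simp add: W_def)
    qed
    have 2: "(N + 2) * (call_factor * (L * L * L * (N + 1 + ?F))) \<le> call_factor * W"
    proof -
      have "N + 1 + ?F \<le> (N + 2) * (1 + ?F)" by simp
      then have "(N + 2) * (call_factor * (L * L * L * (N + 1 + ?F)))
        \<le> (N + 2) * (call_factor * (L * L * L * ((N + 2) * (1 + ?F))))"
        by (intro mult_le_mono2)
      also have "\<dots> = call_factor * W" by (simp only: W_def mult_ac)
      finally show ?thesis .
    qed
    have 3: "L \<le> W"
    proof -
      have "1 * 1 * L * 1 \<le> P0 * (1 + ?F)" using LL by (intro mult_le_mono) auto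
      then show ?thesis by (simp add: W_def)
    qed
    have 4: "(N + 2) * L \<le> W"
    proof -
      have "(N + 2) * 1 * L * 1 \<le> P0 * (1 + ?F)" using LL by (intro mult_le_mono) auto
      then show ?thesis by (simp add: W_def)
    qed
    have "check_time ?F = (N + 2) * (call_factor * (L * L * L * (N + 1 + ?F))) + 2000 *
      ((N + 2) * L)"
      by (simp add: distrib_left)
    moreover have "trial_factor * P0 * (1 + ?F) = trial_factor * W" by (simp only: W_def mult.assoc)
    moreover have "trial_factor * W = call_factor * W + 4000 * W"
      by (simp add: trial_factor_def distrib_right)
    ultimately show ?thesis using 1 2 3 4 by linarith
  qed
  have basic: "expects (trial pE) m (trial_factor * P0 * (1 + ?F)) ?Q (\<lambda>_. 0) 0"
  proof (rule expects_mono[OF _ T])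
    show "expects (trial pE) m ((N + 1) * (N + 1) * (1000 * L) + (check_time ?F + 100 * L)) ?Q
      (\<lambda>_. 0) 0"
      unfolding trial_def
      by (rule expects_Seq[OF expects_const[OF step1]], rule order_refl,
        rule expects_of_halts[OF halts_mono[OF c]]) auto
  qed auto
  show ?thesis
  proof (cases "found m \<or> m 14 0 \<noteq> 0")
    case True
    then show ?thesis by (intro expects_const[OF basic]) (auto simp: trial_frame_def)
  next
    case False
    show ?thesis
    proof (cases "good ?k")
      case True
      then have SS: "S = Sol" "Sol \<in> Fam" "card Sol = ?k" by (auto simp: S_def good_def)
      have fin: "finite Sol" using S SS finite_subset by auto
      have "expects (trial pE) m ((N + 1) * (N + 1) * (1000 * L) + (check_time ?F + 100 * L)) ?Q ?f
          (ennreal (1 - hit_prob n (4 ^ n) n ?t (card S)))"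
        unfolding trial_def
      proof (rule expects_Seq[OF step1])
        fix m1 assume m1: "?Q1 m1"
        have "extensible (X m1) (?k - ?t)" if sub: "X m1 \<subseteq> S"
        proof -
          \<comment> \<open>The sample has exactly \<open>t\<close> elements, so the rest of
            \<open>Sol\<close> just fits into the \<open>k - t\<close> elements that may be
            added.\<close>
          have "card (Sol - X m1) = ?k - ?t"
            using m1 sub SS X_subset(2) by (subst card_Diff_subset) auto
          moreover have "Sol - X m1 \<union> X m1 = Sol" using sub SS by blast
          ultimately show ?thesis
            unfolding extensible_def using SS S by (intro exI[of _ "Sol - X m1"]) auto
        qed
        then show "expects (check pE ;;
          15 ::= Sub (reg 15) (Const 1)) m1 (check_time ?F + 100 * L) ?Q ?f
            (if X m1 \<subseteq> S then 0 else 1)"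
          by (intro expects_mono[OF expects_of_halts[OF c[OF m1], where f = ?f
            and v = "if X m1 \<subseteq> S then 0 else 1"]]) auto
      qed
      moreover have "1 - hit_prob n (4 ^ n) n ?t (card S) \<le> trial_miss ?k ?t"
        using hit_prob_start[of ?t ?k n] t True SS by (simp add: trial_miss_def)
      ultimately show ?thesis
        using False T by (elim expects_mono) (auto intro: ennreal_leI)
    next
      case False
      then have "trial_miss ?k ?t = 1" by (simp add: trial_miss_def)
      then show ?thesis using \<open>\<not> (found m \<or> m 14 0 \<noteq> 0)\<close> by (intro expects_const[OF basic]) auto
    qed
  qed
qed

definition batch_frame :: "mem \<Rightarrow> mem \<Rightarrow> bool" where
  "batch_frame m m' \<longleftrightarrow> env m' \<and> (\<forall>a<12. a \<notin> {0, 3, 6} \<longrightarrow> m' a = m a) \<and> sound m' \<and>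
     (found m \<longrightarrow> found m') \<and> m' 13 0 \<le> 1 \<and> m' 22 0 \<le> m 22 0 + max_versions \<and>
     (reps n (m 5 0) (m 7 0) * (8 * TE (m 7 0) (m 5 0 - m 7 0) + 2) \<le> m 9 0 \<longrightarrow> m' 13 0 = 1)"

text \<open>The potential is the miss probability of one trial to the power of the number of trials
  left; multiplying the bound for a trial by a constant expresses their independence.\<close>

lemma trials:
  assumes env: "env m" and so: "sound m" and t: "m 7 0 \<le> m 5 0" "m 5 0 \<le> n" and tmo: "m 14 0 = 0"
    and F: "m 28 0 + L < 2 ^ L" "m 22 0 + m 15 0 * (n + 1) + n + 2 < 2 ^ L"
  shows "expects (While (reg 15) (trial pE)) m
    ((m 15 0 + 1) * ((trial_factor + 11) * P0 * (1 + m 28 0)))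
    (\<lambda>m'. trial_frame m m' \<and> m' 22 0 \<le> m 22 0 + m 15 0 * (n + 1))
    (\<lambda>m'. if found m' \<or> m' 14 0 \<noteq> 0 then 0 else 1)
    (if found m then 0 else ennreal (trial_miss (m 5 0) (m 7 0) ^ m 15 0))"
proof -
  let ?J = "m 15 0" and ?p = "trial_miss (m 5 0) (m 7 0)" and ?F = "m 28 0"
  define Inv where "Inv i m' \<longleftrightarrow> trial_frame m m' \<and> m' 15 0 = ?J - i \<and>
    m' 22 0 \<le> m 22 0 + i * (n + 1)" for i m'
  define \<phi> where "\<phi> i m' = (if found m' \<or> m' 14 0 \<noteq> 0 then 0 else ennreal (?p ^ (?J - i)))" for i m'
  have "expects (While (reg 15) (trial pE)) m ((?J + 1) * (1 + 10 * L) + ?J *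
    (trial_factor * P0 * (1 + ?F)))
    (\<lambda>m'. trial_frame m m' \<and> m' 22 0 \<le> m 22 0 + ?J * (n + 1))
    (\<lambda>m'. if found m' \<or> m' 14 0 \<noteq> 0 then 0 else 1) (\<phi> 0 m)"
  proof (rule expects_While[where Inv = Inv and \<phi> = \<phi>])
    show "Inv 0 m" using trial_frame_refl[OF env so] by (simp add: Inv_def)
    fix i m' assume i: "i \<le> ?J" and inv: "Inv i m'"
    have b: "small L m'" using inv by (simp add: Inv_def trial_frame_def env_def)
    show "cost (reg 15) m' \<le> 10 * L" by (rule order_trans[OF cost_low[OF b _ L(1)]]) auto
    {
      assume "eval (reg 15) m' \<noteq> 0"
      then have iJ: "i < ?J" using inv by (simp add: Inv_def)
      have eq: "m' 5 = m 5" "m' 7 = m 7" "m' 28 = m 28" using inv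
        by (auto simp: Inv_def trial_frame_def)
      have "i * (n + 1) \<le> ?J * (n + 1)" using i by (intro mult_le_mono1)
      then have v: "m' 22 0 + n + 2 < 2 ^ L" using inv F(2) by (simp add: Inv_def)
      have "expects (trial pE) m' (trial_factor * P0 * (1 + m' 28 0))
        (\<lambda>m''. trial_frame m' m'' \<and> m'' 15 0 = m' 15 0 - 1 \<and> m'' 22 0 \<le> m' 22 0 + n + 1)
        (\<lambda>m''. if found m'' \<or> m'' 14 0 \<noteq> 0 then 0 else 1)
        (if found m' \<or> m' 14 0 \<noteq> 0 then 0 else ennreal (trial_miss (m' 5 0) (m' 7 0)))"
        using inv t F v by (intro trial) (auto simp: Inv_def trial_frame_def)
      from expects_scale[OF this, of "ennreal (?p ^ (?J - Suc i))"]
      have "expects (trial pE) m' (trial_factor * P0 * (1 + ?F))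
        (\<lambda>m''. trial_frame m' m'' \<and> m'' 15 0 = m' 15 0 - 1 \<and> m'' 22 0 \<le> m' 22 0 + n + 1)
        (\<lambda>m''. ennreal (?p ^ (?J - Suc i)) * (if found m'' \<or> m'' 14 0 \<noteq> 0 then 0 else 1))
        (ennreal (?p ^ (?J - Suc i)) * (if found m' \<or> m' 14 0 \<noteq> 0 then 0 else ennreal ?p))"
        by (simp only: eq)
      moreover have "ennreal (?p ^ (?J - Suc i)) * ennreal ?p = ennreal (?p ^ (?J - i))"
      proof -
        have "?J - i = Suc (?J - Suc i)" using iJ by simp
        then show ?thesis using trial_miss_bounds
          by (simp add: ennreal_mult[symmetric] mult.commute)
      qed
      moreover have "trial_frame m m'" using inv by (simp add: Inv_def)
      ultimately show "i < ?J \<and> expects (trial pE) m' (trial_factor * P0 * (1 + ?F)) (Inv (Suc i))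
        (\<phi> (Suc i)) (\<phi> i m')"
        using iJ inv trial_frame_trans[of m m']
        by (auto elim!: expects_mono simp: Inv_def \<phi>_def)
    next
      assume "eval (reg 15) m' = 0"
      then have "i = ?J" using inv i by (simp add: Inv_def)
      then show "(trial_frame m m' \<and> m' 22 0 \<le> m 22 0 + ?J * (n + 1)) \<and>
          (if found m' \<or> m' 14 0 \<noteq> 0 then 0 else 1) \<le> \<phi> i m'"
        using inv by (simp add: Inv_def \<phi>_def)
    }
  qed
  then show ?thesis
  proof (rule expects_mono)
    define W where "W = P0 * (1 + ?F)"
    have "11 * L \<le> 11 * W"
    proof -
      have "1 * 1 * L * 1 \<le> P0 * (1 + ?F)" using L(1) by (intro mult_le_mono) auto
      then show ?thesis by (simp add: W_def)
    qed
    moreover have "(trial_factor + 11) * P0 * (1 + ?F) = (trial_factor + 11) * W" "trial_factor *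
      P0 * (1 + ?F) = trial_factor * W"
      by (simp_all only: W_def mult.assoc)
    moreover have "(trial_factor + 11) * W = trial_factor * W + 11 * W" by (simp add: distrib_right)
    ultimately have "1 + 10 * L + trial_factor * P0 * (1 + ?F)
      \<le> (trial_factor + 11) * P0 * (1 + ?F)"
      using L(1) by linarith
    then have "(?J + 1) * (1 + 10 * L + trial_factor * P0 * (1 + ?F))
      \<le> (?J + 1) * ((trial_factor + 11) * P0 * (1 + ?F))"
      by (rule mult_le_mono2)
    moreover have "?J * (trial_factor * P0 * (1 + ?F))
      \<le> (?J + 1) * (trial_factor * P0 * (1 + ?F))" by (intro mult_le_mono1) simp
    ultimately show "(?J + 1) * (1 + 10 * L) + ?J * (trial_factor * P0 * (1 + ?F))
      \<le> (?J + 1) * ((trial_factor + 11) * P0 * (1 + ?F))"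
      unfolding distrib_left[of "?J + 1" "1 + 10 * L"] by linarith
  qed (use tmo in \<open>auto simp: \<phi>_def\<close>)
qed

end

section \<open>Racing the sample sizes\<close>

text \<open>Both falling factorials gain a factor that involves the old \<open>t\<close>, so
  register 7 is increased last. After \<open>t = k\<close> the next round starts with twice the
  budget.\<close>

definition advance :: com where
  "advance = 8 ::= Add (reg 8) (Const 1) ;;
    Cond (Sub (reg 5) (reg 7))
      (10 ::= Mul (reg 10) (Sub (reg 4) (reg 7)) ;; 11 ::= Mul (reg 11) (Sub (reg 5) (reg 7)) ;;
       7 ::= Add (reg 7) (Const 1))
      (7 ::= Const 0 ;; 9 ::= Add (reg 9) (reg 9) ;; 10 ::= Const 1 ;; 11 ::= Const 1)"

definition race :: "com \<Rightarrow> com" where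
  "race p = While (Sub (Const 1) (reg 13)) (batch p ;; advance)"

definition all_sizes :: "com \<Rightarrow> com" where
  "all_sizes p = While (Sub (Add (reg 4) (Const 1)) (reg 5))
    ((8 ::= Const 0 ;; 7 ::= Const 0 ;; 9 ::= Const 1 ;; 10 ::= Const 1 ;; 11 ::= Const 1 ;;
      13 ::= Const 0) ;;
     race p ;; 5 ::= Add (reg 5) (Const 1))"

lemma falling_mono: "k \<le> n \<Longrightarrow> falling k t \<le> falling n t"
  unfolding falling_def by (intro prod_mono) auto

text \<open>The sum of \<open>(1 / 2) ^ (j + 3)\<close> over \<open>j \<ge> s\<close>.\<close>

definition miss_tail :: "nat \<Rightarrow> ennreal" where
  "miss_tail s = ennreal ((1 / 2) ^ (s + 2))"

lemma miss_tail_le: "miss_tail s \<le> 1"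
  unfolding miss_tail_def by (intro ennreal_le_1[THEN iffD2] power_le_one) auto

lemma miss_tail_Suc: "miss_tail (Suc s) + ennreal ((1 / 2) ^ (s + 3))
  = miss_tail s" "miss_tail (Suc s) \<le> miss_tail s"
proof -
  have "miss_tail (Suc s) + ennreal ((1 / 2) ^ (s + 3))
    = ennreal ((1 / 2) ^ (s + 3) + (1 / 2) ^ (s + 3))"
    by (simp add: miss_tail_def ennreal_plus[symmetric] eval_nat_numeral del: ennreal_plus)
  also have "(1 / 2) ^ (s + 3) + (1 / 2) ^ (s + 3) = ((1 / 2) ^ (s + 2) :: real)"
    by (simp add: power_add eval_nat_numeral)
  finally show "miss_tail (Suc s) + ennreal ((1 / 2) ^ (s + 3)) = miss_tail s"
    by (simp add: miss_tail_def)
  then show "miss_tail (Suc s) \<le> miss_tail s" by (metis le_iff_add)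
qed

context search_all
begin

definition batch_time :: nat where
  "batch_time = (trial_factor + 400) * (P0 * (8 * ((max_batches + 3) * 2 ^ lb)))"

lemma L_le_P0: "L \<le> P0"
proof -
  have "1 * 1 * L \<le> P0" using L(1) by (intro mult_le_mono) auto
  then show ?thesis by simp
qed

text \<open>For a good \<open>k\<close> the potential before batch \<open>s\<close> is
  \<open>miss_tail s\<close>. A complete batch without success ends the race and costs 1, but has
  probability at most \<open>(1 / 2) ^ (s + 3)\<close>; otherwise the potential falls to
  \<open>miss_tail (Suc s)\<close> or to 0.\<close>

lemma batch:
  assumes env: "env m" and so: "sound m" and t: "m 7 0 \<le> m 5 0" "m 5 0 \<le> n"
    and fal: "m 10 0 = falling n (m 7 0)" "m 11 0 = falling (m 5 0) (m 7 0)"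
    and B: "m 9 0 \<le> 2 ^ lb" "m 8 0 \<le> max_batches" "m 13 0 = 0" "m 22 0 + max_versions + n + 2 < 2
      ^ L"
  shows "expects (batch pE) m batch_time (batch_frame m)
    (\<lambda>m'. if found m' then 0 else if m' 13 0 \<noteq> 0 then 1 else
      if good (m 5 0) then miss_tail (Suc (m 8 0)) else 1)
    (if found m then 0 else if good (m 5 0) then miss_tail (m 8 0) else 1)"
proof -
  let ?t = "m 7 0" and ?k = "m 5 0" and ?s = "m 8 0" and ?B = "m 9 0"
  define M where "M = reps n ?k ?t"
  define F where "F = ?B div M"
  define J where "J = 2 * M * (?s + 3)"
  have bm: "small L m" using env by (simp add: env_def)
  have L2: "(2::nat) < 2 ^ L" using L by linarith
  have M1: "1 \<le> M" by (simp add: M_def reps_def)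
  have "M \<le> falling n ?t + 1" by (simp add: M_def reps_def)
  also have "\<dots> \<le> n ^ n + 1" using falling_le_self[of ?t n] t by simp
  finally have M2L: "M < 2 ^ L" using Ln by linarith
  have "F \<le> ?B" by (simp add: F_def)
  then have FB: "F \<le> 2 ^ lb" using B(1) by linarith
  have FL: "F + L < 2 ^ L" "F < 2 ^ L" using FB LV' by auto
  let ?f = "\<lambda>m'. if found m' then 0 else if m' 13 0 \<noteq> 0 then 1 else
    if good ?k then miss_tail (Suc ?s) else 1"
  let ?v = "if found m then 0 else if good ?k then miss_tail ?s else 1"
  let ?R1 = "\<lambda>m1. (same {12, 28} m m1 \<and> m1 12 0 = M \<and> m1 28 0 = F) \<and> small L m1"
  have S1: "halts (12 ::= Add (Div (reg 10) (reg 11)) (Const 1) ;;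
    28 ::= Div (reg 9) (reg 12)) m (100 * L) ?R1"
    by (rule halts_mono[OF halts_wp[OF L(1), where Q = "\<lambda>m1. same {12, 28} m m1 \<and> m1 12 0 = M \<and>
      m1 28 0 = F"]])
      (use bm M2L FL fal in \<open>auto simp: same_def M_def reps_def F_def\<close>)
  have skip: "batch_frame m m1 \<and> ?f m1 \<le> ?v" if m1: "?R1 m1" and F0: "F = 0" for m1
  proof -
    have e: "m1 0 = m 0" "m1 13 = m 13" "m1 22 = m 22" using m1 by (auto simp: same_def)
    have "env m1" using env m1 by (simp add: env_def same_def)
    moreover have "\<not> M * (8 * TE ?t (?k - ?t) + 2) \<le> ?B"
    proof
      assume "M * (8 * TE ?t (?k - ?t) + 2) \<le> ?B"
      then have "8 * TE ?t (?k - ?t) + 2 \<le> F"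
        using M1 by (simp add: F_def less_eq_div_iff_mult_less_eq mult.commute)
      then show False using F0 by simp
    qed
    moreover have "sound m1" "found m1 = found m"
      using so sound_cong[of m1 m] found_cong[of m1 m] e by auto
    moreover have "\<forall>a<12. a \<notin> {0, 3, 6} \<longrightarrow> m1 a = m a" using m1 by (simp add: same_def)
    ultimately show ?thesis
      using B(3) e miss_tail_Suc(2)[of ?s] unfolding batch_frame_def M_def[symmetric] by simp
  qed
  have run: "expects ((14 ::= Const 0 ;;
    15 ::= Mul (Mul (Const 2) (reg 12)) (Add (reg 8) (Const 3))) ;;
       While (reg 15) (trial pE) ;; 13 ::= Sub (Const 1) (reg 14)) m1
       (100 * L + ((J + 1) * ((trial_factor + 11) * P0 * (1 + F)) + 100 * L)) (batch_frame m) ?f ?v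
    \<and> J * (1 + F) \<le> 4 * ((max_batches + 3) * 2 ^ lb)"
    if m1: "?R1 m1" and F0: "F \<noteq> 0" for m1
  proof -
    have MF: "M * F \<le> ?B" by (simp add: F_def)
    have "M * 1 \<le> M * F" using F0 by (intro mult_le_mono2) simp
    then have MB: "M \<le> 2 ^ lb" using MF B(1) by linarith
    have "J \<le> 2 * 2 ^ lb * (max_batches + 3)" unfolding J_def using MB B(2)
      by (intro mult_le_mono) auto
    then have "J * (n + 1) \<le> 2 * 2 ^ lb * (max_batches + 3) * (n + 1)" by (rule mult_le_mono1)
    then have "J * (n + 1) \<le> max_versions" by (simp add: max_versions_def)
    moreover have "J \<le> J * (n + 1)" by simp
    moreover have "max_versions \<le> (n + 2) * (max_batches + 1) * max_versions" by simp
    ultimately have JV: "J * (n + 1) \<le> max_versions" "J < 2 ^ L" using LV' by linarith+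
    \<comment> \<open>The fixed cost of a trial is absorbed into its limit, which is possible
      because the limit is not 0. This is why batches with limit 0 are skipped: otherwise the number
      of trials would not be bounded by the budget.\<close>
    have "J * (1 + F) \<le> J * (2 * F)" using F0 by (intro mult_le_mono2) simp
    also have "\<dots> = 4 * ((?s + 3) * (M * F))" by (simp add: J_def)
    also have "\<dots> \<le> 4 * ((max_batches + 3) * 2 ^ lb)" using MF B by (intro mult_le_mono) auto
    finally have T: "J * (1 + F) \<le> 4 * ((max_batches + 3) * 2 ^ lb)" .
    let ?R2 = "\<lambda>m2. (same {12, 14, 15, 28} m m2 \<and> m2 12 0 = M \<and> m2 28 0 = F \<and> m2 14 0 = 0 \<and>
      m2 15 0 = J) \<and> small L m2"
    have S2: "halts (14 ::= Const 0 ;;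
      15 ::= Mul (Mul (Const 2) (reg 12)) (Add (reg 8) (Const 3))) m1 (100 * L) ?R2"
      by (rule halts_mono[OF halts_wp[OF L(1), where Q = "\<lambda>m2. same {12, 14, 15, 28} m m2 \<and>
        m2 12 0 = M \<and> m2 28 0 = F \<and> m2 14 0 = 0 \<and> m2 15 0 = J"]])
        (use m1 JV L2 nbits_2 nbits_le_iff[of 2 3] in \<open>auto simp: same_def J_def\<close>)
    let ?R3 = "\<lambda>m2 m3. trial_frame m2 m3 \<and> m3 22 0 \<le> m2 22 0 + m2 15 0 * (n + 1)"
    have S3: "expects (While (reg 15) (trial pE)) m2
      ((J + 1) * ((trial_factor + 11) * P0 * (1 + F))) (?R3 m2)
        (\<lambda>m'. if found m' \<or> m' 14 0 \<noteq> 0 then 0 else 1) (if found m then 0 else ennreal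
          (trial_miss ?k ?t ^ J))"
      if m2: "?R2 m2" for m2
    proof -
      have e: "m2 0 = m 0" "m2 5 = m 5" "m2 7 = m 7" "m2 22 = m 22" using m2
        by (auto simp: same_def)
      have "env m2" using env m2 by (simp add: env_def same_def)
      moreover have so2: "sound m2" "found m2 = found m"
        using so sound_cong[of m2 m] found_cong[of m2 m] e by auto
      moreover have r: "m2 15 0 = J" "m2 28 0 = F" "m2 14 0 = 0" using m2 by auto
      moreover have "m2 22 0 + m2 15 0 * (n + 1) + n + 2 < 2 ^ L"
        unfolding e r using JV(1) B(4) by linarith
      moreover have "m2 28 0 + L < 2 ^ L" unfolding r by (rule FL)
      moreover have "m2 7 0 \<le> m2 5 0" "m2 5 0 \<le> n" unfolding e by (fact t)+
      ultimately show ?thesis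
        using trials[of m2] unfolding e r so2 by blast
    qed
    have S4: "halts (13 ::= Sub (Const 1) (reg 14)) m3 (100 * L) (\<lambda>m4. batch_frame m m4 \<and>
      found m4 = found m3 \<and> m4 13 0 = 1 - m3 14 0)"
      if m2: "?R2 m2" and m3: "?R3 m2 m3" for m2 m3
    proof -
      have b3: "small L m3" using m3 by (simp add: trial_frame_def env_def)
      have "halts (13 ::= Sub (Const 1) (reg 14)) m3 (com_size (13 ::= Sub (Const 1) (reg 14)) * L)
          (\<lambda>m4. (same {13} m3 m4 \<and> m4 13 0 = 1 - m3 14 0) \<and> small L m4)"
        using b3 L2 L(1) by (intro halts_wp) (auto simp: same_def)
      then show ?thesis
      proof (rule halts_mono)
        fix m4 assume m4: "(same {13} m3 m4 \<and> m4 13 0 = 1 - m3 14 0) \<and> small L m4"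
        have "env m3" using m3 by (simp add: trial_frame_def)
        then have env4: "env m4" using m4 by (simp add: env_def same_def)
        have e: "m4 0 = m3 0" "m4 22 = m3 22" using m4 by (auto simp: same_def)
        have e2: "m2 0 = m 0" "m2 5 = m 5" "m2 7 = m 7" "m2 22 = m 22" using m2
          by (auto simp: same_def)
        have sim_frame: "\<forall>a<12. a \<notin> {0, 3, 6} \<longrightarrow> m4 a = m a"
        proof (intro allI impI)
          fix a :: nat assume a: "a < 12" "a \<notin> {0, 3, 6}"
          have "m4 a = m3 a" using m4 a by (simp add: same_def)
          also have "\<dots> = m2 a" using m3 a by (simp add: trial_frame_def)
          also have "\<dots> = m a" using m2 a by (simp add: same_def)
          finally show "m4 a = m a" .
        qed
        have "m4 13 0 = 1" if le: "M * (8 * TE ?t (?k - ?t) + 2) \<le> ?B"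
        proof -
          have "8 * TE ?t (?k - ?t) + 2 \<le> F"
            using M1 le by (simp add: F_def less_eq_div_iff_mult_less_eq mult.commute)
          then have "m3 14 0 = m2 14 0" using m3 m2 by (simp add: trial_frame_def e2)
          then show ?thesis using m4 m2 by simp
        qed
        moreover have "m4 22 0 \<le> m 22 0 + max_versions" using m3 m2 JV by (simp add: e e2)
        moreover have "found m \<longrightarrow> found m4" "found m4 = found m3" "sound m4"
          using m3 found_cong[of m2 m] found_cong[of m4 m3] sound_cong[of m4 m3] e e2
            by (auto simp: trial_frame_def)
        ultimately show "batch_frame m m4 \<and> found m4 = found m3 \<and> m4 13 0 = 1 - m3 14 0"
          using env4 sim_frame m4 unfolding batch_frame_def M_def[symmetric] by simp
      qed simp
    qed
    \<comment> \<open>A union bound: \<open>?g\<close> is at most \<open>miss_tail (Suc ?s)\<close>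
      plus the indicator of a complete batch without success.\<close>
    let ?g = "\<lambda>m'. if found m' then 0 else if m' 13 0 \<noteq> 0 then 1 else miss_tail (Suc ?s)"
    have main: "expects ((14 ::= Const 0 ;;
      15 ::= Mul (Mul (Const 2) (reg 12)) (Add (reg 8) (Const 3))) ;;
       While (reg 15) (trial pE) ;; 13 ::= Sub (Const 1) (reg 14)) m1
       (100 * L + ((J + 1) * ((trial_factor + 11) * P0 * (1 + F)) + 100 * L)) (batch_frame m) ?g
       (miss_tail (Suc ?s) + (if found m then 0 else ennreal (trial_miss ?k ?t ^ J)))"
    proof (rule expects_Seq[OF expects_of_halts[OF S2]])
      fix m2 assume m2: "?R2 m2"
      show "expects (While (reg 15) (trial pE) ;; 13 ::= Sub (Const 1) (reg 14)) m2
        ((J + 1) * ((trial_factor + 11) * P0 * (1 + F)) + 100 * L) (batch_frame m) ?g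
        (miss_tail (Suc ?s) + (if found m then 0 else ennreal (trial_miss ?k ?t ^ J)))"
      proof (rule expects_Seq[OF expects_add[OF S3[OF m2], of "miss_tail (Suc ?s)"]])
        fix m3 assume m3: "?R3 m2 m3"
        show "expects (13 ::= Sub (Const 1) (reg 14)) m3 (100 * L) (batch_frame m) ?g
          (miss_tail (Suc ?s) + (if found m3 \<or> m3 14 0 \<noteq> 0 then 0 else 1))"
          by (rule expects_mono[OF expects_of_halts[OF S4[OF m2 m3], where f = ?g
                and v = "miss_tail (Suc ?s) + (if found m3 \<or> m3 14 0 \<noteq> 0 then 0 else 1)"]]) auto
      qed
    qed simp
    have "expects ((14 ::= Const 0 ;; 15 ::= Mul (Mul (Const 2) (reg 12)) (Add (reg 8) (Const 3)))
      ;;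
       While (reg 15) (trial pE) ;; 13 ::= Sub (Const 1) (reg 14)) m1
       (100 * L + ((J + 1) * ((trial_factor + 11) * P0 * (1 + F)) + 100 * L)) (batch_frame m) ?f ?v"
    proof (cases "found m \<or> \<not> good ?k")
      case True
      then show ?thesis
        using miss_tail_le by (intro expects_const[OF main]) (auto simp: batch_frame_def)
    next
      case False
      have "trial_miss ?k ?t ^ J \<le> (1 / 2) ^ (?s + 3)"
        using miss_all[OF M1, of "?s + 3"] False by (simp add: trial_miss_def J_def M_def)
      then have "miss_tail (Suc ?s) + ennreal (trial_miss ?k ?t ^ J)
        \<le> miss_tail (Suc ?s) + ennreal ((1 / 2) ^ (?s + 3))"
        by (intro add_left_mono ennreal_leI)
      then show ?thesis
        using False by (intro expects_mono[OF main]) (auto simp: miss_tail_Suc)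
    qed
    then show ?thesis using T by blast
  qed
  have J1: "1 \<le> J" using M1 by (simp add: J_def)
  define T' where "T' = (trial_factor + 11) * (P0 * (8 * ((max_batches + 3) * 2 ^ lb))) + 200 * L"
  have Cond: "expects (Cond (reg 28) ((14 ::= Const 0 ;;
    15 ::= Mul (Mul (Const 2) (reg 12)) (Add (reg 8) (Const 3))) ;;
       While (reg 15) (trial pE) ;; 13 ::= Sub (Const 1) (reg 14)) Skip) m1 (20 * L + T')
         (batch_frame m) ?f ?v"
    if m1: "?R1 m1" for m1
  proof -
    have "expects (Cond (reg 28) ((14 ::= Const 0 ;;
      15 ::= Mul (Mul (Const 2) (reg 12)) (Add (reg 8) (Const 3))) ;;
       While (reg 15) (trial pE) ;; 13 ::= Sub (Const 1) (reg 14)) Skip) m1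
         (1 + cost (reg 28) m1 + T') (batch_frame m) ?f ?v"
    proof (rule expects_Cond)
      assume "eval (reg 28) m1 \<noteq> 0"
      then have F0: "F \<noteq> 0" using m1 by simp
      note r = run[OF m1 F0]
      have "(J + 1) * ((trial_factor + 11) * P0 * (1 + F))
        \<le> (2 * J) * ((trial_factor + 11) * P0 * (1 + F))"
        using J1 by (intro mult_le_mono1) simp
      also have "\<dots> = (trial_factor + 11) * (P0 * (2 * (J * (1 + F))))" by (simp only: mult_ac)
      also have "\<dots> \<le> (trial_factor + 11) * (P0 * (2 * (4 * ((max_batches + 3) * 2 ^ lb))))"
        using r by (intro mult_le_mono2) blast
      finally have "100 * L + ((J + 1) * ((trial_factor + 11) * P0 * (1 + F)) + 100 * L) \<le> T'"
        unfolding T'_def by simp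
      then show "expects ((14 ::= Const 0 ;;
        15 ::= Mul (Mul (Const 2) (reg 12)) (Add (reg 8) (Const 3))) ;;
       While (reg 15) (trial pE) ;; 13 ::= Sub (Const 1) (reg 14)) m1 T' (batch_frame m) ?f ?v"
        using r by (blast intro: expects_mono)
    next
      assume "eval (reg 28) m1 = 0"
      then have F0: "F = 0" using m1 by simp
      have "halts Skip m1 1 (\<lambda>m'. batch_frame m m' \<and> ?f m' \<le> ?v)"
        by (rule halts_Skip) (rule skip[OF m1 F0])
      then have "halts Skip m1 T' (\<lambda>m'. batch_frame m m' \<and> ?f m' \<le> ?v)"
        by (rule halts_mono) (use L in \<open>auto simp: T'_def\<close>)
      then have "expects Skip m1 T' (\<lambda>m'. batch_frame m m' \<and> ?f m' \<le> ?v) ?f ?v"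
        by (rule expects_of_halts) blast
      then show "expects Skip m1 T' (batch_frame m) ?f ?v" by (rule expects_mono) blast+
    qed
    moreover have "1 + cost (reg 28) m1 \<le> 20 * L"
    proof -
      have "cost (reg 28) m1 \<le> exp_size (reg 28) * L" using m1 L(1) by (intro cost_low) auto
      then show ?thesis using L(1) by simp
    qed
    ultimately show ?thesis by (elim expects_mono) auto
  qed
  have "expects (batch pE) m (100 * L + (20 * L + T')) (batch_frame m) ?f ?v"
    unfolding batch_def
  proof (rule expects_Seq)
    show "expects (12 ::= Add (Div (reg 10) (reg 11)) (Const 1) ;;
      28 ::= Div (reg 9) (reg 12)) m (100 * L) ?R1 (\<lambda>_. ?v) ?v"
      by (rule expects_of_halts[OF S1]) simp
  qed (rule Cond)
  then show ?thesis
  proof (rule expects_mono)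
    define Y where "Y = P0 * (8 * ((max_batches + 3) * 2 ^ lb))"
    have "P0 * 1 \<le> Y" unfolding Y_def by (intro mult_le_mono2) simp
    then have "L \<le> Y" using L_le_P0 by simp
    moreover have "batch_time = (trial_factor + 400) * Y" "T' = (trial_factor + 11) * Y + 200 * L"
      by (simp_all only: batch_time_def T'_def Y_def)
    moreover have "(trial_factor + 400) * Y = trial_factor * Y + 400 * Y" "(trial_factor + 11) * Y
      = trial_factor * Y + 11 * Y"
      by (simp_all add: distrib_right)
    ultimately show "100 * L + (20 * L + T') \<le> batch_time" by linarith
  qed auto
qed

end

context search_all
begin

lemma advance:
  assumes b: "small L m" and t: "m 7 0 \<le> m 5 0" "m 5 0 \<le> n" "m 4 0 = n"
    and fal: "m 10 0 = falling n (m 7 0)" "m 11 0 = falling (m 5 0) (m 7 0)"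
    and B: "m 9 0 \<le> 2 ^ lb" "m 8 0 \<le> max_batches"
  shows "halts advance m (400 * L) (\<lambda>m'. small L m' \<and> same {7, 8, 9, 10, 11} m m' \<and>
    m' 8 0 = Suc (m 8 0) \<and>
    (if m 7 0 < m 5 0 then m' 7 0 = Suc (m 7 0) \<and> m' 9 0 = m 9 0 else m' 7 0 = 0 \<and>
      m' 9 0 = 2 * m 9 0) \<and>
    m' 10 0 = falling n (m' 7 0) \<and> m' 11 0 = falling (m 5 0) (m' 7 0))"
proof (rule halts_mono[OF halts_wp[OF L(1), where Q = "\<lambda>m'. same {7, 8, 9, 10, 11} m m' \<and>
  m' 8 0 = Suc (m 8 0) \<and>
    (if m 7 0 < m 5 0 then m' 7 0 = Suc (m 7 0) \<and> m' 9 0 = m 9 0 else m' 7 0 = 0 \<and>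
      m' 9 0 = 2 * m 9 0) \<and>
    m' 10 0 = falling n (m' 7 0) \<and> m' 11 0 = falling (m 5 0) (m' 7 0)"]])
  have "max_versions \<ge> max_batches + 3" by (simp add: max_versions_def trans_le_add1)
  moreover have "max_versions \<le> (n + 2) * (max_batches + 1) * max_versions" by simp
  ultimately have SL: "max_batches + 1 < 2 ^ L" using LV' by linarith
  have BL: "2 * 2 ^ lb < (2::nat) ^ L" using LV' by simp
  have nL: "Suc n < 2 ^ L" using LV' by linarith
  have fL: "falling n (Suc (m 7 0)) < 2 ^ L" "falling (m 5 0) (Suc (m 7 0)) < 2 ^ L"
    if "m 7 0 < m 5 0"
  proof -
    have "falling n (Suc (m 7 0)) \<le> n ^ n" using that t by (intro falling_le_self) simp
    then show "falling n (Suc (m 7 0)) < 2 ^ L" using Ln by linarith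
    then show "falling (m 5 0) (Suc (m 7 0)) < 2 ^ L"
      using falling_mono[OF t(2), of "Suc (m 7 0)"] by linarith
  qed
  show "wp L advance (\<lambda>m'. same {7, 8, 9, 10, 11} m m' \<and> m' 8 0 = Suc (m 8 0) \<and>
    (if m 7 0 < m 5 0 then m' 7 0 = Suc (m 7 0) \<and> m' 9 0 = m 9 0 else m' 7 0 = 0 \<and>
      m' 9 0 = 2 * m 9 0) \<and>
    m' 10 0 = falling n (m' 7 0) \<and> m' 11 0 = falling (m 5 0) (m' 7 0)) m"
    unfolding advance_def using t fal B SL BL nL fL L by (auto simp: same_def falling_Suc)
qed (use b in \<open>auto simp: advance_def\<close>)

text \<open>The batch number encodes the round \<open>r\<close> and the sample size by
  \<open>s = r * (k + 1) + t\<close>. Here \<open>ts\<close> is a sample size that is sure to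
  complete with budget \<open>2 ^ lb\<close>, so a race still going on has not passed
  \<open>ts\<close> in round \<open>lb\<close>; this bounds the number of batches.\<close>

definition race_inv :: "mem \<Rightarrow> nat \<Rightarrow> nat \<Rightarrow> mem \<Rightarrow> bool" where
  "race_inv m ts s m' \<longleftrightarrow> env m' \<and> sound m' \<and> (\<forall>a<12. a \<notin> {0, 3, 6, 7, 8, 9, 10, 11} \<longrightarrow> m' a = m a) \<and>
     m' 8 0 = s \<and> m' 7 0 \<le> m 5 0 \<and> m' 10 0 = falling n (m' 7 0) \<and>
       m' 11 0 = falling (m 5 0) (m' 7 0) \<and>
     (\<exists>r. s = r * (m 5 0 + 1) + m' 7 0 \<and> m' 9 0 = 2 ^ r \<and>
        (m' 13 0 = 0 \<longrightarrow> r < lb \<or> r = lb \<and> m' 7 0 \<le> ts)) \<and>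
     m' 13 0 \<le> 1 \<and> m' 22 0 \<le> m 22 0 + s * max_versions \<and> (found m \<longrightarrow> found m')"

lemma race_inv_step:
  assumes inv: "race_inv m ts s m'" and s: "s < max_batches" "m' 13 0 = 0" and k: "m 5 0 \<le> n"
    and ts: "ts \<le> m 5 0" "reps n (m 5 0) ts * (8 * TE ts (m 5 0 - ts) + 2) \<le> 2 ^ lb"
    and v: "m 22 0 + max_batches * max_versions + n + 2 < 2 ^ L"
  shows "expects (batch pE ;; advance) m' (batch_time + 400 * L) (race_inv m ts (Suc s))
    (\<lambda>m''. if found m'' then 0 else if m'' 13 0 \<noteq> 0 then 1 else
      if good (m 5 0) then miss_tail (Suc s) else 1)
    (if found m' then 0 else if good (m 5 0) then miss_tail s else 1)"
proof (rule expects_Seq)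
  let ?k = "m 5 0"
  obtain r where r: "s = r * (?k + 1) + m' 7 0" "m' 9 0 = 2 ^ r" "r < lb \<or> r = lb \<and> m' 7 0 \<le> ts"
    using inv s(2) by (auto simp: race_inv_def)
  have env: "env m'" and so: "sound m'" and e5: "m' 5 = m 5" and t: "m' 7 0 \<le> ?k"
    and fal: "m' 10 0 = falling n (m' 7 0)" "m' 11 0 = falling ?k (m' 7 0)" and s8: "m' 8 0 = s"
    using inv by (auto simp: race_inv_def)
  have n4: "m' 4 0 = n" using env by (simp add: env_def)
  have rB: "(2::nat) ^ r \<le> 2 ^ lb" using r(3) by (intro power_increasing) auto
  have sv: "(s + 1) * max_versions \<le> max_batches * max_versions" using s(1)
    by (intro mult_le_mono1) simp
  have vL: "m' 22 0 + max_versions + n + 2 < 2 ^ L"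
  proof -
    have "m' 22 0 \<le> m 22 0 + s * max_versions" using inv by (simp add: race_inv_def)
    then show ?thesis using sv v by simp
  qed
  let ?f = "\<lambda>m''. if found m'' then 0 else if m'' 13 0 \<noteq> 0 then 1 else
    if good ?k then miss_tail (Suc s) else 1"
  show "expects (batch pE) m' batch_time (batch_frame m') ?f (if found m' then 0 else
    if good ?k then miss_tail s else 1)"
    using batch[OF env so, unfolded e5 s8] t k fal r(2) rB s vL by simp
  fix m1 assume b: "batch_frame m' m1"
  have eq: "m1 7 = m' 7" "m1 5 = m 5" "m1 4 = m' 4" "m1 8 = m' 8" "m1 9 = m' 9" "m1 10
    = m' 10" "m1 11 = m' 11"
    using b by (simp_all add: batch_frame_def e5)
  have fr1: "\<forall>a<12. a \<notin> {0, 3, 6, 7, 8, 9, 10, 11} \<longrightarrow> m1 a = m a"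
    using b inv by (simp add: batch_frame_def race_inv_def)
  have env1: "env m1" using b by (simp add: batch_frame_def)
  have "halts advance m1 (400 * L) (\<lambda>m''. small L m'' \<and> same {7, 8, 9, 10, 11} m1 m'' \<and>
    m'' 8 0 = Suc (m1 8 0) \<and>
    (if m1 7 0 < m1 5 0 then m'' 7 0 = Suc (m1 7 0) \<and> m'' 9 0 = m1 9 0 else m'' 7 0 = 0 \<and>
      m'' 9 0 = 2 * m1 9 0) \<and>
    m'' 10 0 = falling n (m'' 7 0) \<and> m'' 11 0 = falling (m1 5 0) (m'' 7 0))"
    using env1 t k fal rB r(2) s s8 n4 by (intro advance) (auto simp: eq env_def)
  then have "halts advance m1 (400 * L) (\<lambda>m''. race_inv m ts (Suc s) m'' \<and> m'' 0 = m1 0 \<and>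
    m'' 13 = m1 13)"
  proof (rule halts_mono)
    fix m2 assume m2: "small L m2 \<and> same {7, 8, 9, 10, 11} m1 m2 \<and> m2 8 0 = Suc (m1 8 0) \<and>
      (if m1 7 0 < m1 5 0 then m2 7 0 = Suc (m1 7 0) \<and> m2 9 0 = m1 9 0 else m2 7 0 = 0 \<and>
        m2 9 0 = 2 * m1 9 0) \<and>
      m2 10 0 = falling n (m2 7 0) \<and> m2 11 0 = falling (m1 5 0) (m2 7 0)"
    have e: "m2 0 = m1 0" "m2 13 = m1 13" "m2 22 = m1 22" using m2 by (auto simp: same_def)
    have "env m2" using env1 m2 by (simp add: env_def same_def)
    moreover have "sound m2" "found m2 = found m1"
      using b sound_cong[of m2 m1] found_cong[of m2 m1] e by (auto simp: batch_frame_def)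
    moreover have "found m \<longrightarrow> found m1" using b inv by (auto simp: batch_frame_def race_inv_def)
    moreover have "\<forall>a<12. a \<notin> {0, 3, 6, 7, 8, 9, 10, 11} \<longrightarrow> m2 a = m a"
      using m2 fr1 by (simp add: same_def)
    moreover have "m2 22 0 \<le> m 22 0 + Suc s * max_versions"
      using b inv e by (simp add: batch_frame_def race_inv_def)
    moreover have "m2 13 0 \<le> 1" using b e by (simp add: batch_frame_def)
    moreover have "m2 7 0 \<le> ?k" using m2 by (auto simp: eq split: if_splits)
    moreover have "\<exists>r. Suc s = r * (?k + 1) + m2 7 0 \<and> m2 9 0 = 2 ^ r \<and>
        (m2 13 0 = 0 \<longrightarrow> r < lb \<or> r = lb \<and> m2 7 0 \<le> ts)"
    proof -
      \<comment> \<open>In round \<open>lb\<close> the budget suffices for \<open>ts\<close>, so its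
        batch completes and sets register 13.\<close>
      have nd: "r < lb \<or> m' 7 0 < ts" if "m2 13 0 = 0"
      proof (rule ccontr)
        assume "\<not> (r < lb \<or> m' 7 0 < ts)"
        then have "r = lb" "m' 7 0 = ts" using r(3) by auto
        then have "m1 13 0 = 1" using b ts(2) r(2) by (simp add: batch_frame_def e5)
        then show False using that e by simp
      qed
      show ?thesis
      proof (cases "m' 7 0 < ?k")
        case True
        then show ?thesis
          using m2 r nd by (intro exI[of _ r]) (auto simp: eq)
      next
        case False
        then have t: "m' 7 0 = ?k" using t by simp
        have "r < lb" if "m2 13 0 = 0" using nd[OF that] ts(1) t by auto
        then show ?thesis
          using m2 r t by (intro exI[of _ "Suc r"]) (auto simp: eq)
      qed
    qed
    moreover have "m2 8 0 = Suc s" using m2 s8 by (simp add: eq)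
    moreover have "m2 10 0 = falling n (m2 7 0)" "m2 11 0 = falling ?k (m2 7 0)" using m2
      by (simp_all add: eq)
    ultimately show "race_inv m ts (Suc s) m2 \<and> m2 0 = m1 0 \<and> m2 13 = m1 13"
      unfolding race_inv_def using e by blast
  qed simp
  then have "expects advance m1 (400 * L) (\<lambda>m''. race_inv m ts (Suc s) m'' \<and> m'' 0 = m1 0 \<and>
    m'' 13 = m1 13) ?f (?f m1)"
    by (rule expects_of_halts) (simp add: found_def)
  then show "expects advance m1 (400 * L) (race_inv m ts (Suc s)) ?f (?f m1)"
    by (rule expects_mono) blast+
qed

definition race_time :: nat where "race_time = (max_batches + 1) * (batch_time + 600 * L)"

text \<open>The initial potential \<open>miss_tail 0\<close> is the whole error of a race, 1/4, no
  matter which batch ends it.\<close>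

lemma race:
  assumes env: "env m" and so: "sound m" and k: "m 5 0 \<le> n"
    and init: "m 7 0 = 0" "m 8 0 = 0" "m 9 0 = 1" "m 10 0 = 1" "m 11 0 = 1" "m 13 0 = 0"
    and v: "m 22 0 + max_batches * max_versions + n + 2 < 2 ^ L"
  shows "expects (race pE) m race_time
    (\<lambda>m'. env m' \<and> sound m' \<and> m' 5 = m 5 \<and> m' 22 0 \<le> m 22 0 + max_batches * max_versions \<and>
      (found m \<longrightarrow> found m'))
    (\<lambda>m'. if found m' then 0 else 1) (if found m then 0 else
      if good (m 5 0) then ennreal (1 / 4) else 1)"
proof -
  let ?k = "m 5 0"
  obtain ts where ts: "ts \<le> ?k" "reps n ?k ts * (8 * TE ts (?k - ts) + 2) \<le> 2 ^ lb"
    using opt[OF k] lb by (meson le_trans)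
  let ?Q = "\<lambda>m'. env m' \<and> sound m' \<and> m' 5 = m 5 \<and> m' 22 0 \<le> m 22 0 + max_batches * max_versions \<and>
    (found m \<longrightarrow> found m')"
  let ?\<phi> = "\<lambda>s m'. if found m' then 0 else if m' 13 0 \<noteq> 0 then 1 else
    if good ?k then miss_tail s else 1"
  have "expects (race pE) m ((max_batches + 1) * (1 + 20 * L) + max_batches *
    (batch_time + 400 * L)) ?Q
    (\<lambda>m'. if found m' then 0 else 1) (?\<phi> 0 m)"
    unfolding race_def
  proof (rule expects_While[where Inv = "race_inv m ts" and \<phi> = ?\<phi>])
    have "0 < lb \<or> 0 = lb" by auto
    then show "race_inv m ts 0 m" using env so init by (auto simp: race_inv_def)
    fix s m' assume s: "s \<le> max_batches" and inv: "race_inv m ts s m'"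
    have b: "small L m'" using inv by (simp add: race_inv_def env_def)
    show "cost (Sub (Const 1) (reg 13)) m' \<le> 20 * L"
      by (rule order_trans[OF cost_low[OF b _ L(1)]]) auto
    {
      assume "eval (Sub (Const 1) (reg 13)) m' \<noteq> 0"
      then have d: "m' 13 0 = 0" by simp
      then obtain r where r: "s = r * (?k + 1) + m' 7 0" "r \<le> lb" using inv
        by (auto simp: race_inv_def)
      have "m' 7 0 \<le> ?k" using inv by (simp add: race_inv_def)
      have "r * (?k + 1) \<le> lb * (n + 1)" using r(2) k by (intro mult_le_mono) auto
      then have sS: "s < max_batches" using r(1) \<open>m' 7 0 \<le> ?k\<close> k by (simp add: max_batches_def)
      then show "s < max_batches \<and>
        expects (batch pE ;; advance) m' (batch_time + 400 * L) (race_inv m ts (Suc s))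
        (?\<phi> (Suc s)) (?\<phi> s m')"
      proof
        have eq: "?\<phi> s m' = (if found m' then 0 else if good ?k then miss_tail s else 1)" using d
          by simp
        show "expects (batch pE ;; advance) m' (batch_time + 400 * L) (race_inv m ts (Suc s))
          (?\<phi> (Suc s)) (?\<phi> s m')"
          unfolding eq by (rule race_inv_step[OF inv sS d k ts v])
      qed
    next
      assume "eval (Sub (Const 1) (reg 13)) m' = 0"
      then have "m' 13 0 \<noteq> 0" by auto
      moreover have "m' 22 0 \<le> m 22 0 + max_batches * max_versions"
      proof -
        have "s * max_versions \<le> max_batches * max_versions" using s by (rule mult_le_mono1)
        moreover have "m' 22 0 \<le> m 22 0 + s * max_versions" using inv unfolding race_inv_def
          by blast
        ultimately show ?thesis by linarith
      qed
      moreover have "env m'" "sound m'" "m' 5 = m 5" "found m \<longrightarrow> found m'"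
        using inv by (simp_all add: race_inv_def)
      ultimately show "?Q m' \<and> (if found m' then 0 else 1) \<le> ?\<phi> s m'" by simp
    }
  qed
  then show ?thesis
  proof (rule expects_mono)
    have "(max_batches + 1) * (1 + 20 * L) \<le> (max_batches + 1) * (200 * L)" using L(1)
      by (intro mult_le_mono2) linarith
    moreover have "max_batches * (batch_time + 400 * L)
      \<le> (max_batches + 1) * (batch_time + 400 * L)" by (intro mult_le_mono1) simp
    moreover have "race_time = (max_batches + 1) * (200 * L) + (max_batches + 1) *
      (batch_time + 400 * L)"
      unfolding race_time_def distrib_left[symmetric] by simp
    ultimately show "(max_batches + 1) * (1 + 20 * L) + max_batches * (batch_time + 400 * L)
      \<le> race_time" by linarith
  qed (use init in \<open>auto simp: miss_tail_def power2_eq_square\<close>)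
qed

definition sizes_time :: nat where "sizes_time = (n + 2) * (race_time + 1000 * L)"

text \<open>Only the race for \<open>k = card Sol\<close> is credited. Before it the potential is
  1/4, after it 1 unless something has been found; the other races cannot hurt, as a found solution
  is at most replaced by another one.\<close>

lemma all_sizes:
  assumes env: "env m" and so: "sound m" and init: "m 5 0 = 0" "m 22 0 = 0"
  shows "expects (all_sizes pE) m sizes_time sound (\<lambda>m'. if found m' then 0 else 1)
    (if Sol \<in> Fam then ennreal (1 / 4) else 1)"
proof -
  define Inv where "Inv k m' \<longleftrightarrow> env m' \<and> sound m' \<and> m' 5 0 = k \<and>
    m' 22 0 \<le> k * (max_batches * max_versions)" for k m'
  define \<phi> where "\<phi> k m' = (if found m' then 0 else
    if Sol \<in> Fam \<and> k \<le> card Sol then ennreal (1 / 4) else 1)" for k m'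
  have q1: "ennreal (1 / 4) \<le> 1" by (simp add: ennreal_le_1)
  have SolS: "card Sol \<le> n" if "Sol \<in> Fam"
  proof -
    have "Sol \<subseteq> set us" using that fam by auto
    then have "card Sol \<le> card (set us)" by (intro card_mono) auto
    then show ?thesis using us(1) by (simp add: distinct_card)
  qed
  let ?i = "8 ::= Const 0 ;; 7 ::= Const 0 ;; 9 ::= Const 1 ;; 10 ::= Const 1 ;; 11 ::= Const 1 ;;
    13 ::= Const 0"
  let ?body = "?i ;; race pE ;; 5 ::= Add (reg 5) (Const 1)"
  have L2: "(2::nat) < 2 ^ L" using L by linarith
  have "expects (all_sizes pE) m ((n + 1 + 1) * (1 + 50 * L) + (n + 1) *
    (100 * L + (race_time + 100 * L))) sound
      (\<lambda>m'. if found m' then 0 else 1) (\<phi> 0 m)"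
    unfolding all_sizes_def
  proof (rule expects_While[where Inv = Inv and \<phi> = \<phi>])
    show "Inv 0 m" using env so init by (simp add: Inv_def)
    fix k m' assume k: "k \<le> n + 1" and inv: "Inv k m'"
    have b: "small L m'" and n4: "m' 4 0 = n" "m' 5 0 = k" using inv by (auto simp: Inv_def env_def)
    show "cost (Sub (Add (reg 4) (Const 1)) (reg 5)) m' \<le> 50 * L"
      by (rule order_trans[OF cost_low[OF b _ L(1)]]) auto
    {
      assume "eval (Sub (Add (reg 4) (Const 1)) (reg 5)) m' = 0"
      then have "k = n + 1" using n4 k by simp
      then have "\<not> (Sol \<in> Fam \<and> k \<le> card Sol)" using SolS by auto
      then show "sound m' \<and> (if found m' then 0 else 1) \<le> \<phi> k m'" using inv
        by (auto simp: Inv_def \<phi>_def)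
    next
      assume "eval (Sub (Add (reg 4) (Const 1)) (reg 5)) m' \<noteq> 0"
      then have kn: "k \<le> n" using n4 by simp
      let ?R1 = "\<lambda>m1. (same {7, 8, 9, 10, 11, 13} m' m1 \<and> m1 7 0 = 0 \<and> m1 8 0 = 0 \<and> m1 9 0 = 1 \<and>
        m1 10 0 = 1 \<and>
          m1 11 0 = 1 \<and> m1 13 0 = 0) \<and> small L m1"
      let ?R2 = "\<lambda>m2. env m2 \<and> sound m2 \<and> m2 5 = m' 5 \<and>
        m2 22 0 \<le> m' 22 0 + max_batches * max_versions \<and> (found m' \<longrightarrow> found m2)"
      let ?v = "if found m' then 0 else if good k then ennreal (1 / 4) else 1"
      have S1: "halts ?i m' (100 * L) ?R1"
        by (rule halts_mono[OF halts_wp[OF L(1), where Q = "\<lambda>m1. same {7, 8, 9, 10, 11,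
          13} m' m1 \<and> m1 7 0 = 0 \<and>
            m1 8 0 = 0 \<and> m1 9 0 = 1 \<and> m1 10 0 = 1 \<and> m1 11 0 = 1 \<and> m1 13 0 = 0"]])
          (use b L2 in \<open>auto simp: same_def\<close>)
      have S2: "expects (race pE) m1 race_time ?R2 (\<lambda>m'. if found m' then 0 else 1) ?v"
        if m1: "?R1 m1" for m1
      proof -
        have e: "m1 0 = m' 0" "m1 5 = m' 5" "m1 22 = m' 22" using m1 by (auto simp: same_def)
        have "env m'" using inv by (simp add: Inv_def)
        then have env1: "env m1" using m1 by (simp add: env_def same_def)
        have s: "sound m1" "found m1 = found m'"
          using inv sound_cong[of m1 m'] found_cong[of m1 m'] e by (auto simp: Inv_def)
        have v: "m1 22 0 + max_batches * max_versions + n + 2 < 2 ^ L"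
        proof -
          have "k * (max_batches * max_versions) + max_batches * max_versions
            \<le> (n + 1) * (max_batches * max_versions)"
            using kn mult_le_mono1[of "k + 1" "n + 1" "max_batches * max_versions"] by simp
          also have "\<dots> \<le> (n + 2) * ((max_batches + 1) * max_versions)" by (intro mult_le_mono) auto
          finally have "k * (max_batches * max_versions) + max_batches * max_versions
            \<le> (n + 2) * (max_batches + 1) * max_versions" by (simp only: mult.assoc)
          moreover have "m1 22 0 \<le> k * (max_batches * max_versions)" using inv unfolding Inv_def e
            by blast
          ultimately have "m1 22 0 + max_batches * max_versions
            \<le> (n + 2) * (max_batches + 1) * max_versions" by linarith
          then show ?thesis using LV' by linarith
        qed
        have k5: "m1 5 0 \<le> n" using kn n4 e by simp
        have r: "m1 7 0 = 0" "m1 8 0 = 0" "m1 9 0 = 1" "m1 10 0 = 1" "m1 11 0 = 1" "m1 13 0 = 0"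
          using m1 by blast+
        show ?thesis using race[OF env1 s(1) k5 r v] unfolding e s n4 .
      qed
      have S3: "halts (5 ::= Add (reg 5) (Const 1)) m2 (100 * L) (\<lambda>m3. Inv (Suc k) m3 \<and>
        found m3 = found m2)"
        if m2: "?R2 m2" for m2
      proof -
        have b2: "small L m2" using m2 by (simp add: env_def)
        have "Suc k < 2 ^ L" using kn us L by linarith
        then have "halts (5 ::= Add (reg 5) (Const 1)) m2 (com_size (5 ::= Add (reg 5) (Const 1))
          * L)
            (\<lambda>m3. (same {5} m2 m3 \<and> m3 5 0 = Suc k) \<and> small L m3)"
          using b2 L(1) m2 n4 by (intro halts_wp) (auto simp: same_def)
        then show ?thesis
        proof (rule halts_mono)
          fix m3 assume m3: "(same {5} m2 m3 \<and> m3 5 0 = Suc k) \<and> small L m3"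
          have e: "m3 0 = m2 0" "m3 22 = m2 22" using m3 by (auto simp: same_def)
          have "env m2" using m2 by simp
          then have "env m3" using m3 by (simp add: env_def same_def)
          then show "Inv (Suc k) m3 \<and> found m3 = found m2"
            using m2 m3 inv sound_cong[of m3 m2] found_cong[of m3 m2] e by (simp add: Inv_def)
        qed simp
      qed
      have body: "expects ?body m' (100 * L + (race_time + 100 * L)) (\<lambda>m3. Inv (Suc k) m3 \<and>
        (found m' \<longrightarrow> found m3)) (\<lambda>m'. if found m' then 0 else 1) ?v"
      proof (rule expects_Seq[OF expects_of_halts[OF S1]])
        fix m1 assume m1: "?R1 m1"
        show "expects (race pE ;; 5 ::= Add (reg 5) (Const 1)) m1 (race_time + 100 * L)
            (\<lambda>m3. Inv (Suc k) m3 \<and> (found m' \<longrightarrow> found m3)) (\<lambda>m'. if found m' then 0 else 1) ?v"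
        proof (rule expects_Seq[OF S2[OF m1]])
          fix m2 assume m2: "?R2 m2"
          show "expects (5 ::= Add (reg 5) (Const 1)) m2 (100 * L) (\<lambda>m3. Inv (Suc k) m3 \<and>
            (found m' \<longrightarrow> found m3))
              (\<lambda>m'. if found m' then 0 else 1) (if found m2 then 0 else 1)"
            by (rule expects_mono[OF expects_of_halts[OF S3[OF m2], where f = "\<lambda>m'.
              if found m' then 0 else 1"
                  and v = "if found m2 then 0 else 1"]]) (use m2 in auto)
        qed
      qed simp
      have "expects ?body m' (100 * L + (race_time + 100 * L)) (\<lambda>m3. Inv (Suc k) m3 \<and>
        (found m' \<longrightarrow> found m3)) (\<phi> (Suc k)) (\<phi> k m')"
      proof (cases "good k \<and> \<not> found m'")
        case True
        then show ?thesis
          by (intro expects_mono[OF body]) (auto simp: \<phi>_def good_def)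
      next
        case False
        then show ?thesis
          using q1 by (intro expects_const[OF body]) (auto simp: \<phi>_def good_def)
      qed
      then show "k < n + 1 \<and> expects ?body m' (100 * L + (race_time + 100 * L)) (Inv (Suc k))
        (\<phi> (Suc k)) (\<phi> k m')"
        using kn by (auto elim!: expects_mono)
    }
  qed
  then show ?thesis
  proof (rule expects_mono)
    have "(n + 1 + 1) * (1 + 50 * L) \<le> (n + 2) * (51 * L)" using L(1) by (intro mult_le_mono) auto
    moreover have "(n + 1) * (100 * L + (race_time + 100 * L)) \<le> (n + 2) * (race_time + 200 * L)"
      by (intro mult_le_mono) auto
    moreover have "sizes_time = (n + 2) * (51 * L) + (n + 2) * (race_time + 200 * L) + (n + 2) *
      (749 * L)"
      unfolding sizes_time_def distrib_left[symmetric] by simp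
    ultimately show "(n + 1 + 1) * (1 + 50 * L) + (n + 1) * (100 * L + (race_time + 100 * L))
      \<le> sizes_time" by linarith
  qed (auto simp: \<phi>_def)
qed

end

section \<open>Reading the universe\<close>

definition copy_in :: com where
  "copy_in = While (Load 0 (reg 26))
    (Store 1 (reg 26) (Load 0 (reg 26)) ;; Store 33 (cell_exp (reg 26)) (Load 0 (reg 26)) ;;
     26 ::= Add (reg 26) (Const 1))"

definition copy_out :: com where
  "copy_out = While (Load 33 (cell_exp (reg 26)))
    (Store 2 (reg 26) (Load 33 (cell_exp (reg 26))) ;; 26 ::= Add (reg 26) (Const 1))"

text \<open>The program for the universe may use arbitrary arrays and leave anything behind.
  Simulation number 0 confines it to the arrays from 33 on; the budget \<open>fuel\<close> is chosen
  so that it is not exhausted. The negative answer is the initial output, to be overwritten when a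
  solution is found.\<close>

definition prelude :: "com \<Rightarrow> aexp \<Rightarrow> com" where
  "prelude pU fuel = copy_in ;; (23 ::= fuel) ;; sim pU ;; (26 ::= Const 0) ;; copy_out ;;
    (4 ::= reg 26 ;; 0 ::= Const 1 ;; Store 0 (Const 1) (Const 0) ;; 5 ::= Const 0)"

context search
begin

lemma copy_in:
  "halts copy_in (input [bits I]) (300 * (L * (N + 1))) (\<lambda>m. small L m \<and> m 26 0 = N \<and>
     m 1 = input [bits I] 0 \<and> (\<forall>a<33. a \<notin> {0, 1, 26} \<longrightarrow> m a = (\<lambda>_. 0)) \<and>
     (\<forall>a j. m (33 + a) (cell 0 j) = input [bits I] a j) \<and>
     (\<forall>a j u. u \<noteq> 0 \<longrightarrow> m (33 + a) (cell u j) = 0))"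
proof -
  define m0 where "m0 = input [bits I]"
  have m0: "m0 a = (\<lambda>_. 0)" if "a \<noteq> 0" for a using that by (auto simp: m0_def input_def)
  have L2: "(2::nat) < 2 ^ L" using L by linarith
  have b0: "small L m0" using L2 by (auto simp: small_def m0_def input_def bits_def)
  have nz: "m0 0 i \<noteq> 0 \<longleftrightarrow> i < N" for i by (auto simp: m0_def input_def bits_def)
  define Inv where "Inv i m \<longleftrightarrow> same {1, 26, 33} m0 m \<and> m 26 0 = i \<and>
      (\<forall>j. m 1 j = (if j < i then m0 0 j else 0)) \<and>
      (\<forall>j. m 33 (cell 0 j) = (if j < i then m0 0 j else 0)) \<and>
        (\<forall>j u. u \<noteq> 0 \<longrightarrow> m 33 (cell u j) = 0)" for i m
  have "halts copy_in m0
    ((1 + exp_size (Load 0 (reg 26)) + com_size (Store 1 (reg 26) (Load 0 (reg 26)) ;;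
    Store 33 (cell_exp (reg 26)) (Load 0 (reg 26)) ;;
     26 ::= Add (reg 26) (Const 1))) * (L * (N + 1))) (\<lambda>m. \<exists>i\<le>N. Inv i m \<and>
       eval (Load 0 (reg 26)) m = 0 \<and> small L m)"
    unfolding copy_in_def
  proof (rule halts_loop[OF L(1)])
    fix i m assume i: "i \<le> N" "Inv i m" "small L m" "eval (Load 0 (reg 26)) m \<noteq> 0"
    have m00: "m 0 = m0 0" and m22: "m 22 0 = 0" using i(2) m0[of 22]
      by (auto simp: Inv_def same_def)
    have iN: "i < N" using i nz[of i] m00 by (simp add: Inv_def)
    have "m0 0 i < 2 ^ L" using smallD[OF b0] by simp
    then show "i < N \<and> wp L (Store 1 (reg 26) (Load 0 (reg 26)) ;;
      Store 33 (cell_exp (reg 26)) (Load 0 (reg 26)) ;;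
     26 ::= Add (reg 26) (Const 1)) (Inv (Suc i)) m"
      using i iN m00 m22 L by (auto simp: Inv_def same_def)
  qed (use b0 m0 in \<open>auto simp: Inv_def same_def\<close>)
  then show ?thesis
    unfolding m0_def[symmetric]
  proof (rule halts_mono)
    fix m assume "\<exists>i\<le>N. Inv i m \<and> eval (Load 0 (reg 26)) m = 0 \<and> small L m"
    then obtain i where i: "i \<le> N" "Inv i m" "m 0 i = 0" "small L m" by (auto simp: Inv_def)
    then have "m0 0 i = 0" by (simp add: Inv_def same_def)
    then have iN: "i = N" using nz[of i] i(1) by auto
    have z: "m0 0 j = 0" if "\<not> j < N" for j using nz[of j] that by simp
    have "m 1 = m0 0" using i(2) iN z by (auto simp: Inv_def)
    moreover have "m (33 + a) (cell 0 j) = m0 a j" for a j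
    proof (cases "a = 0")
      case True
      then show ?thesis using i(2) iN z by (simp add: Inv_def)
    next
      case False
      then have "m (33 + a) = m0 (33 + a)" using i(2) by (simp add: Inv_def same_def)
      then show ?thesis using False m0 by simp
    qed
    moreover have "m (33 + a) (cell u j) = 0" if "u \<noteq> 0" for a j u
    proof (cases "a = 0")
      case False
      then have "m (33 + a) = m0 (33 + a)" using i(2) by (simp add: Inv_def same_def)
      then show ?thesis using m0 by simp
    qed (use that i(2) in \<open>simp add: Inv_def\<close>)
    moreover have "\<forall>a<33. a \<notin> {0, 1, 26} \<longrightarrow> m a = (\<lambda>_. 0)"
      using i(2) m0 by (simp add: Inv_def same_def)
    ultimately show "small L m \<and> m 26 0 = N \<and> m 1 = m0 0 \<and> (\<forall>a<33. a \<notin> {0, 1, 26} \<longrightarrow> m a = (\<lambda>_. 0)) \<and>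
     (\<forall>a j. m (33 + a) (cell 0 j) = m0 a j) \<and> (\<forall>a j u. u \<noteq> 0 \<longrightarrow> m (33 + a) (cell u j) = 0)"
      using i iN by (simp add: Inv_def)
  next
    show "(1 + exp_size (Load 0 (reg 26)) + com_size (Store 1 (reg 26) (Load 0 (reg 26)) ;;
      Store 33 (cell_exp (reg 26)) (Load 0 (reg 26)) ;;
     26 ::= Add (reg 26) (Const 1))) * (L * (N + 1)) \<le> 300 * (L * (N + 1))"
      by (intro mult_le_mono1) (simp add: cell_exp_def)
  qed
qed

lemma copy_out:
  assumes m: "small L m" "m 26 0 = 0" "m 22 0 = 0"
    and out: "\<And>i. i < n \<Longrightarrow> m 33 (cell 0 i) = Suc (us ! i) \<and> Suc (us ! i) < 2 ^ L" "m 33 (cell 0 n)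
      = 0"
  shows "halts copy_out m (400 * (L * (N + 1))) (\<lambda>m'. small L m' \<and> same {2, 26} m m' \<and> m' 26 0 = n \<and>
    (\<forall>i<n. m' 2 i = Suc (us ! i)))"
proof -
  define Inv where "Inv i m' \<longleftrightarrow> small L m' \<and> same {2, 26} m m' \<and> m' 26 0 = i \<and>
    (\<forall>j<i. m' 2 j = Suc (us ! j))" for i m'
  let ?e = "Load 33 (cell_exp (reg 26))"
  have e: "eval ?e m' = (if i < n then Suc (us ! i) else 0)" "cost ?e m' \<le> 100 * L"
    if "i \<le> n" "Inv i m'" for i m'
  proof -
    have m': "m' 33 = m 33" "m' 22 0 = 0" "m' 26 0 = i" "small L m'"
      using that(2) m by (auto simp: Inv_def same_def)
    show ev: "eval ?e m' = (if i < n then Suc (us ! i) else 0)"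
      using m' out that(1) by (cases "i = n") auto
    have 1: "nbits (eval ?e m') \<le> L"
      unfolding ev using out(1)[of i] L by (subst nbits_le_iff) auto
    have 2: "nbits (eval (reg 26) m') \<le> L"
      using smallD[OF m'(4), of 26 0] L(1) by (simp add: nbits_le_iff)
    have 3: "cost (reg 26) m' \<le> 2 * L"
      using cost_low[OF m'(4) _ L(1), of "reg 26"] by simp
    have "cost (cell_exp (reg 26)) m' \<le> 3 * cost (reg 26) m' + 2 + 8 * L + 7 * nbits
      (eval (reg 26) m')"
      using m'(2) L(1) by (intro cost_cell_exp) simp
    then have "cost (cell_exp (reg 26)) m' \<le> 30 * L" using 2 3 L(1) by linarith
    moreover have "cost ?e m' = cost (cell_exp (reg 26)) m' + nbits (eval ?e m')" by simp
    ultimately show "cost ?e m' \<le> 100 * L" using 1 by linarith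
  qed
  have "halts copy_out m ((n + 1) * (1 + 100 * L) + n * (200 * L)) (\<lambda>m'. \<exists>i\<le>n. Inv i m' \<and>
    eval ?e m' = 0)"
    unfolding copy_out_def
  proof (rule halts_While)
    show "Inv 0 m" using m by (simp add: Inv_def same_def)
    fix i m' assume i: "i \<le> n" "Inv i m'"
    show "cost ?e m' \<le> 100 * L" by (rule e(2)[OF i])
    assume "eval ?e m' \<noteq> 0"
    then have lt: "i < n" using e(1)[OF i] by (auto split: if_splits)
    then have ev: "eval ?e m' = Suc (us ! i)" using e(1)[OF i] by simp
    let ?m1 = "m'(2 := (m' 2)(i := Suc (us ! i)))"
    have bm: "small L m'" and m26: "m' 26 0 = i" using i by (simp_all add: Inv_def)
    have b1: "small L ?m1" using bm out(1)[OF lt] by (auto simp: small_def)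
    have "halts (Store 2 (reg 26) ?e ;;
      26 ::= Add (reg 26) (Const 1)) m' ((1 + cost (reg 26) m' + cost ?e m') + 40 * L)
      (Inv (Suc i))"
    proof (rule halts_Seq[where R = "\<lambda>m1. m1 = ?m1"])
      show "halts (Store 2 (reg 26) ?e) m' (1 + cost (reg 26) m' + cost ?e m') (\<lambda>m1. m1 = ?m1)"
        by (rule halts_Store) (use ev m26 in simp)
      fix m1 assume m1: "m1 = ?m1"
      have "Suc i < 2 ^ L" using lt us(2) L by linarith
      then have "halts (26 ::= Add (reg 26) (Const 1)) m1
        (com_size (26 ::= Add (reg 26) (Const 1)) * L)
          (\<lambda>m2. m2 = m1(26 := (m1 26)(0 := Suc i)) \<and> small L m2)"
        using b1 m1 m26 L(1) by (intro halts_wp) auto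
      then show "halts (26 ::= Add (reg 26) (Const 1)) m1 (40 * L) (Inv (Suc i))"
        by (rule halts_mono) (use m1 i in \<open>auto simp: Inv_def same_def less_Suc_eq\<close>)
    qed
    moreover have "cost (reg 26) m' \<le> 2 * L"
      using cost_low[OF bm _ L(1), of "reg 26"] by simp
    ultimately show "i < n \<and> halts (Store 2 (reg 26) ?e ;;
      26 ::= Add (reg 26) (Const 1)) m' (200 * L) (Inv (Suc i))"
      using lt e(2)[OF i] L(1) by (auto elim!: halts_mono)
  qed
  then show ?thesis
  proof (rule halts_mono)
    have "(n + 1) * (1 + 100 * L) + n * (200 * L) \<le> (N + 1) * (101 * L) + (N + 1) * (200 * L)"
      using L(1) us(2) by (intro add_mono mult_le_mono) auto
    also have "\<dots> \<le> 400 * (L * (N + 1))" unfolding distrib_left[symmetric] by simp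
    finally show "(n + 1) * (1 + 100 * L) + n * (200 * L) \<le> 400 * (L * (N + 1))" .
    fix m' assume "\<exists>i\<le>n. Inv i m' \<and> eval ?e m' = 0"
    then obtain i where i: "i \<le> n" "Inv i m'" "eval ?e m' = 0" by blast
    then have "i = n" using e(1)[OF i(1,2)] by (auto split: if_splits)
    then show "small L m' \<and> same {2, 26} m m' \<and> m' 26 0 = n \<and> (\<forall>i<n. m' 2 i = Suc (us ! i))"
      using i by (simp add: Inv_def)
  qed
qed

definition prelude_factor :: "com \<Rightarrow> aexp \<Rightarrow> nat" where
  "prelude_factor pU fuel = 3 * sim_factor pU + exp_size fuel + 2000"

lemma prelude:
  assumes run: "runs pU (input [bits I]) [] t mU" "outputs mU us"
    and fuel: "low fuel" "\<And>m. m 26 0 = N \<Longrightarrow> eval fuel m = FU"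
    and FU: "8 * t < FU" "FU + L < 2 ^ L" "t \<le> L"
  shows "halts (prelude pU fuel) (input [bits I]) (prelude_factor pU fuel *
    (L * L * L * (N + 1 + FU)))
    (\<lambda>m. env m \<and> sound m \<and> m 5 0 = 0 \<and> m 22 0 = 0)"
proof -
  have L2: "(2::nat) < 2 ^ L" "n < 2 ^ L" using L us by linarith+
  have inb: "input [bits I] a j < 2 ^ L" for a j using L2 by (auto simp: input_def bits_def)
  let ?A = "\<lambda>m. small L m \<and> m 26 0 = N \<and> m 1 = input [bits I] 0 \<and>
     (\<forall>a<33. a \<notin> {0, 1, 26} \<longrightarrow> m a = (\<lambda>_. 0)) \<and>
     (\<forall>a j. m (33 + a) (cell 0 j) = input [bits I] a j) \<and>
       (\<forall>a j u. u \<noteq> 0 \<longrightarrow> m (33 + a) (cell u j) = 0)"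
  let ?B = "\<lambda>m. small L m \<and> m 1 = input [bits I] 0 \<and> m 22 0 = 0 \<and> m 23 0 = FU \<and>
     (\<forall>a j. m (33 + a) (cell 0 j) = input [bits I] a j) \<and>
       (\<forall>a j u. u \<noteq> 0 \<longrightarrow> m (33 + a) (cell u j) = 0)"
  let ?C = "\<lambda>m. small L m \<and> m 1 = input [bits I] 0 \<and> m 22 0 = 0 \<and>
     (\<forall>j. m 33 (cell 0 j) = mU 0 j) \<and> (\<forall>a j u. u \<noteq> 0 \<longrightarrow> m (33 + a) (cell u j) = 0)"
  let ?D = "\<lambda>m. small L m \<and> m 1 = input [bits I] 0 \<and> m 22 0 = 0 \<and> m 26 0 = n \<and>
    (\<forall>i<n. m 2 i = Suc (us ! i)) \<and>
     (\<forall>a j u. u \<noteq> 0 \<longrightarrow> m (33 + a) (cell u j) = 0)"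
  let ?E = "\<lambda>m. env m \<and> sound m \<and> m 5 0 = 0 \<and> m 22 0 = 0"
  have S1: "halts copy_in (input [bits I]) (300 * (L * (N + 1))) ?A" by (rule copy_in)
  have S2: "halts (23 ::= fuel) m ((exp_size fuel + 2) * L) ?B" if m: "?A m" for m
  proof -
    have "halts (23 ::= fuel) m (com_size (23 ::= fuel) * L) (\<lambda>m'. m' = m(23 := (m 23)(0 := FU)) \<and>
      small L m')"
      using m fuel FU L(1) by (intro halts_wp) auto
    then show ?thesis by (rule halts_mono) (use m in auto)
  qed
  have S3: "halts (sim pU) m (3 * sim_factor pU * (L * L * (FU + L))) ?C" if m: "?B m" for m
  proof -
    have Z: "nbits (L + FU) \<le> L" using FU L by (subst nbits_le_iff) auto
    have "sim_state 0 L (L + FU) (input [bits I]) m FU"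
      unfolding sim_state_def represents_def using m FU L Z inb by (auto simp: nbits_le_iff)
    from sim_run[OF run(1) refl this]
    obtain T M where M: "runs (sim pU) m [] T M" "sim_bound (sim_factor pU) 0 L (L + FU) mU m FU t
      T M" by blast
    have nz: "M 23 0 \<noteq> 0" using M(2) FU(1) by (simp add: sim_bound_def)
    then have r: "represents 0 mU M" and sim_frame: "sim_frame 0 m M" using M(2)
      by (auto simp: sim_bound_def sim_state_def)
    have "M (33 + 0) (cell 0 j) = mU 0 j" for j using r unfolding represents_def by blast
    then have "?C M" using m r sim_frame small_sim_frame[OF sim_frame]
      by (simp add: sim_frame_def represents_def)
    moreover have "T \<le> 3 * sim_factor pU * (L * L * (FU + L))"
    proof -
      have "T \<le> sim_factor pU * (L * L) * (FU - M 23 0 + (if M 23 0 = 0 then L + FU else 0))"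
        using M(2) unfolding sim_bound_def by blast
      also have "\<dots> \<le> sim_factor pU * (L * L) * (3 * (FU + L))"
      proof (intro mult_le_mono2)
        have "FU - M 23 0 + (if M 23 0 = 0 then L + FU else 0) \<le> FU + (L + FU)"
          by (intro add_mono) auto
        then show "FU - M 23 0 + (if M 23 0 = 0 then L + FU else 0) \<le> 3 * (FU + L)" by simp
      qed
      finally show ?thesis by (simp only: mult_ac)
    qed
    ultimately show ?thesis using M(1) unfolding halts_def by blast
  qed
  have S4: "halts (26 ::= Const 0) m (40 * L) (\<lambda>m'. ?C m' \<and> m' 26 0 = 0)" if m: "?C m" for m
  proof -
    have "halts (26 ::= Const 0) m (com_size (26 ::= Const 0) * L) (\<lambda>m'. m'
      = m(26 := (m 26)(0 := 0)) \<and> small L m')"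
      using m L2 L(1) by (intro halts_wp) auto
    then show ?thesis by (rule halts_mono) (use m in auto)
  qed
  have S5: "halts copy_out m (400 * (L * (N + 1))) ?D" if m: "?C m \<and> m 26 0 = 0" for m
  proof -
    have 1: "m 33 (cell 0 i) = Suc (us ! i) \<and> Suc (us ! i) < 2 ^ L" if i: "i < n" for i
    proof -
      have mU: "mU 0 i = Suc (us ! i)" using run(2) i by (simp add: outputs_def)
      \<comment> \<open>The elements are not bounded in terms of the instance as such, but writing
        them took time at least their length.\<close>
      have "mU 0 i < 2 ^ L"
      proof (cases "mU 0 i = input [bits I] 0 i")
        case False
        then have "nbits (mU 0 i) \<le> t" using runs_nbits[OF run(1)] by blast
        then show ?thesis using FU(3) L nbits_le_iff[of L "mU 0 i"] by linarith
      qed (use inb in simp)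
      then show ?thesis using m mU by simp
    qed
    have 2: "m 33 (cell 0 n) = 0" using m run(2) by (simp add: outputs_def)
    show ?thesis
    proof (rule halts_mono[OF copy_out])
      fix m' assume m': "small L m' \<and> same {2, 26} m m' \<and> m' 26 0 = n \<and>
        (\<forall>i<n. m' 2 i = Suc (us ! i))"
      then have "m' 1 = m 1" "m' 22 = m 22" "m' (33 + a) = m (33 + a)" for a
        by (auto simp: same_def)
      then show "?D m'" using m m' by simp
    qed (use m 1 2 in auto)
  qed
  let ?last = "4 ::= reg 26 ;; 0 ::= Const 1 ;; Store 0 (Const 1) (Const 0) ;; 5 ::= Const 0"
  have S6: "halts ?last m (100 * L) ?E" if m: "?D m" for m
  proof -
    have "halts ?last m (com_size ?last * L) (\<lambda>m'. (same {0, 4, 5} m m' \<and> m' 4 0 = n \<and>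
      m' 5 0 = 0 \<and> m' 0 0 = 1 \<and> m' 0 1 = 0) \<and> small L m')"
      using m L2 L(1) by (intro halts_wp) (auto simp: same_def)
    then show ?thesis
    proof (rule halts_mono)
      fix m' assume m': "(same {0, 4, 5} m m' \<and> m' 4 0 = n \<and> m' 5 0 = 0 \<and> m' 0 0 = 1 \<and>
        m' 0 1 = 0) \<and> small L m'"
      have e: "m' 1 = m 1" "m' 2 = m 2" "m' 22 = m 22" "m' (33 + a) = m (33 + a)" for a
        using m' by (auto simp: same_def)
      have "env m'" unfolding env_def e using m m' by simp
      moreover have "sound m'" using m' by (simp add: sound_def outputs_def)
      ultimately show "?E m'" using m m' e by simp
    qed simp
  qed
  note T5 = halts_Seq[OF S5 S6] note T4 = halts_Seq[OF S4 T5] note T3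
    = halts_Seq[OF S3 T4] note T2 = halts_Seq[OF S2 T3]
  note T1 = halts_Seq[OF S1 T2, folded prelude_def]
  show ?thesis
  proof (rule halts_mono[OF T1])
    define W where "W = L * L * L * (N + 1 + FU)"
    have "L * (N + 1) \<le> L * L * L * (N + 1 + FU)" using L(1) by (intro mult_mono) auto
    then have 1: "L * (N + 1) \<le> W" by (simp add: W_def)
    have "L * 1 \<le> L * L * L * (N + 1 + FU)" using L(1) by (intro mult_mono) auto
    then have 2: "L \<le> W" by (simp add: W_def)
    have "FU + L \<le> L * (N + 1 + FU)"
    proof -
      have "FU \<le> L * FU" "L \<le> L * (N + 1)" using L(1) by simp_all
      then show ?thesis unfolding distrib_left by linarith
    qed
    then have "3 * sim_factor pU * (L * L * (FU + L))
      \<le> 3 * sim_factor pU * (L * L * (L * (N + 1 + FU)))" by (intro mult_le_mono2)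
    also have "\<dots> = 3 * sim_factor pU * W" by (simp only: W_def mult.assoc)
    finally have 3: "3 * sim_factor pU * (L * L * (FU + L)) \<le> 3 * sim_factor pU * W" .
    have 4: "(exp_size fuel + 2) * L \<le> exp_size fuel * W + 2 * W"
      using mult_le_mono2[OF 2, of "exp_size fuel + 2"] by (simp only: distrib_right)
    have "prelude_factor pU fuel * W = 3 * sim_factor pU * W + exp_size fuel * W + 2000 * W"
      by (simp add: prelude_factor_def distrib_right)
    then show "300 * (L * (N + 1)) + ((exp_size fuel + 2) * L +
      (3 * sim_factor pU * (L * L * (FU + L)) +
        (40 * L + (400 * (L * (N + 1)) + 100 * L))))
          \<le> prelude_factor pU fuel * (L * L * L * (N + 1 + FU))"
      using 1 2 3 4 unfolding W_def[symmetric] by linarith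
  qed
qed

end

section \<open>Growth of the running time\<close>

text \<open>Growth up to a polynomial factor in the length of the instance. Nonnegativity is
  included so that bounds can be multiplied.\<close>

definition grows :: "(bool list \<Rightarrow> real) \<Rightarrow> (bool list \<Rightarrow> real) \<Rightarrow> bool" where
  "grows g f \<longleftrightarrow> (\<exists>C d. \<forall>I. 0 \<le> f I \<and> f I \<le> C * g I * (real (length I) + 1) ^ d)"

abbreviation "poly_bounded \<equiv> grows (\<lambda>_. 1)"

lemma grows_mono: "grows g h \<Longrightarrow> (\<And>I. 0 \<le> f I \<and> f I \<le> h I) \<Longrightarrow> grows g f"
  unfolding grows_def by (meson order_trans)

lemma growsD:
  assumes "grows g f" "\<And>I. 0 \<le> g I"
  obtains C d where "1 \<le> C" "\<And>I. 0 \<le> f I \<and> f I \<le> C * g I * (real (length I) + 1) ^ d"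
proof -
  obtain C d where C: "\<And>I. 0 \<le> f I \<and> f I \<le> C * g I * (real (length I) + 1) ^ d"
    using assms(1) unfolding grows_def by blast
  have "f I \<le> max 1 C * g I * (real (length I) + 1) ^ d" for I
  proof -
    have "C * g I * (real (length I) + 1) ^ d \<le> max 1 C * g I * (real (length I) + 1) ^ d"
      using assms(2) by (intro mult_right_mono) auto
    then show ?thesis using C[of I] by linarith
  qed
  then show ?thesis using that[of "max 1 C" d] C by auto
qed

lemma grows_length: "poly_bounded (\<lambda>I. real (length I))"
  unfolding grows_def by (rule exI[of _ 1], rule exI[of _ 1]) auto

lemma grows_const:
  assumes "\<And>I. 1 \<le> g I" "0 \<le> c"
  shows "grows g (\<lambda>_. c)"
  unfolding grows_def
proof (rule exI[of _ c], rule exI[of _ 0], intro allI)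
  fix I show "0 \<le> c \<and> c \<le> c * g I * (real (length I) + 1) ^ 0"
    using mult_left_mono[OF assms(1)[of I] assms(2)] assms(2) by simp
qed

lemma grows_add:
  assumes "grows g f" "grows g h" "\<And>I. 0 \<le> g I"
  shows "grows g (\<lambda>I. f I + h I)"
proof -
  obtain C d where C: "1 \<le> C" "\<And>I. 0 \<le> f I \<and> f I \<le> C * g I * (real (length I) + 1) ^ d"
    using growsD[OF assms(1,3)] by blast
  obtain C' d' where C': "1 \<le> C'" "\<And>I. 0 \<le> h I \<and> h I \<le> C' * g I * (real (length I) + 1) ^ d'"
    using growsD[OF assms(2,3)] by blast
  have "f I + h I \<le> (C + C') * g I * (real (length I) + 1) ^ (d + d')" for I
  proof -
    let ?x = "real (length I) + 1"
    have "C * g I * ?x ^ d \<le> C * g I * ?x ^ (d + d')" "C' * g I * ?x ^ d'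
      \<le> C' * g I * ?x ^ (d + d')"
      using C(1) C'(1) assms(3)[of I] by (intro mult_left_mono power_increasing; simp)+
    then show ?thesis using C(2)[of I] C'(2)[of I] by (simp add: distrib_right)
  qed
  then show ?thesis unfolding grows_def using C C' by (metis add_nonneg_nonneg)
qed

lemma grows_mult:
  assumes "poly_bounded f" "grows g h" "\<And>I. 0 \<le> g I"
  shows "grows g (\<lambda>I. f I * h I)"
proof -
  obtain C d where C: "1 \<le> C" "\<And>I. 0 \<le> f I \<and> f I \<le> C * 1 * (real (length I) + 1) ^ d"
    using growsD[OF assms(1)] by auto
  obtain C' d' where C': "1 \<le> C'" "\<And>I. 0 \<le> h I \<and> h I \<le> C' * g I * (real (length I) + 1) ^ d'"
    using growsD[OF assms(2,3)] by blast
  have "f I * h I \<le> (C * C') * g I * (real (length I) + 1) ^ (d + d')" for I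
  proof -
    have "f I * h I \<le> (C * 1 * (real (length I) + 1) ^ d) * (C' * g I * (real (length I) + 1) ^ d')"
      using C C' by (intro mult_mono) auto
    then show ?thesis by (simp add: power_add mult_ac)
  qed
  then show ?thesis unfolding grows_def using C C' by (metis mult_nonneg_nonneg)
qed

lemma grows_poly:
  assumes "poly_bounded f" "\<And>I. 1 \<le> g I"
  shows "grows g f"
proof -
  have "0 \<le> g I" for I using assms(2)[of I] by linarith
  then have "grows g (\<lambda>I. f I * 1)" by (intro grows_mult[OF assms(1)] grows_const assms(2)) auto
  then show ?thesis by simp
qed

lemma grows_power: "poly_bounded f \<Longrightarrow> poly_bounded (\<lambda>I. f I ^ k)"
  by (induction k) (auto intro!: grows_const grows_mult)

text \<open>The logarithm of an exponential in at most \<open>length I\<close>, times a polynomial,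
  is polynomially bounded.\<close>

lemma grows_nbits:
  fixes v size :: "bool list \<Rightarrow> nat"
  assumes "grows (\<lambda>I. \<beta> ^ size I) (\<lambda>I. real (v I))" "1 \<le> \<beta>" "\<And>I. size I \<le> length I"
  shows "poly_bounded (\<lambda>I. real (nbits (v I)))"
proof -
  obtain C d where C: "1 \<le> C" "\<And>I. 0 \<le> real (v I) \<and>
    real (v I) \<le> C * \<beta> ^ size I * (real (length I) + 1) ^ d"
    using growsD[OF assms(1)] assms(2) by auto
  let ?h = "\<lambda>I. (ln (4 * C) + real (length I) * ln \<beta> + real d * real (length I)) * (1 / ln 2)"
  have h: "real (nbits (v I)) \<le> ?h I" for I
  proof -
    let ?x = "real (length I) + 1"
    have x: "1 \<le> \<beta> ^ size I" "1 \<le> ?x ^ d" using assms(2) by (auto simp: one_le_power)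
    have "real (2 ^ nbits (v I)) \<le> real (2 * (v I + 1))" using nbits_lower[of "v I"]
      by (simp only: of_nat_le_iff)
    then have "2 ^ nbits (v I) \<le> 2 * (real (v I) + 1)" by simp
    also have "real (v I) + 1 \<le> 2 * (C * \<beta> ^ size I * ?x ^ d)"
    proof -
      have "1 * 1 * 1 \<le> C * \<beta> ^ size I * ?x ^ d" using C(1) x by (intro mult_mono) auto
      then show ?thesis using C(2)[of I] by linarith
    qed
    finally have "2 ^ nbits (v I) \<le> (4 * C) * \<beta> ^ size I * ?x ^ d" by simp
    moreover from this have "0 < (4 * C) * \<beta> ^ size I * ?x ^ d"
      by (rule less_le_trans[rotated]) simp
    ultimately have "ln ((2::real) ^ nbits (v I)) \<le> ln ((4 * C) * \<beta> ^ size I * ?x ^ d)"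
      by (subst ln_le_cancel_iff) auto
    also have "\<dots> = ln (4 * C) + real (size I) * ln \<beta> + real d * ln ?x"
      using C(1) assms(2) by (simp add: ln_mult ln_realpow)
    also have "\<dots> \<le> ln (4 * C) + real (length I) * ln \<beta> + real d * real (length I)"
      using assms(2,3) ln_add_one_self_le_self[of "real (length I)"]
      by (intro add_mono mult_right_mono mult_left_mono) (auto simp: add.commute)
    finally show ?thesis by (simp add: ln_realpow field_simps)
  qed
  have "poly_bounded (\<lambda>I. (ln (4 * C) + real (length I) * ln \<beta> + real d * real (length I)) *
    (1 / ln 2))"
    using C(1) assms(2) by (intro grows_mult grows_add grows_const grows_length) auto
  then show ?thesis by (rule grows_mono) (use h in auto)
qed

primrec power_exp :: "aexp \<Rightarrow> nat \<Rightarrow> aexp" where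
  "power_exp e 0 = Const 1"
| "power_exp e (Suc d) = Mul e (power_exp e d)"

lemma eval_power_exp [simp]: "eval (power_exp e d) m = eval e m ^ d"
  by (induction d) auto

lemma low_power_exp [simp]: "low e \<Longrightarrow> low (power_exp e d)"
  by (induction d) auto

context search_all
begin

definition total :: "nat \<Rightarrow> nat \<Rightarrow> nat" where
  "total K FU = K * (L * L * L * (N + 1 + FU)) + sizes_time"

text \<open>Spelled out without names of the locale, so that outside of it the bound can be studied
  as a function of the instance.\<close>

lemma total_eq: "total K FU = K * (L * L * L * (N + 1 + FU)) +
    (n + 2) * (((lb + 1) * (n + 1) + 1) * ((3 * sim_factor pE + idle_time pE + 6400) *
      ((N + 2) * (N + 2) * (L * L * L) * (8 * (((lb + 1) * (n + 1) + 3) * 2 ^ lb))) + 600 * L) +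
        1000 * L)"
  by (simp only: total_def sizes_time_def race_time_def batch_time_def trial_factor_def
    call_factor_def max_batches_def add.assoc numeral_plus_numeral) simp

lemma whole:
  assumes run: "runs pU (input [bits I]) [] t mU" "outputs mU us"
    and fuel: "low fuel" "\<And>m. m 26 0 = N \<Longrightarrow> eval fuel m = FU"
    and FU: "8 * t < FU" "FU + L < 2 ^ L" "t \<le> L"
  shows "expects (prelude pU fuel ;;
    all_sizes pE) (input [bits I]) (total (prelude_factor pU fuel) FU) sound
    (\<lambda>m'. if found m' then 0 else 1) (if Sol \<in> Fam then ennreal (1 / 4) else 1)"
  unfolding total_def
proof (rule expects_Seq)
  show "expects (prelude pU fuel) (input [bits I]) (prelude_factor pU fuel *
    (L * L * L * (N + 1 + FU)))
    (\<lambda>m. env m \<and> sound m \<and> m 5 0 = 0 \<and> m 22 0 = 0) (\<lambda>_. if Sol \<in> Fam then ennreal (1 / 4) else 1)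
    (if Sol \<in> Fam then ennreal (1 / 4) else 1)"
    by (rule expects_of_halts[OF prelude[OF assms]], assumption) (rule order_refl)
qed (use all_sizes in blast)

lemma sound_iff: "sound m \<and> found m \<longleftrightarrow> (\<exists>xs. outputs m (1 # xs) \<and> distinct xs \<and> set xs \<in> Fam)"
  by (auto simp: sound_def found_def outputs_def)

lemma sound_empty: "Fam = {} \<Longrightarrow> sound m \<Longrightarrow> outputs m [0]"
  unfolding sound_def by blast

end

text \<open>Polynomially many bits suffice for all numbers of the search, because
  \<open>x < 2 ^ x\<close> turns each product of bounds into a power of 2 whose exponent is a
  sum.\<close>

lemma search_all_intro:
  assumes s: "search I us Fam pE TE L"
    and opt: "\<And>k. k \<le> length us \<Longrightarrow> \<exists>t\<le>k. reps (length us) k t * (8 * TE t (k - t) + 2) \<le> BB"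
    and LB: "2 * length us + 2 * ((nbits BB + 1) * (length us + 1)) + nbits BB + 11 +
      (length us * length us + 2) \<le> L"
  shows "search_all I us Fam pE TE L BB (nbits BB)"
proof -
  interpret search I us Fam pE TE L by (rule s)
  define lb where "lb = nbits BB"
  define S where "S = (lb + 1) * (n + 1)"
  \<comment> \<open>The sum of the exponents obtained from the five factors of the product in
    \<open>LV\<close>. Three more bits in \<open>L\<close> leave room for the remaining
    summands.\<close>
  define G where "G = 2 * n + 2 * S + lb + 8"
  have GL: "G + 3 \<le> L" "n * n + 2 \<le> L" "2 * n < L" using LB unfolding G_def S_def lb_def
    by linarith+
  have small: "x < 2 ^ x" for x :: nat by (rule less_exp)
  show ?thesis
  proof (unfold_locales)
    show "\<exists>t\<le>k. reps n k t * (8 * TE t (k - t) + 2) \<le> BB" if "k \<le> n" for k by (rule opt[OF that])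
    show "BB \<le> 2 ^ nbits BB" using less_nbits[of BB] by simp
    have "(4::nat) ^ n = 2 ^ (2 * n)" by (simp add: power_mult)
    also have "\<dots> < 2 ^ L" using GL(3) by (intro power_strict_increasing) auto
    finally show "4 ^ n < (2::nat) ^ L" .
    have "n ^ n \<le> (2 ^ n) ^ n" using small[of n] by (intro power_mono) auto
    moreover have "1 \<le> ((2::nat) ^ n) ^ n" "((2::nat) ^ n) ^ n = 2 ^ (n * n)"
      by (simp_all add: power_mult)
    ultimately have "n ^ n + 1 \<le> 2 ^ (n * n) + 2 ^ (n * n)" by linarith
    also have "\<dots> = 2 ^ (n * n + 1)" by simp
    also have "\<dots> < 2 ^ L" using GL(2) by (intro power_strict_increasing) auto
    finally show "n ^ n + 1 < 2 ^ L" .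
    have 1: "(n + 2) * (S + 1) * (2 ^ (lb + 1) * (S + 3) * (n + 1)) \<le> 2 ^ G"
    proof -
      have "(n + 2) * (S + 1) * (2 ^ (lb + 1) * (S + 3) * (n + 1)) \<le>
          2 ^ (n + 2) * 2 ^ (S + 1) * (2 ^ (lb + 1) * 2 ^ (S + 3) * 2 ^ (n + 1))"
        by (intro mult_le_mono less_imp_le[OF small] order_refl)
      also have "\<dots> = 2 ^ G" unfolding power_add[symmetric] G_def
        by (rule arg_cong[where f = "power 2"]) simp
      finally show ?thesis .
    qed
    have 2: "(2::nat) ^ (lb + 1) \<le> 2 ^ G" unfolding G_def by (intro power_increasing) auto
    have 3: "n + 4 \<le> 2 ^ G" 
    proof -
      have "n + 4 \<le> G" by (simp add: G_def)
      then show ?thesis using small[of G] by linarith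
    qed
    have 4: "(8::nat) * 2 ^ G \<le> 2 ^ L"
    proof -
      have "(8::nat) * 2 ^ G = 2 ^ (G + 3)" by (simp add: power_add)
      also have "\<dots> \<le> 2 ^ L" using GL(1) by (intro power_increasing) auto
      finally show ?thesis .
    qed
    have 5: "2 * L \<le> 2 ^ L"
    proof -
      have "L - 1 < 2 ^ (L - 1)" by (rule small)
      then have "L \<le> 2 ^ (L - 1)" by linarith
      moreover have "(2::nat) ^ L = 2 * 2 ^ (L - 1)" using GL(1) by (cases L) auto
      ultimately show ?thesis by linarith
    qed
    have "0 < (2::nat) ^ G" by simp
    then show "(n + 2) * ((nbits BB + 1) * (n + 1) + 1) *
      (2 ^ (nbits BB + 1) * ((nbits BB + 1) * (n + 1) + 3) * (n + 1)) +
        2 ^ (nbits BB + 1) + L + n + 4 < 2 ^ L"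
      using 1 2 3 4 5 unfolding S_def lb_def by linarith
  qed
qed

lemma main:
  fixes \<Phi> :: "bool list \<Rightarrow> nat set \<times> nat set set" and b c :: real
  assumes iss: "implicit_set_system \<Phi>" and ptc: "poly_time_computable \<Phi>"
    and bc: "b \<ge> 1" "c \<ge> 1"
    and ext: "extension_algorithm \<Phi> pE (\<lambda>I X k.
           CE * b ^ (card (universe \<Phi> I) - card X) * c ^ k * (real (length I) + 1) ^ dE)"
  shows "\<exists>p C d. randomized_subset_algorithm \<Phi> p (\<lambda>I.
           C * (1 + b - 1 / c) ^ card (universe \<Phi> I) * (real (length I) + 1) ^ d)"
proof -
  define \<beta> where "\<beta> = 1 + b - 1 / c"
  have "1 / c \<le> 1" using bc by simp
  then have \<beta>: "1 \<le> \<beta>" using bc unfolding \<beta>_def by linarith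
  obtain pU CU dU where U: "\<forall>I. \<exists>us. distinct us \<and> set us = universe \<Phi> I \<and>
        computes_within pU [bits I] (CU * (real (length I) + 1) ^ dU) us"
    using ptc unfolding poly_time_computable_def by blast
  then obtain us where univ: "\<And>I. distinct (us I)" "\<And>I. set (us I) = universe \<Phi> I"
      "\<And>I. computes_within pU [bits I] (CU * (real (length I) + 1) ^ dU) (us I)"
    by metis
  have card: "card (universe \<Phi> I) = length (us I)" for I
    using distinct_card[OF univ(1)[of I]] univ(2)[of I] by simp
  have usN: "length (us I) \<le> length I" for I
    using iss card[of I] unfolding implicit_set_system_def by metis
  \<comment> \<open>The constant of a time bound could be negative; its absolute value makes
    \<open>e\<close> nonnegative and monotone.\<close>
  define A where "A = \<bar>CE\<bar>"
  \<comment> \<open>This constant becomes part of the program text through \<open>fuel\<close> and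
    therefore has to be a natural number, whereas \<open>b\<close>, \<open>c\<close> and
    \<open>CE\<close> occur in the analysis only.\<close>
  define cU where "cU = nat \<lceil>\<bar>CU\<bar>\<rceil>"
  define FU where "FU I = 8 * (cU * (length I + 1) ^ dU) + 1" for I :: "bool list"
  define fuel where "fuel
    = Add (Mul (Const 8) (Mul (Const cU) (power_exp (Add (reg 26) (Const 1)) dU))) (Const 1)"
  define e where "e I x \<kappa> = A * (b ^ (length (us I) - x) * c ^ \<kappa>) * (real (length I) + 1) ^ dE"
    for I x \<kappa>
  define TE where "TE I x \<kappa> = nat \<lceil>e I x \<kappa>\<rceil>" for I x \<kappa>
  \<comment> \<open>Twice \<open>8 * A + 10\<close>: the 2 is that of \<open>reps_bounds\<close>,
    and the 10 is the 2 in \<open>8 * TE + 2\<close> plus 8 for rounding \<open>e\<close>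
    up.\<close>
  define K where "K = 16 * A + 20"
  define R where "R I = K * (real (length I) + 1) ^ dE * ((real (length (us I)) + 1) * \<beta> ^ length
    (us I))" for I
  define BB where "BB I = nat \<lceil>R I\<rceil>" for I
  define lb where "lb I = nbits (BB I)" for I
  define L where "L I = (2 * length (us I) + 2 * ((lb I + 1) * (length (us I) + 1)) + lb I + 11 +
      (length (us I) * length (us I) + 2)) + length I + FU I" for I
  \<comment> \<open>An unspecified set if the family is empty; in that case the miss probability is
    only bounded by 1.\<close>
  define Sol where "Sol I = (SOME S. S \<in> family \<Phi> I)" for I
  have A0: "0 \<le> A" by (simp add: A_def)
  have K0: "0 \<le> K" using A0 by (simp add: K_def)
  have e0: "0 \<le> e I x \<kappa>" for I x \<kappa> using A0 bc by (simp add: e_def)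
  have base: "search I (us I) (family \<Phi> I) pE (TE I) (L I)" for I
  proof
    show "distinct (us I)" "length (us I) \<le> length I" using univ(1) usN by auto
    show "family \<Phi> I \<subseteq> Pow (set (us I))" using iss univ(2) by (simp add: implicit_set_system_def)
    show "1 \<le> L I" by (simp add: L_def)
    have "length I + 3 \<le> L I" by (simp add: L_def)
    also have "L I < 2 ^ L I" by (rule less_exp)
    finally show "length I + 3 < 2 ^ L I" .
    show "TE I x j \<le> TE I y k" if "y \<le> x" "j \<le> k" for x y j k
    proof -
      have "e I x j \<le> e I y k"
        unfolding e_def using that bc A0
        by (intro mult_right_mono mult_left_mono mult_mono power_increasing) auto
      then show ?thesis unfolding TE_def by (intro nat_mono ceiling_mono)
    qed
    fix xs \<kappa> assume xs: "distinct xs" "set xs \<subseteq> set (us I)"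
    obtain t m where t: "runs pE (input [bits I, xs, replicate \<kappa> 0]) [] t m"
      "real t \<le> CE * b ^ (card (universe \<Phi> I) - card (set xs)) * c ^ \<kappa> * (real (length I) + 1) ^ dE"
      "outputs m [of_bool (\<exists>S. S \<subseteq> universe \<Phi> I - set xs \<and> S \<union> set xs \<in> family \<Phi> I \<and> card S \<le> \<kappa>)]"
      using ext xs univ(2)[of I] unfolding extension_algorithm_def computes_within_def by blast
    have "real t \<le> CE * (b ^ (length (us I) - length xs) * c ^ \<kappa> * (real (length I) + 1) ^ dE)"
      using t(2) xs by (simp add: card distinct_card mult.assoc)
    also have "\<dots> \<le> A * (b ^ (length (us I) - length xs) * c ^ \<kappa> * (real (length I) + 1) ^ dE)"
      using bc by (intro mult_right_mono) (auto simp: A_def)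
    finally have "real t \<le> e I (length xs) \<kappa>" by (simp add: e_def mult.assoc)
    then have "t \<le> TE I (length xs) \<kappa>" unfolding TE_def by linarith
    then show "\<exists>t m. runs pE (input [bits I, xs, replicate \<kappa> 0]) [] t m \<and> t \<le> TE I (length xs) \<kappa> \<and>
        outputs m [of_bool (\<exists>S. S \<subseteq> set (us I) - set xs \<and> S \<union> set xs \<in> family \<Phi> I \<and> card S \<le> \<kappa>)]"
      unfolding univ(2) using t(1,3) by blast
  qed
  have opt: "\<exists>t\<le>k. reps (length (us I)) k t * (8 * TE I t (k - t) + 2) \<le> BB I"
    if k: "k \<le> length (us I)" for I k
  proof -
    let ?n = "length (us I)" and ?N = "(real (length I) + 1) ^ dE"
    obtain t where t: "t \<le> k" "real (?n choose t) * (b ^ (?n - t) * c ^ (k - t)) \<le>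
        real (k choose t) * ((real ?n + 1) * \<beta> ^ ?n)"
      using optimal_sample_size[OF bc k] unfolding \<beta>_def by blast
    define w where "w = b ^ (?n - t) * c ^ (k - t)"
    have w1: "1 \<le> w" "1 \<le> ?N" using bc mult_mono[of 1 "b ^ (?n - t)" 1 "c ^ (k - t)"]
      by (auto simp: w_def one_le_power)
    have pos: "0 < real (k choose t)" using t by simp
    have "real (8 * TE I t (k - t) + 2) \<le> 8 * (A * w * ?N) + 10"
      using e0[of I t "k - t"] unfolding TE_def e_def w_def by linarith
    also have "\<dots> \<le> (8 * A + 10) * (w * ?N)"
      using mult_mono[of 1 w 1 ?N] w1 by (simp add: distrib_right mult.assoc)
    finally have 1: "real (8 * TE I t (k - t) + 2) \<le> (8 * A + 10) * (w * ?N)" .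
    have "real (k choose t) * real (reps ?n k t) * real (8 * TE I t (k - t) + 2)
        \<le> 2 * real (?n choose t) * ((8 * A + 10) * (w * ?N))"
      by (rule mult_mono[OF reps_bounds(2)[OF t(1) k] 1]) auto
    also have "\<dots> = K * ?N * (real (?n choose t) * w)" by (simp add: K_def algebra_simps)
    also have "\<dots> \<le> K * ?N * (real (k choose t) * ((real ?n + 1) * \<beta> ^ ?n))"
      using t(2) K0 unfolding w_def by (intro mult_left_mono) auto
    also have "\<dots> = real (k choose t) * R I" by (simp add: R_def)
    finally have "real (k choose t) * real (reps ?n k t * (8 * TE I t (k - t) + 2))
      \<le> real (k choose t) * R I"
      by (simp only: of_nat_mult mult.assoc)
    then have "real (reps ?n k t * (8 * TE I t (k - t) + 2)) \<le> R I"
      using pos by (rule mult_left_le_imp_le)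
    then have "reps ?n k t * (8 * TE I t (k - t) + 2) \<le> BB I" unfolding BB_def by linarith
    then show ?thesis using t(1) by blast
  qed
  have loc2: "search_all I (us I) (family \<Phi> I) pE (TE I) (L I) (BB I) (lb I)" for I
    unfolding lb_def
    by (rule search_all_intro[OF base opt]) (simp_all add: L_def lb_def)
  define prog where "prog = prelude pU fuel ;; all_sizes pE"
  define KS0 where "KS0 = 3 * sim_factor pU + exp_size fuel + 2000"
  define T where "T I = KS0 * (L I * L I * L I * (length I + 1 + FU I)) +
    (length (us I) + 2) * (((lb I + 1) * (length (us I) + 1) + 1) *
      ((3 * sim_factor pE + idle_time pE + 6400) *
      ((length I + 2) * (length I + 2) * (L I * L I * L I) *
        (8 * (((lb I + 1) * (length (us I) + 1) + 3) * 2 ^ lb I))) + 600 * L I) + 1000 * L I)" for I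
  have expects: "expects prog (input [bits I]) (T I) (search.sound (family \<Phi> I))
      (\<lambda>m'. if search.found m' then 0 else 1) (if Sol I \<in> family \<Phi> I then ennreal (1 / 4) else 1)"
        for I
  proof -
    interpret search_all I "us I" "family \<Phi> I" pE "TE I" "L I" "BB I" "lb I" "Sol I" by (rule loc2)
    obtain t mU where t: "runs pU (input [bits I]) [] t mU" "real t
      \<le> CU * (real (length I) + 1) ^ dU" "outputs mU (us I)"
      using univ(3)[of I] unfolding computes_within_def by blast
    have "CU \<le> real cU" unfolding cU_def by linarith
    then have "CU * (real (length I) + 1) ^ dU \<le> real cU * (real (length I) + 1) ^ dU"
      by (intro mult_right_mono) auto
    also have "\<dots> = real (cU * (length I + 1) ^ dU)" by (simp add: add.commute)
    finally have tU: "t \<le> cU * (length I + 1) ^ dU" using t(2) by linarith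
    \<comment> \<open>\<open>L\<close> contains \<open>FU\<close> as a summand, and its constant
      summands 11 and 2 add up to 13.\<close>
    have "FU I + L I \<le> 2 * L I - 13" by (simp add: L_def)
    moreover have "2 * L I < 2 ^ L I + 1"
    proof -
      have "L I - 1 < 2 ^ (L I - 1)" by (rule less_exp)
      moreover have "(2::nat) ^ L I = 2 * 2 ^ (L I - 1)" using L(1) by (cases "L I") auto
      ultimately show ?thesis by linarith
    qed
    moreover have "13 \<le> L I" by (simp add: L_def)
    ultimately have FL: "FU I + L I < 2 ^ L I" by linarith
    have tL: "t \<le> L I" using tU by (simp add: L_def FU_def)
    have ft: "8 * t < FU I" using tU by (simp add: FU_def)
    have "total (prelude_factor pU fuel) (FU I) = T I"
      by (simp only: total_eq T_def prelude_factor_def KS0_def)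
    then show ?thesis
      using whole[OF t(1,3) _ _ ft FL tL, of fuel] unfolding prog_def by (simp add: fuel_def FU_def)
  qed
  define g where "g I = \<beta> ^ length (us I)" for I
  have g1: "1 \<le> g I" and g0: "0 \<le> g I" for I using \<beta> by (auto simp: g_def one_le_power)
  note poly = grows_add grows_mult grows_const grows_power
  have pn: "poly_bounded (\<lambda>I. real (length (us I)))"
    by (rule grows_mono[OF grows_length]) (use usN in simp)
  have "grows g g" unfolding grows_def using g0 by (intro exI[of _ 1] exI[of _ 0]) simp
  then have "grows g R"
    unfolding R_def[abs_def] g_def[symmetric] using K0 g0 g1
    by (intro poly pn grows_length) auto
  then have "grows g (\<lambda>I. R I + 1)" using g0 g1 by (intro poly) auto
  then have gBB: "grows g (\<lambda>I. real (BB I))"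
  proof (rule grows_mono)
    fix I
    have "0 \<le> R I" using K0 \<beta> by (simp add: R_def)
    then show "0 \<le> real (BB I) \<and> real (BB I) \<le> R I + 1" unfolding BB_def by linarith
  qed
  have plb: "poly_bounded (\<lambda>I. real (lb I))"
    unfolding lb_def by (rule grows_nbits[OF gBB[unfolded g_def[abs_def]] \<beta> usN])
  \<comment> \<open>The only exponential factor of \<open>T\<close> is \<open>2 ^ lb\<close>, which
    is at most \<open>2 * (BB + 1)\<close>; \<open>lb\<close> and \<open>L\<close> are logarithmic
    in it up to polynomial terms. The base \<open>\<beta>\<close> is thus inherited from
    \<open>BB\<close> unchanged.\<close>
  have "grows g (\<lambda>I. 2 * (real (BB I) + 1))" using gBB g0 g1 by (intro poly) auto
  then have g2: "grows g (\<lambda>I. 2 ^ lb I)"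
  proof (rule grows_mono)
    fix I
    have "real (2 ^ lb I) \<le> real (2 * (BB I + 1))"
      using nbits_lower[of "BB I"] unfolding lb_def by (simp only: of_nat_le_iff)
    then show "0 \<le> (2::real) ^ lb I \<and> 2 ^ lb I \<le> 2 * (real (BB I) + 1)" by simp
  qed
  have pFU: "poly_bounded (\<lambda>I. real (FU I))"
    unfolding FU_def of_nat_add of_nat_mult of_nat_power by (intro poly grows_length) auto
  have pL: "poly_bounded (\<lambda>I. real (L I))"
    unfolding L_def of_nat_add of_nat_mult of_nat_power by (intro poly grows_length pn plb pFU) auto
  have "grows g (\<lambda>I. real (T I))"
    unfolding T_def of_nat_add of_nat_mult of_nat_power of_nat_numeral
    by (intro poly grows_length pn plb pFU pL g2 g0 g1 grows_poly[OF pL] grows_poly[OF pFU]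
      grows_poly[OF grows_length]) auto
  then obtain C d where C: "\<And>I. real (T I) \<le> C * g I * (real (length I) + 1) ^ d"
    unfolding grows_def by blast
  have "randomized_subset_algorithm \<Phi> prog (\<lambda>I. C * \<beta> ^ card (universe \<Phi> I) *
    (real (length I) + 1) ^ d)"
    unfolding randomized_subset_algorithm_def
  proof (intro allI conjI impI)
    fix I \<omega>
    obtain l t m where "runs prog (input [bits I]) (stake l \<omega>) t m" "t \<le> T I"
      using expects_run[OF expects] by blast
    then show "\<exists>l t m. runs prog (input [bits I]) (stake l \<omega>) t m \<and>
        real t \<le> C * \<beta> ^ card (universe \<Phi> I) * (real (length I) + 1) ^ d"
      using C[of I] unfolding g_def card by (meson of_nat_le_iff order_trans)
  next
    fix I \<omega> assume "family \<Phi> I = {}"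
    interpret search_all I "us I" "family \<Phi> I" pE "TE I" "L I" "BB I" "lb I" "Sol I" by (rule loc2)
    show "\<exists>l t m. runs prog (input [bits I]) (stake l \<omega>) t m \<and> outputs m [0]"
      using expects_run[OF expects[of I], of \<omega>] sound_empty[OF \<open>family \<Phi> I = {}\<close>] by blast
  next
    fix I assume ne: "family \<Phi> I \<noteq> {}"
    interpret search_all I "us I" "family \<Phi> I" pE "TE I" "L I" "BB I" "lb I" "Sol I" by (rule loc2)
    have "Sol I \<in> family \<Phi> I" using ne unfolding Sol_def by (simp add: some_in_eq)
    then have "expects prog (input [bits I]) (T I) sound (\<lambda>m'.
      if found m' then 0 else 1) (ennreal (1 / 4))"
      using expects[of I] by simp
    from expects_prob[OF this]
    have "1 - 1 / 4 \<le> \<P>(\<omega> in coins. \<exists>l t m. runs prog (input [bits I]) (stake l \<omega>) t m \<and> sound m \<and>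
      found m)"
      by simp
    then show "1 / 2 < \<P>(\<omega> in coins. \<exists>l t m xs. runs prog (input [bits I]) (stake l \<omega>) t m \<and>
        outputs m (1 # xs) \<and> distinct xs \<and> set xs \<in> family \<Phi> I)"
      unfolding sound_iff by simp
  qed
  then show ?thesis unfolding \<beta>_def by blast
qed

theorem theorem1:
  fixes \<Phi> :: "bool list \<Rightarrow> nat set \<times> nat set set" and b c :: real
  assumes "implicit_set_system \<Phi>"
    and "poly_time_computable \<Phi>"
    and "b \<ge> 1" and "c \<ge> 1"
    and "\<exists>p C d. extension_algorithm \<Phi> p (\<lambda>I X k.
           C * b ^ (card (universe \<Phi> I) - card X) * c ^ k * (real (length I) + 1) ^ d)"
  shows "\<exists>p C d. randomized_subset_algorithm \<Phi> p (\<lambda>I.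
           C * (1 + b - 1 / c) ^ card (universe \<Phi> I) * (real (length I) + 1) ^ d)"
proof -
  obtain p C d where "extension_algorithm \<Phi> p (\<lambda>I X k.
      C * b ^ (card (universe \<Phi> I) - card X) * c ^ k * (real (length I) + 1) ^ d)"
    using assms(5) by blast
  from main[OF assms(1-4) this] show ?thesis .
qed

end
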